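(* Let $\alpha,\beta$ be real numbers with $\beta>0$ such that the pair $(\alpha,\beta)$ is algebraically independent and strongly Diophantine, and let $\Lambda=\{m+n(\alpha+i\beta):\ m,n\in\mathbb{Z}\}\subset\mathbb{C}\cong\mathbb{R}^2$. For $t,\rho>0$ let $N_\Lambda(t)=\#\{x\in\Lambda:\ |x|\le t\}$ and $$S_\Lambda(t,\rho)=\frac{N_\Lambda(t+\rho)-N_\Lambda(t)-\frac{\pi}{\beta}(2t\rho+\rho^2)}{\sqrt t}.$$ Let $\rho=\rho(T)$ satisfy $\rho(T)\to 0$ as $T\to\infty$, and suppose that for every $\delta>0$, $\rho(T)\gg T^{-\delta}$. Set $\sigma^2:=\frac{4\pi}{\beta}\rho$. Then for every interval $\mathcal{A}\subset\mathbb{R}$, $$\lim_{T\to\infty}\frac{1}{T}\,\mathrm{meas}\Big\{t\in[T,2T]:\ \frac{S_\Lambda(t,\rho)}{\sigma}\in\mathcal{A}\Big\}=\frac{1}{\sqrt{2\pi}}\int_{\mathcal{A}}e^{-x^2/2}\,dx.$$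
   Context: A pair $(\alpha,\beta)$ of real numbers is called strongly Diophantine if for every natural number $n$ there exists $K_1>0$ such that for every polynomial $p(x,y)=\sum_{i+j\le n}a_{i,j}x^iy^j$ with integer coefficients and $p(\alpha,\beta)\neq 0$ one has $|p(\alpha,\beta)|\gg_n \big(\max_{i+j\le n}|a_{i,j}|\big)^{-K_1}$. Algebraically independent means $p(\alpha,\beta)\ne0$ for every nonzero integer polynomial $p$. "meas" denotes Lebesgue measure. *)

theory Defs
  imports "HOL-Analysis.Analysis" "HOL-Library.Landau_Symbols"
begin

text \<open>
  An integer polynomial in two variables of total degree at most \<open>n\<close> is given by a coefficient
  family \<open>a :: nat \<Rightarrow> nat \<Rightarrow> int\<close>, of which only the values \<open>a i j\<close> with \<open>i + j \<le> n\<close> are used.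
\<close>

definition eval2 :: "nat \<Rightarrow> (nat \<Rightarrow> nat \<Rightarrow> int) \<Rightarrow> real \<Rightarrow> real \<Rightarrow> real" where
  "eval2 n a x y = (\<Sum>(i, j) | i + j \<le> n. of_int (a i j) * x ^ i * y ^ j)"

definition height2 :: "nat \<Rightarrow> (nat \<Rightarrow> nat \<Rightarrow> int) \<Rightarrow> int" where
  "height2 n a = Max {\<bar>a i j\<bar> | i j. i + j \<le> n}"

definition algebraically_independent :: "real \<Rightarrow> real \<Rightarrow> bool" where
  "algebraically_independent \<alpha> \<beta> \<longleftrightarrow>
     (\<forall>n a. (\<exists>i j. i + j \<le> n \<and> a i j \<noteq> 0) \<longrightarrow> eval2 n a \<alpha> \<beta> \<noteq> 0)"

text \<open>The constant \<open>C\<close> is the one implied by \<open>\<gg>\<^sub>n\<close>; like \<open>K\<close>, it depends on \<open>n\<close>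
  (and on \<open>\<alpha>\<close>, \<open>\<beta>\<close>) but not on the polynomial.\<close>

definition strongly_Diophantine :: "real \<Rightarrow> real \<Rightarrow> bool" where
  "strongly_Diophantine \<alpha> \<beta> \<longleftrightarrow>
     (\<forall>n. \<exists>K>0. \<exists>C>0. \<forall>a. eval2 n a \<alpha> \<beta> \<noteq> 0 \<longrightarrow>
        \<bar>eval2 n a \<alpha> \<beta>\<bar> \<ge> C * of_int (height2 n a) powr (- K))"

definition planar_lattice :: "real \<Rightarrow> real \<Rightarrow> complex set" where
  "planar_lattice \<alpha> \<beta> = {of_int m + of_int n * Complex \<alpha> \<beta> | m n. True}"

definition count_pts :: "complex set \<Rightarrow> real \<Rightarrow> nat" where
  "count_pts \<Lambda> t = card {x \<in> \<Lambda>. norm x \<le> t}"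

definition S_annulus :: "real \<Rightarrow> real \<Rightarrow> real \<Rightarrow> real \<Rightarrow> real" where
  "S_annulus \<alpha> \<beta> t \<rho> =
     (real (count_pts (planar_lattice \<alpha> \<beta>) (t + \<rho>)) - real (count_pts (planar_lattice \<alpha> \<beta>) t)
        - pi / \<beta> * (2 * t * \<rho> + \<rho>\<^sup>2)) / sqrt t"

end

(*
  Poisson summation for a Gaussian smoothing of the disc, together with the asymptotics of the
  Fourier transform of the disc, shows that (N(t) - pi t^2 / beta) / sqrt t is close in mean square
  over [T, 2T + 1] to the trigonometric sum
    1 / (pi beta) * (sum over 0 < kap x <= M of kap x powr (-3/2) * sin (2 pi t kap x - pi / 4)),
  where kap x = |x| / beta runs over the lengths of the dual lattice.  With M = rho^-9 the
  error is negligible against sigma, and the increment over [t, t + rho] becomes a trigonometric sum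
  whose frequencies are integer multiples of the lengths of primitive vectors.  By algebraic
  independence and the strong Diophantine property, linear forms in these lengths with integer
  coefficients of size H are bounded below by a power of 1/H: the product of all conjugates over the
  signs of the square roots is an integer polynomial in alpha, beta, and it does not vanish identically
  because of the corner of one of the square roots.  As rho decays more slowly than any power of T,
  every moment of the increment therefore agrees asymptotically with that of a model in which the
  primitive vectors carry independent uniform phases.  The characteristic function of the model is
  Gaussian in the limit by Lindeberg's argument, its exponential moments turn the comparison of
  moments into one of characteristic functions, and Levy's continuity theorem gives the claim.
*)

theory Submission
  imports Defs "HOL-Probability.Probability" "HOL-Complex_Analysis.Complex_Analysis" "HOL-Real_Asymp.Real_Asymp"
begin

section \<open>Poisson summation\<close>

text \<open>One competition fixes the exponents. The variance of the increment is of order \<rho>,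
  so the mean square error of the truncated sum must be o(\<rho>). The error obtained is M^(-1/8),
  that is \<rho>^(9/8) for M = \<rho>^(-9). The 1/8 is what is left of a decay kap^(-9/4) after a
  summable factor kap^(-17/8) is split off, and 9/4 = 3 - 3/4 reflects the number r^(3/4) of lattice
  points in an annulus of radius r and width r^(-1/4). That count is itself deduced from the
  smoothed Poisson formula, before any arithmetic of \<alpha> and \<beta> enters. The smoothing
  width is T^(-2): the cost of smoothing is small only after averaging over t, and pointwise a much
  weaker bound is used. The window [T, 2T + 1] leaves room for the shift by \<rho> \<le> 1. The dual
  lengths |x| / \<beta> occur because the dual lattice is the lattice itself, turned by a right
  angle and divided by \<beta>. Every loss in the comparison of k-th moments is a power of 1 /
  \<rho> whose exponent depends on k only. The number of moments used must be fixed before the limit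
  is taken; uniform exponential moments of the model allow this.\<close>

definition e2 :: "real \<Rightarrow> complex" where "e2 x = cis (2 * pi * x)"

lemma e2_add: "e2 (x + y) = e2 x * e2 y" by (simp add: e2_def cis_mult algebra_simps)
lemma e2_minus: "e2 (- x) = cnj (e2 x)" by (simp add: e2_def cis_cnj)
lemma e2_0 [simp]: "e2 0 = 1" by (simp add: e2_def)
lemma norm_e2 [simp]: "norm (e2 x) = 1" by (simp add: e2_def)
lemma e2_int [simp]: "e2 (of_int k) = 1" unfolding e2_def complex_eq_iff by (simp add: cos_int_2pin sin_int_2pin)
lemma continuous_e2 [continuous_intros]:
  "continuous_on S f \<Longrightarrow> continuous_on S (\<lambda>x. e2 (f x))" unfolding e2_def by (intro continuous_intros)
lemma borel_measurable_e2 [measurable]: "e2 \<in> borel_measurable borel" by (intro borel_measurable_continuous_onI continuous_intros)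
lemma Re_e2: "Re (e2 x) = cos (2 * pi * x)" and Im_e2: "Im (e2 x) = sin (2 * pi * x)" by (simp_all add: e2_def)

inductive trig_poly :: "(real \<Rightarrow> complex) \<Rightarrow> bool" where
  trig_poly_base: "trig_poly (\<lambda>x. c * e2 (of_int k * x))"
| trig_poly_add: "trig_poly p \<Longrightarrow> trig_poly q \<Longrightarrow> trig_poly (\<lambda>x. p x + q x)"

lemma trig_poly_const: "trig_poly (\<lambda>x. c)" using trig_poly_base[of c 0] by simp

lemma trig_poly_mult: "trig_poly p \<Longrightarrow> trig_poly q \<Longrightarrow> trig_poly (\<lambda>x. p x * q x)"
proof (induction rule: trig_poly.induct)
  case (trig_poly_base c k)
  then show ?case
  proof (induction rule: trig_poly.induct)
    case (trig_poly_base d l)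
    have "(\<lambda>x. c * e2 (of_int k * x) * (d * e2 (of_int l * x))) = (\<lambda>x. (c * d) * e2 (of_int (k + l) * x))"
      by (auto simp: e2_add ring_distribs)
    then show ?case using trig_poly.trig_poly_base[of "c * d" "k + l"] by simp
  qed (use trig_poly.trig_poly_add in \<open>simp add: ring_distribs\<close>)
qed (use trig_poly.trig_poly_add in \<open>simp add: ring_distribs\<close>)

lemma continuous_on_trig_poly: "trig_poly p \<Longrightarrow> continuous_on S p"
  by (induction rule: trig_poly.induct) (intro continuous_intros; assumption)+

text \<open>A real linear functional on the complex plane is a combination of Re and Im, hence on
  the circle a combination of \<open>e2 x\<close> and \<open>e2 (- x)\<close>; sums and products
  preserve the class.\<close>

lemma trig_poly_real_polynomial:
  "real_polynomial_function p \<Longrightarrow> trig_poly (\<lambda>x. of_real (p (e2 x)))"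
proof (induction rule: real_polynomial_function.induct)
  case (linear f)
  interpret bounded_linear f by fact
  have *: "complex_of_real (f (e2 x)) =
     (of_real (f 1) / 2 + of_real (f \<i>) / (2 * \<i>)) * e2 (of_int 1 * x) +
     (of_real (f 1) / 2 - of_real (f \<i>) / (2 * \<i>)) * e2 (of_int (-1) * x)" for x
  proof -
    have "f (e2 x) = f (Re (e2 x) *\<^sub>R 1 + Im (e2 x) *\<^sub>R \<i>)" by (rule arg_cong[of _ _ f]) (simp add: complex_eq_iff)
    also have "\<dots> = Re (e2 x) * f 1 + Im (e2 x) * f \<i>" by (simp only: add scaleR real_scaleR_def)
    finally show ?thesis by (simp add: complex_eq_iff e2_minus)
  qed
  show ?case unfolding * by (intro trig_poly_add trig_poly_base)
next
  case (add f g) then show ?case using trig_poly.trig_poly_add by simp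
next
  case (mult f g) then show ?case using trig_poly_mult by simp
qed (rule trig_poly_const)

lemma trig_poly_polynomial:
  assumes "polynomial_function (g :: complex \<Rightarrow> complex)"
  shows "trig_poly (\<lambda>x. g (e2 x))"
proof -
  have "trig_poly (\<lambda>x. of_real ((Re \<circ> g) (e2 x)) + \<i> * of_real ((Im \<circ> g) (e2 x)))"
    using assms bounded_linear_Re bounded_linear_Im unfolding polynomial_function_def
    by (intro trig_poly_add trig_poly_mult trig_poly_const trig_poly_real_polynomial) blast+
  then show ?thesis by (simp add: complex_eq[symmetric])
qed

lemma periodic_int:
  assumes "\<And>x::real. H (x + 1) = H x"
  shows "H (x + of_int k) = H x"
proof -
  have n: "H (x + of_nat n) = H x" for x n by (induction n) (simp_all add: add.assoc[symmetric] assms add.commute[of 1])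
  show ?thesis
  proof (cases "k \<ge> 0")
    case True then show ?thesis using n[of x "nat k"] by simp
  next
    case False then show ?thesis using n[of "x + of_int k" "nat (-k)"] by simp
  qed
qed

lemma e2_eq_iff: "e2 x = e2 y \<longleftrightarrow> (\<exists>k. x = y + of_int k)"
proof
  assume "e2 x = e2 y"
  then have "cis (2 * pi * x) = cis (2 * pi * y)" by (simp add: e2_def)
  then have "sin (2 * pi * x) = sin (2 * pi * y) \<and> cos (2 * pi * x) = cos (2 * pi * y)" by (metis Re_e2 Im_e2 e2_def)
  then obtain n where "2 * pi * x = 2 * pi * y + 2 * pi * of_int n" using sin_cos_eq_iff by metis
  then have "2 * pi * x = 2 * pi * (y + of_int n)" by (simp add: algebra_simps)
  then show "\<exists>k. x = y + of_int k" by auto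
next
  assume "\<exists>k. x = y + of_int k" then show "e2 x = e2 y" by (auto simp: e2_add)
qed

lemma sphere_e2: "sphere 0 1 = e2 ` {0..1}"
proof (intro equalityI subsetI)
  fix w :: complex assume "w \<in> sphere 0 1"
  then have "w = cis (Arg w)" by (metis cis_Arg dist_0_norm mem_sphere norm_eq_zero sgn_div_norm scaleR_one inverse_1 zero_neq_one)
  then have "w = e2 (Arg w / (2 * pi))" by (simp add: e2_def)
  also have "\<dots> = e2 (frac (Arg w / (2 * pi)))"
    unfolding e2_eq_iff by (intro exI[of _ "\<lfloor>Arg w / (2 * pi)\<rfloor>"]) (simp add: frac_def)
  finally show "w \<in> e2 ` {0..1}" using frac_ge_0 frac_lt_1 by (metis atLeastAtMost_iff imageI less_imp_le)
qed auto

text \<open>Uniqueness of Fourier coefficients by Stone-Weierstrass: the conjugate of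
  \<open>H\<close> descends to a continuous function on the circle, is uniformly close to a
  trigonometric polynomial, and \<open>H\<close> is orthogonal to all of these. So the integral of
  |H|^2 lies below every positive number.\<close>

lemma continuous_periodic_eq_0:
  fixes H :: "real \<Rightarrow> complex"
  assumes cont: "continuous_on UNIV H" and per: "\<And>x. H (x + 1) = H x"
    and coeff: "\<And>k::int. integral {0..1} (\<lambda>x. H x * e2 (of_int k * x)) = 0"
  shows "H x = 0"
proof -
  note H_int = periodic_int[of H, OF per]
  have contI: "continuous_on S H" for S using cont continuous_on_subset by blast
  have trig: "integral {0..1} (\<lambda>x. H x * q x) = 0" if "trig_poly q" for q using that
  proof (induction rule: trig_poly.induct)
    case (trig_poly_base c k)
    have "(\<lambda>x. H x * (c * e2 (of_int k * x))) = (\<lambda>x. c * (H x * e2 (of_int k * x)))" by (simp add: ac_simps)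
    then show ?case using coeff[of k] by simp
  next
    case (trig_poly_add p q)
    have "integral {0..1} (\<lambda>x. H x * (p x + q x)) = integral {0..1} (\<lambda>x. H x * p x) + integral {0..1} (\<lambda>x. H x * q x)"
      unfolding ring_distribs using trig_poly_add.hyps
      by (intro integral_add integrable_continuous_interval continuous_on_mult continuous_on_trig_poly contI)
    then show ?case using trig_poly_add.IH by simp
  qed
  \<comment> \<open>Periodicity makes the value independent of the chosen argument of
    \<open>w\<close>. The conjugate is taken so that \<open>H x * f (e2 x)\<close> is |H
    x|^2.\<close>
  define f where "f w = cnj (H (SOME x. w = e2 x))" for w
  have f: "f (e2 x) = cnj (H x)" for x
  proof -
    have "e2 x = e2 (SOME y. e2 x = e2 y)" by (rule someI[where P="\<lambda>y. e2 x = e2 y"]) simp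
    then obtain k where "x = (SOME y. e2 x = e2 y) + of_int k" unfolding e2_eq_iff[of x] by blast
    then show ?thesis unfolding f_def using H_int by metis
  qed
  \<comment> \<open>\<open>e2\<close> identifies the two ends of [0, 1], so there is no continuous
    inverse to compose with. Preimages of closed sets are instead images of compact sets under
    \<open>e2\<close>, hence closed.\<close>
  have "continuous_on (sphere 0 1) f" unfolding continuous_closedin_preimage_eq
  proof (intro allI impI)
    fix T :: "complex set" assume "closed T"
    have "sphere 0 1 \<inter> f -` T = e2 ` ({0..1} \<inter> (\<lambda>x. cnj (H x)) -` T)" unfolding sphere_e2 using f by auto
    moreover have "compact ({0..1} \<inter> (\<lambda>x. cnj (H x)) -` T)"
      using \<open>closed T\<close> by (intro compact_Int_closed closed_vimage continuous_intros contI) auto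
    then have "compact (e2 ` ({0..1} \<inter> (\<lambda>x. cnj (H x)) -` T))" by (intro compact_continuous_image continuous_intros)
    ultimately show "closedin (top_of_set (sphere 0 1)) (sphere 0 1 \<inter> f -` T)" by (metis closed_subset compact_imp_closed inf_le1)
  qed
  note SW = Stone_Weierstrass_polynomial_function[OF compact_sphere this]
  have "\<exists>B. \<forall>x\<in>{0..1}. norm (H x) \<le> B"
    using compact_continuous_image[OF contI compact_Icc, of 0 1] compact_imp_bounded bounded_iff by (metis imageI)
  then obtain B where B: "\<And>x. x \<in> {0..1} \<Longrightarrow> norm (H x) \<le> B" by blast
  have "B \<ge> 0" using B[of 0] norm_ge_zero[of "H 0"] by (simp del: norm_ge_zero)
  let ?I = "integral {0..1} (\<lambda>x. (norm (H x))^2)"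
  have "?I \<le> 0 + e" if "e > 0" for e :: real
  proof -
    define d where "d = e / (B + 1)"
    have "d > 0" using that \<open>B \<ge> 0\<close> by (simp add: d_def)
    from SW[OF this] obtain g where g: "polynomial_function g" "\<And>w. w \<in> sphere 0 1 \<Longrightarrow> norm (f w - g w) < d" by blast
    have tg: "trig_poly (\<lambda>x. g (e2 x))" by (rule trig_poly_polynomial) fact
    have "complex_of_real ?I = integral {0..1} (\<lambda>x. complex_of_real ((norm (H x))^2))"
      by (rule integral_linear[OF _ bounded_linear_of_real, unfolded comp_def, symmetric]) (intro integrable_continuous_interval continuous_intros contI)
    also have "\<dots> = integral {0..1} (\<lambda>x. H x * (f (e2 x) - g (e2 x)) + H x * g (e2 x))"
      by (intro integral_cong) (simp only: f, simp only: complex_norm_square right_diff_distrib diff_add_cancel)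
    also have "\<dots> = integral {0..1} (\<lambda>x. H x * (f (e2 x) - g (e2 x)))" unfolding f
      by (subst integral_add) (use tg in \<open>auto simp: trig intro!: integrable_continuous_interval continuous_intros contI continuous_on_trig_poly[OF tg]\<close>)
    finally have "norm (complex_of_real ?I) = norm (integral {0..1} (\<lambda>x. H x * (f (e2 x) - g (e2 x))))" by simp
    also have "\<dots> \<le> B * d * (1 - 0)"
    proof (rule integral_bound)
      show "continuous_on {0..1} (\<lambda>x. H x * (f (e2 x) - g (e2 x)))"
        unfolding f by (intro continuous_intros contI continuous_on_trig_poly[OF tg])
      fix x :: real assume x: "x \<in> {0..1}"
      show "norm (H x * (f (e2 x) - g (e2 x))) \<le> B * d" unfolding norm_mult using B[OF x] g(2)[of "e2 x"] \<open>B \<ge> 0\<close>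
        by (intro mult_mono) auto
    qed simp
    also have "\<dots> \<le> e" using \<open>B \<ge> 0\<close> that by (simp add: d_def field_simps)
    finally show ?thesis by simp
  qed
  then have "?I \<le> 0" by (rule field_le_epsilon)
  moreover have "?I \<ge> 0" by (intro integral_nonneg integrable_continuous_interval continuous_intros contI) auto
  ultimately have "?I = 0" by simp
  then have "\<forall>x\<in>{0..1}. (norm (H x))^2 = 0" by (subst (asm) integral_eq_0_iff) (auto intro!: continuous_intros contI)
  then have "H (frac x) = 0" by (simp add: frac_lt_1 less_imp_le)
  moreover have "H (frac x + of_int \<lfloor>x\<rfloor>) = H (frac x)" by (rule H_int)
  ultimately show ?thesis by (simp add: frac_def)
qed

section \<open>Absolutely convergent sums as integrals over counting measure\<close>

abbreviation csum :: "('i \<Rightarrow> 'b::{banach, second_countable_topology}) \<Rightarrow> 'b" where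
  "csum \<equiv> integral\<^sup>L (count_space UNIV)"
abbreviation csummable :: "('i \<Rightarrow> 'b::{banach, second_countable_topology}) \<Rightarrow> bool" where
  "csummable \<equiv> integrable (count_space UNIV)"

lemma csummable_bound:
  fixes f :: "'i \<Rightarrow> 'b::{banach, second_countable_topology}" and g :: "'i \<Rightarrow> real"
  assumes "csummable g" "\<And>i. norm (f i) \<le> g i"
  shows "csummable f"
  using assms(1) by (rule Bochner_Integration.integrable_bound) (use assms(2) in \<open>auto intro!: AE_I2 intro: order.trans[OF _ abs_ge_self]\<close>)

text \<open>With sums written as integrals over counting measure this is Fubini on a product
  measure; countability of the index type provides sigma-finiteness and joint measurability.\<close>

lemma csum_integral_swap:
  fixes f :: "'i::countable \<Rightarrow> 'a \<Rightarrow> 'b::{banach, second_countable_topology}"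
  assumes "sigma_finite_measure M" and f: "\<And>i. integrable M (f i)"
    and s: "csummable (\<lambda>i. LINT x|M. norm (f i x))"
  shows "(LINT x|M. csum (\<lambda>i. f i x)) = csum (\<lambda>i. LINT x|M. f i x)"
    and "integrable M (\<lambda>x. csum (\<lambda>i. f i x))"
    and "AE x in M. csummable (\<lambda>i. f i x)"
    and "csummable (\<lambda>i. LINT x|M. f i x)"
proof -
  interpret M: sigma_finite_measure M by fact
  interpret I: sigma_finite_measure "count_space (UNIV::'i set)" by (rule sigma_finite_measure_count_space_countable) simp
  interpret P: pair_sigma_finite "count_space (UNIV::'i set)" M ..
  have [measurable]: "\<And>i. f i \<in> borel_measurable M" using f by auto
  have "case_prod f \<in> borel_measurable (count_space UNIV \<Otimes>\<^sub>M M)" by (rule measurable_pair_measure_countable1) auto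
  then have F: "integrable (count_space UNIV \<Otimes>\<^sub>M M) (case_prod f)" by (rule P.Fubini_integrable) (use f s in auto)
  show "(LINT x|M. csum (\<lambda>i. f i x)) = csum (\<lambda>i. LINT x|M. f i x)" using P.Fubini_integral[OF F] .
  show "integrable M (\<lambda>x. csum (\<lambda>i. f i x))" by (rule P.integrable_snd[OF F])
  show "AE x in M. csummable (\<lambda>i. f i x)" by (rule P.AE_integrable_snd[OF F])
  show "csummable (\<lambda>i. LINT x|M. f i x)" by (rule P.integrable_fst[OF F])
qed

lemma continuous_csum:
  fixes f :: "'i::countable \<Rightarrow> real \<Rightarrow> 'b::{banach, second_countable_topology}"
  assumes c: "\<And>i. continuous_on UNIV (f i)"
    and b: "\<And>R. \<exists>g. csummable g \<and> (\<forall>i a. \<bar>a\<bar> \<le> R \<longrightarrow> norm (f i a) \<le> g i)"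
  shows "continuous_on UNIV (\<lambda>a. csum (\<lambda>i. f i a))" unfolding continuous_on_sequentially
proof (intro allI ballI impI, elim conjE)
  fix X and x :: real assume X: "X \<longlonglongrightarrow> x"
  have "Bseq X" using X by (intro convergent_imp_Bseq) (auto simp: convergent_def)
  then obtain R where R: "\<And>n. \<bar>X n\<bar> \<le> R" unfolding Bseq_def by auto
  obtain g where g: "csummable g" "\<And>i a. \<bar>a\<bar> \<le> R \<Longrightarrow> norm (f i a) \<le> g i" using b[of R] by blast
  have lim: "(\<lambda>n. f i (X n)) \<longlonglongrightarrow> f i x" for i using c X by (auto simp: continuous_on_sequentially comp_def)
  show "((\<lambda>a. csum (\<lambda>i. f i a)) \<circ> X) \<longlonglongrightarrow> csum (\<lambda>i. f i x)" unfolding comp_def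
    by (rule integral_dominated_convergence[where w=g]) (use g R lim in auto)
qed

lemma csummable_nat_abs:
  fixes f :: "nat \<Rightarrow> real"
  assumes "summable f" "\<And>n. f n \<ge> 0"
  shows "csummable (\<lambda>m::int. f (nat \<bar>m\<bar>))"
proof -
  let ?g = "\<lambda>m::int. f (nat \<bar>m\<bar>)"
  have "Infinite_Set_Sum.abs_summable_on f UNIV" using assms by (simp add: abs_summable_on_nat_iff')
  then have 1: "Infinite_Set_Sum.abs_summable_on (\<lambda>n. ?g (int n)) UNIV"
    and 2: "Infinite_Set_Sum.abs_summable_on (\<lambda>n. ?g (- int n)) UNIV" by simp_all
  have "Infinite_Set_Sum.abs_summable_on ?g (range int \<union> range (\<lambda>n. - int n))"
    using abs_summable_on_reindex[where f="?g" and g=int, OF 1] abs_summable_on_reindex[where f="?g" and g="\<lambda>n. - int n", OF 2] by (rule abs_summable_on_union)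
  moreover have "range int \<union> range (\<lambda>n. - int n) = UNIV" by (auto simp: image_iff) (metis int_cases2)
  ultimately show ?thesis by (simp add: abs_summable_on_def)
qed

lemma csummable_gauss:
  assumes "c > (0::real)"
  shows "csummable (\<lambda>m::int. exp (- c * (of_int m)\<^sup>2))"
proof (rule csummable_bound)
  show "csummable (\<lambda>m::int. exp (-c) ^ nat \<bar>m\<bar>)"
    using assms by (intro csummable_nat_abs[of "\<lambda>n. exp (-c) ^ n"] summable_geometric) auto
  fix m :: int
  have "\<bar>m\<bar> * 1 \<le> \<bar>m\<bar> * \<bar>m\<bar>" using mult_left_mono[of 1 "\<bar>m\<bar>" "\<bar>m\<bar>"] by (cases "m = 0") simp_all
  then have "of_int \<bar>m\<bar> \<le> (of_int (m * m) :: real)" by (subst of_int_le_iff) auto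
  then have "real (nat \<bar>m\<bar>) \<le> (of_int m)\<^sup>2" by (simp add: power2_eq_square)
  then show "norm (exp (- c * (of_int m)\<^sup>2)) \<le> exp (-c) ^ nat \<bar>m\<bar>"
    using assms by (simp add: exp_of_nat_mult[symmetric] mult.commute)
qed

text \<open>Rests on (m + 2a)^2 \<ge> 0. It replaces a shifted Gaussian by a majorant uniform in
  bounded shifts, as continuity in the shift and dominated convergence demand.\<close>

lemma gauss_shift_bound:
  assumes "s > 0" "\<bar>a\<bar> \<le> R"
  shows "exp (- s * (m + a)\<^sup>2) \<le> exp (s * R\<^sup>2) * exp (- (s / 2) * m\<^sup>2 :: real)"
proof -
  have "a\<^sup>2 \<le> R\<^sup>2" using assms(2) by (simp add: abs_le_square_iff[symmetric])
  moreover have "2 * (m + a)\<^sup>2 + 2 * a\<^sup>2 - m\<^sup>2 = (m + 2 * a)\<^sup>2" by (simp add: power2_eq_square algebra_simps)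
  ultimately have "m\<^sup>2 / 2 \<le> (m + a)\<^sup>2 + R\<^sup>2" using zero_le_power2[of "m + 2 * a"] by linarith
  then have "s * (m\<^sup>2 / 2) \<le> s * ((m + a)\<^sup>2 + R\<^sup>2)" using assms(1) by simp
  then show ?thesis by (simp add: exp_add[symmetric] algebra_simps)
qed

lemma gauss_fourier:
  assumes "s > 0"
  shows "integrable lborel (\<lambda>x. exp (- pi * s * x\<^sup>2) * e2 (c * x))"
    and "(LINT x|lborel. exp (- pi * s * x\<^sup>2) * e2 (c * x)) = exp (- pi * c\<^sup>2 / s) / sqrt s"
proof -
  \<comment> \<open>Scaling by \<open>r\<close> turns the integrand into the standard normal density
    times a character, so that the value can be read off the characteristic function of the normal
    law.\<close>
  define r where "r = sqrt (2 * pi * s)"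
  have r: "r > 0" "r\<^sup>2 = 2 * pi * s" using assms by (auto simp: r_def)
  define F where "F x = std_normal_density x *\<^sub>R cis (2 * pi * c / r * x)" for x
  have [measurable]: "F \<in> borel_measurable borel"
    unfolding F_def normal_density_def by (intro borel_measurable_continuous_onI continuous_intros) auto
  have "integrable lborel (\<lambda>x. std_normal_density x)" using integrable_std_normal_moment[of 0] by simp
  then have "integrable lborel F" by (rule Bochner_Integration.integrable_bound) (auto simp: F_def)
  then have 1: "integrable lborel (\<lambda>x. F (0 + r * x))" using r by (intro lborel_integrable_real_affine) auto
  have "(LINT x|lborel. F x) = char std_normal_distribution (2 * pi * c / r)"
    unfolding char_def F_def by (subst integral_density) (auto simp: cis_conv_exp)
  also have "\<dots> = exp (- pi * c\<^sup>2 / s)" unfolding char_std_normal_distribution using r assms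
    by (simp add: power_divide power_mult_distrib) (simp add: field_simps power2_eq_square)
  finally have "(LINT x|lborel. F x) = exp (- pi * c\<^sup>2 / s)" .
  also have "(LINT x|lborel. F x) = r *\<^sub>R (LINT x|lborel. F (0 + r * x))" using lborel_integral_real_affine[of r F 0] r by simp
  finally have 2: "(LINT x|lborel. F (0 + r * x)) = exp (- pi * c\<^sup>2 / s) / r" using r by (simp add: scaleR_conv_of_real field_simps)
  have 3: "exp (- pi * s * x\<^sup>2) * e2 (c * x) = sqrt (2 * pi) * F (0 + r * x)" for x
    using r assms by (simp add: F_def normal_density_def e2_def power_mult_distrib scaleR_conv_of_real mult.assoc)
  show "integrable lborel (\<lambda>x. exp (- pi * s * x\<^sup>2) * e2 (c * x))" unfolding 3 using 1 by simp
  show "(LINT x|lborel. exp (- pi * s * x\<^sup>2) * e2 (c * x)) = exp (- pi * c\<^sup>2 / s) / sqrt s"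
    unfolding 3 using 2 by (simp add: r_def real_sqrt_mult)
qed

lemma set_integral_01_AE:
  fixes f :: "real \<Rightarrow> 'b::{banach, second_countable_topology}"
  assumes [measurable]: "f \<in> borel_measurable borel"
  shows "(LINT x:{0..1}|lborel. f x) = (LINT x|lborel. indicator {0..<1} x *\<^sub>R f x)" unfolding set_lebesgue_integral_def
  by (rule integral_cong_AE) (use AE_lborel_singleton[of 1] in \<open>auto split: split_indicator elim!: eventually_mono\<close>)

lemma e2_int_integral:
  "(LINT x:{0..1}|lborel. e2 (of_int k * x)) = (if k = 0 then 1 else 0)"
proof (cases "k = 0")
  case False
  have "((\<lambda>x. e2 (of_int k * x)) has_integral (e2 (of_int k * 1) / (2 * pi * \<i> * of_int k) - e2 (of_int k * 0) / (2 * pi * \<i> * of_int k))) {0..1}"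
  proof (rule fundamental_theorem_of_calculus)
    fix x :: real
    have "((\<lambda>x. exp (2 * pi * \<i> * of_int k * of_real x) / (2 * pi * \<i> * of_int k)) has_vector_derivative
       exp (2 * pi * \<i> * of_int k * of_real x)) (at x within {0..1})"
      using False by (auto intro!: derivative_eq_intros has_vector_derivative_real_field)
    then show "((\<lambda>x. e2 (of_int k * x) / (2 * pi * \<i> * of_int k)) has_vector_derivative e2 (of_int k * x)) (at x within {0..1})"
      by (simp add: e2_def cis_conv_exp mult_ac)
  qed simp
  then have "integral {0..1} (\<lambda>x. e2 (of_int k * x)) = 0" using e2_int[of k] by (simp add: integral_unique)
  then show ?thesis using False by (subst set_borel_integral_eq_integral) (auto intro!: borel_integrable_atLeastAtMost' continuous_intros)
qed (simp add: set_lebesgue_integral_def)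

text \<open>Both sides are continuous and 1-periodic in \<open>a\<close>, so comparing Fourier
  coefficients in \<open>a\<close> suffices. The twist \<open>b\<close> is there for the plane,
  where the formula is applied once per coordinate and the first application leaves a phase for the
  second.\<close>

theorem gauss_poisson:
  assumes s: "s > (0::real)"
  shows "csum (\<lambda>m::int. exp (- pi * s * (of_int m + a)\<^sup>2) * e2 (b * (of_int m + a))) =
         csum (\<lambda>k::int. exp (- pi * (of_int k - b)\<^sup>2 / s) / sqrt s * e2 (of_int k * a))"
proof -
  define G where "G x = exp (- pi * s * x\<^sup>2) * e2 (b * x)" for x
  have contG: "continuous_on S G" for S unfolding G_def by (intro continuous_intros)
  have normG: "norm (G (of_int m + a)) \<le> exp (pi * s * R\<^sup>2) * exp (- (pi * s / 2) * (of_int m)\<^sup>2)"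
    if "\<bar>a\<bar> \<le> R" for m a R using gauss_shift_bound[of "pi * s" a R "of_int m"] s that by (simp add: G_def norm_mult)
  have sG: "csummable (\<lambda>m::int. exp (pi * s * R\<^sup>2) * exp (- (pi * s / 2) * (of_int m)\<^sup>2))" for R
    using s by (intro integrable_mult_right csummable_gauss) auto
  define F where "F a k = exp (- pi * (of_int k - b)\<^sup>2 / s) / sqrt s * e2 (of_int k * a)" for a and k :: int
  define g where "g k = exp (pi / s * b\<^sup>2) * exp (- (pi / s / 2) * (of_int k)\<^sup>2) / sqrt s" for k :: int
  have normF: "norm (F a k) \<le> g k" for a k using gauss_shift_bound[of "pi / s" "-b" "\<bar>b\<bar>" "of_int k"] s
    by (simp add: F_def g_def norm_mult norm_divide divide_right_mono)
  have contF: "continuous_on S (\<lambda>a. F a k)" for S k unfolding F_def by (intro continuous_intros) (use s in auto)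
  have sg: "csummable g" unfolding g_def using s csummable_gauss[of "pi / s / 2"] by simp
  let ?L = "\<lambda>a. csum (\<lambda>m::int. G (of_int m + a))" and ?R = "\<lambda>a. csum (F a)"
  have contL: "continuous_on UNIV ?L"
    by (rule continuous_csum) (use normG sG in \<open>auto intro!: continuous_on_compose2[OF contG] continuous_intros\<close>)
  have contR: "continuous_on UNIV ?R" by (rule continuous_csum) (use normF sg contF in auto)
  have sL: "csummable (\<lambda>m::int. G (of_int m + a))" for a by (rule csummable_bound[OF sG normG[OF order.refl]])
  have perL: "?L (a + 1) = ?L a" for a
  proof -
    have "distr (count_space UNIV) (count_space UNIV) (\<lambda>m::int. m + 1) = count_space UNIV"
      by (rule distr_bij_count_space) (rule bij_plus_right)
    then have "?L a = integral\<^sup>L (distr (count_space UNIV) (count_space UNIV) (\<lambda>m::int. m + 1)) (\<lambda>m. G (of_int m + a))" by simp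
    also have "\<dots> = ?L (a + 1)" by (subst integral_distr) (auto simp: add_ac)
    finally show ?thesis ..
  qed
  have perR: "?R (a + 1) = ?R a" for a
  proof -
    have "F (a + 1) = F a" by (rule ext) (simp add: F_def ring_distribs e2_add)
    then show ?thesis by simp
  qed
  note [measurable] = borel_measurable_continuous_onI[OF contG] borel_measurable_continuous_onI[OF contL] borel_measurable_continuous_onI[OF contR]
    borel_measurable_continuous_onI[OF contF]
  have coefL: "(LINT x:{0..1}|lborel. ?L x * e2 (of_int k * x)) = exp (- pi * (b + of_int k)\<^sup>2 / s) / sqrt s" for k
  proof -
    \<comment> \<open>Unfolding: translates of the half-open unit interval tile the line, so the
      coefficient of the periodised Gaussian becomes a single Fourier integral over the whole
      line.\<close>
    define f where "f m x = indicator {0..<1} x *\<^sub>R (G (of_int m + x) * e2 (of_int k * x))" for m :: int and x :: real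
    define h where "h m x = indicator {of_int m..<of_int m + 1} x *\<^sub>R (G x * e2 (of_int k * x))" for m :: int and x :: real
    have fh: "f m x = h m (of_int m + 1 * x)" for m x
    proof -
      have "e2 (of_int k * of_int m) = 1" by (metis e2_int of_int_mult)
      then show ?thesis by (auto simp: f_def h_def ring_distribs e2_add split: split_indicator)
    qed
    have [measurable]: "f m \<in> borel_measurable borel" "h m \<in> borel_measurable borel" for m unfolding f_def h_def by measurable
    have nf: "norm (f m x) \<le> exp (pi * s) * exp (- (pi * s / 2) * (of_int m)\<^sup>2) * indicator {0..<1} x" for m x
      using normG[of x 1 m] by (auto simp: f_def norm_mult split: split_indicator)
    have intf: "integrable lborel (f m)" for m
    proof (rule Bochner_Integration.integrable_bound)
      show "integrable lborel (\<lambda>x. exp (pi * s) * exp (- (pi * s / 2) * (of_int m)\<^sup>2) * indicator {0..<1::real} x)"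
        by (intro integrable_mult_right integrable_real_indicator) auto
    qed (auto intro!: AE_I2 order.trans[OF nf] abs_ge_self)
    have inth: "integrable lborel (h m)" for m using lborel_integrable_real_affine[OF intf, of 1 m "- of_int m"] by (simp add: fh)
    have fh_int: "(LINT x|lborel. f m x) = (LINT x|lborel. h m x)" for m
      unfolding fh using lborel_integral_real_affine[of 1 "h m" "of_int m"] by simp
    have fh_nint: "(LINT x|lborel. norm (f m x)) = (LINT x|lborel. norm (h m x))" for m
      unfolding fh using lborel_integral_real_affine[of 1 "\<lambda>x. norm (h m x)" "of_int m"] by simp
    have sf: "csummable (\<lambda>m. LINT x|lborel. norm (f m x))"
    proof (rule csummable_bound[OF sG[of 1]])
      fix m
      have "(LINT x|lborel. norm (f m x)) \<le> (LINT x|lborel. exp (pi * s) * exp (- (pi * s / 2) * (of_int m)\<^sup>2) * indicator {0..<1::real} x)"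
        by (rule Bochner_Integration.integral_mono[OF integrable_norm[OF intf] _ nf]) (auto intro!: integrable_mult_right integrable_real_indicator)
      then show "norm (LINT x|lborel. norm (f m x)) \<le> exp (pi * s * 1\<^sup>2) * exp (- (pi * s / 2) * (of_int m)\<^sup>2)" by simp
    qed
    have sh: "csummable (\<lambda>m. LINT x|lborel. norm (h m x))" using sf unfolding fh_nint .
    have hx: "csum (\<lambda>m. h m x) = G x * e2 (of_int k * x)" for x
    proof -
      have "h m x = indicator {\<lfloor>x\<rfloor>} m *\<^sub>R (G x * e2 (of_int k * x))" for m
        unfolding h_def using floor_eq_iff[of x m] by (auto split: split_indicator)
      then show ?thesis by simp
    qed
    have "(LINT x:{0..1}|lborel. ?L x * e2 (of_int k * x)) = (LINT x|lborel. csum (\<lambda>m. f m x))"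
      by (subst set_integral_01_AE) (auto intro!: Bochner_Integration.integral_cong simp: f_def sL)
    also have "\<dots> = csum (\<lambda>m. LINT x|lborel. h m x)"
      unfolding fh_int[symmetric] by (rule csum_integral_swap(1)) (use intf sf sigma_finite_lborel in auto)
    also have "\<dots> = (LINT x|lborel. csum (\<lambda>m. h m x))"
      by (rule csum_integral_swap(1)[symmetric]) (use inth sh sigma_finite_lborel in auto)
    also have "\<dots> = (LINT x|lborel. exp (- pi * s * x\<^sup>2) * e2 ((b + of_int k) * x))"
      by (simp add: hx G_def ring_distribs e2_add mult.assoc)
    also have "\<dots> = exp (- pi * (b + of_int k)\<^sup>2 / s) / sqrt s" by (rule gauss_fourier(2)[OF s])
    finally show ?thesis .
  qed
  have coefR: "(LINT x:{0..1}|lborel. ?R x * e2 (of_int k * x)) = exp (- pi * (b + of_int k)\<^sup>2 / s) / sqrt s" for k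
  proof -
    define f where "f l x = indicator {0..1} x *\<^sub>R (F x l * e2 (of_int k * x))" for l :: int and x :: real
    have [measurable]: "f m \<in> borel_measurable borel" for m unfolding f_def by measurable
    have nf: "norm (f l x) \<le> g l * indicator {0..1} x" for l x
      using normF[of x l] by (auto simp: f_def norm_mult split: split_indicator)
    have intf: "integrable lborel (f m)" for m
    proof (rule Bochner_Integration.integrable_bound)
      show "integrable lborel (\<lambda>x. g m * indicator {0..1::real} x)" by (intro integrable_mult_right integrable_real_indicator) auto
    qed (auto intro!: AE_I2 order.trans[OF nf] abs_ge_self)
    have sf: "csummable (\<lambda>m. LINT x|lborel. norm (f m x))"
    proof (rule csummable_bound[OF sg])
      fix m
      have "(LINT x|lborel. norm (f m x)) \<le> (LINT x|lborel. g m * indicator {0..1::real} x)"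
        by (rule Bochner_Integration.integral_mono[OF integrable_norm[OF intf] _ nf]) (auto intro!: integrable_mult_right integrable_real_indicator)
      then show "norm (LINT x|lborel. norm (f m x)) \<le> g m" by simp
    qed
    \<comment> \<open>Orthogonality leaves only l = -k. The sign arises because the coefficients are
      taken against \<open>e2 (k x)\<close> and not against its conjugate.\<close>
    have fl: "(LINT x|lborel. f l x) = indicator {-k} l *\<^sub>R (exp (- pi * (b + of_int k)\<^sup>2 / s) / sqrt s)" for l
    proof -
      have "(LINT x|lborel. f l x) = (LINT x:{0..1}|lborel. (exp (- pi * (of_int l - b)\<^sup>2 / s) / sqrt s) * e2 (of_int (l + k) * x))"
        unfolding set_lebesgue_integral_def
        by (rule Bochner_Integration.integral_cong) (auto simp: f_def F_def ring_distribs e2_add mult.assoc)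
      also have "\<dots> = (exp (- pi * (of_int l - b)\<^sup>2 / s) / sqrt s) * (if l + k = 0 then 1 else 0 :: complex)"
        by (subst set_integral_mult_right) (simp only: e2_int_integral)
      also have "\<dots> = indicator {-k} l *\<^sub>R (exp (- pi * (b + of_int k)\<^sup>2 / s) / sqrt s)"
      proof (cases "l = -k")
        case True
        then have "(of_int l - b)\<^sup>2 = (b + of_int k)\<^sup>2" by (simp add: power2_eq_square algebra_simps)
        then show ?thesis using True by simp
      qed (auto simp: add_eq_0_iff2 split: split_indicator)
      finally show ?thesis .
    qed
    have "(LINT x:{0..1}|lborel. ?R x * e2 (of_int k * x)) = (LINT x|lborel. csum (\<lambda>m. f m x))"
      unfolding set_lebesgue_integral_def using csummable_bound[OF sg normF] by (auto intro!: Bochner_Integration.integral_cong simp: f_def)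
    also have "\<dots> = csum (\<lambda>m. LINT x|lborel. f m x)" by (rule csum_integral_swap(1)) (use intf sf sigma_finite_lborel in auto)
    also have "\<dots> = exp (- pi * (b + of_int k)\<^sup>2 / s) / sqrt s" unfolding fl by simp
    finally show ?thesis .
  qed
  have "?L a - ?R a = 0"
  proof (rule continuous_periodic_eq_0[where H="\<lambda>a. ?L a - ?R a"])
    show "continuous_on UNIV (\<lambda>a. ?L a - ?R a)" by (intro continuous_intros contL contR)
    show "?L (x + 1) - ?R (x + 1) = ?L x - ?R x" for x unfolding perL perR ..
    fix k :: int
    have cL: "continuous_on S ?L" and cR: "continuous_on S ?R" for S using contL contR continuous_on_subset by blast+
    have 1: "set_integrable lborel {0..1} (\<lambda>x. ?L x * e2 (of_int k * x))" "set_integrable lborel {0..1} (\<lambda>x. ?R x * e2 (of_int k * x))"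
      by (intro borel_integrable_atLeastAtMost' continuous_intros cL cR)+
    have "integral {0..1} (\<lambda>x. (?L x - ?R x) * e2 (of_int k * x)) = integral {0..1} (\<lambda>x. ?L x * e2 (of_int k * x)) - integral {0..1} (\<lambda>x. ?R x * e2 (of_int k * x))"
      unfolding left_diff_distrib
      by (intro Henstock_Kurzweil_Integration.integral_diff integrable_continuous_interval continuous_intros cL cR)
    then show "integral {0..1} (\<lambda>x. (?L x - ?R x) * e2 (of_int k * x)) = 0"
      using set_borel_integral_eq_integral(2)[OF 1(1)] set_borel_integral_eq_integral(2)[OF 1(2)] coefL coefR by simp
  qed
  then show ?thesis unfolding G_def F_def by simp
qed

section \<open>The Fourier transform of the disc\<close>

lemma has_bochner_integral_powr_exp:
  assumes a: "a > (0::real)" and z: "z > 0"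
  shows "has_bochner_integral lborel (\<lambda>y. indicator {0..} y * (y powr (a - 1) * exp (- z * y))) (Gamma a / z powr a)"
proof -
  define f where "f t = indicator {0..} t * t powr (a - 1) / exp t" for t :: real
  have [measurable]: "f \<in> borel_measurable borel" unfolding f_def by measurable
  have "has_bochner_integral lborel f (Gamma a)" using Gamma_conv_nn_integral_real[OF a] Gamma_real_pos[OF a]
    by (intro has_bochner_integral_nn_integral) (auto simp: f_def intro!: AE_I2)
  then have f: "integrable lborel f" "integral\<^sup>L lborel f = Gamma a" by (auto simp: has_bochner_integral_iff)
  have "has_bochner_integral lborel (\<lambda>y. f (0 + z * y)) (Gamma a / z)"
    using lborel_integrable_real_affine[OF f(1), of z 0] lborel_integral_real_affine[of z f 0] f(2) z
    by (simp add: has_bochner_integral_iff)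
  then have "has_bochner_integral lborel (\<lambda>y. z powr (1 - a) * f (0 + z * y)) (z powr (1 - a) * (Gamma a / z))"
    by (rule has_bochner_integral_mult_right)
  moreover have "z powr (1 - a) * f (0 + z * y) = indicator {0..} y * (y powr (a - 1) * exp (- z * y))" for y
    using z by (auto simp: f_def powr_mult powr_diff exp_minus zero_le_mult_iff field_simps split: split_indicator)
  moreover have "z powr (1 - a) * (Gamma a / z) = Gamma a / z powr a" using z by (simp add: powr_diff field_simps)
  ultimately show ?thesis by (simp only:)
qed

text \<open>The contour argument below produces these integrals cut off at height Y; it needs their
  limit for one exponent and a bound uniform in Y for another.\<close>

lemma integral_powr_exp_Icc:
  fixes a z :: real
  assumes a: "a \<ge> 1" and z: "z > 0"
  defines "F \<equiv> \<lambda>Y. integral {0..Y} (\<lambda>y. y powr (a - 1) * exp (- z * y))"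
  shows "(F \<longlongrightarrow> Gamma a / z powr a) at_top" "F Y \<le> Gamma a / z powr a"
    and "(\<lambda>y. y powr (a - 1) * exp (- z * y)) integrable_on {0..Y}"
proof -
  let ?f = "\<lambda>y::real. y powr (a - 1) * exp (- z * y)"
  have B: "has_bochner_integral lborel (\<lambda>y. indicator {0..} y * ?f y) (Gamma a / z powr a)"
    using has_bochner_integral_powr_exp[of a z] assms by simp
  then have i: "set_integrable lborel {0..} ?f" and v: "set_lebesgue_integral lborel {0..} ?f = Gamma a / z powr a"
    by (simp_all add: has_bochner_integral_iff set_integrable_def set_lebesgue_integral_def)
  have si: "set_integrable lborel {0..b} ?f" for b using i by (rule set_integrable_subset) auto
  have F: "F b = set_lebesgue_integral lborel {0..b} ?f" for b unfolding F_def using set_borel_integral_eq_integral(2)[OF si] by simp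
  show "(F \<longlongrightarrow> Gamma a / z powr a) at_top"
    unfolding F[abs_def] v[symmetric] by (rule tendsto_set_lebesgue_integral_at_top) (use i in auto)
  show "?f integrable_on {0..Y}" by (rule set_borel_integral_eq_integral(1)[OF si])
  show "F Y \<le> Gamma a / z powr a" unfolding F v[symmetric] set_lebesgue_integral_def
    using i si[of Y] by (intro Bochner_Integration.integral_mono) (auto simp: set_integrable_def split: split_indicator)
qed

text \<open>The closed half plane meets the branch cut only in 0, where |csqrt w| = sqrt |w| gives
  continuity. The boundary matters because the branch points will be corners of the contour.\<close>

lemma continuous_on_csqrt_Re_nonneg: "continuous_on {w. Re w \<ge> 0} csqrt"
proof (intro continuous_at_imp_continuous_on ballI)
  fix w assume w: "w \<in> {w. Re w \<ge> 0}"
  show "isCont csqrt w"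
  proof (cases "w = 0")
    case True
    have "((\<lambda>w. norm (csqrt w)) \<longlongrightarrow> 0) (at 0)" unfolding norm_csqrt by (auto intro!: tendsto_eq_intros)
    then have "(csqrt \<longlongrightarrow> 0) (at 0)" by (rule tendsto_norm_zero_cancel)
    then show ?thesis using True by (simp add: isCont_def)
  next
    case False
    then have "w \<notin> \<real>\<^sub>\<le>\<^sub>0" using w by (auto simp: complex_nonpos_Reals_iff complex_eq_iff)
    then show ?thesis by (rule continuous_at_csqrt)
  qed
qed

lemma csqrt_imaginary:
  assumes "y \<ge> 0"
  shows "csqrt (Complex 0 y) = sqrt y * cis (pi/4)" "csqrt (Complex 0 (-y)) = sqrt y * cis (-pi/4)"
proof -
  have *: "csqrt (Complex 0 (s * y)) = sqrt y * cis (s * pi / 4)" if s: "s = 1 \<or> s = -1" for s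
  proof (cases "y = 0")
    case False
    show ?thesis
    proof (rule csqrt_unique)
      have "(complex_of_real (sqrt y) * cis (s * pi / 4))\<^sup>2 = of_real ((sqrt y)\<^sup>2) * cis (s * pi / 2)"
        by (simp add: power2_eq_square cis_mult mult_ac) (simp flip: of_real_mult)
      also have "\<dots> = Complex 0 (s * y)" using s assms by (auto simp: complex_eq_iff)
      finally show "(complex_of_real (sqrt y) * cis (s * pi / 4))\<^sup>2 = Complex 0 (s * y)" .
      show "0 < Re (complex_of_real (sqrt y) * cis (s * pi / 4)) \<or> Re (complex_of_real (sqrt y) * cis (s * pi / 4)) = 0 \<and> 0 \<le> Im (complex_of_real (sqrt y) * cis (s * pi / 4))"
        using False assms s by (auto simp: cos_45)
    qed
  qed (simp add: complex_eq_iff Complex_eq)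
  show "csqrt (Complex 0 y) = sqrt y * cis (pi/4)" "csqrt (Complex 0 (-y)) = sqrt y * cis (-pi/4)" using *[of 1] *[of "-1"] by auto
qed

text \<open>The difference times the corresponding sum is iy, and the sum has real part at least
  1.\<close>

lemma norm_csqrt_2_diff: "norm (csqrt (Complex 2 y) - sqrt 2) \<le> \<bar>y\<bar>"
proof -
  let ?c = "csqrt (Complex 2 y)"
  have "(?c - sqrt 2) * (?c + sqrt 2) = ?c\<^sup>2 - (complex_of_real (sqrt 2))\<^sup>2" by (simp add: power2_eq_square algebra_simps)
  also have "\<dots> = Complex 0 y" by (simp add: complex_eq_iff flip: of_real_power)
  finally have "norm ((?c - sqrt 2) * (?c + sqrt 2)) = norm (Complex 0 y)" by (rule arg_cong)
  then have "norm (?c - sqrt 2) * norm (?c + sqrt 2) = \<bar>y\<bar>" unfolding norm_mult by (simp only: complex_norm) simp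
  moreover have "1 \<le> norm (?c + sqrt 2)"
  proof -
    have "1 \<le> Re (?c + sqrt 2)" using csqrt_principal[of "Complex 2 y"] by (auto simp: add_increasing)
    then show ?thesis using complex_Re_le_cmod order.trans by blast
  qed
  ultimately show ?thesis using mult_left_mono[of 1 "norm (?c + sqrt 2)" "norm (?c - sqrt 2)"] by simp
qed

lemma contour_integral_linepath_horizontal:
  assumes "a < b"
  shows "contour_integral (linepath (Complex a c) (Complex b c)) f = integral {a..b} (\<lambda>x. f (Complex x c))"
proof -
  have eq: "linepath (Complex a c) (Complex b c) t = linepath (of_real a) (of_real b) t + \<i> * c" for t
    by (auto simp: complex_eq_iff linepath_def algebra_simps)
  have "contour_integral (linepath (Complex a c) (Complex b c)) f =
      contour_integral (linepath (of_real a) (of_real b)) (\<lambda>w. f (w + \<i> * c))"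
    unfolding contour_integral_integral vector_derivative_linepath_at eq by (simp add: complex_eq_iff Complex_eq)
  also have "\<dots> = integral {a..b} (\<lambda>x. f (Complex x c))"
    using assms by (subst contour_integral_linepath_Reals_eq) (auto simp: Complex_eq)
  finally show ?thesis .
qed

text \<open>This is pi * J_1(z) / z with the Bessel function J_1, in the form in which it arises
  from the chords of the unit disc.\<close>

definition bessel_int :: "real \<Rightarrow> real" where
  "bessel_int z = integral {-1..1} (\<lambda>x. sqrt (1 - x\<^sup>2) * cos (z * x))"

text \<open>The segment [-1, 1] is replaced by the other three sides of a rectangle above it. On the
  vertical sides the exponential decays, so only the square root singularities at the corners -1 and
  1 count, and they give Laplace integrals with Gamma values. The top side disappears as its height
  grows.\<close>

lemma bessel_int_asymptotics:
  assumes z: "z > 0"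
  shows "\<bar>bessel_int z - sqrt (2 * pi) * z powr (-3/2) * sin (z - pi/4)\<bar> \<le> 2 * Gamma (5/2) * z powr (-5/2)"
proof -
  \<comment> \<open>Each square root has its cut on the real axis outside the strip, so the product
    is holomorphic inside the strip and continuous up to its boundary, the branch points
    included.\<close>
  define g where "g w = csqrt (1 - w) * csqrt (1 + w) * exp (\<i> * z * w)" for w
  define S where "S = {w. - 1 \<le> Re w \<and> Re w \<le> 1}"
  have cg: "continuous_on S g" unfolding g_def
    by (intro continuous_intros continuous_on_compose2[OF continuous_on_csqrt_Re_nonneg]) (auto simp: S_def)
  define M where "M Y = integral {0..Y} (\<lambda>y. y powr (3/2 - 1) * exp (- z * y))" for Y
  \<comment> \<open>The first error is the cost of replacing csqrt (2 + iy) and csqrt (2 - iy) by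
    sqrt 2 on the two vertical sides; the second is the contribution of the top side.\<close>
  have main: "\<bar>bessel_int z - 2 * sqrt 2 * M Y * sin (z - pi/4)\<bar> \<le> 2 * (Gamma (5/2) / z powr (5/2)) + 2 * ((2 + Y) * exp (- z * Y))"
    if Y: "Y > 0" for Y
  proof -
    let ?a = "Complex (-1) 0" and ?b = "Complex 1 0" and ?c = "Complex 1 Y" and ?d = "Complex (-1) Y"
    have cS: "convex S" unfolding S_def unfolding Collect_conj_eq by (intro convex_Int convex_halfspace_Re_ge convex_halfspace_Re_le)
    have sub: "closed_segment p q \<subseteq> S" if "p \<in> S" "q \<in> S" for p q using that cS by (simp add: closed_segment_subset)
    have inS: "?a \<in> S" "?b \<in> S" "?c \<in> S" "?d \<in> S" by (auto simp: S_def)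
    have ci: "g contour_integrable_on linepath p q" if "p \<in> S" "q \<in> S" for p q
      by (rule contour_integrable_continuous_linepath) (use cg sub[OF that] continuous_on_subset in blast)
    have "(g has_contour_integral 0) (linepath ?a ?b +++ linepath ?b ?c +++ linepath ?c ?d +++ linepath ?d ?a)"
    proof (rule Cauchy_theorem_convex[where S=S and K="{}"])
      fix w assume w: "w \<in> interior S - {}"
      have "interior S \<subseteq> {w. - 1 < Re w \<and> Re w < 1}"
      proof -
        have "S = {w. w \<bullet> 1 \<ge> -1} \<inter> {w. w \<bullet> 1 \<le> 1}" by (auto simp: S_def inner_complex_def)
        then show ?thesis using interior_halfspace_ge[of "1::complex" "-1"] interior_halfspace_le[of "1::complex" 1]
          by (auto simp: inner_complex_def)
      qed
      then have "w \<in> {w. - 1 < Re w \<and> Re w < 1}" using w by auto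
      moreover have "open {w. - 1 < Re w \<and> Re w < 1}"
        unfolding Collect_conj_eq by (intro open_Int open_halfspace_Re_gt open_halfspace_Re_lt)
      moreover have "g holomorphic_on {w. - 1 < Re w \<and> Re w < 1}"
        unfolding g_def by (intro holomorphic_intros) (auto simp: complex_nonpos_Reals_iff)
      ultimately show "g field_differentiable at w" using holomorphic_on_imp_differentiable_at by blast
    qed (use cg cS inS sub in \<open>auto simp: path_image_join\<close>)
    then have "contour_integral (linepath ?a ?b +++ linepath ?b ?c +++ linepath ?c ?d +++ linepath ?d ?a) g = 0"
      by (rule contour_integral_unique)
    then have sum0: "contour_integral (linepath ?a ?b) g + contour_integral (linepath ?b ?c) g
       + contour_integral (linepath ?c ?d) g + contour_integral (linepath ?d ?a) g = 0"
      using ci inS by (simp add: contour_integral_join add.assoc)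
    define JR where "JR = integral {0..Y} (\<lambda>y. g (Complex 1 y))"
    define JL where "JL = integral {0..Y} (\<lambda>y. g (Complex (-1) y))"
    define Top where "Top = integral {-1..1} (\<lambda>x. g (Complex x Y))"
    define Bot where "Bot = integral {-1..1} (\<lambda>x. g (Complex x 0))"
    have 1: "contour_integral (linepath ?b ?c) g = \<i> * JR" unfolding JR_def by (rule contour_integral_linepath_same_Re) (use Y in auto)
    have "contour_integral (linepath ?a ?d) g = \<i> * JL" unfolding JL_def by (rule contour_integral_linepath_same_Re) (use Y in auto)
    then have 2: "contour_integral (linepath ?d ?a) g = - \<i> * JL"
      using contour_integral_reverse_linepath[OF continuous_on_subset[OF cg sub[OF inS(4,1)]]] by simp
    have 3: "contour_integral (linepath ?a ?b) g = Bot" unfolding Bot_def by (rule contour_integral_linepath_horizontal) auto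
    have "contour_integral (linepath ?d ?c) g = Top" unfolding Top_def by (rule contour_integral_linepath_horizontal) auto
    then have 4: "contour_integral (linepath ?c ?d) g = - Top"
      using contour_integral_reverse_linepath[OF continuous_on_subset[OF cg sub[OF inS(3,4)]]] by simp
    have E: "Bot = \<i> * (JL - JR) + Top" using sum0 unfolding 1 2 3 4 by (simp add: algebra_simps add_eq_0_iff)
    have cgv: "continuous_on {u..v} (\<lambda>y. g (Complex r y))" if "\<bar>r\<bar> \<le> 1" for r u v
      by (rule continuous_on_compose2[OF cg]) (use that in \<open>auto simp: S_def Complex_eq intro!: continuous_intros\<close>)
    have cgh: "continuous_on {-1..1} (\<lambda>x. g (Complex x r))" for r
      by (rule continuous_on_compose2[OF cg]) (auto simp: S_def Complex_eq intro!: continuous_intros)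
    have bot: "Re Bot = bessel_int z"
    proof -
      have "Re Bot = integral {-1..1} (\<lambda>x. Re (g (Complex x 0)))" unfolding Bot_def
        by (rule integral_linear[OF _ bounded_linear_Re, unfolded comp_def, symmetric]) (intro integrable_continuous_interval cgh)
      also have "\<dots> = bessel_int z" unfolding bessel_int_def
      proof (rule integral_cong)
        fix x :: real assume x: "x \<in> {-1..1}"
        have "1 - Complex x 0 = of_real (1 - x)" "1 + Complex x 0 = of_real (1 + x)" by (simp_all add: complex_eq_iff)
        then have "csqrt (1 - Complex x 0) = of_real (sqrt (1 - x))" "csqrt (1 + Complex x 0) = of_real (sqrt (1 + x))"
          using x by (simp_all del: of_real_diff of_real_add)
        moreover have "sqrt (1 - x\<^sup>2) = sqrt (1 - x) * sqrt (1 + x)"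
          by (simp add: real_sqrt_mult[symmetric] power2_eq_square algebra_simps)
        moreover have "exp (\<i> * z * Complex x 0) = cis (z * x)" by (simp add: cis_conv_exp Complex_eq mult.assoc)
        ultimately show "Re (g (Complex x 0)) = sqrt (1 - x\<^sup>2) * cos (z * x)"
          unfolding g_def by (simp only: of_real_mult[symmetric] Re_complex_of_real times_complex.sel Im_complex_of_real cis.sel)
      qed
      finally show ?thesis .
    qed
    have top: "norm Top \<le> (2 + Y) * exp (- z * Y) * (1 - (- 1))" unfolding Top_def
    proof (rule integral_bound)
      fix x :: real assume x: "x \<in> {-1..1}"
      have n: "norm (csqrt w) \<le> sqrt (2 + Y)" if "\<bar>Re w\<bar> \<le> 2" "\<bar>Im w\<bar> \<le> Y" for w
        unfolding norm_csqrt using cmod_le[of w] that by (intro real_sqrt_le_mono) linarith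
      have "norm (exp (\<i> * z * Complex x Y)) = exp (- z * Y)" by (simp add: norm_exp_eq_Re)
      moreover have "norm (csqrt (1 - Complex x Y)) * norm (csqrt (1 + Complex x Y)) \<le> sqrt (2 + Y) * sqrt (2 + Y)"
        using x Y by (intro mult_mono n) auto
      ultimately show "norm (g (Complex x Y)) \<le> (2 + Y) * exp (- z * Y)" using Y by (simp add: g_def norm_mult)
    qed (use cgh in auto)
    \<comment> \<open>Serves both vertical sides: \<open>w\<close> is the constant phase of the side
      and \<open>u\<close> the square root that stays near sqrt 2. The deviation of
      \<open>u\<close>, at most y, raises the power under the Laplace integral from 1/2 to
      3/2.\<close>
    have side: "norm (integral {0..Y} (\<lambda>y. g (Complex r y)) - w * sqrt 2 * M Y) \<le> Gamma (5/2) / z powr (5/2)"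
      if r: "\<bar>r\<bar> \<le> 1" and w: "norm w = 1" and
         gr: "\<And>y. y \<ge> 0 \<Longrightarrow> \<exists>u::complex. norm (u - sqrt 2) \<le> y \<and> g (Complex r y) = w * u * (sqrt y * exp (- z * y))" for r :: real and w :: complex
    proof -
      have cm: "continuous_on {0..Y} (\<lambda>y. w * sqrt 2 * (y powr (3/2 - 1) * exp (- z * y)))"
      proof -
        have "continuous_on {0..Y} (\<lambda>y. y powr (3/2 - 1))" by (rule continuous_on_powr') (auto intro!: continuous_intros)
        moreover have "continuous_on {0..Y} (\<lambda>y. exp (- z * y))" by (intro continuous_intros)
        ultimately have "continuous_on {0..Y} (\<lambda>y. y powr (3/2 - 1) * exp (- z * y))" by (rule continuous_on_mult)
        then show ?thesis by (intro continuous_on_mult[OF continuous_on_const continuous_on_of_real])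
      qed
      have "w * sqrt 2 * M Y = integral {0..Y} (\<lambda>y. w * sqrt 2 * (y powr (3/2 - 1) * exp (- z * y)))" unfolding M_def
        by (subst integral_linear[OF integral_powr_exp_Icc(3) bounded_linear_of_real, unfolded comp_def, symmetric])
           (use z in auto)
      then have "integral {0..Y} (\<lambda>y. g (Complex r y)) - w * sqrt 2 * M Y
         = integral {0..Y} (\<lambda>y. g (Complex r y) - w * sqrt 2 * (y powr (3/2 - 1) * exp (- z * y)))"
        using cgv[OF r, of 0 Y] cm by (simp add: Henstock_Kurzweil_Integration.integral_diff integrable_continuous_interval)
      also have "norm \<dots> \<le> integral {0..Y} (\<lambda>y. y powr (5/2 - 1) * exp (- z * y))"
      proof (rule integral_norm_bound_integral)
        show "(\<lambda>y. g (Complex r y) - w * sqrt 2 * (y powr (3/2 - 1) * exp (- z * y))) integrable_on {0..Y}"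
          by (rule integrable_continuous_interval[OF continuous_on_diff[OF cgv[OF r] cm]])
        show "(\<lambda>y. y powr (5/2 - 1) * exp (- z * y)) integrable_on {0..Y}" using z by (intro integral_powr_exp_Icc(3)) auto
        fix y assume y: "y \<in> {0..Y}"
        then obtain u :: complex where u: "norm (u - sqrt 2) \<le> y" "g (Complex r y) = w * u * (sqrt y * exp (- z * y))"
          using gr[of y] by auto
        have "y powr (1/2) = sqrt y" using y by (simp add: powr_half_sqrt)
        then have "g (Complex r y) - w * sqrt 2 * (y powr (3/2 - 1) * exp (- z * y)) = w * (u - sqrt 2) * (sqrt y * exp (- z * y))"
          using u(2) by (simp add: algebra_simps)
        also have "norm \<dots> \<le> y * (sqrt y * exp (- z * y))" using y u(1) w by (simp add: norm_mult mult_right_mono)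
        also have "\<dots> = y powr (5/2 - 1) * exp (- z * y)"
        proof (cases "y = 0")
          case False
          have "y powr (5/2 - 1) = y powr (1 + 1/2)" by simp
          also have "\<dots> = y powr 1 * y powr (1/2)" by (rule powr_add)
          finally have "y powr (5/2 - 1) = y powr 1 * y powr (1/2)" .
          then show ?thesis using y False by (simp add: powr_half_sqrt)
        qed simp
        finally show "norm (g (Complex r y) - w * sqrt 2 * (y powr (3/2 - 1) * exp (- z * y))) \<le> y powr (5/2 - 1) * exp (- z * y)" .
      qed
      also have "\<dots> \<le> Gamma (5/2) / z powr (5/2)" using z by (intro integral_powr_exp_Icc(2)) auto
      finally show ?thesis .
    qed
    have expC: "exp (\<i> * z * Complex r y) = cis (z * r) * exp (- z * y)" for r y
    proof -
      have "\<i> * z * Complex r y = \<i> * of_real (z * r) + of_real (- z * y)" by (simp add: complex_eq_iff)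
      then show ?thesis by (simp only: exp_add cis_conv_exp exp_of_real)
    qed
    have R: "norm (JR - cis (z - pi/4) * sqrt 2 * M Y) \<le> Gamma (5/2) / z powr (5/2)" unfolding JR_def
    proof (rule side)
      fix y :: real assume y: "y \<ge> 0"
      have "g (Complex 1 y) = cis (z - pi/4) * csqrt (Complex 2 y) * (sqrt y * exp (- z * y))"
      proof -
        have "1 - Complex 1 y = Complex 0 (-y)" "1 + Complex 1 y = Complex 2 y" by (auto simp: complex_eq_iff)
        then show ?thesis unfolding g_def expC using csqrt_imaginary[OF y]
          by (simp add: cis_mult[symmetric] cis_divide[symmetric] diff_conv_add_uminus mult_ac del: add_uminus_conv_diff)
      qed
      then show "\<exists>u::complex. norm (u - sqrt 2) \<le> y \<and> g (Complex 1 y) = cis (z - pi/4) * u * (sqrt y * exp (- z * y))"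
        using norm_csqrt_2_diff[of y] y by auto
    qed auto
    have L: "norm (JL - cis (- (z - pi/4)) * sqrt 2 * M Y) \<le> Gamma (5/2) / z powr (5/2)" unfolding JL_def
    proof (rule side)
      fix y :: real assume y: "y \<ge> 0"
      have "g (Complex (-1) y) = cis (- (z - pi/4)) * csqrt (Complex 2 (-y)) * (sqrt y * exp (- z * y))"
      proof -
        have "1 + Complex (-1) y = Complex 0 y" "1 - Complex (-1) y = Complex 2 (-y)" by (auto simp: complex_eq_iff)
        moreover have "cis (- (z - pi/4)) = cis (- z) * cis (pi/4)" by (simp add: cis_mult)
        ultimately show ?thesis unfolding g_def expC using csqrt_imaginary[OF y] by (simp add: mult_ac)
      qed
      then show "\<exists>u::complex. norm (u - sqrt 2) \<le> y \<and> g (Complex (-1) y) = cis (- (z - pi/4)) * u * (sqrt y * exp (- z * y))"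
        using norm_csqrt_2_diff[of "-y"] y by auto
    qed auto
    let ?m = "\<i> * (cis (- (z - pi/4)) * sqrt 2 * M Y - cis (z - pi/4) * sqrt 2 * M Y)"
    have m: "Re ?m = 2 * sqrt 2 * M Y * sin (z - pi/4)"
    proof -
      have "Re (\<i> * (cis (- a) * of_real u * of_real v - cis a * of_real u * of_real v)) = 2 * u * v * sin a" for a u v by simp
      then show ?thesis .
    qed
    have "norm (Bot - ?m) = norm (\<i> * (JL - cis (- (z - pi/4)) * sqrt 2 * M Y) - \<i> * (JR - cis (z - pi/4) * sqrt 2 * M Y) + Top)"
      unfolding E by (simp add: algebra_simps)
    also have "\<dots> \<le> norm (\<i> * (JL - cis (- (z - pi/4)) * sqrt 2 * M Y)) + norm (\<i> * (JR - cis (z - pi/4) * sqrt 2 * M Y)) + norm Top"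
      using norm_triangle_ineq[of "\<i> * (JL - cis (- (z - pi/4)) * sqrt 2 * M Y) - \<i> * (JR - cis (z - pi/4) * sqrt 2 * M Y)" Top]
        norm_triangle_ineq4[of "\<i> * (JL - cis (- (z - pi/4)) * sqrt 2 * M Y)" "\<i> * (JR - cis (z - pi/4) * sqrt 2 * M Y)"] by linarith
    also have "\<dots> \<le> 2 * (Gamma (5/2) / z powr (5/2)) + 2 * ((2 + Y) * exp (- z * Y))" using R L top by (simp add: norm_mult)
    finally have "norm (Bot - ?m) \<le> 2 * (Gamma (5/2) / z powr (5/2)) + 2 * ((2 + Y) * exp (- z * Y))" .
    moreover have "Re (Bot - ?m) = bessel_int z - 2 * sqrt 2 * M Y * sin (z - pi/4)" by (simp only: minus_complex.sel bot m)
    ultimately show ?thesis using abs_Re_le_cmod[of "Bot - ?m"] by linarith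
  qed
  have "((\<lambda>Y. 2 * (Gamma (5/2) / z powr (5/2)) + 2 * ((2 + Y) * exp (- z * Y))) \<longlongrightarrow> 2 * (Gamma (5/2) / z powr (5/2)) + 2 * 0) at_top"
    using z by (intro tendsto_intros) real_asymp
  moreover have "((\<lambda>Y. \<bar>bessel_int z - 2 * sqrt 2 * M Y * sin (z - pi/4)\<bar>) \<longlongrightarrow>
      \<bar>bessel_int z - 2 * sqrt 2 * (Gamma (3/2) / z powr (3/2)) * sin (z - pi/4)\<bar>) at_top"
    unfolding M_def using z by (intro tendsto_intros integral_powr_exp_Icc(1)) auto
  ultimately have "\<bar>bessel_int z - 2 * sqrt 2 * (Gamma (3/2) / z powr (3/2)) * sin (z - pi/4)\<bar> \<le> 2 * (Gamma (5/2) / z powr (5/2)) + 2 * 0"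
    by (rule tendsto_le[OF trivial_limit_at_top_linorder]) (rule eventually_mono[OF eventually_gt_at_top[of 0] main])
  moreover have "Gamma (3/2) = sqrt pi / (2::real)"
  proof -
    have "(1/2::real) \<notin> \<int>\<^sub>\<le>\<^sub>0"
    proof
      assume "(1/2::real) \<in> \<int>\<^sub>\<le>\<^sub>0"
      then obtain n where "n \<le> 0" "1/2 = real_of_int n" by (elim nonpos_Ints_cases)
      then show False by linarith
    qed
    then show ?thesis using Gamma_plus1[of "1/2::real"] Gamma_one_half_real by simp
  qed
  ultimately show ?thesis by (simp add: powr_minus real_sqrt_mult field_simps)
qed

section \<open>Shears, rotations and the Fourier integral of a disc\<close>

lemma borel_measurable_fst_snd [measurable]:
  "(fst :: real \<times> real \<Rightarrow> real) \<in> borel_measurable borel" "(snd :: real \<times> real \<Rightarrow> real) \<in> borel_measurable borel"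
  by (intro borel_measurable_continuous_onI continuous_intros)+

lemma borel_measurable_shear [measurable]:
  "(\<lambda>p. (fst p + a * snd p, snd p) :: real \<times> real) \<in> borel_measurable borel"
  "(\<lambda>p. (fst p, snd p + a * fst p) :: real \<times> real) \<in> borel_measurable borel"
  by (intro borel_measurable_continuous_onI continuous_intros)+

text \<open>By Fubini, since the shear acts on each horizontal line as a translation.\<close>

lemma distr_shear_fst: "distr lborel borel (\<lambda>p. (fst p + a * snd p, snd p)) = (lborel :: (real \<times> real) measure)"
proof (rule measure_eqI)
  fix A :: "(real \<times> real) set" assume "A \<in> sets (distr lborel borel (\<lambda>p. (fst p + a * snd p, snd p)))"
  then have A[measurable]: "A \<in> sets borel" by simp
  have m: "indicator A \<in> borel_measurable (lborel \<Otimes>\<^sub>M lborel :: (real \<times> real) measure)" by (simp add: lborel_prod)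
  have m': "(\<lambda>p. indicator A (fst p + a * snd p, snd p) :: ennreal) \<in> borel_measurable (lborel \<Otimes>\<^sub>M lborel)"
    using measurable_compose[OF borel_measurable_shear(1) borel_measurable_indicator[OF A]] by (simp add: lborel_prod)
  have "emeasure (distr lborel borel (\<lambda>p. (fst p + a * snd p, snd p))) A
      = (\<integral>\<^sup>+p. indicator A (fst p + a * snd p, snd p) \<partial>(lborel \<Otimes>\<^sub>M lborel))"
    by (subst nn_integral_indicator[symmetric], simp, subst nn_integral_distr) (auto simp: lborel_prod)
  also have "\<dots> = (\<integral>\<^sup>+y. \<integral>\<^sup>+x. indicator A (x + a * y, y) \<partial>lborel \<partial>lborel)"
    by (subst lborel_pair.nn_integral_snd[symmetric]) (use m' in auto)
  also have "\<dots> = (\<integral>\<^sup>+y. \<integral>\<^sup>+x. indicator A (x, y) \<partial>lborel \<partial>lborel)"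
  proof (rule nn_integral_cong)
    fix y :: real
    have "(\<lambda>x. indicator A (x, y) :: ennreal) \<in> borel_measurable borel" by measurable
    from nn_integral_real_affine[OF this, of 1 "a * y"]
    show "(\<integral>\<^sup>+x. indicator A (x + a * y, y) \<partial>lborel) = (\<integral>\<^sup>+x. indicator A (x, y) \<partial>lborel)"
      by (simp add: add.commute)
  qed
  also have "\<dots> = (\<integral>\<^sup>+p. indicator A p \<partial>(lborel \<Otimes>\<^sub>M lborel))"
    using m by (subst lborel_pair.nn_integral_snd[symmetric]) auto
  also have "\<dots> = emeasure lborel A" by (simp add: lborel_prod)
  finally show "emeasure (distr lborel borel (\<lambda>p. (fst p + a * snd p, snd p))) A = emeasure lborel A" .
qed simp

lemma distr_shear_snd: "distr lborel borel (\<lambda>p. (fst p, snd p + a * fst p)) = (lborel :: (real \<times> real) measure)"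
proof (rule measure_eqI)
  fix A :: "(real \<times> real) set" assume "A \<in> sets (distr lborel borel (\<lambda>p. (fst p, snd p + a * fst p)))"
  then have A[measurable]: "A \<in> sets borel" by simp
  have m: "indicator A \<in> borel_measurable (lborel \<Otimes>\<^sub>M lborel :: (real \<times> real) measure)" by (simp add: lborel_prod)
  have m': "(\<lambda>p. indicator A (fst p, snd p + a * fst p) :: ennreal) \<in> borel_measurable (lborel \<Otimes>\<^sub>M lborel)"
    using measurable_compose[OF borel_measurable_shear(2) borel_measurable_indicator[OF A]] by (simp add: lborel_prod)
  have "emeasure (distr lborel borel (\<lambda>p. (fst p, snd p + a * fst p))) A
      = (\<integral>\<^sup>+p. indicator A (fst p, snd p + a * fst p) \<partial>(lborel \<Otimes>\<^sub>M lborel))"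
    by (subst nn_integral_indicator[symmetric], simp, subst nn_integral_distr) (auto simp: lborel_prod)
  also have "\<dots> = (\<integral>\<^sup>+x. \<integral>\<^sup>+y. indicator A (x, y + a * x) \<partial>lborel \<partial>lborel)"
    by (subst lborel.nn_integral_fst[symmetric]) (use m' in auto)
  also have "\<dots> = (\<integral>\<^sup>+x. \<integral>\<^sup>+y. indicator A (x, y) \<partial>lborel \<partial>lborel)"
  proof (rule nn_integral_cong)
    fix x :: real
    have "(\<lambda>y. indicator A (x, y) :: ennreal) \<in> borel_measurable borel" by measurable
    from nn_integral_real_affine[OF this, of 1 "a * x"]
    show "(\<integral>\<^sup>+y. indicator A (x, y + a * x) \<partial>lborel) = (\<integral>\<^sup>+y. indicator A (x, y) \<partial>lborel)"
      by (simp add: add.commute)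
  qed
  also have "\<dots> = (\<integral>\<^sup>+p. indicator A p \<partial>(lborel \<Otimes>\<^sub>M lborel))"
    using m by (subst lborel.nn_integral_fst[symmetric]) auto
  also have "\<dots> = emeasure lborel A" by (simp add: lborel_prod)
  finally show "emeasure (distr lborel borel (\<lambda>p. (fst p, snd p + a * fst p))) A = emeasure lborel A" .
qed simp

text \<open>A rotation that is not a homothety is a product of three shears.\<close>

lemma integral_rotate:
  fixes f :: "real \<times> real \<Rightarrow> complex"
  assumes [measurable]: "f \<in> borel_measurable borel" and cs: "c\<^sup>2 + s\<^sup>2 = 1" "s \<noteq> 0"
  shows "(LINT p|lborel. f (c * fst p - s * snd p, s * fst p + c * snd p)) = (LINT p|lborel. f p)"
proof -
  \<comment> \<open>Minus the tangent of half the rotation angle, which is where \<open>s\<close>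
    has to be nonzero.\<close>
  define a where "a = (c - 1) / s"
  have a: "1 + a * s = c" "a * (1 + c) = - s"
  proof -
    show "1 + a * s = c" using cs(2) by (simp add: a_def)
    have "(c - 1) * (1 + c) = - s * s" using cs(1) by (simp add: power2_eq_square algebra_simps)
    then show "a * (1 + c) = - s" using cs(2) by (simp add: a_def field_simps)
  qed
  let ?X = "\<lambda>p::real \<times> real. (fst p + a * snd p, snd p)" and ?Y = "\<lambda>p::real \<times> real. (fst p, snd p + s * fst p)"
  have int1: "(LINT p|lborel. g (?X p)) = (LINT p|lborel. g p)" if [measurable]: "g \<in> borel_measurable borel" for g :: "real \<times> real \<Rightarrow> complex"
    by (subst (2) distr_shear_fst[of a, symmetric], subst integral_distr) auto
  have int2: "(LINT p|lborel. g (?Y p)) = (LINT p|lborel. g p)" if [measurable]: "g \<in> borel_measurable borel" for g :: "real \<times> real \<Rightarrow> complex"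
    by (subst (2) distr_shear_snd[of s, symmetric], subst integral_distr) auto
  have "(LINT p|lborel. f (c * fst p - s * snd p, s * fst p + c * snd p)) = (LINT p|lborel. f (?X (?Y (?X p))))"
  proof (intro Bochner_Integration.integral_cong refl arg_cong[of _ _ f])
    fix p :: "real \<times> real"
    have "a + a * c = - s" using a(2) by (simp add: algebra_simps)
    moreover have "fst p + a * snd p + a * (snd p + s * (fst p + a * snd p)) = (1 + a * s) * fst p + (a + a * (1 + a * s)) * snd p"
      by (simp add: algebra_simps)
    moreover have "snd p + s * (fst p + a * snd p) = s * fst p + (1 + a * s) * snd p" by (simp add: algebra_simps)
    ultimately show "(c * fst p - s * snd p, s * fst p + c * snd p) = ?X (?Y (?X p))" by (simp add: a(1))
  qed
  also have "\<dots> = (LINT p|lborel. f (?X (?Y p)))" by (rule int1[of "\<lambda>p. f (?X (?Y p))"]) measurable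
  also have "\<dots> = (LINT p|lborel. f (?X p))" by (rule int2[of "\<lambda>p. f (?X p)"]) measurable
  also have "\<dots> = (LINT p|lborel. f p)" by (rule int1) measurable
  finally show ?thesis .
qed

lemma norm_Pair_le_iff: "t \<ge> 0 \<Longrightarrow> norm (x, y) \<le> t \<longleftrightarrow> x\<^sup>2 + y\<^sup>2 \<le> (t::real)\<^sup>2" for x y :: real
  unfolding norm_prod_def by (simp add: real_sqrt_le_iff' real_le_lsqrt sqrt_le_D)

text \<open>Integration along the chords perpendicular to the axis leaves the chord length times a
  character. The chord length is even, so the imaginary part vanishes; scaling by \<open>t\<close>
  reduces the rest to the unit disc.\<close>

lemma disc_fourier_axis:
  assumes t: "t > 0"
  shows "(LINT p|lborel. indicator (cball (0 :: real \<times> real) t) p *\<^sub>R e2 (k * fst p)) = 2 * t\<^sup>2 * bessel_int (2 * pi * (t * k))"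
proof -
  have [measurable]: "cball 0 t \<in> sets (borel :: (real \<times> real) measure)" by simp
  define F where "F p = indicator (cball 0 t) p *\<^sub>R e2 (k * fst p)" for p :: "real \<times> real"
  have ind: "integrable lborel (indicator (cball 0 t :: (real \<times> real) set) :: _ \<Rightarrow> real)"
    using emeasure_bounded_finite[of "cball 0 t"] by (intro integrable_real_indicator) auto
  have intF: "integrable (lborel \<Otimes>\<^sub>M lborel) F"
  proof -
    have "(\<lambda>p. indicator (cball 0 t) p *\<^sub>R e2 (k * fst p)) \<in> borel_measurable (borel :: (real \<times> real) measure)" by measurable
    then have "F \<in> borel_measurable borel" by (simp add: F_def[abs_def])
    then show ?thesis unfolding lborel_prod by (intro Bochner_Integration.integrable_bound[OF ind]) (auto simp: F_def)
  qed
  define h where "h x = (if \<bar>x\<bar> \<le> t then 2 * sqrt (t\<^sup>2 - x\<^sup>2) else 0)" for x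
  have slice: "(LINT y|lborel. F (x, y)) = h x *\<^sub>R e2 (k * x)" for x
  proof (cases "\<bar>x\<bar> \<le> t")
    case True
    then have x2: "x\<^sup>2 \<le> t\<^sup>2" using t by (simp add: abs_le_square_iff[symmetric])
    have "F (x, y) = indicator {- sqrt (t\<^sup>2 - x\<^sup>2)..sqrt (t\<^sup>2 - x\<^sup>2)} y *\<^sub>R e2 (k * x)" for y
    proof -
      have "x\<^sup>2 + y\<^sup>2 \<le> t\<^sup>2 \<longleftrightarrow> \<bar>y\<bar> \<le> sqrt (t\<^sup>2 - x\<^sup>2)"
        using x2 real_sqrt_le_iff[of "y\<^sup>2" "t\<^sup>2 - x\<^sup>2"] by auto
      then show ?thesis using t by (auto simp: F_def norm_Pair_le_iff abs_le_iff split: split_indicator)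
    qed
    then show ?thesis using x2 True by (simp add: h_def)
  next
    case False
    then have "t\<^sup>2 < x\<^sup>2" using t by (metis abs_of_pos abs_le_square_iff not_le)
    then have "\<not> x\<^sup>2 + y\<^sup>2 \<le> t\<^sup>2" for y using zero_le_power2[of y] by linarith
    then have "F (x, y) = 0" for y using t by (auto simp: F_def norm_Pair_le_iff)
    then show ?thesis using False by (simp add: h_def)
  qed
  have [measurable]: "h \<in> borel_measurable borel" unfolding h_def by measurable
  have "integral\<^sup>L (lborel \<Otimes>\<^sub>M lborel) F = (LINT x|lborel. LINT y|lborel. F (x, y))"
    using lborel_pair.integral_fst'[OF intF] by simp
  also have "\<dots> = (LINT x|lborel. h x *\<^sub>R e2 (k * x))" unfolding slice ..
  finally have 1: "(LINT p|lborel. F p) = (LINT x|lborel. h x *\<^sub>R e2 (k * x))" by (simp add: lborel_prod)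
  have int1: "integrable lborel (\<lambda>x. h x *\<^sub>R e2 (k * x))" using lborel_pair.integrable_fst'[OF intF] by (simp add: slice)
  have Im0: "Im (LINT x|lborel. h x *\<^sub>R e2 (k * x)) = 0"
  proof -
    let ?I = "LINT x|lborel. h x * sin (2 * pi * (k * x))"
    have "Im (LINT x|lborel. h x *\<^sub>R e2 (k * x)) = ?I" using int1 by (simp add: integral_Im[symmetric] Im_e2 del: integral_Im)
    moreover have "?I = (LINT x|lborel. h (0 + -1 * x) * sin (2 * pi * (k * (0 + -1 * x))))"
      by (subst lborel_integral_real_affine[where c="-1" and t=0]) auto
    moreover have "h (- x) = h x" for x by (simp add: h_def)
    then have "(LINT x|lborel. h (0 + -1 * x) * sin (2 * pi * (k * (0 + -1 * x)))) = - ?I" by simp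
    ultimately show ?thesis by simp
  qed
  have "Re (LINT x|lborel. h x *\<^sub>R e2 (k * x)) = (LINT x|lborel. h x * cos (2 * pi * (k * x)))"
    using int1 by (simp add: integral_Re[symmetric] Re_e2 del: integral_Re)
  also have "\<dots> = t * (LINT x|lborel. h (0 + t * x) * cos (2 * pi * (k * (0 + t * x))))"
    using t by (subst lborel_integral_real_affine[where c=t and t=0]) auto
  also have "\<dots> = t * (LINT x:{-1..1}|lborel. (2 * t) * (sqrt (1 - x\<^sup>2) * cos (2 * pi * (t * k) * x)))"
    unfolding set_lebesgue_integral_def
  proof (intro arg_cong2[of _ _ _ _ "(*)"] refl Bochner_Integration.integral_cong)
    fix x :: real
    have "\<bar>t * x\<bar> \<le> t \<longleftrightarrow> \<bar>x\<bar> \<le> 1" using t by (simp add: abs_mult)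
    moreover have "sqrt (t\<^sup>2 - (t * x)\<^sup>2) = t * sqrt (1 - x\<^sup>2)"
    proof -
      have "t\<^sup>2 - (t * x)\<^sup>2 = t\<^sup>2 * (1 - x\<^sup>2)" by (simp add: algebra_simps power_mult_distrib)
      then show ?thesis using t by (simp add: real_sqrt_mult)
    qed
    ultimately show "h (0 + t * x) * cos (2 * pi * (k * (0 + t * x)))
       = indicator {-1..1} x *\<^sub>R ((2 * t) * (sqrt (1 - x\<^sup>2) * cos (2 * pi * (t * k) * x)))"
      by (auto simp: h_def abs_le_iff mult_ac split: split_indicator)
  qed
  also have "\<dots> = 2 * t\<^sup>2 * (LINT x:{-1..1}|lborel. sqrt (1 - x\<^sup>2) * cos (2 * pi * (t * k) * x))"
    by (subst set_integral_mult_right) (simp add: power2_eq_square)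
  also have "(LINT x:{-1..1}|lborel. sqrt (1 - x\<^sup>2) * cos (2 * pi * (t * k) * x)) = bessel_int (2 * pi * (t * k))"
    unfolding bessel_int_def by (intro set_borel_integral_eq_integral borel_integrable_atLeastAtMost' continuous_intros)
  finally have "(LINT x|lborel. h x *\<^sub>R e2 (k * x)) = of_real (2 * t\<^sup>2 * bessel_int (2 * pi * (t * k)))"
    using Im0 by (simp add: complex_eq_iff)
  then show ?thesis using 1 unfolding F_def by simp
qed

text \<open>A rotation moves the frequency (a, b) onto the first axis and preserves the disc. For
  \<open>b = 0\<close> that rotation would have sine 0 and is excluded, but there evenness of the
  cosine takes care of the sign of \<open>a\<close>.\<close>

lemma disc_fourier:
  assumes t: "t > 0"
  shows "(LINT p|lborel. indicator (cball 0 t) p *\<^sub>R e2 (a * fst p + b * snd p))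
       = 2 * t\<^sup>2 * bessel_int (2 * pi * (t * sqrt (a\<^sup>2 + b\<^sup>2)))"
proof (cases "b = 0")
  case True
  then show ?thesis using disc_fourier_axis[OF t, of a] by (cases "a \<ge> 0") (auto simp: bessel_int_def)
next
  case False
  define k where "k = sqrt (a\<^sup>2 + b\<^sup>2)"
  have k: "k > 0" "k\<^sup>2 = a\<^sup>2 + b\<^sup>2" using False by (auto simp: k_def sum_power2_gt_zero_iff)
  define c s where "c = a / k" and "s = - b / k"
  have cs: "c\<^sup>2 + s\<^sup>2 = 1" "s \<noteq> 0" "k * c = a" "k * s = - b"
    using k False by (auto simp: c_def s_def power_divide simp flip: add_divide_distrib)
  have [measurable]: "cball 0 t \<in> sets (borel :: (real \<times> real) measure)" by simp
  define f where "f p = indicator (cball 0 t) p *\<^sub>R e2 (k * fst p)" for p :: "real \<times> real"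
  have [measurable]: "f \<in> borel_measurable borel" unfolding f_def by measurable
  have "(LINT p|lborel. indicator (cball 0 t) p *\<^sub>R e2 (a * fst p + b * snd p)) = (LINT p|lborel. f (c * fst p - s * snd p, s * fst p + c * snd p))"
  proof (intro Bochner_Integration.integral_cong refl)
    fix p :: "real \<times> real"
    have "(c * fst p - s * snd p)\<^sup>2 + (s * fst p + c * snd p)\<^sup>2 = (c\<^sup>2 + s\<^sup>2) * ((fst p)\<^sup>2 + (snd p)\<^sup>2)"
      by (simp add: power2_eq_square algebra_simps)
    then have "norm (c * fst p - s * snd p, s * fst p + c * snd p) \<le> t \<longleftrightarrow> norm p \<le> t"
      using t cs(1) norm_Pair_le_iff[of t "fst p" "snd p"] by (simp add: norm_Pair_le_iff)
    moreover have "k * (c * fst p - s * snd p) = a * fst p + b * snd p"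
      using cs(3,4) by (simp add: right_diff_distrib mult.assoc[symmetric])
    ultimately show "indicator (cball 0 t) p *\<^sub>R e2 (a * fst p + b * snd p) = f (c * fst p - s * snd p, s * fst p + c * snd p)"
      by (auto simp: f_def split: split_indicator)
  qed
  also have "\<dots> = (LINT p|lborel. f p)" by (rule integral_rotate) (use cs in auto)
  finally show ?thesis unfolding f_def disc_fourier_axis[OF t] k_def .
qed

section \<open>Linear forms in norms of lattice vectors\<close>

text \<open>Integer polynomials as functions of a valuation, generated by multiplication with one
  variable at a time: the rules are the closure properties under which heights are tracked later, so
  that tracking is one induction.\<close>

inductive int_poly :: "((nat \<Rightarrow> real) \<Rightarrow> real) \<Rightarrow> bool" where
  int_poly_const: "int_poly (\<lambda>v. of_int c)"
| int_poly_add: "int_poly F \<Longrightarrow> int_poly G \<Longrightarrow> int_poly (\<lambda>v. F v + G v)"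
| int_poly_var: "int_poly F \<Longrightarrow> int_poly (\<lambda>v. v i * F v)"

lemma int_poly_cmult: "int_poly G \<Longrightarrow> int_poly (\<lambda>v. of_int c * G v)"
proof (induction rule: int_poly.induct)
  case (int_poly_const d)
  then show ?case using int_poly.int_poly_const[of "c * d"] by simp
next
  case (int_poly_add F G)
  then show ?case using int_poly.int_poly_add[OF int_poly_add.IH] by (simp add: ring_distribs)
next
  case (int_poly_var F i)
  then show ?case using int_poly.int_poly_var[OF int_poly_var.IH, of i] by (simp add: mult.left_commute)
qed

lemma int_poly_mult: "int_poly F \<Longrightarrow> int_poly G \<Longrightarrow> int_poly (\<lambda>v. F v * G v)"
proof (induction rule: int_poly.induct)
  case (int_poly_const d)
  then show ?case using int_poly_cmult by simp
next
  case (int_poly_add F1 F2)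
  then show ?case using int_poly.int_poly_add[OF int_poly_add.IH] by (simp add: ring_distribs)
next
  case (int_poly_var F i)
  then show ?case using int_poly.int_poly_var[OF int_poly_var.IH, of i] by (simp add: mult.assoc)
qed

lemma int_poly_proj: "int_poly (\<lambda>v. v i)" using int_poly_var[OF int_poly_const[of 1]] by simp

lemma int_poly_sum: "int_poly (\<lambda>v. \<Sum>i<n::nat. v i)"
  by (induction n) (use int_poly_const[of 0] int_poly_add int_poly_proj in auto)

text \<open>The parts even and odd in the j-th variable. Writing the square by updating the
  valuation keeps \<open>A\<close> and \<open>B\<close> inside the same inductive class.\<close>

lemma int_poly_even_odd:
  "int_poly F \<Longrightarrow> \<exists>A B. int_poly A \<and> int_poly B \<and> (\<forall>v. F v = A (v(j := (v j)\<^sup>2)) + v j * B (v(j := (v j)\<^sup>2)))"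
proof (induction rule: int_poly.induct)
  case (int_poly_const c)
  show ?case by (intro exI[of _ "\<lambda>v. of_int c"] exI[of _ "\<lambda>v. of_int 0"] conjI int_poly.int_poly_const) simp
next
  case (int_poly_add F G)
  then obtain A B C D where *: "int_poly A" "int_poly B" "\<And>v. F v = A (v(j := (v j)\<^sup>2)) + v j * B (v(j := (v j)\<^sup>2))"
    "int_poly C" "int_poly D" "\<And>v. G v = C (v(j := (v j)\<^sup>2)) + v j * D (v(j := (v j)\<^sup>2))" by metis
  show ?case by (rule exI[of _ "\<lambda>v. A v + C v"], rule exI[of _ "\<lambda>v. B v + D v"])
       (intro conjI allI int_poly.int_poly_add *, simp only: *(3,6) ring_distribs ac_simps)
next
  case (int_poly_var F i)
  then obtain A B where *: "int_poly A" "int_poly B" "\<And>v. F v = A (v(j := (v j)\<^sup>2)) + v j * B (v(j := (v j)\<^sup>2))" by metis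
  show ?case
  proof (cases "i = j")
    case True
    show ?thesis by (rule exI[of _ "\<lambda>v. v j * B v"], rule exI[of _ A])
         (intro conjI allI int_poly.int_poly_var *, simp only: *(3) True power2_eq_square ring_distribs ac_simps fun_upd_same)
  next
    case False
    show ?thesis by (rule exI[of _ "\<lambda>v. v i * A v"], rule exI[of _ "\<lambda>v. v i * B v"])
         (intro conjI allI int_poly.int_poly_var *, simp only: *(3) ring_distribs mult.left_commute fun_upd_other[OF False])
  qed
qed

text \<open>(A + v B) (A - v B) = A^2 - v^2 B^2: the norm for a single square root.\<close>

lemma int_poly_norm_step:
  assumes "int_poly F"
  shows "\<exists>G. int_poly G \<and> (\<forall>v. F v * F (v(j := - v j)) = G (v(j := (v j)\<^sup>2)))"
proof -
  obtain A B where *: "int_poly A" "int_poly B" "\<And>v. F v = A (v(j := (v j)\<^sup>2)) + v j * B (v(j := (v j)\<^sup>2))"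
    using int_poly_even_odd[OF assms] by metis
  have "int_poly (\<lambda>v. A v * A v + of_int (-1) * (v j * (B v * B v)))"
    by (intro int_poly_add int_poly_mult int_poly_cmult int_poly_var *)
  then show ?thesis by (intro exI[of _ "\<lambda>v. A v * A v + of_int (-1) * (v j * (B v * B v))"])
       (auto simp: *(3) algebra_simps power2_eq_square)
qed

definition flip_signs :: "nat set \<Rightarrow> (nat \<Rightarrow> real) \<Rightarrow> nat \<Rightarrow> real" where
  "flip_signs S v i = (if i \<in> S then - v i else v i)"

text \<open>The sign patterns on one more variable are the old ones taken with either sign of the
  new variable, so the norm for one square root can be iterated. The result plays the part of a norm
  from a field generated by square roots, without any field extension.\<close>

lemma int_poly_sign_norm:
  assumes "int_poly F"
  shows "\<exists>G. int_poly G \<and> (\<forall>v. (\<Prod>S\<in>Pow {..<n}. F (flip_signs S v)) = G (\<lambda>i. if i < n then (v i)\<^sup>2 else v i))"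
proof (induction n)
  case 0
  then show ?case using assms by (intro exI[of _ F]) (auto simp: flip_signs_def)
next
  case (Suc n)
  then obtain G where G: "int_poly G"
    "\<And>v. (\<Prod>S\<in>Pow {..<n}. F (flip_signs S v)) = G (\<lambda>i. if i < n then (v i)\<^sup>2 else v i)" by blast
  obtain G' where G': "int_poly G'" "\<And>v. G v * G (v(n := - v n)) = G' (v(n := (v n)\<^sup>2))"
    using int_poly_norm_step[OF G(1), of n] by blast
  have "(\<Prod>S\<in>Pow {..<Suc n}. F (flip_signs S v)) = G' (\<lambda>i. if i < Suc n then (v i)\<^sup>2 else v i)" for v
  proof -
    have "Pow {..<Suc n} = Pow {..<n} \<union> insert n ` Pow {..<n}" by (simp add: lessThan_Suc Pow_insert)
    moreover have "Pow {..<n} \<inter> insert n ` Pow {..<n} = {}" by auto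
    moreover have inj: "inj_on (insert n) (Pow {..<n})" by (auto simp: inj_on_def)
    ultimately have "(\<Prod>S\<in>Pow {..<Suc n}. F (flip_signs S v)) =
      (\<Prod>S\<in>Pow {..<n}. F (flip_signs S v)) * (\<Prod>S\<in>Pow {..<n}. F (flip_signs (insert n S) v))"
      by (simp add: prod.union_disjoint prod.reindex)
    also have "(\<Prod>S\<in>Pow {..<n}. F (flip_signs (insert n S) v)) = (\<Prod>S\<in>Pow {..<n}. F (flip_signs S (v(n := - v n))))"
      by (intro prod.cong refl arg_cong[of _ _ F]) (auto simp: flip_signs_def fun_eq_iff)
    also have "(\<Prod>S\<in>Pow {..<n}. F (flip_signs S v)) * \<dots> =
       G (\<lambda>i. if i < n then (v i)\<^sup>2 else v i) * G ((\<lambda>i. if i < n then (v i)\<^sup>2 else v i)(n := - v n))"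
      unfolding G(2) by (intro arg_cong2[of _ _ _ _ "(*)"] refl arg_cong[of _ _ G]) auto
    also have "\<dots> = G' ((\<lambda>i. if i < n then (v i)\<^sup>2 else v i)(n := (v n)\<^sup>2))"
      using G'(2)[of "\<lambda>i. if i < n then (v i)\<^sup>2 else v i"] by simp
    also have "((\<lambda>i. if i < n then (v i)\<^sup>2 else v i)(n := (v n)\<^sup>2)) = (\<lambda>i. if i < Suc n then (v i)\<^sup>2 else v i)"
      by (auto simp: fun_eq_iff less_Suc_eq)
    finally show ?thesis .
  qed
  with G'(1) show ?case by blast
qed

text \<open>Families of bivariate integer polynomials of bounded degree whose coefficients grow at most
  polynomially in a height parameter.\<close>

definition poly_family :: "('p \<Rightarrow> bool) \<Rightarrow> ('p \<Rightarrow> real) \<Rightarrow> ('p \<Rightarrow> real \<Rightarrow> real \<Rightarrow> real) \<Rightarrow> bool" where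
  "poly_family D H f \<longleftrightarrow> (\<exists>n C K. C \<ge> 0 \<and> (\<forall>p. D p \<longrightarrow> (\<exists>a. (\<forall>x y. f p x y = eval2 n a x y) \<and>
     (\<forall>i j. (n < i + j \<longrightarrow> a i j = 0) \<and> of_int \<bar>a i j\<bar> \<le> C * H p ^ K))))"

lemma finite_deg_pairs: "finite {(i::nat, j). i + j \<le> n}" by (rule finite_subset[of _ "{..n} \<times> {..n}"]) auto

lemma eval2_pad:
  assumes "\<And>i j. n < i + j \<Longrightarrow> a i j = 0" "n \<le> n'"
  shows "eval2 n' a x y = eval2 n a x y" unfolding eval2_def
proof (rule sum.mono_neutral_right)
  show "\<forall>q\<in>{(i, j). i + j \<le> n'} - {(i, j). i + j \<le> n}. (case q of (i, j) \<Rightarrow> of_int (a i j) * x ^ i * y ^ j) = 0"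
  proof (intro ballI)
    fix q assume q: "q \<in> {(i, j). i + j \<le> n'} - {(i, j). i + j \<le> n}"
    obtain i j where ij: "q = (i, j)" by (cases q)
    then have "a i j = 0" using q by (intro assms(1)) simp
    then show "(case q of (i, j) \<Rightarrow> of_int (a i j) * x ^ i * y ^ j) = 0" using ij by simp
  qed
qed (use assms finite_deg_pairs in auto)

lemma poly_family_const:
  assumes "\<And>p. D p \<Longrightarrow> of_int \<bar>c p\<bar> \<le> C * H p ^ K" "C \<ge> 0"
    "\<And>p. D p \<Longrightarrow> H p \<ge> 1"
  shows "poly_family D H (\<lambda>p x y. of_int (c p))" unfolding poly_family_def
proof (rule exI[of _ 0], rule exI[of _ C], rule exI[of _ K], intro conjI allI impI)
  fix p assume p: "D p"
  have "{(i::nat, j::nat). i + j \<le> 0} = {(0, 0)}" by auto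
  then show "\<exists>a. (\<forall>x y. of_int (c p) = eval2 0 a x y) \<and> (\<forall>i j. (0 < i + j \<longrightarrow> a i j = 0) \<and> of_int \<bar>a i j\<bar> \<le> C * H p ^ K)"
    using assms(1)[OF p] assms(2) assms(3)[OF p] by (intro exI[of _ "\<lambda>i j. if i + j = 0 then c p else 0"]) (auto simp: eval2_def)
qed (use assms in auto)

lemma poly_family_add:
  assumes "poly_family D H f" "poly_family D H g" and H: "\<And>p. D p \<Longrightarrow> H p \<ge> 1"
  shows "poly_family D H (\<lambda>p x y. f p x y + g p x y)"
proof -
  obtain n C K where f: "C \<ge> 0" "\<And>p. D p \<Longrightarrow> (\<exists>a. (\<forall>x y. f p x y = eval2 n a x y) \<and>
     (\<forall>i j. (n < i + j \<longrightarrow> a i j = 0) \<and> of_int \<bar>a i j\<bar> \<le> C * H p ^ K))"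
    using assms(1) unfolding poly_family_def by blast
  obtain m B L where g: "B \<ge> 0" "\<And>p. D p \<Longrightarrow> (\<exists>a. (\<forall>x y. g p x y = eval2 m a x y) \<and>
     (\<forall>i j. (m < i + j \<longrightarrow> a i j = 0) \<and> of_int \<bar>a i j\<bar> \<le> B * H p ^ L))"
    using assms(2) unfolding poly_family_def by blast
  show ?thesis unfolding poly_family_def
  proof (rule exI[of _ "n + m"], rule exI[of _ "C + B"], rule exI[of _ "K + L"], intro conjI allI impI)
    fix p assume p: "D p"
    obtain a where a: "\<And>x y. f p x y = eval2 n a x y" "\<And>i j. n < i + j \<Longrightarrow> a i j = 0"
      "\<And>i j. of_int \<bar>a i j\<bar> \<le> C * H p ^ K" using f(2)[OF p] by blast
    obtain b where b: "\<And>x y. g p x y = eval2 m b x y" "\<And>i j. m < i + j \<Longrightarrow> b i j = 0"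
      "\<And>i j. of_int \<bar>b i j\<bar> \<le> B * H p ^ L" using g(2)[OF p] by blast
    have "f p x y + g p x y = eval2 (n + m) (\<lambda>i j. a i j + b i j) x y" for x y
    proof -
      have "eval2 (n + m) (\<lambda>i j. a i j + b i j) x y = eval2 (n + m) a x y + eval2 (n + m) b x y"
        unfolding eval2_def sum.distrib[symmetric] by (rule sum.cong) (auto simp: algebra_simps)
      then show ?thesis using a b eval2_pad[of n a "n + m"] eval2_pad[of m b "n + m"] by simp
    qed
    moreover have "of_int \<bar>a i j + b i j\<bar> \<le> (C + B) * H p ^ (K + L)" for i j
    proof -
      have "real_of_int \<bar>a i j + b i j\<bar> \<le> C * H p ^ K + B * H p ^ L" using a(3)[of i j] b(3)[of i j] by linarith
      also have "\<dots> \<le> C * H p ^ (K + L) + B * H p ^ (K + L)"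
        using H[OF p] f(1) g(1) by (intro add_mono mult_left_mono power_increasing) auto
      finally show ?thesis by (simp add: algebra_simps)
    qed
    ultimately show "\<exists>a. (\<forall>x y. f p x y + g p x y = eval2 (n + m) a x y) \<and>
       (\<forall>i j. (n + m < i + j \<longrightarrow> a i j = 0) \<and> of_int \<bar>a i j\<bar> \<le> (C + B) * H p ^ (K + L))"
      using a(2) b(2) by (intro exI[of _ "\<lambda>i j. a i j + b i j"]) auto
  qed (use f g in auto)
qed

lemma poly_family_cmult:
  assumes "poly_family D H f" "\<And>p. D p \<Longrightarrow> of_int \<bar>c p\<bar> \<le> B * H p ^ L" "B \<ge> 0"
    and H: "\<And>p. D p \<Longrightarrow> H p \<ge> 1"
  shows "poly_family D H (\<lambda>p x y. of_int (c p) * f p x y)"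
proof -
  obtain n C K where f: "C \<ge> 0" "\<And>p. D p \<Longrightarrow> (\<exists>a. (\<forall>x y. f p x y = eval2 n a x y) \<and>
     (\<forall>i j. (n < i + j \<longrightarrow> a i j = 0) \<and> of_int \<bar>a i j\<bar> \<le> C * H p ^ K))"
    using assms(1) unfolding poly_family_def by blast
  show ?thesis unfolding poly_family_def
  proof (rule exI[of _ n], rule exI[of _ "B * C"], rule exI[of _ "L + K"], intro conjI allI impI)
    fix p assume p: "D p"
    obtain a where a: "\<And>x y. f p x y = eval2 n a x y" "\<And>i j. n < i + j \<Longrightarrow> a i j = 0"
      "\<And>i j. of_int \<bar>a i j\<bar> \<le> C * H p ^ K" using f(2)[OF p] by blast
    have "of_int (c p) * f p x y = eval2 n (\<lambda>i j. c p * a i j) x y" for x y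
      unfolding a(1) eval2_def sum_distrib_left by (rule sum.cong) auto
    moreover have "of_int \<bar>c p * a i j\<bar> \<le> B * C * H p ^ (L + K)" for i j
    proof -
      have "real_of_int \<bar>c p * a i j\<bar> = of_int \<bar>c p\<bar> * of_int \<bar>a i j\<bar>" by (simp add: abs_mult)
      also have "\<dots> \<le> (B * H p ^ L) * (C * H p ^ K)" using H[OF p] assms(2)[OF p] a(3) assms(3) by (intro mult_mono) auto
      finally show ?thesis by (simp add: power_add mult_ac)
    qed
    ultimately show "\<exists>a. (\<forall>x y. of_int (c p) * f p x y = eval2 n a x y) \<and>
       (\<forall>i j. (n < i + j \<longrightarrow> a i j = 0) \<and> of_int \<bar>a i j\<bar> \<le> B * C * H p ^ (L + K))"
      using a(2) by (intro exI[of _ "\<lambda>i j. c p * a i j"]) auto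
  qed (use f assms in auto)
qed

lemma poly_family_mult_x:
  assumes "poly_family D H f" and H: "\<And>p. D p \<Longrightarrow> H p \<ge> 1"
  shows "poly_family D H (\<lambda>p x y. x * f p x y)"
proof -
  obtain n C K where f: "C \<ge> 0" "\<And>p. D p \<Longrightarrow> (\<exists>a. (\<forall>x y. f p x y = eval2 n a x y) \<and>
     (\<forall>i j. (n < i + j \<longrightarrow> a i j = 0) \<and> of_int \<bar>a i j\<bar> \<le> C * H p ^ K))"
    using assms(1) unfolding poly_family_def by blast
  show ?thesis unfolding poly_family_def
  proof (rule exI[of _ "Suc n"], rule exI[of _ C], rule exI[of _ K], intro conjI allI impI)
    fix p assume p: "D p"
    obtain a where a: "\<And>x y. f p x y = eval2 n a x y" "\<And>i j. n < i + j \<Longrightarrow> a i j = 0"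
      "\<And>i j. of_int \<bar>a i j\<bar> \<le> C * H p ^ K" using f(2)[OF p] by blast
    define b where "b i j = (if i = 0 then 0 else a (i - 1) j)" for i j
    have "x * f p x y = eval2 (Suc n) b x y" for x y
    proof -
      have "eval2 (Suc n) b x y = (\<Sum>(i, j)\<in>(\<lambda>(i, j). (Suc i, j)) ` {(i, j). i + j \<le> n}. of_int (b i j) * x ^ i * y ^ j)"
        unfolding eval2_def
      proof (rule sum.mono_neutral_right)
        show "\<forall>q\<in>{(i, j). i + j \<le> Suc n} - (\<lambda>(i, j). (Suc i, j)) ` {(i, j). i + j \<le> n}. (case q of (i, j) \<Rightarrow> of_int (b i j) * x ^ i * y ^ j) = 0"
        proof (intro ballI)
          fix q assume q: "q \<in> {(i, j). i + j \<le> Suc n} - (\<lambda>(i, j). (Suc i, j)) ` {(i, j). i + j \<le> n}"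
          obtain i j where ij: "q = (i, j)" by (cases q)
          have "i = 0"
          proof (cases i)
            case (Suc i')
            then have "q = (\<lambda>(i, j). (Suc i, j)) (i', j)" "(i', j) \<in> {(i, j). i + j \<le> n}" using q ij by auto
            then show ?thesis using q by blast
          qed
          then show "(case q of (i, j) \<Rightarrow> of_int (b i j) * x ^ i * y ^ j) = 0" using ij by (simp add: b_def)
        qed
      qed (use finite_deg_pairs in auto)
      also have "\<dots> = (\<Sum>(i, j)\<in>{(i, j). i + j \<le> n}. x * (of_int (a i j) * x ^ i * y ^ j))"
        by (subst sum.reindex) (auto simp: inj_on_def b_def case_prod_unfold mult_ac intro!: sum.cong)
      also have "\<dots> = x * f p x y" unfolding a(1) eval2_def by (simp add: sum_distrib_left case_prod_unfold)
      finally show ?thesis ..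
    qed
    moreover have "of_int \<bar>b i j\<bar> \<le> C * H p ^ K" for i j using a(3) f(1) H[OF p] by (auto simp: b_def)
    moreover have "b i j = 0" if "Suc n < i + j" for i j using that a(2) by (auto simp: b_def)
    ultimately show "\<exists>a. (\<forall>x y. x * f p x y = eval2 (Suc n) a x y) \<and>
       (\<forall>i j. (Suc n < i + j \<longrightarrow> a i j = 0) \<and> of_int \<bar>a i j\<bar> \<le> C * H p ^ K)"
      by (intro exI[of _ b]) auto
  qed (use f in auto)
qed

lemma eval2_transpose: "eval2 n (\<lambda>i j. a j i) y x = eval2 n a x y" unfolding eval2_def
  by (rule sum.reindex_bij_witness[of _ "\<lambda>(i, j). (j, i)" "\<lambda>(i, j). (j, i)"]) auto

text \<open>Exchanging the variables reduces multiplication by y to multiplication by x.\<close>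

lemma poly_family_transpose:
  assumes "poly_family D H f"
  shows "poly_family D H (\<lambda>p x y. f p y x)"
proof -
  obtain n C K where f: "C \<ge> 0" "\<And>p. D p \<Longrightarrow> (\<exists>a. (\<forall>x y. f p x y = eval2 n a x y) \<and>
     (\<forall>i j. (n < i + j \<longrightarrow> a i j = 0) \<and> of_int \<bar>a i j\<bar> \<le> C * H p ^ K))"
    using assms(1) unfolding poly_family_def by blast
  show ?thesis unfolding poly_family_def
  proof (rule exI[of _ n], rule exI[of _ C], rule exI[of _ K], intro conjI allI impI)
    fix p assume p: "D p"
    obtain a where a: "\<And>x y. f p x y = eval2 n a x y" "\<And>i j. n < i + j \<Longrightarrow> a i j = 0"
      "\<And>i j. of_int \<bar>a i j\<bar> \<le> C * H p ^ K" using f(2)[OF p] by blast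
    then show "\<exists>a. (\<forall>x y. f p y x = eval2 n a x y) \<and>
       (\<forall>i j. (n < i + j \<longrightarrow> a i j = 0) \<and> of_int \<bar>a i j\<bar> \<le> C * H p ^ K)"
      by (intro exI[of _ "\<lambda>i j. a j i"]) (auto simp: eval2_transpose[of n a] add.commute)
  qed (use f in auto)
qed

lemma poly_family_mult_y:
  assumes "poly_family D H f" and H: "\<And>p. D p \<Longrightarrow> H p \<ge> 1"
  shows "poly_family D H (\<lambda>p x y. y * f p x y)"
  using poly_family_transpose[OF poly_family_mult_x[OF poly_family_transpose[OF assms(1)] H]] by simp

text \<open>Coefficients, the two coordinates of each vector, and a common height bound, packed into
  one index so that \<open>poly_family\<close> can be uniform in all of them.\<close>

type_synonym form_data = "(nat \<Rightarrow> int) \<times> (nat \<Rightarrow> int) \<times> (nat \<Rightarrow> int) \<times> real"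

definition form_bounded :: "nat \<Rightarrow> form_data \<Rightarrow> bool" where
  "form_bounded d = (\<lambda>(N, m, n, H). H \<ge> 1 \<and> (\<forall>i<d. of_int \<bar>N i\<bar> \<le> H \<and> of_int \<bar>m i\<bar> \<le> H \<and> of_int \<bar>n i\<bar> \<le> H))"

definition form_height :: "form_data \<Rightarrow> real" where
  "form_height = (\<lambda>(N, m, n, H). H)"

text \<open>The square of the i-th summand of the linear form at the point x + iy. It is polynomial
  in x and y, whereas the summand itself carries a square root.\<close>

definition form_sq :: "form_data \<Rightarrow> nat \<Rightarrow> real \<Rightarrow> real \<Rightarrow> real" where
  "form_sq = (\<lambda>(N, m, n, H) i x y. (of_int (N i))\<^sup>2 * ((of_int (m i) + of_int (n i) * x)\<^sup>2 + (of_int (n i) * y)\<^sup>2))"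

lemma form_height_ge_1: "form_bounded d p \<Longrightarrow> form_height p \<ge> 1" by (auto simp: form_bounded_def form_height_def)

text \<open>Expanded, the factor is a + b x + c (x^2 + y^2) with coefficients of size at most 2 H^4;
  the 2 belongs to the mixed term.\<close>

lemma poly_family_form_sq:
  assumes "i < d" "poly_family (form_bounded d) form_height f"
  shows "poly_family (form_bounded d) form_height (\<lambda>p x y. form_sq p i x y * f p x y)"
proof -
  let ?F = "poly_family (form_bounded d) form_height"
  define a b c where "a = (\<lambda>(N::nat \<Rightarrow> int, m::nat \<Rightarrow> int, n::nat \<Rightarrow> int, H::real). (N i)\<^sup>2 * (m i)\<^sup>2)"
    and "b = (\<lambda>(N::nat \<Rightarrow> int, m::nat \<Rightarrow> int, n::nat \<Rightarrow> int, H::real). 2 * (N i)\<^sup>2 * (m i * n i))"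
    and "c = (\<lambda>(N::nat \<Rightarrow> int, m::nat \<Rightarrow> int, n::nat \<Rightarrow> int, H::real). (N i)\<^sup>2 * (n i)\<^sup>2)"
  have le: "of_int \<bar>(N i)\<^sup>2 * (u * v)\<bar> \<le> H ^ 4"
    if "of_int \<bar>N i\<bar> \<le> H" "of_int \<bar>u\<bar> \<le> H" "of_int \<bar>v\<bar> \<le> (H::real)" for N :: "nat \<Rightarrow> int" and u v H
  proof -
    have "of_int \<bar>(N i)\<^sup>2 * (u * v)\<bar> = (of_int \<bar>N i\<bar> * of_int \<bar>N i\<bar>) * (of_int \<bar>u\<bar> * (of_int \<bar>v\<bar> :: real))"
      by (simp add: abs_mult power2_eq_square)
    also have "\<dots> \<le> (H * H) * (H * H)" using that by (intro mult_mono) (auto intro: order.trans[OF abs_ge_zero])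
    finally show ?thesis by (simp add: power4_eq_xxxx mult.assoc)
  qed
  have a: "of_int \<bar>a p\<bar> \<le> 2 * form_height p ^ 4" and b: "of_int \<bar>b p\<bar> \<le> 2 * form_height p ^ 4" and c: "of_int \<bar>c p\<bar> \<le> 2 * form_height p ^ 4"
    if "form_bounded d p" for p
  proof -
    obtain N m n H where p: "p = (N, m, n, H)" by (cases p)
    have h: "of_int \<bar>N i\<bar> \<le> H" "of_int \<bar>m i\<bar> \<le> H" "of_int \<bar>n i\<bar> \<le> H" "H \<ge> 1"
      using that assms(1) by (auto simp: p form_bounded_def)
    have H4: "H ^ 4 \<le> 2 * H ^ 4" by simp
    show "of_int \<bar>a p\<bar> \<le> 2 * form_height p ^ 4" "of_int \<bar>b p\<bar> \<le> 2 * form_height p ^ 4" "of_int \<bar>c p\<bar> \<le> 2 * form_height p ^ 4"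
      using order.trans[OF le[of N H "m i" "m i", OF h(1,2,2)] H4] le[of N H "m i" "n i", OF h(1,2,3)] order.trans[OF le[of N H "n i" "n i", OF h(1,3,3)] H4]
      by (simp_all add: p form_height_def a_def b_def c_def power2_eq_square abs_mult mult.assoc)
  qed
  have "?F (\<lambda>p x y. (of_int (a p) * f p x y + of_int (b p) * (x * f p x y)) +
     (of_int (c p) * (x * (x * f p x y)) + of_int (c p) * (y * (y * f p x y))))"
    by (intro poly_family_add[OF _ _ form_height_ge_1] poly_family_mult_x[OF _ form_height_ge_1]
        poly_family_mult_y[OF _ form_height_ge_1] poly_family_cmult[OF _ a _ form_height_ge_1]
        poly_family_cmult[OF _ b _ form_height_ge_1] poly_family_cmult[OF _ c _ form_height_ge_1] assms(2)) auto
  moreover have "(of_int (a p) * f p x y + of_int (b p) * (x * f p x y)) +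
     (of_int (c p) * (x * (x * f p x y)) + of_int (c p) * (y * (y * f p x y))) = form_sq p i x y * f p x y" for p x y
    by (cases p) (simp add: a_def b_def c_def form_sq_def power2_eq_square algebra_simps)
  ultimately show ?thesis by simp
qed

lemma poly_family_int_poly:
  "int_poly G \<Longrightarrow> poly_family (form_bounded d) form_height (\<lambda>p x y. G (\<lambda>i. if i < d then form_sq p i x y else 0))"
proof (induction rule: int_poly.induct)
  case (int_poly_const c)
  show ?case by (rule poly_family_const[where C="of_int \<bar>c\<bar>" and K=0]) (auto simp: form_height_ge_1)
next
  case (int_poly_add F G)
  then show ?case using form_height_ge_1 by (intro poly_family_add) auto
next
  case (int_poly_var F i)
  show ?case
  proof (cases "i < d")
    case True
    then show ?thesis using poly_family_form_sq[OF True int_poly_var.IH] by simp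
  next
    case False
    then show ?thesis using poly_family_const[of "form_bounded d" "\<lambda>_. 0" 0 form_height 0] form_height_ge_1 by simp
  qed
qed

text \<open>The summand with vanishing \<open>A\<close> has a corner at \<open>0\<close>, which smooth even summands cannot cancel.\<close>

lemma eventually_corner_sum_nonzero:
  fixes c A B :: "'i \<Rightarrow> real"
  assumes "finite I" "i0 \<in> I" "A i0 = 0" "c i0 \<noteq> 0" "B i0 \<noteq> 0" "\<And>i. i \<in> I \<Longrightarrow> i \<noteq> i0 \<Longrightarrow> A i \<noteq> 0"
  shows "\<forall>\<^sub>F y in at_right 0. (\<Sum>i\<in>I. c i * sqrt ((A i)\<^sup>2 + (B i * y)\<^sup>2)) \<noteq> 0"
proof -
  define h where "h y = (\<Sum>i\<in>I - {i0}. c i * sqrt ((A i)\<^sup>2 + (B i * y)\<^sup>2))" for y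
  define F where "F y = (\<Sum>i\<in>I. c i * sqrt ((A i)\<^sup>2 + (B i * y)\<^sup>2))" for y
  have F: "F y = c i0 * \<bar>B i0\<bar> * \<bar>y\<bar> + h y" for y
    unfolding F_def h_def using assms by (subst sum.remove[of I i0]) (auto simp: abs_mult)
  have h': "(h has_real_derivative 0) (at 0)"
  proof -
    have "((\<lambda>y. c i * sqrt ((A i)\<^sup>2 + (B i * y)\<^sup>2)) has_real_derivative 0) (at 0)" if i: "i \<in> I - {i0}" for i
    proof -
      have "(A i)\<^sup>2 > 0" using i assms(6) by simp
      then show ?thesis by (auto intro!: derivative_eq_intros)
    qed
    then have "((\<lambda>y. \<Sum>i\<in>I - {i0}. c i * sqrt ((A i)\<^sup>2 + (B i * y)\<^sup>2)) has_real_derivative (\<Sum>i\<in>I - {i0}. 0)) (at 0)"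
      by (rule DERIV_sum)
    then show ?thesis by (simp add: h_def[abs_def])
  qed
  then have "isCont h 0" by (rule DERIV_isCont)
  then have hlim: "(h \<longlongrightarrow> h 0) (at_right 0)" by (auto simp: isCont_def intro: tendsto_mono[OF at_le])
  show ?thesis
  \<comment> \<open>If \<open>h 0\<close> is nonzero, it dominates near 0. If it vanishes, h y / y
    tends to the derivative 0, while the corner contributes the nonzero constant c |B| to the
    quotient by y.\<close>
  proof (cases "h 0 = 0")
    case False
    have "((\<lambda>y. c i0 * \<bar>B i0\<bar> * \<bar>y\<bar> + h y) \<longlongrightarrow> c i0 * \<bar>B i0\<bar> * \<bar>0\<bar> + h 0) (at_right 0)"
      by (intro tendsto_intros hlim)
    then show ?thesis using False tendsto_imp_eventually_ne[of F "h 0" "at_right 0" 0] unfolding F_def[symmetric] by (simp add: F[abs_def])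
  next
    case True
    have "((\<lambda>y. (h y - h 0) / (y - 0)) \<longlongrightarrow> 0) (at 0)" using h' by (simp add: has_field_derivative_iff)
    then have "((\<lambda>y. h y / y) \<longlongrightarrow> 0) (at_right 0)" using True by (auto intro: tendsto_mono[OF at_le])
    then have "((\<lambda>y. c i0 * \<bar>B i0\<bar> + h y / y) \<longlongrightarrow> c i0 * \<bar>B i0\<bar> + 0) (at_right 0)" by (intro tendsto_intros)
    then have "\<forall>\<^sub>F y in at_right 0. c i0 * \<bar>B i0\<bar> + h y / y \<noteq> 0"
      by (rule tendsto_imp_eventually_ne) (use assms in auto)
    moreover have "\<forall>\<^sub>F y::real in at_right 0. y > 0" by (simp add: eventually_at_right_less)
    ultimately show ?thesis unfolding F_def[symmetric]
    proof eventually_elim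
      case (elim y)
      then have "F y = y * (c i0 * \<bar>B i0\<bar> + h y / y)" unfolding F by (simp add: field_simps)
      then show ?case using elim by simp
    qed
  qed
qed

text \<open>One point must serve all sign patterns. The corner argument yields non-vanishing for all
  small y > 0, and finitely many statements of this kind hold simultaneously.\<close>

lemma ex_signed_sums_nonzero:
  fixes N m n :: "nat \<Rightarrow> int"
  assumes N: "\<exists>i<d. N i \<noteq> 0" and nz: "\<And>i. i < d \<Longrightarrow> m i \<noteq> 0 \<or> n i \<noteq> 0"
    and np: "\<And>i j. i < d \<Longrightarrow> j < d \<Longrightarrow> i \<noteq> j \<Longrightarrow> m i * n j \<noteq> m j * n i"
  shows "\<exists>x y. \<forall>S\<in>Pow {..<d}. (\<Sum>i<d. flip_signs S (\<lambda>i. of_int (N i) * sqrt ((of_int (m i) + of_int (n i) * x)\<^sup>2 + (of_int (n i) * y)\<^sup>2)) i) \<noteq> 0"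
proof (cases "\<exists>i<d. N i \<noteq> 0 \<and> n i \<noteq> 0")
  case True
  then obtain i0 where i0: "i0 < d" "N i0 \<noteq> 0" "n i0 \<noteq> 0" by blast
  \<comment> \<open>Here the i0-th vector degenerates to (0, n y), whose length has a corner at y =
    0. No other vector loses its first coordinate, because none is proportional to this one.\<close>
  define x where "x = - of_int (m i0) / real_of_int (n i0)"
  have flip: "flip_signs S v i = flip_signs S (\<lambda>_. 1) i * v i" for S v i by (simp add: flip_signs_def)
  have "\<forall>\<^sub>F y in at_right 0. (\<Sum>i<d. (flip_signs S (\<lambda>_. 1) i * of_int (N i)) * sqrt ((of_int (m i) + of_int (n i) * x)\<^sup>2 + (of_int (n i) * y)\<^sup>2)) \<noteq> 0" for S
  proof (rule eventually_corner_sum_nonzero[where ?i0.0=i0])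
    fix i assume i: "i \<in> {..<d}" "i \<noteq> i0"
    then have "m i * n i0 \<noteq> m i0 * n i" using np[of i i0] i0 by simp
    then have "real_of_int (m i * n i0) \<noteq> real_of_int (m i0 * n i)" by (simp only: of_int_eq_iff not_False_eq_True)
    then show "of_int (m i) + of_int (n i) * x \<noteq> 0" using i0 by (simp add: x_def field_simps)
  qed (use i0 in \<open>auto simp: x_def flip_signs_def\<close>)
  then have "\<forall>\<^sub>F y in at_right 0. \<forall>S\<in>Pow {..<d}. (\<Sum>i<d. flip_signs S (\<lambda>i. of_int (N i) * sqrt ((of_int (m i) + of_int (n i) * x)\<^sup>2 + (of_int (n i) * y)\<^sup>2)) i) \<noteq> 0"
    by (intro eventually_ball_finite) (auto simp: flip[where v="\<lambda>i. of_int (N i) * _ i"] mult.assoc)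
  then show ?thesis using eventually_happens'[OF trivial_limit_at_right_real] by blast
next
  case False
  obtain i0 where i0: "i0 < d" "N i0 \<noteq> 0" using N by blast
  have n0: "n i0 = 0" using False i0 by blast
  \<comment> \<open>All vectors with nonzero coefficient have second coordinate 0 in this case and
    are thus proportional to one another, so only one of them can occur and nothing can
    cancel.\<close>
  have other: "N i = 0" if "i < d" "i \<noteq> i0" for i
  proof (rule ccontr)
    assume "N i \<noteq> 0"
    then have "n i = 0" using False that by blast
    then show False using np[OF that(1) i0(1) that(2)] n0 by simp
  qed
  have "(\<Sum>i<d. flip_signs S (\<lambda>i. of_int (N i) * sqrt ((of_int (m i) + of_int (n i) * 0)\<^sup>2 + (of_int (n i) * 0)\<^sup>2)) i) \<noteq> 0" for S
  proof -
    have "(\<Sum>i<d. flip_signs S (\<lambda>i. of_int (N i) * sqrt ((of_int (m i) + of_int (n i) * 0)\<^sup>2 + (of_int (n i) * 0)\<^sup>2)) i)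
       = (\<Sum>i\<in>{i0}. flip_signs S (\<lambda>i. of_int (N i) * sqrt ((of_int (m i) + of_int (n i) * 0)\<^sup>2 + (of_int (n i) * 0)\<^sup>2)) i)"
      by (rule sum.mono_neutral_right) (use i0 other in \<open>auto simp: flip_signs_def\<close>)
    also have "\<dots> \<noteq> 0" using i0 n0 nz[OF i0(1)] by (simp add: flip_signs_def)
    finally show ?thesis .
  qed
  then show ?thesis by blast
qed

text \<open>The Diophantine hypothesis bounds the product of all conjugates from below. Each
  conjugate is trivially at most B H^2, so dividing by all conjugates except the form itself leaves
  a lower bound for the form, uniform in the data for a fixed number \<open>d\<close> of
  terms.\<close>

theorem linear_form_lower_bound:
  assumes ai: "algebraically_independent \<alpha> \<beta>" and sd: "strongly_Diophantine \<alpha> \<beta>"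
  shows "\<exists>c>0. \<exists>K\<ge>0. \<forall>N m n H. form_bounded d (N, m, n, H) \<longrightarrow> (\<exists>i<d. N i \<noteq> 0) \<longrightarrow>
     (\<forall>i<d. m i \<noteq> 0 \<or> n i \<noteq> 0) \<longrightarrow> (\<forall>i<d. \<forall>j<d. i \<noteq> j \<longrightarrow> m i * n j \<noteq> m j * n i) \<longrightarrow>
     c * H powr (- K) \<le> \<bar>\<Sum>i<d. of_int (N i) * cmod (of_int (m i) + of_int (n i) * Complex \<alpha> \<beta>)\<bar>"
proof -
  \<comment> \<open>Padded by 0 beyond \<open>d\<close>, since the polynomials above act on
    valuations of all natural numbers.\<close>
  let ?s = "\<lambda>(N, m, n, H) x y i. if i < d then of_int (N i) * sqrt ((of_int (m i) + of_int (n i) * x)\<^sup>2 + (of_int (n i) * y)\<^sup>2) else 0 :: real"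
  obtain G where G: "int_poly G" "\<And>v. (\<Prod>S\<in>Pow {..<d}. (\<Sum>i<d. flip_signs S v i)) = G (\<lambda>i. if i < d then (v i)\<^sup>2 else v i)"
    using int_poly_sign_norm[OF int_poly_sum, of d d] by blast
  have sq: "(\<lambda>i. if i < d then (?s p x y i)\<^sup>2 else ?s p x y i) = (\<lambda>i. if i < d then form_sq p i x y else 0)" for p x y
    by (cases p) (auto simp: fun_eq_iff form_sq_def power_mult_distrib)
  obtain D C K where C: "C \<ge> 0" and fam: "\<And>p. form_bounded d p \<Longrightarrow> \<exists>a. (\<forall>x y. G (\<lambda>i. if i < d then form_sq p i x y else 0) = eval2 D a x y) \<and>
     (\<forall>i j. (D < i + j \<longrightarrow> a i j = 0) \<and> of_int \<bar>a i j\<bar> \<le> C * form_height p ^ K)"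
    using poly_family_int_poly[OF G(1), of d] unfolding poly_family_def by blast
  obtain K1 C1 where K1: "K1 > 0" "C1 > 0" and low: "\<And>a. eval2 D a \<alpha> \<beta> \<noteq> 0 \<Longrightarrow> C1 * of_int (height2 D a) powr (- K1) \<le> \<bar>eval2 D a \<alpha> \<beta>\<bar>"
    using sd unfolding strongly_Diophantine_def by blast
  define z where "z = Complex \<alpha> \<beta>"
  define B where "B = real d * (1 + cmod z) + 1"
  have B: "B \<ge> 1" by (simp add: B_def)
  define r where "r = 2 ^ d - (1::nat)"
  define c where "c = C1 * (C + 1) powr (- K1) / B ^ r"
  have "c > 0" using K1 C B by (simp add: c_def)
  \<comment> \<open>The exponent collects K1 * K from the coefficients, of size C H^K, and 2 from
    each of the \<open>r\<close> nontrivial conjugates.\<close>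
  moreover have "c * H powr (- (K1 * K + 2 * r)) \<le> \<bar>\<Sum>i<d. of_int (N i) * cmod (of_int (m i) + of_int (n i) * z)\<bar>"
    if bd: "form_bounded d (N, m, n, H)" and N: "\<exists>i<d. N i \<noteq> 0" and nz: "\<forall>i<d. m i \<noteq> 0 \<or> n i \<noteq> 0"
      and np: "\<forall>i<d. \<forall>j<d. i \<noteq> j \<longrightarrow> m i * n j \<noteq> m j * n i" for N m n H
  proof -
    define s where "s x y = ?s (N, m, n, H) x y" for x y
    have H: "H \<ge> 1" using bd by (simp add: form_bounded_def)
    have bounds: "\<bar>of_int (N i)\<bar> \<le> H" "\<bar>of_int (m i)\<bar> \<le> H" "\<bar>of_int (n i)\<bar> \<le> H" if "i < d" for i
      using bd that by (auto simp: form_bounded_def)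
    obtain a where a: "\<And>x y. (\<Prod>S\<in>Pow {..<d}. (\<Sum>i<d. flip_signs S (s x y) i)) = eval2 D a x y"
      "\<And>i j. of_int \<bar>a i j\<bar> \<le> C * H ^ K"
      using fam[OF bd] G(2)[of "s _ _"] unfolding s_def sq by (auto simp: form_height_def)
    have sum_s: "(\<Sum>i<d. flip_signs S (s x y) i) = (\<Sum>i<d. flip_signs S (\<lambda>i. of_int (N i) * sqrt ((of_int (m i) + of_int (n i) * x)\<^sup>2 + (of_int (n i) * y)\<^sup>2)) i)" for S x y
      by (intro sum.cong) (auto simp: s_def flip_signs_def)
    have "\<exists>x y. \<forall>S\<in>Pow {..<d}. (\<Sum>i<d. flip_signs S (s x y) i) \<noteq> 0"
      unfolding sum_s by (rule ex_signed_sums_nonzero) (use N nz np in auto)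
    then obtain x y where "\<forall>S\<in>Pow {..<d}. (\<Sum>i<d. flip_signs S (s x y) i) \<noteq> 0" by (elim exE)
    \<comment> \<open>Non-vanishing at one real point shows that some coefficient is nonzero;
      algebraic independence then gives non-vanishing at (\<alpha>, \<beta>).\<close>
    then have "(\<Prod>S\<in>Pow {..<d}. (\<Sum>i<d. flip_signs S (s x y) i)) \<noteq> 0" by (simp add: prod_zero_iff)
    then have "eval2 D a x y \<noteq> 0" unfolding a(1) .
    have "\<exists>i j. i + j \<le> D \<and> a i j \<noteq> 0"
    proof (rule ccontr)
      assume "\<not> (\<exists>i j. i + j \<le> D \<and> a i j \<noteq> 0)"
      then have "eval2 D a x y = 0" unfolding eval2_def by (intro sum.neutral) auto
      then show False using \<open>eval2 D a x y \<noteq> 0\<close> by simp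
    qed
    then obtain i0 j0 where ij0: "i0 + j0 \<le> D" "a i0 j0 \<noteq> 0" by (elim exE conjE)
    then have ne: "eval2 D a \<alpha> \<beta> \<noteq> 0" using ai unfolding algebraically_independent_def by blast
    have fin: "finite {\<bar>a i j\<bar> | i j. i + j \<le> D}"
    proof -
      have "{\<bar>a i j\<bar> | i j. i + j \<le> D} = (\<lambda>(i, j). \<bar>a i j\<bar>) ` {(i, j). i + j \<le> D}" by auto
      then show ?thesis using finite_deg_pairs by simp
    qed
    \<comment> \<open>A nonzero integer coefficient makes the height positive, which the
      monotonicity of a negative power requires.\<close>
    have "1 \<le> \<bar>a i0 j0\<bar>" using ij0 by simp
    also have "\<dots> \<le> height2 D a" unfolding height2_def using fin ij0 by (intro Max_ge) auto
    finally have h1: "1 \<le> height2 D a" .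
    have "height2 D a \<in> {\<bar>a i j\<bar> | i j. i + j \<le> D}" unfolding height2_def using fin ij0 by (intro Max_in) auto
    then have "of_int (height2 D a) \<le> C * H ^ K" using a(2) by auto
    also have "\<dots> \<le> (C + 1) * H ^ K" using H by (intro mult_right_mono) auto
    finally have "((C + 1) * H ^ K) powr (- K1) \<le> of_int (height2 D a) powr (- K1)" using h1 K1 by (intro powr_mono2') auto
    then have "C1 * ((C + 1) * H ^ K) powr (- K1) \<le> C1 * of_int (height2 D a) powr (- K1)" using K1 by (intro mult_left_mono) auto
    also have "\<dots> \<le> \<bar>eval2 D a \<alpha> \<beta>\<bar>" by (rule low[OF ne])
    also have "\<dots> = \<bar>\<Sum>i<d. s \<alpha> \<beta> i\<bar> * (\<Prod>S\<in>Pow {..<d} - {{}}. \<bar>\<Sum>i<d. flip_signs S (s \<alpha> \<beta>) i\<bar>)"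
    proof -
      have "\<bar>eval2 D a \<alpha> \<beta>\<bar> = (\<Prod>S\<in>Pow {..<d}. \<bar>\<Sum>i<d. flip_signs S (s \<alpha> \<beta>) i\<bar>)"
        unfolding a(1)[symmetric] by (simp add: abs_prod)
      also have "\<dots> = \<bar>\<Sum>i<d. flip_signs {} (s \<alpha> \<beta>) i\<bar> * (\<Prod>S\<in>Pow {..<d} - {{}}. \<bar>\<Sum>i<d. flip_signs S (s \<alpha> \<beta>) i\<bar>)"
        by (rule prod.remove) auto
      finally show ?thesis by (simp add: flip_signs_def)
    qed
    also have "\<dots> \<le> \<bar>\<Sum>i<d. s \<alpha> \<beta> i\<bar> * (\<Prod>S\<in>Pow {..<d} - {{}}. B * H\<^sup>2)"
    proof (intro mult_left_mono prod_mono conjI)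
      fix S
      have si: "\<bar>flip_signs S (s \<alpha> \<beta>) i\<bar> \<le> (1 + cmod z) * H\<^sup>2" if i: "i < d" for i
      proof -
        have "(of_int (m i) + of_int (n i) * \<alpha>)\<^sup>2 + (of_int (n i) * \<beta>)\<^sup>2 = (cmod (of_int (m i) + of_int (n i) * z))\<^sup>2"
          by (simp add: cmod_power2 z_def)
        then have "\<bar>flip_signs S (s \<alpha> \<beta>) i\<bar> = \<bar>of_int (N i)\<bar> * cmod (of_int (m i) + of_int (n i) * z)"
          using i by (simp add: flip_signs_def s_def abs_mult)
        also have "\<dots> \<le> H * (H * (1 + cmod z))"
        proof (rule mult_mono)
          have "cmod (of_int (m i) + of_int (n i) * z) \<le> \<bar>of_int (m i)\<bar> + \<bar>of_int (n i)\<bar> * cmod z"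
            using norm_triangle_ineq[of "of_int (m i)" "of_int (n i) * z"] by (simp add: norm_mult)
          also have "\<dots> \<le> H + H * cmod z" using bounds[OF i] by (intro add_mono mult_right_mono) auto
          finally show "cmod (of_int (m i) + of_int (n i) * z) \<le> H * (1 + cmod z)" by (simp add: algebra_simps)
        qed (use bounds[OF i] H in auto)
        finally show ?thesis by (simp add: power2_eq_square mult_ac)
      qed
      have "\<bar>\<Sum>i<d. flip_signs S (s \<alpha> \<beta>) i\<bar> \<le> (\<Sum>i<d. (1 + cmod z) * H\<^sup>2)"
        by (rule order.trans[OF sum_abs sum_mono]) (use si in auto)
      also have "\<dots> \<le> B * H\<^sup>2" by (simp add: B_def algebra_simps)
      finally show "\<bar>\<Sum>i<d. flip_signs S (s \<alpha> \<beta>) i\<bar> \<le> B * H\<^sup>2" .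
    qed auto
    also have "(\<Prod>S\<in>Pow {..<d} - {{}}. B * H\<^sup>2) = (B * H\<^sup>2) ^ r" by (simp add: card_Diff_singleton card_Pow r_def)
    finally have main: "C1 * ((C + 1) * H ^ K) powr (- K1) \<le> \<bar>\<Sum>i<d. s \<alpha> \<beta> i\<bar> * (B * H\<^sup>2) ^ r" .
    have "c * H powr (- (K1 * K + 2 * r)) * (B * H\<^sup>2) ^ r = C1 * ((C + 1) * H ^ K) powr (- K1)"
    proof -
      have "(B * H\<^sup>2) ^ r = B ^ r * H ^ (2 * r)" by (simp add: power_mult_distrib power_mult)
      also have "H ^ (2 * r) = H powr real (2 * r)" using H by (intro powr_realpow[symmetric]) simp
      finally have "(B * H\<^sup>2) ^ r = B ^ r * H powr (2 * r)" by simp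
      moreover have "((C + 1) * H ^ K) powr (- K1) = (C + 1) powr (- K1) * H powr (- (K1 * K))"
      proof -
        have "H ^ K = H powr real K" using H by (intro powr_realpow[symmetric]) simp
        then show ?thesis using H C by (simp add: powr_mult powr_powr mult.commute)
      qed
      moreover have "H powr (- (K1 * K + 2 * r)) * H powr (2 * r) = H powr (- (K1 * K))" using H by (simp flip: powr_add)
      ultimately show ?thesis using B by (simp add: c_def field_simps)
    qed
    with main have "c * H powr (- (K1 * K + 2 * r)) * (B * H\<^sup>2) ^ r \<le> \<bar>\<Sum>i<d. s \<alpha> \<beta> i\<bar> * (B * H\<^sup>2) ^ r" by simp
    moreover have "(B * H\<^sup>2) ^ r > 0" using B H by simp
    ultimately have "c * H powr (- (K1 * K + 2 * r)) \<le> \<bar>\<Sum>i<d. s \<alpha> \<beta> i\<bar>" by simp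
    also have "(\<Sum>i<d. s \<alpha> \<beta> i) = (\<Sum>i<d. of_int (N i) * cmod (of_int (m i) + of_int (n i) * z))"
      by (intro sum.cong refl) (auto simp: s_def z_def cmod_def)
    finally show ?thesis .
  qed
  ultimately show ?thesis unfolding z_def using K1 by (intro exI[of _ c] conjI exI[of _ "K1 * K + 2 * r"]) auto
qed

section \<open>Smoothed lattice point counts\<close>

lemma csum_norm_bound:
  fixes f :: "'i \<Rightarrow> 'b::{banach, second_countable_topology}"
  assumes "csummable g" "\<And>i. norm (f i) \<le> g i"
  shows "norm (csum f) \<le> csum g"
proof -
  have f: "csummable f" by (rule csummable_bound[OF assms])
  have "norm (csum f) \<le> csum (\<lambda>i. norm (f i))" by (rule integral_norm_bound)
  also have "\<dots> \<le> csum g" by (rule Bochner_Integration.integral_mono[OF integrable_norm[OF f] assms])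
  finally show ?thesis .
qed

lemma csummable_Sigma:
  fixes F :: "'i::countable \<times> 'j::countable \<Rightarrow> 'b::{banach, second_countable_topology}"
  assumes "\<And>i. csummable (\<lambda>j. F (i, j))" "csummable (\<lambda>i. csum (\<lambda>j. norm (F (i, j))))"
  shows "csummable F"
proof -
  interpret I: sigma_finite_measure "count_space (UNIV::'i set)" by (rule sigma_finite_measure_count_space_countable) simp
  interpret J: sigma_finite_measure "count_space (UNIV::'j set)" by (rule sigma_finite_measure_count_space_countable) simp
  interpret P: pair_sigma_finite "count_space (UNIV::'i set)" "count_space (UNIV::'j set)" ..
  have "integrable (count_space UNIV \<Otimes>\<^sub>M count_space UNIV) F"
    by (rule P.Fubini_integrable) (use assms in \<open>auto simp: pair_measure_countable\<close>)
  then show ?thesis by (simp add: pair_measure_countable)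
qed

lemma csum_Sigma:
  fixes F :: "'i::countable \<times> 'j::countable \<Rightarrow> 'b::{banach, second_countable_topology}"
  assumes "csummable F"
  shows "csum F = csum (\<lambda>i. csum (\<lambda>j. F (i, j)))" "csum F = csum (\<lambda>j. csum (\<lambda>i. F (i, j)))"
    "csummable (\<lambda>i. csum (\<lambda>j. F (i, j)))"
proof -
  interpret I: sigma_finite_measure "count_space (UNIV::'i set)" by (rule sigma_finite_measure_count_space_countable) simp
  interpret J: sigma_finite_measure "count_space (UNIV::'j set)" by (rule sigma_finite_measure_count_space_countable) simp
  interpret P: pair_sigma_finite "count_space (UNIV::'i set)" "count_space (UNIV::'j set)" ..
  have F: "integrable (count_space UNIV \<Otimes>\<^sub>M count_space UNIV) F" using assms by (simp add: pair_measure_countable)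
  show "csum F = csum (\<lambda>i. csum (\<lambda>j. F (i, j)))" using P.integral_fst'[OF F] by (simp add: pair_measure_countable)
  show "csum F = csum (\<lambda>j. csum (\<lambda>i. F (i, j)))" using P.integral_snd[of "\<lambda>i j. F (i, j)"] F by (simp add: pair_measure_countable)
  show "csummable (\<lambda>i. csum (\<lambda>j. F (i, j)))" by (rule P.integrable_fst'[OF F])
qed

lemma csummable_times:
  fixes f :: "'i::countable \<Rightarrow> real" and g :: "'j::countable \<Rightarrow> real"
  assumes "csummable f" "csummable g"
  shows "csummable (\<lambda>(i, j). f i * g j)" by (rule csummable_Sigma) (use assms in \<open>auto simp: abs_mult\<close>)

lemma csum_reindex_bij:
  assumes "bij g"
  shows "csum (\<lambda>x. f (g x)) = csum f"
proof -
  have "distr (count_space UNIV) (count_space UNIV) g = count_space UNIV" by (rule distr_bij_count_space) (use assms in simp)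
  then show ?thesis by (metis (no_types) integral_distr borel_measurable_count_space measurable_count_space)
qed

lemma csummable_reindex_bij:
  fixes f :: "'j \<Rightarrow> 'b::{banach, second_countable_topology}"
  assumes "bij g" "csummable f"
  shows "csummable (\<lambda>x. f (g x))" using assms abs_summable_on_reindex_bij_betw[of g UNIV UNIV f] by (simp add: abs_summable_on_def)

lemma csum_split_zero:
  fixes f :: "'i::zero \<Rightarrow> 'b::{banach, second_countable_topology}"
  assumes "csummable f"
  shows "csum f = f 0 + csum (\<lambda>x. if x = 0 then 0 else f x)" "csummable (\<lambda>x. if x = 0 then 0 else f x)"
proof -
  have s: "csummable (\<lambda>x. indicator {0} x *\<^sub>R f 0)" by simp
  have eq: "(\<lambda>x. if x = 0 then 0 else f x) = (\<lambda>x. f x - indicator {0} x *\<^sub>R f 0)" by (auto simp: fun_eq_iff)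
  show "csum f = f 0 + csum (\<lambda>x. if x = 0 then 0 else f x)"
    unfolding eq using assms s by (subst Bochner_Integration.integral_diff) auto
  show "csummable (\<lambda>x. if x = 0 then 0 else f x)" unfolding eq using assms s by (intro Bochner_Integration.integrable_diff)
qed

lemma csummable_int_powr:
  assumes "q > (1::real)"
  shows "csummable (\<lambda>m::int. (1 + \<bar>of_int m\<bar>) powr (- q))"
proof -
  have "summable (\<lambda>n. real (Suc n) powr (- q))" using assms by (subst summable_Suc_iff) (simp add: summable_real_powr_iff)
  then have "csummable (\<lambda>m::int. real (Suc (nat \<bar>m\<bar>)) powr (- q))"
    by (intro csummable_nat_abs[of "\<lambda>n. real (Suc n) powr (- q)"]) auto
  then show ?thesis by (simp add: add.commute)
qed

text \<open>At frequency 0 the disc formula says that twice this value is the area of the unit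
  disc.\<close>

lemma bessel_int_0: "bessel_int 0 = pi / 2"
proof -
  have "complex_of_real (2 * 1\<^sup>2 * bessel_int 0) = (LINT p|lborel. indicator (cball (0::real\<times>real) 1) p *\<^sub>R (1::complex))"
    using disc_fourier_axis[of 1 0] by simp
  also have "\<dots> = measure lborel (cball (0::real\<times>real) 1)"
    using emeasure_bounded_finite[of "cball (0::real\<times>real) 1"] by (subst integral_scaleR_left) (auto simp: scaleR_conv_of_real)
  also have "measure lborel (cball (0::real\<times>real) 1) = pi"
    using content_cball[of 1 "0::real\<times>real"] by (simp add: unit_ball_vol_2 measure_completion)
  finally have "complex_of_real (2 * bessel_int 0) = of_real pi" by simp
  then have "2 * bessel_int 0 = pi" unfolding of_real_eq_iff .
  then show ?thesis by simp
qed

section \<open>The lattice in integer coordinates\<close>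

locale planar =
  fixes \<alpha> \<beta> :: real
  assumes beta_pos: "\<beta> > 0"
begin

definition vec :: "int \<times> int \<Rightarrow> real \<times> real" where
  "vec x = (of_int (fst x) + of_int (snd x) * \<alpha>, of_int (snd x) * \<beta>)"

definition nm :: "int \<times> int \<Rightarrow> real" where "nm x = norm (vec x)"

lemma nm_cmod: "nm x = cmod (of_int (fst x) + of_int (snd x) * Complex \<alpha> \<beta>)"
  by (simp add: nm_def vec_def norm_prod_def cmod_def)

lemma nm_sq: "(nm x)\<^sup>2 = (of_int (fst x) + of_int (snd x) * \<alpha>)\<^sup>2 + (of_int (snd x) * \<beta>)\<^sup>2"
  by (simp add: nm_def vec_def norm_prod_def)

lemma nm_nonneg [simp]: "nm x \<ge> 0" by (simp add: nm_def)
lemma nm_0 [simp]: "nm 0 = 0" by (simp add: nm_def vec_def)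

text \<open>Found by bounding the second coordinate by nm / \<beta> and the first by nm + |\<alpha>|
  nm / \<beta>, and adding up.\<close>

definition lc :: real where "lc = 1 / (1 + (\<bar>\<alpha>\<bar> + 1) / \<beta>)"

lemma lc_pos: "lc > 0" using beta_pos by (auto simp: lc_def intro!: divide_pos_pos add_pos_nonneg)

lemma nm_lower: "lc * (\<bar>of_int (fst x)\<bar> + \<bar>of_int (snd x)\<bar>) \<le> nm x"
proof -
  have pos: "1 + (\<bar>\<alpha>\<bar> + 1) / \<beta> > 0" using beta_pos by (intro add_pos_nonneg) auto
  have 1: "\<bar>of_int (snd x)\<bar> * \<beta> \<le> nm x"
    unfolding nm_def vec_def using norm_snd_le[of "of_int (snd x) * \<beta>" "of_int (fst x) + of_int (snd x) * \<alpha>"] beta_pos by (simp add: abs_mult)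
  then have 2: "\<bar>of_int (snd x)\<bar> \<le> nm x / \<beta>" using beta_pos by (simp add: field_simps)
  have "\<bar>of_int (fst x) + of_int (snd x) * \<alpha>\<bar> \<le> nm x"
    unfolding nm_def vec_def using norm_fst_le[of "of_int (fst x) + of_int (snd x) * \<alpha>" "of_int (snd x) * \<beta>"] by simp
  then have "\<bar>of_int (fst x)\<bar> \<le> nm x + \<bar>of_int (snd x)\<bar> * \<bar>\<alpha>\<bar>" by (simp add: abs_mult[symmetric])
  also have "\<dots> \<le> nm x + nm x / \<beta> * \<bar>\<alpha>\<bar>" using 2 by (intro add_left_mono mult_right_mono) auto
  finally have "\<bar>of_int (fst x)\<bar> \<le> nm x + nm x / \<beta> * \<bar>\<alpha>\<bar>" .
  moreover have "nm x * (1 + (\<bar>\<alpha>\<bar> + 1) / \<beta>) = nm x + nm x / \<beta> * \<bar>\<alpha>\<bar> + nm x / \<beta>"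
    using beta_pos by (simp add: field_simps)
  ultimately have "\<bar>of_int (fst x)\<bar> + \<bar>of_int (snd x)\<bar> \<le> nm x * (1 + (\<bar>\<alpha>\<bar> + 1) / \<beta>)"
    using 2 by linarith
  then show ?thesis using pos by (simp add: lc_def field_simps)
qed

lemma nm_pos: "x \<noteq> 0 \<Longrightarrow> nm x > 0" and nm_ge_lc: "x \<noteq> 0 \<Longrightarrow> nm x \<ge> lc"
proof -
  assume "x \<noteq> 0"
  then have "fst x \<noteq> 0 \<or> snd x \<noteq> 0" by (metis prod.collapse zero_prod_def)
  then have "1 \<le> \<bar>fst x\<bar> + \<bar>snd x\<bar>" by auto
  then have "real_of_int 1 \<le> of_int (\<bar>fst x\<bar> + \<bar>snd x\<bar>)" by (simp only: of_int_le_iff)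
  then have "lc * 1 \<le> lc * (\<bar>of_int (fst x)\<bar> + \<bar>of_int (snd x)\<bar>)" using lc_pos by (intro mult_left_mono) auto
  then show "nm x \<ge> lc" using nm_lower[of x] by simp
  then show "nm x > 0" using lc_pos by simp
qed

text \<open>For a + b \<ge> 1 one has (1 + a) (1 + b) \<le> 3 (a + b)^2. This majorises the summand
  by a product of one-dimensional sums with exponent p/2 > 1.\<close>

lemma csummable_nm_powr:
  assumes "p > 2"
  shows "csummable (\<lambda>x. if x = 0 then 0 else nm x powr (- p))"
proof (rule csummable_bound)
  let ?g = "\<lambda>x::int\<times>int. (lc\<^sup>2 / 3) powr (- p / 2) * ((1 + \<bar>of_int (fst x)\<bar>) powr (- (p / 2)) * (1 + \<bar>of_int (snd x)\<bar>) powr (- (p / 2)))"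
  have "csummable (\<lambda>(i, j). (1 + \<bar>real_of_int i\<bar>) powr (- (p / 2)) * (1 + \<bar>real_of_int j\<bar>) powr (- (p / 2)))"
    using assms by (intro csummable_times csummable_int_powr) auto
  then show "csummable ?g" by (auto simp: case_prod_unfold)
  fix x :: "int \<times> int"
  show "norm (if x = 0 then 0 else nm x powr (- p)) \<le> ?g x"
  proof (cases "x = 0")
    case False
    define a b where "a = \<bar>real_of_int (fst x)\<bar>" and "b = \<bar>real_of_int (snd x)\<bar>"
    have "fst x \<noteq> 0 \<or> snd x \<noteq> 0" using False by (metis prod.collapse zero_prod_def)
    then have "1 \<le> \<bar>fst x\<bar> + \<bar>snd x\<bar>" by auto
    then have "real_of_int 1 \<le> of_int (\<bar>fst x\<bar> + \<bar>snd x\<bar>)" by (simp only: of_int_le_iff)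
    then have ab: "a + b \<ge> 1" "a \<ge> 0" "b \<ge> 0" by (auto simp: a_def b_def)
    have "1 * 1 \<le> (a + b) * (a + b)" "1 * (a + b) \<le> (a + b) * (a + b)" using ab by (intro mult_mono; simp)+
    moreover have "0 \<le> a * a + b * b + a * b" using ab by simp
    ultimately have s: "(1 + a) * (1 + b) \<le> 3 * (a + b)\<^sup>2" by (simp add: power2_eq_square algebra_simps)
    have "(lc * (a + b))\<^sup>2 \<le> (nm x)\<^sup>2" using nm_lower[of x] lc_pos ab by (intro power_mono) (auto simp: a_def b_def)
    then have "lc\<^sup>2 * (a + b)\<^sup>2 \<le> (nm x)\<^sup>2" by (simp add: power_mult_distrib)
    moreover have "lc\<^sup>2 * ((1 + a) * (1 + b)) \<le> lc\<^sup>2 * (3 * (a + b)\<^sup>2)" using s by (intro mult_left_mono) auto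
    ultimately have le: "lc\<^sup>2 / 3 * ((1 + a) * (1 + b)) \<le> (nm x)\<^sup>2" by simp
    have "nm x powr (- p) = ((nm x)\<^sup>2) powr (- p / 2)"
    proof -
      have "(nm x)\<^sup>2 = nm x powr 2" using nm_pos[OF False] by (simp add: powr_numeral)
      then show ?thesis by (simp only: powr_powr) simp
    qed
    also have "\<dots> \<le> (lc\<^sup>2 / 3 * ((1 + a) * (1 + b))) powr (- p / 2)"
      using assms ab lc_pos le by (intro powr_mono2') (auto intro!: mult_pos_pos)
    also have "\<dots> = (lc\<^sup>2 / 3) powr (- p / 2) * ((1 + a) * (1 + b)) powr (- p / 2)" by (rule powr_mult)
    also have "((1 + a) * (1 + b)) powr (- p / 2) = (1 + a) powr (- p / 2) * (1 + b) powr (- p / 2)" by (rule powr_mult)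
    also have "(lc\<^sup>2 / 3) powr (- p / 2) * \<dots> = ?g x" by (simp add: a_def b_def)
    finally show ?thesis using False by simp
  qed auto
qed

definition gbound :: "real \<Rightarrow> int \<times> int \<Rightarrow> real" where
  "gbound c x = exp (- c * (nm x)\<^sup>2)"

lemma csummable_gbound:
  assumes "c > 0"
  shows "csummable (gbound c)"
proof (rule csummable_bound)
  have "csummable (\<lambda>(i, j). exp (- (c * lc\<^sup>2) * (real_of_int i)\<^sup>2) * exp (- (c * lc\<^sup>2) * (real_of_int j)\<^sup>2))"
    using assms lc_pos by (intro csummable_times csummable_gauss) auto
  then show "csummable (\<lambda>x. exp (- (c * lc\<^sup>2) * (real_of_int (fst x))\<^sup>2) * exp (- (c * lc\<^sup>2) * (real_of_int (snd x))\<^sup>2))"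
    by (simp add: case_prod_unfold)
  fix x :: "int \<times> int"
  have "(lc * (\<bar>of_int (fst x)\<bar> + \<bar>of_int (snd x)\<bar>))\<^sup>2 \<le> (nm x)\<^sup>2"
    using nm_lower[of x] lc_pos by (intro power_mono) auto
  moreover have "(real_of_int (fst x))\<^sup>2 + (of_int (snd x))\<^sup>2 \<le> (\<bar>of_int (fst x)\<bar> + \<bar>of_int (snd x)\<bar>)\<^sup>2"
    by (simp add: power2_sum)
  then have "lc\<^sup>2 * ((real_of_int (fst x))\<^sup>2 + (of_int (snd x))\<^sup>2) \<le> (lc * (\<bar>of_int (fst x)\<bar> + \<bar>of_int (snd x)\<bar>))\<^sup>2"
    unfolding power_mult_distrib by (intro mult_left_mono) auto
  ultimately have "c * (lc\<^sup>2 * ((real_of_int (fst x))\<^sup>2 + (of_int (snd x))\<^sup>2)) \<le> c * (nm x)\<^sup>2"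
    using assms by (intro mult_left_mono) auto
  then show "norm (gbound c x) \<le> exp (- (c * lc\<^sup>2) * (real_of_int (fst x))\<^sup>2) * exp (- (c * lc\<^sup>2) * (real_of_int (snd x))\<^sup>2)"
    by (simp add: gbound_def exp_add[symmetric] algebra_simps)
qed

lemma gauss_norm_shift:
  assumes "s > 0"
  shows "exp (- s * (norm (vec x - y))\<^sup>2) \<le> exp (s * (norm y)\<^sup>2) * gbound (s / 2) x"
proof -
  have "nm x \<le> norm (vec x - y) + norm y" unfolding nm_def using norm_triangle_ineq[of "vec x - y" y] by simp
  then have "(nm x)\<^sup>2 \<le> (norm (vec x - y) + norm y)\<^sup>2" by (intro power_mono) auto
  also have "\<dots> \<le> 2 * (norm (vec x - y))\<^sup>2 + 2 * (norm y)\<^sup>2"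
    using zero_le_power2[of "norm (vec x - y) - norm y"] by (simp add: power2_sum power2_diff)
  finally have "s * ((nm x)\<^sup>2 / 2) \<le> s * ((norm (vec x - y))\<^sup>2 + (norm y)\<^sup>2)" using assms by (intro mult_left_mono) auto
  then show ?thesis by (simp add: gbound_def exp_add[symmetric] algebra_simps)
qed

text \<open>One-dimensional Poisson summation in the first coordinate and then in the second. The
  shear by \<alpha> leaves a phase after the first summation, which is the twist of the second. The
  reindexing (k, l) to (l, -k) displays the dual vectors as lattice vectors turned by a right angle
  and divided by \<beta>.\<close>

lemma poisson_2d:
  assumes h: "h > 0"
  shows "csum (\<lambda>x. complex_of_real (exp (- (pi / h\<^sup>2) * (norm (vec x - y))\<^sup>2))) =
    h\<^sup>2 / \<beta> * csum (\<lambda>x. exp (- pi * h\<^sup>2 * (nm x / \<beta>)\<^sup>2) * e2 (of_int (snd x) * fst y + (- (of_int (fst x) + of_int (snd x) * \<alpha>) / \<beta>) * snd y))"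
proof -
  obtain y1 y2 where y: "y = (y1, y2)" by (cases y)
  define s where "s = 1 / h\<^sup>2"
  have s: "s > 0" using h by (simp add: s_def)
  have sq: "sqrt s = 1 / h" "sqrt (s * \<beta>\<^sup>2) = \<beta> / h" using h beta_pos by (simp_all add: s_def real_sqrt_divide real_sqrt_mult)
  define L where "L x = complex_of_real (exp (- (pi / h\<^sup>2) * (norm (vec x - y))\<^sup>2))" for x
  define E where "E n = exp (- pi * s * (of_int n * \<beta> - y2)\<^sup>2)" for n :: int
  have sE: "csummable E"
  proof (rule csummable_bound)
    show "csummable (\<lambda>n::int. exp (pi * s * \<beta>\<^sup>2 * \<bar>y2 / \<beta>\<bar>\<^sup>2) * exp (- (pi * s * \<beta>\<^sup>2 / 2) * (of_int n)\<^sup>2))"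
      using s beta_pos by (intro integrable_mult_right csummable_gauss) auto
    fix n :: int
    have "of_int n * \<beta> - y2 = \<beta> * (of_int n + - (y2 / \<beta>))" using beta_pos by (simp add: field_simps)
    then have "E n = exp (- (pi * s * \<beta>\<^sup>2) * (of_int n + - (y2 / \<beta>))\<^sup>2)" by (simp add: E_def power_mult_distrib)
    also have "\<dots> \<le> exp (pi * s * \<beta>\<^sup>2 * \<bar>y2 / \<beta>\<bar>\<^sup>2) * exp (- (pi * s * \<beta>\<^sup>2 / 2) * (of_int n)\<^sup>2)"
      by (rule gauss_shift_bound) (use s beta_pos in auto)
    finally show "norm (E n) \<le> exp (pi * s * \<beta>\<^sup>2 * \<bar>y2 / \<beta>\<bar>\<^sup>2) * exp (- (pi * s * \<beta>\<^sup>2 / 2) * (of_int n)\<^sup>2)"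
      by (simp add: E_def)
  qed
  have sL: "csummable L"
  proof (rule csummable_bound)
    show "csummable (\<lambda>x. exp ((pi / h\<^sup>2) * (norm y)\<^sup>2) * gbound ((pi / h\<^sup>2) / 2) x)"
      using h by (intro integrable_mult_right csummable_gbound) auto
    show "norm (L x) \<le> exp ((pi / h\<^sup>2) * (norm y)\<^sup>2) * gbound ((pi / h\<^sup>2) / 2) x" for x
      using gauss_norm_shift[of "pi / h\<^sup>2" x y] h by (simp add: L_def)
  qed
  \<comment> \<open>The terms after summation in the first coordinate alone. They are absolutely
    summable over (n, k), so the order of summation may be exchanged before the second
    application.\<close>
  define F where "F = (\<lambda>(n, k). complex_of_real (E n * (exp (- pi * (of_int k)\<^sup>2 / s) / sqrt s)) * e2 (of_int k * (of_int n * \<alpha> - y1)))"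
  have sF: "csummable F"
  proof (rule csummable_bound)
    show "csummable (\<lambda>(n, k). E n * (exp (- (pi / s) * (of_int k)\<^sup>2) / sqrt s))"
      using s sE by (intro csummable_times integrable_divide csummable_gauss) auto
    show "norm (F x) \<le> (case x of (n, k) \<Rightarrow> E n * (exp (- (pi / s) * (of_int k)\<^sup>2) / sqrt s))" for x
      using s by (cases x) (simp add: F_def norm_mult norm_divide E_def)
  qed
  have "csum L = csum (\<lambda>n. csum (\<lambda>m. L (m, n)))" by (rule csum_Sigma(2)[OF sL])
  also have "\<dots> = csum (\<lambda>n. csum (\<lambda>k. F (n, k)))"
  proof (rule arg_cong[of _ _ csum], rule ext)
    fix n :: int
    have "L (m, n) = E n * (exp (- pi * s * (of_int m + (of_int n * \<alpha> - y1))\<^sup>2) * e2 (0 * (of_int m + (of_int n * \<alpha> - y1))))" for m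
    proof -
      have "(norm (vec (m, n) - y))\<^sup>2 = (of_int m + (of_int n * \<alpha> - y1))\<^sup>2 + (of_int n * \<beta> - y2)\<^sup>2"
        by (simp add: vec_def y norm_prod_def add_diff_eq)
      then have "- (pi / h\<^sup>2) * (norm (vec (m, n) - y))\<^sup>2 = - pi * s * (of_int n * \<beta> - y2)\<^sup>2 + - pi * s * (of_int m + (of_int n * \<alpha> - y1))\<^sup>2"
        by (simp add: s_def distrib_left add.commute)
      then show ?thesis unfolding L_def E_def by (simp only: exp_add of_real_mult mult_zero_left e2_0 mult_1_right)
    qed
    then have "csum (\<lambda>m. L (m, n)) = E n * csum (\<lambda>m::int. exp (- pi * s * (of_int m + (of_int n * \<alpha> - y1))\<^sup>2) * e2 (0 * (of_int m + (of_int n * \<alpha> - y1))))"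
      by (simp only: integral_mult_right_zero)
    also have "\<dots> = E n * csum (\<lambda>k::int. exp (- pi * (of_int k - 0)\<^sup>2 / s) / sqrt s * e2 (of_int k * (of_int n * \<alpha> - y1)))"
      by (subst gauss_poisson[OF s]) (rule refl)
    also have "\<dots> = csum (\<lambda>k::int. E n * (exp (- pi * (of_int k - 0)\<^sup>2 / s) / sqrt s * e2 (of_int k * (of_int n * \<alpha> - y1))))"
      by (simp only: integral_mult_right_zero)
    finally show "csum (\<lambda>m. L (m, n)) = csum (\<lambda>k. F (n, k))" by (simp add: F_def mult.assoc)
  qed
  also have "\<dots> = csum (\<lambda>k. csum (\<lambda>n. F (n, k)))" using csum_Sigma(1,2)[OF sF] by simp
  also have "\<dots> = csum (\<lambda>k. csum (\<lambda>l. h\<^sup>2 / \<beta> * (exp (- pi * h\<^sup>2 * (nm (l, - k) / \<beta>)\<^sup>2) * e2 (of_int (- k) * y1 + (- (of_int l + of_int (- k) * \<alpha>) / \<beta>) * y2))))"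
  proof (rule arg_cong[of _ _ csum], rule ext)
    fix k :: int
    define s' where "s' = s * \<beta>\<^sup>2"
    define a b where "a = - y2 / \<beta>" and "b = of_int k * \<alpha>"
    have s': "s' > 0" using s beta_pos by (simp add: s'_def)
    define K where "K = complex_of_real (exp (- pi * (of_int k)\<^sup>2 / s) / sqrt s) * e2 (- b * a - of_int k * y1)"
    have "F (n, k) = K * (exp (- pi * s' * (of_int n + a)\<^sup>2) * e2 (b * (of_int n + a)))" for n
    proof -
      have "of_int n * \<beta> - y2 = \<beta> * (of_int n + a)" using beta_pos by (simp add: field_simps a_def)
      then have "E n = exp (- pi * s' * (of_int n + a)\<^sup>2)" by (simp add: E_def power_mult_distrib s'_def)
      moreover have "e2 (of_int k * (of_int n * \<alpha> - y1)) = e2 (- b * a - of_int k * y1) * e2 (b * (of_int n + a))"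
        unfolding e2_add[symmetric] b_def by (simp add: algebra_simps)
      ultimately show ?thesis unfolding F_def K_def by simp
    qed
    then have "csum (\<lambda>n. F (n, k)) = K * csum (\<lambda>n::int. exp (- pi * s' * (of_int n + a)\<^sup>2) * e2 (b * (of_int n + a)))"
      by (simp only: integral_mult_right_zero)
    also have "\<dots> = csum (\<lambda>l::int. K * (exp (- pi * (of_int l - b)\<^sup>2 / s') / sqrt s' * e2 (of_int l * a)))"
      by (subst gauss_poisson[OF s']) (simp only: integral_mult_right_zero)
    also have "\<dots> = csum (\<lambda>l. h\<^sup>2 / \<beta> * (exp (- pi * h\<^sup>2 * (nm (l, - k) / \<beta>)\<^sup>2) * e2 (of_int (- k) * y1 + (- (of_int l + of_int (- k) * \<alpha>) / \<beta>) * y2)))"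
    proof (rule arg_cong[of _ _ csum], rule ext)
      fix l :: int
      have 1: "e2 (- b * a - of_int k * y1) * e2 (of_int l * a) = e2 (of_int (- k) * y1 + (- (of_int l + of_int (- k) * \<alpha>) / \<beta>) * y2)"
        unfolding e2_add[symmetric] b_def a_def by (intro arg_cong[of _ _ e2]) (simp add: divide_inverse algebra_simps)
      have 2: "exp (- pi * (of_int k)\<^sup>2 / s) * exp (- pi * (of_int l - b)\<^sup>2 / s') = exp (- pi * h\<^sup>2 * (nm (l, - k) / \<beta>)\<^sup>2)"
      proof -
        have n: "(nm (l, - k) / \<beta>)\<^sup>2 = (of_int l - b)\<^sup>2 / \<beta>\<^sup>2 + (of_int k)\<^sup>2"
          using beta_pos by (simp add: power_divide nm_sq b_def add_divide_distrib power_mult_distrib)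
        have "- pi * (of_int k)\<^sup>2 / s = - pi * h\<^sup>2 * (of_int k)\<^sup>2" "- pi * (of_int l - b)\<^sup>2 / s' = - pi * h\<^sup>2 * ((of_int l - b)\<^sup>2 / \<beta>\<^sup>2)"
          by (simp_all add: s_def s'_def)
        then show ?thesis unfolding exp_add[symmetric] n by (simp only: distrib_left add.commute)
      qed
      have 3: "sqrt s * sqrt s' = \<beta> / h\<^sup>2" unfolding s'_def sq by (simp add: power2_eq_square)
      have "K * (exp (- pi * (of_int l - b)\<^sup>2 / s') / sqrt s' * e2 (of_int l * a)) =
        complex_of_real ((exp (- pi * (of_int k)\<^sup>2 / s) * exp (- pi * (of_int l - b)\<^sup>2 / s')) / (sqrt s * sqrt s')) * (e2 (- b * a - of_int k * y1) * e2 (of_int l * a))"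
        unfolding K_def by simp
      then show "K * (exp (- pi * (of_int l - b)\<^sup>2 / s') / sqrt s' * e2 (of_int l * a)) =
        h\<^sup>2 / \<beta> * (exp (- pi * h\<^sup>2 * (nm (l, - k) / \<beta>)\<^sup>2) * e2 (of_int (- k) * y1 + (- (of_int l + of_int (- k) * \<alpha>) / \<beta>) * y2))"
        unfolding 1 2 3 by simp
    qed
    finally show "csum (\<lambda>n. F (n, k)) = csum (\<lambda>l. h\<^sup>2 / \<beta> * (exp (- pi * h\<^sup>2 * (nm (l, - k) / \<beta>)\<^sup>2) * e2 (of_int (- k) * y1 + (- (of_int l + of_int (- k) * \<alpha>) / \<beta>) * y2)))" .
  qed
  also have "\<dots> = csum (\<lambda>(k, l). h\<^sup>2 / \<beta> * (exp (- pi * h\<^sup>2 * (nm (l, - k) / \<beta>)\<^sup>2) * e2 (of_int (- k) * y1 + (- (of_int l + of_int (- k) * \<alpha>) / \<beta>) * y2)))"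
  proof -
    let ?G = "\<lambda>x. complex_of_real (h\<^sup>2 / \<beta>) * (exp (- pi * h\<^sup>2 * (nm x / \<beta>)\<^sup>2) * e2 (of_int (snd x) * y1 + (- (of_int (fst x) + of_int (snd x) * \<alpha>) / \<beta>) * y2))"
    have "csummable (\<lambda>x. h\<^sup>2 / \<beta> * gbound (pi * h\<^sup>2 / \<beta>\<^sup>2) x)"
      using h beta_pos by (intro integrable_mult_right csummable_gbound) auto
    then have "csummable ?G"
      by (rule csummable_bound) (use beta_pos in \<open>auto simp: norm_mult norm_divide norm_power gbound_def power_divide\<close>)
    moreover have "bij (\<lambda>(k::int, l::int). (l, - k))" by (rule o_bij[of "\<lambda>(l, k). (- k, l)"]) auto
    ultimately have "csummable (\<lambda>x. ?G ((\<lambda>(k, l). (l, - k)) x))" by (rule csummable_reindex_bij[rotated])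
    then have "csummable (\<lambda>(k, l). ?G (l, - k))" by (simp add: case_prod_unfold)
    from csum_Sigma(1)[OF this] show ?thesis by simp
  qed
  also have "\<dots> = csum (\<lambda>x. h\<^sup>2 / \<beta> * (exp (- pi * h\<^sup>2 * (nm x / \<beta>)\<^sup>2) * e2 (of_int (snd x) * y1 + (- (of_int (fst x) + of_int (snd x) * \<alpha>) / \<beta>) * y2)))"
  proof -
    have "bij (\<lambda>(k::int, l::int). (l, - k))" by (rule o_bij[of "\<lambda>(l, k). (- k, l)"]) auto
    from csum_reindex_bij[OF this, of "\<lambda>x. h\<^sup>2 / \<beta> * (exp (- pi * h\<^sup>2 * (nm x / \<beta>)\<^sup>2) * e2 (of_int (snd x) * y1 + (- (of_int (fst x) + of_int (snd x) * \<alpha>) / \<beta>) * y2))"]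
    show ?thesis by (simp add: case_prod_unfold)
  qed
  also have "\<dots> = h\<^sup>2 / \<beta> * csum (\<lambda>x. exp (- pi * h\<^sup>2 * (nm x / \<beta>)\<^sup>2) * e2 (of_int (snd x) * y1 + (- (of_int (fst x) + of_int (snd x) * \<alpha>) / \<beta>) * y2))"
    by (simp only: integral_mult_right_zero)
  finally show ?thesis unfolding L_def y by simp
qed

text \<open>The indicator of the disc convolved with a Gaussian of total mass 1 and width
  \<open>h\<close>, evaluated at a lattice vector.\<close>

definition smooth_ind :: "real \<Rightarrow> real \<Rightarrow> int \<times> int \<Rightarrow> real" where
  "smooth_ind h t x = (LINT y|lborel. indicator (cball 0 t) y * exp (- (pi / h\<^sup>2) * (norm (vec x - y))\<^sup>2)) / h\<^sup>2"

definition smooth_count :: "real \<Rightarrow> real \<Rightarrow> real" where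
  "smooth_count h t = csum (smooth_ind h t)"

lemma integrable_cball: "integrable lborel (indicator (cball (c :: real \<times> real) t) :: _ \<Rightarrow> real)"
  using emeasure_bounded_finite[of "cball c t"] by (intro integrable_real_indicator) auto

lemma measure_cball: "t \<ge> 0 \<Longrightarrow> measure lborel (cball (0 :: real \<times> real) t) = pi * t\<^sup>2"
  using content_cball[of t "0::real\<times>real"] by (simp add: unit_ball_vol_2 measure_completion power2_eq_square)

lemma borel_measurable_gauss_vec [measurable]:
  "(\<lambda>y. exp (- c * (norm (vec x - y))\<^sup>2)) \<in> borel_measurable borel"
  by (intro borel_measurable_continuous_onI continuous_intros)

lemma smooth_ind_bounds:
  assumes h: "h > 0" and t: "t \<ge> 0"
  shows "smooth_ind h t x \<ge> 0"
    and "integrable lborel (\<lambda>y. indicator (cball 0 t) y * exp (- (pi / h\<^sup>2) * (norm (vec x - y))\<^sup>2))"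
    and "(LINT y|lborel. indicator (cball 0 t) y * exp (- (pi / h\<^sup>2) * (norm (vec x - y))\<^sup>2)) \<le> pi * t\<^sup>2 * exp ((pi / h\<^sup>2) * t\<^sup>2) * gbound (pi / h\<^sup>2 / 2) x"
proof -
  let ?f = "\<lambda>y. indicator (cball 0 t) y * exp (- (pi / h\<^sup>2) * (norm (vec x - y))\<^sup>2) :: real"
  have [measurable]: "cball 0 t \<in> sets (borel :: (real \<times> real) measure)" by simp
  show "smooth_ind h t x \<ge> 0" unfolding smooth_ind_def by (intro divide_nonneg_nonneg integral_nonneg_AE) auto
  show i: "integrable lborel ?f" by (rule Bochner_Integration.integrable_bound[OF integrable_cball[of 0 t]]) (auto split: split_indicator)
  have "integral\<^sup>L lborel ?f \<le> (LINT y|lborel. exp ((pi / h\<^sup>2) * t\<^sup>2) * gbound (pi / h\<^sup>2 / 2) x * indicator (cball (0::real\<times>real) t) y)"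
  proof (rule Bochner_Integration.integral_mono[OF i])
    show "integrable lborel (\<lambda>y. exp ((pi / h\<^sup>2) * t\<^sup>2) * gbound (pi / h\<^sup>2 / 2) x * indicator (cball (0::real\<times>real) t) y)"
      by (intro integrable_mult_right integrable_cball)
    fix y :: "real \<times> real"
    show "?f y \<le> exp ((pi / h\<^sup>2) * t\<^sup>2) * gbound (pi / h\<^sup>2 / 2) x * indicator (cball 0 t) y"
    proof (cases "norm y \<le> t")
      case True
      have "(norm y)\<^sup>2 \<le> t\<^sup>2" using True by (intro power_mono) auto
      then have "exp ((pi / h\<^sup>2) * (norm y)\<^sup>2) \<le> exp ((pi / h\<^sup>2) * t\<^sup>2)" using h by (simp add: divide_right_mono)
      then have "exp ((pi / h\<^sup>2) * (norm y)\<^sup>2) * gbound (pi / h\<^sup>2 / 2) x \<le> exp ((pi / h\<^sup>2) * t\<^sup>2) * gbound (pi / h\<^sup>2 / 2) x"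
        by (intro mult_right_mono) (auto simp: gbound_def)
      then show ?thesis using gauss_norm_shift[of "pi / h\<^sup>2" x y] h True by simp
    qed simp
  qed
  then show "integral\<^sup>L lborel ?f \<le> pi * t\<^sup>2 * exp ((pi / h\<^sup>2) * t\<^sup>2) * gbound (pi / h\<^sup>2 / 2) x"
    using t by (simp add: measure_cball mult_ac)
qed

lemma csummable_smooth_ind:
  assumes h: "h > 0" and t: "t \<ge> 0"
  shows "csummable (smooth_ind h t)"
proof (rule csummable_bound)
  show "csummable (\<lambda>x. pi * t\<^sup>2 * exp ((pi / h\<^sup>2) * t\<^sup>2) / h\<^sup>2 * gbound (pi / h\<^sup>2 / 2) x)"
    using h by (intro integrable_mult_right csummable_gbound) auto
  show "norm (smooth_ind h t x) \<le> pi * t\<^sup>2 * exp ((pi / h\<^sup>2) * t\<^sup>2) / h\<^sup>2 * gbound (pi / h\<^sup>2 / 2) x" for x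
    using smooth_ind_bounds[OF assms, of x] h by (simp add: smooth_ind_def divide_right_mono)
qed

text \<open>Planar Poisson summation integrated over \<open>y\<close> in the disc, with sum and
  integral exchanged on both sides; each dual vector then contributes the Fourier integral of the
  disc at its length.\<close>

lemma smooth_count_bessel:
  assumes h: "h > 0" and t: "t > 0"
  shows "smooth_count h t = 2 * t\<^sup>2 / \<beta> * csum (\<lambda>x. exp (- pi * h\<^sup>2 * (nm x / \<beta>)\<^sup>2) * bessel_int (2 * pi * (t * (nm x / \<beta>))))"
proof -
  have [measurable]: "cball 0 t \<in> sets (borel :: (real \<times> real) measure)" by simp
  let ?f = "\<lambda>x y. complex_of_real (indicator (cball 0 t) y * exp (- (pi / h\<^sup>2) * (norm (vec x - y))\<^sup>2))"
  let ?g = "\<lambda>x y. indicator (cball 0 t) y *\<^sub>R (complex_of_real (exp (- pi * h\<^sup>2 * (nm x / \<beta>)\<^sup>2)) * e2 (of_int (snd x) * fst y + (- (of_int (fst x) + of_int (snd x) * \<alpha>) / \<beta>) * snd y))"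
  have f: "integrable lborel (?f x)" for x using smooth_ind_bounds(2)[OF h] t by (simp del: of_real_mult)
  have sf: "csummable (\<lambda>x. LINT y|lborel. norm (?f x y))"
  proof (rule csummable_bound)
    show "csummable (\<lambda>x. pi * t\<^sup>2 * exp ((pi / h\<^sup>2) * t\<^sup>2) * gbound (pi / h\<^sup>2 / 2) x)"
      using h by (intro integrable_mult_right csummable_gbound) auto
    show "norm (LINT y|lborel. norm (?f x y)) \<le> pi * t\<^sup>2 * exp ((pi / h\<^sup>2) * t\<^sup>2) * gbound (pi / h\<^sup>2 / 2) x" for x
      using smooth_ind_bounds(1,3)[OF h, of t x] t h by (simp add: smooth_ind_def norm_mult abs_mult zero_le_divide_iff)
  qed
  have meas: "?g x \<in> borel_measurable borel" for x by measurable
  have normg: "norm (?g x y) \<le> gbound (pi * h\<^sup>2 / \<beta>\<^sup>2) x * indicator (cball 0 t) y" for x y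
    by (auto simp: norm_mult gbound_def power_divide split: split_indicator)
  have g: "integrable lborel (?g x)" for x
  proof (rule Bochner_Integration.integrable_bound)
    show "integrable lborel (\<lambda>y. gbound (pi * h\<^sup>2 / \<beta>\<^sup>2) x * indicator (cball (0::real\<times>real) t) y)"
      by (intro integrable_mult_right integrable_cball)
    show "AE y in lborel. norm (?g x y) \<le> norm (gbound (pi * h\<^sup>2 / \<beta>\<^sup>2) x * indicator (cball (0::real\<times>real) t) y)"
      by (rule AE_I2, rule order.trans[OF normg]) simp
  qed (use meas[of x] in simp)
  have sg: "csummable (\<lambda>x. LINT y|lborel. norm (?g x y))"
  proof (rule csummable_bound)
    show "csummable (\<lambda>x. pi * t\<^sup>2 * gbound (pi * h\<^sup>2 / \<beta>\<^sup>2) x)"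
      using h beta_pos by (intro integrable_mult_right csummable_gbound) auto
    fix x
    have "(LINT y|lborel. norm (?g x y)) \<le> (LINT y|lborel. gbound (pi * h\<^sup>2 / \<beta>\<^sup>2) x * indicator (cball (0::real\<times>real) t) y)"
      by (rule Bochner_Integration.integral_mono[OF integrable_norm[OF g] _ normg]) (intro integrable_mult_right integrable_cball)
    also have "\<dots> = pi * t\<^sup>2 * gbound (pi * h\<^sup>2 / \<beta>\<^sup>2) x" using t by (simp add: measure_cball)
    finally show "norm (LINT y|lborel. norm (?g x y)) \<le> pi * t\<^sup>2 * gbound (pi * h\<^sup>2 / \<beta>\<^sup>2) x"
      by (simp add: integral_nonneg_AE)
  qed
  have "complex_of_real (h\<^sup>2 * smooth_count h t) = csum (\<lambda>x. complex_of_real (h\<^sup>2 * smooth_ind h t x))"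
    by (simp add: smooth_count_def integral_complex_of_real)
  also have "\<dots> = csum (\<lambda>x. LINT y|lborel. ?f x y)"
    using h by (intro arg_cong[of _ _ csum] ext) (simp add: smooth_ind_def del: of_real_mult)
  also have "\<dots> = (LINT y|lborel. csum (\<lambda>x. ?f x y))"
    by (rule csum_integral_swap(1)[symmetric]) (use f sf sigma_finite_lborel in auto)
  also have "\<dots> = (LINT y|lborel. h\<^sup>2 / \<beta> * csum (\<lambda>x. ?g x y))"
  proof (intro Bochner_Integration.integral_cong refl)
    fix y :: "real \<times> real"
    have "csum (\<lambda>x. ?f x y) = indicator (cball 0 t) y *\<^sub>R csum (\<lambda>x. complex_of_real (exp (- (pi / h\<^sup>2) * (norm (vec x - y))\<^sup>2)))"
      by (subst integral_scaleR_right[symmetric]) (auto simp: scaleR_conv_of_real split: split_indicator)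
    also have "\<dots> = h\<^sup>2 / \<beta> * csum (\<lambda>x. ?g x y)" unfolding poisson_2d[OF h] by (auto split: split_indicator)
    finally show "csum (\<lambda>x. ?f x y) = h\<^sup>2 / \<beta> * csum (\<lambda>x. ?g x y)" .
  qed
  also have "\<dots> = h\<^sup>2 / \<beta> * csum (\<lambda>x. LINT y|lborel. ?g x y)"
    by (subst integral_mult_right_zero, subst csum_integral_swap(1)) (use g sg sigma_finite_lborel in auto)
  also have "csum (\<lambda>x. LINT y|lborel. ?g x y) = csum (\<lambda>x. complex_of_real (2 * t\<^sup>2 * (exp (- pi * h\<^sup>2 * (nm x / \<beta>)\<^sup>2) * bessel_int (2 * pi * (t * (nm x / \<beta>))))))"
  proof (intro arg_cong[of _ _ csum] ext)
    fix x
    have "(LINT y|lborel. ?g x y) = exp (- pi * h\<^sup>2 * (nm x / \<beta>)\<^sup>2) * (LINT y|lborel. indicator (cball 0 t) y *\<^sub>R e2 (of_int (snd x) * fst y + (- (of_int (fst x) + of_int (snd x) * \<alpha>) / \<beta>) * snd y))"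
      by (subst integral_mult_right_zero[symmetric]) (simp add: mult.left_commute scaleR_conv_of_real)
    also have "sqrt ((of_int (snd x))\<^sup>2 + (- (of_int (fst x) + of_int (snd x) * \<alpha>) / \<beta>)\<^sup>2) = nm x / \<beta>"
    proof (rule real_sqrt_unique)
      show "(nm x / \<beta>)\<^sup>2 = (of_int (snd x))\<^sup>2 + (- (of_int (fst x) + of_int (snd x) * \<alpha>) / \<beta>)\<^sup>2"
      proof -
        have "(- (of_int (fst x) + of_int (snd x) * \<alpha>) / \<beta>)\<^sup>2 = (of_int (fst x) + of_int (snd x) * \<alpha>)\<^sup>2 / \<beta>\<^sup>2"
          by (simp only: power2_minus power_divide)
        then show ?thesis using beta_pos by (simp add: power_divide nm_sq add_divide_distrib power_mult_distrib)
      qed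
    qed (use beta_pos in auto)
    then have "(LINT y|lborel. indicator (cball 0 t) y *\<^sub>R e2 (of_int (snd x) * fst y + (- (of_int (fst x) + of_int (snd x) * \<alpha>) / \<beta>) * snd y)) = 2 * t\<^sup>2 * bessel_int (2 * pi * (t * (nm x / \<beta>)))"
      unfolding disc_fourier[OF t] by simp
    finally show "(LINT y|lborel. ?g x y) = complex_of_real (2 * t\<^sup>2 * (exp (- pi * h\<^sup>2 * (nm x / \<beta>)\<^sup>2) * bessel_int (2 * pi * (t * (nm x / \<beta>)))))"
      by simp
  qed
  also have "\<dots> = of_real (2 * t\<^sup>2 * csum (\<lambda>x. exp (- pi * h\<^sup>2 * (nm x / \<beta>)\<^sup>2) * bessel_int (2 * pi * (t * (nm x / \<beta>)))))"
    by (simp only: integral_complex_of_real integral_mult_right_zero)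
  finally have "complex_of_real (h\<^sup>2 * smooth_count h t) = complex_of_real (h\<^sup>2 * (2 * t\<^sup>2 / \<beta> * csum (\<lambda>x. exp (- pi * h\<^sup>2 * (nm x / \<beta>)\<^sup>2) * bessel_int (2 * pi * (t * (nm x / \<beta>))))))"
    by simp
  then have "h\<^sup>2 * smooth_count h t = h\<^sup>2 * (2 * t\<^sup>2 / \<beta> * csum (\<lambda>x. exp (- pi * h\<^sup>2 * (nm x / \<beta>)\<^sup>2) * bessel_int (2 * pi * (t * (nm x / \<beta>)))))"
    unfolding of_real_eq_iff .
  then show ?thesis by (subst (asm) mult_left_cancel) (use h in auto)
qed

definition kap :: "int \<times> int \<Rightarrow> real" where "kap x = nm x / \<beta>"

text \<open>The leading Bessel asymptotics at frequency \<open>kap x\<close>, up to a common factor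
  sqrt t / (pi \<beta>). The value at 0 is set to 0, as that term yields the area and not an
  oscillation.\<close>

definition osc :: "real \<Rightarrow> real \<Rightarrow> int \<times> int \<Rightarrow> real" where
  "osc h t x = (if x = 0 then 0 else exp (- pi * h\<^sup>2 * (kap x)\<^sup>2) * kap x powr (-3/2) * sin (2 * pi * t * kap x - pi/4))"

lemma kap_nonneg [simp]: "kap x \<ge> 0" using beta_pos by (simp add: kap_def)
lemma kap_0 [simp]: "kap 0 = 0" by (simp add: kap_def)
lemma kap_pos: "x \<noteq> 0 \<Longrightarrow> kap x > 0" using beta_pos nm_pos by (simp add: kap_def)

lemma csummable_kap_powr:
  assumes "p > 2"
  shows "csummable (\<lambda>x. if x = 0 then 0 else kap x powr (- p))"
proof -
  have "(\<lambda>x. if x = 0 then 0 else kap x powr (- p)) = (\<lambda>x. \<beta> powr p * (if x = 0 then 0 else nm x powr (- p)))"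
    using beta_pos by (auto simp: fun_eq_iff kap_def powr_divide powr_minus field_simps)
  then show ?thesis using csummable_nm_powr[OF assms] by simp
qed

lemma csummable_osc: assumes "h > 0" shows "csummable (osc h t)"
proof (rule csummable_bound)
  show "csummable (\<lambda>x. (lc / \<beta>) powr (-3/2) * gbound (pi * h\<^sup>2 / \<beta>\<^sup>2) x)"
    using assms beta_pos by (intro integrable_mult_right csummable_gbound) auto
  fix x
  show "norm (osc h t x) \<le> (lc / \<beta>) powr (-3/2) * gbound (pi * h\<^sup>2 / \<beta>\<^sup>2) x"
  proof (cases "x = 0")
    case False
    have "kap x powr (-3/2) \<le> (lc / \<beta>) powr (-3/2)"
      using nm_ge_lc[OF False] lc_pos beta_pos by (intro powr_mono2') (auto simp: kap_def divide_right_mono)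
    then have "exp (- pi * h\<^sup>2 * (kap x)\<^sup>2) * (kap x powr (-3/2) * \<bar>sin (2 * pi * t * kap x - pi/4)\<bar>)
        \<le> exp (- pi * h\<^sup>2 * (kap x)\<^sup>2) * ((lc / \<beta>) powr (-3/2) * 1)" by (intro mult_left_mono mult_mono) auto
    then show ?thesis using False by (simp add: osc_def gbound_def abs_mult kap_def power_divide mult_ac)
  qed (simp add: osc_def gbound_def)
qed

text \<open>The term at 0 gives the area, since \<open>bessel_int 0\<close> is pi/2. The Bessel
  remainders decay like kap^(-5/2), which is summable over the plane without the Gaussian factor, so
  the constant does not depend on \<open>h\<close>.\<close>

lemma smooth_count_asymptotics:
  "\<exists>C. \<forall>h>0. \<forall>t>0. \<bar>smooth_count h t - pi * t\<^sup>2 / \<beta> - sqrt t / (pi * \<beta>) * csum (osc h t)\<bar> \<le> C / sqrt t"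
proof -
  let ?k = "\<lambda>x. if x = 0 then 0 else kap x powr (- (5/2))"
  define K where "K = 4 * Gamma (5/2) / (2 * pi) powr (5/2) / \<beta>"
  have sk: "csummable ?k" by (rule csummable_kap_powr) simp
  have "\<bar>smooth_count h t - pi * t\<^sup>2 / \<beta> - sqrt t / (pi * \<beta>) * csum (osc h t)\<bar> \<le> K * csum ?k / sqrt t"
    if h: "h > 0" and t: "t > 0" for h t
  proof -
    define b where "b x = 2 * t\<^sup>2 / \<beta> * (exp (- pi * h\<^sup>2 * (kap x)\<^sup>2) * bessel_int (2 * pi * (t * kap x)))" for x
    have est: "\<bar>b x - sqrt t / (pi * \<beta>) * osc h t x\<bar> \<le> K / sqrt t * ?k x" if "x \<noteq> 0" for x
    proof -
      define z where "z = 2 * pi * (t * kap x)"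
      have k: "kap x > 0" by (rule kap_pos[OF that])
      have z: "z > 0" using t k by (simp add: z_def)
      have t32: "t\<^sup>2 * t powr (-3/2) = sqrt t" "t\<^sup>2 * t powr (-5/2) = 1 / sqrt t"
      proof -
        have t2: "t\<^sup>2 = t powr 2" using t by (simp add: powr_numeral)
        have "t\<^sup>2 * t powr (-3/2) = t powr (1/2)" unfolding t2 powr_add[symmetric] by simp
        then show "t\<^sup>2 * t powr (-3/2) = sqrt t" using t by (simp add: powr_half_sqrt)
        have "t\<^sup>2 * t powr (-5/2) = t powr (- (1/2))" unfolding t2 powr_add[symmetric] by simp
        also have "\<dots> = 1 / t powr (1/2)" by (rule powr_minus_divide)
        finally show "t\<^sup>2 * t powr (-5/2) = 1 / sqrt t" using t by (simp add: powr_half_sqrt)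
      qed
      have c: "2 * sqrt (2 * pi) * (2 * pi) powr (-3/2) = 1 / pi"
      proof -
        have "(2 * pi) powr (-3/2) = (2 * pi) powr (1/2 + - 2)" by simp
        also have "\<dots> = (2 * pi) powr (1/2) * (1 / (2 * pi) powr 2)" unfolding powr_add powr_minus_divide ..
        also have "\<dots> = sqrt (2 * pi) * (1 / (2 * pi)\<^sup>2)" by (simp add: powr_half_sqrt powr_numeral)
        finally have "2 * sqrt (2 * pi) * (2 * pi) powr (-3/2) = 2 * (sqrt (2 * pi) * sqrt (2 * pi)) * (1 / (2 * pi)\<^sup>2)" by simp
        also have "sqrt (2 * pi) * sqrt (2 * pi) = 2 * pi" by simp
        also have "2 * (2 * pi) * (1 / (2 * pi)\<^sup>2) = 1 / pi" by (simp add: power2_eq_square)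
        finally show ?thesis .
      qed
      have zp: "z powr q = (2 * pi) powr q * t powr q * kap x powr q" for q using t k by (simp add: z_def powr_mult mult.assoc)
      let ?e = "exp (- pi * h\<^sup>2 * (kap x)\<^sup>2)"
      have "b x - sqrt t / (pi * \<beta>) * osc h t x = 2 * t\<^sup>2 / \<beta> * ?e * (bessel_int z - sqrt (2 * pi) * z powr (-3/2) * sin (z - pi/4))"
      proof -
        have "2 * t\<^sup>2 / \<beta> * ?e * (sqrt (2 * pi) * z powr (-3/2) * sin (z - pi/4))
          = (2 * sqrt (2 * pi) * (2 * pi) powr (-3/2)) * (t\<^sup>2 * t powr (-3/2)) / \<beta> * ?e * kap x powr (-3/2) * sin (z - pi/4)"
          unfolding zp by simp
        also have "\<dots> = sqrt t / (pi * \<beta>) * osc h t x" unfolding c t32 using that by (simp add: osc_def z_def mult_ac)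
        finally show ?thesis unfolding b_def right_diff_distrib z_def by simp
      qed
      also have "\<bar>\<dots>\<bar> = 2 * t\<^sup>2 / \<beta> * (?e * \<bar>bessel_int z - sqrt (2 * pi) * z powr (-3/2) * sin (z - pi/4)\<bar>)"
        using beta_pos by (simp add: abs_mult)
      also have "\<dots> \<le> 2 * t\<^sup>2 / \<beta> * (1 * (2 * Gamma (5/2) * z powr (-5/2)))"
        using beta_pos by (intro mult_left_mono mult_mono bessel_int_asymptotics z) auto
      also have "\<dots> = 4 * Gamma (5/2) * (2 * pi) powr (-5/2) / \<beta> * (t\<^sup>2 * t powr (-5/2)) * kap x powr (-5/2)"
        unfolding zp by simp
      also have "\<dots> = K / sqrt t * ?k x" unfolding t32 using that by (simp add: K_def powr_minus_divide)
      finally show ?thesis .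
    qed
    have sb: "csummable b"
    proof -
      have 1: "csummable (\<lambda>x. sqrt t / (pi * \<beta>) * osc h t x)" by (intro integrable_mult_right csummable_osc h)
      have "csummable (\<lambda>x. if x = 0 then 0 else b x - sqrt t / (pi * \<beta>) * osc h t x)"
        by (rule csummable_bound[OF integrable_mult_right[OF sk, of "K / sqrt t"]]) (use est in auto)
      from Bochner_Integration.integrable_add[OF this 1]
      have "csummable (\<lambda>x. if x = 0 then 0 else b x)"
        by (rule Bochner_Integration.integrable_cong[THEN iffD1, rotated 2]) (auto simp: osc_def)
      moreover have "csummable (\<lambda>x. indicator {0} x *\<^sub>R b 0)" by simp
      ultimately have "csummable (\<lambda>x. (if x = 0 then 0 else b x) + indicator {0} x *\<^sub>R b 0)"
        by (rule Bochner_Integration.integrable_add)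
      then show ?thesis by (rule Bochner_Integration.integrable_cong[THEN iffD1, rotated 2]) auto
    qed
    have "smooth_count h t = csum b" unfolding smooth_count_bessel[OF h t] b_def[abs_def] kap_def by (simp only: integral_mult_right_zero)
    also have "\<dots> = pi * t\<^sup>2 / \<beta> + csum (\<lambda>x. if x = 0 then 0 else b x)"
      by (subst csum_split_zero(1)[OF sb]) (simp add: b_def bessel_int_0)
    finally have "smooth_count h t - pi * t\<^sup>2 / \<beta> - sqrt t / (pi * \<beta>) * csum (osc h t)
       = csum (\<lambda>x. if x = 0 then 0 else b x) - csum (\<lambda>x. sqrt t / (pi * \<beta>) * osc h t x)" by simp
    also have "\<dots> = csum (\<lambda>x. (if x = 0 then 0 else b x) - sqrt t / (pi * \<beta>) * osc h t x)"
      by (intro Bochner_Integration.integral_diff[symmetric] csum_split_zero(2) sb integrable_mult_right csummable_osc h)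
    also have "\<bar>\<dots>\<bar> \<le> csum (\<lambda>x. K / sqrt t * ?k x)"
    proof -
      have "norm (csum (\<lambda>x. (if x = 0 then 0 else b x) - sqrt t / (pi * \<beta>) * osc h t x)) \<le> csum (\<lambda>x. K / sqrt t * ?k x)"
      proof (rule csum_norm_bound)
        show "csummable (\<lambda>x. K / sqrt t * ?k x)" by (intro integrable_mult_right sk)
      qed (use est in \<open>auto simp: osc_def\<close>)
      then show ?thesis by simp
    qed
    also have "\<dots> = K * csum ?k / sqrt t" by (simp only: integral_mult_right_zero) simp
    finally show ?thesis .
  qed
  then show ?thesis by blast
qed

end

section \<open>Sharp against smoothed counts, and lattice points in annuli\<close>

lemma gauss_line:
  fixes a :: real
  assumes s: "s > 0"
  shows "integrable lborel (\<lambda>x. exp (- (pi * s) * (a - x)\<^sup>2))" "(LINT x|lborel. exp (- (pi * s) * (a - x)\<^sup>2)) = 1 / sqrt s"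
proof -
  have i: "integrable lborel (\<lambda>x. complex_of_real (exp (- pi * s * x\<^sup>2)))" "(LINT x|lborel. complex_of_real (exp (- pi * s * x\<^sup>2))) = of_real (1 / sqrt s)"
    using gauss_fourier[OF s, of 0] by simp_all
  have r: "integrable lborel (\<lambda>x. exp (- pi * s * x\<^sup>2))" using i(1) by (subst (asm) complex_of_real_integrable_eq)
  have v: "(LINT x|lborel. exp (- pi * s * x\<^sup>2)) = 1 / sqrt s" using i(2) unfolding integral_complex_of_real of_real_eq_iff .
  show "integrable lborel (\<lambda>x. exp (- (pi * s) * (a - x)\<^sup>2))" using lborel_integrable_real_affine[OF r, of "-1" a] by simp
  show "(LINT x|lborel. exp (- (pi * s) * (a - x)\<^sup>2)) = 1 / sqrt s"
    using lborel_integral_real_affine[of "-1" "\<lambda>x. exp (- pi * s * x\<^sup>2)" a] v by simp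
qed

lemma gauss_plane:
  fixes v :: "real \<times> real"
  assumes s: "s > 0"
  shows "integrable lborel (\<lambda>y. exp (- (pi * s) * (norm (v - y))\<^sup>2))"
    and "(LINT y|lborel. exp (- (pi * s) * (norm (v - y))\<^sup>2)) = 1 / s"
proof -
  note g1 = gauss_line[OF s]
  obtain a b where v: "v = (a, b)" by (cases v)
  have eq: "exp (- (pi * s) * (norm (v - y))\<^sup>2) = exp (- (pi * s) * (a - fst y)\<^sup>2) * exp (- (pi * s) * (b - snd y)\<^sup>2)" for y
    by (cases y) (simp add: v norm_prod_def exp_add[symmetric] distrib_left)
  have meas: "(\<lambda>y. exp (- (pi * s) * (norm (v - y))\<^sup>2)) \<in> borel_measurable (borel :: (real \<times> real) measure)"
    by (intro borel_measurable_continuous_onI continuous_intros)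
  have I: "integrable (lborel \<Otimes>\<^sub>M lborel) (\<lambda>y. exp (- (pi * s) * (norm (v - y))\<^sup>2))"
  proof (rule lborel_pair.Fubini_integrable)
    show "(\<lambda>y. exp (- (pi * s) * (norm (v - y))\<^sup>2)) \<in> borel_measurable (lborel \<Otimes>\<^sub>M lborel)"
      using meas by (simp add: lborel_prod)
  qed (insert g1, simp_all only: eq, simp_all add: abs_mult)
  then show "integrable lborel (\<lambda>y. exp (- (pi * s) * (norm (v - y))\<^sup>2))" by (simp add: lborel_prod)
  have "(LINT y|lborel. exp (- (pi * s) * (norm (v - y))\<^sup>2)) = (LINT x|lborel. LINT y|lborel. exp (- (pi * s) * (norm (v - (x, y)))\<^sup>2))"
    using lborel_pair.integral_fst'[OF I] by (simp add: lborel_prod)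
  also have "\<dots> = 1 / sqrt s * (1 / sqrt s)"
    by (simp only: eq fst_conv snd_conv integral_mult_right_zero integral_mult_left_zero g1(2))
  also have "\<dots> = 1 / s" using s by simp
  finally show "(LINT y|lborel. exp (- (pi * s) * (norm (v - y))\<^sup>2)) = 1 / s" .
qed

text \<open>Used with u = h kap x: the Gaussian factor can be traded for one more power of decay in
  \<open>kap x\<close>, at the price 1/h.\<close>

lemma exp_neg_sq_le: "u > 0 \<Longrightarrow> exp (- pi * u\<^sup>2) \<le> 1 / (u::real)"
proof -
  assume u: "u > 0"
  have "u \<le> 1 + 3 * u\<^sup>2" using zero_le_power2[of "u - 1"] by (simp add: power2_diff) (smt (verit) zero_le_power2)
  also have "\<dots> \<le> 1 + pi * u\<^sup>2" using pi_gt3 by (intro add_left_mono mult_right_mono) auto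
  also have "\<dots> \<le> exp (pi * u\<^sup>2)" by (rule exp_ge_add_one_self)
  finally show ?thesis using u by (simp add: exp_minus field_simps)
qed

context planar
begin

text \<open>Half of the exponent pi / h^2 of the smoothing Gaussian; the other half is spent on
  integrating over the plane.\<close>

definition tail :: "real \<Rightarrow> real \<Rightarrow> int \<times> int \<Rightarrow> real" where
  "tail h r x = exp (- (pi / (2 * h\<^sup>2)) * (nm x - r)\<^sup>2)"

text \<open>A point on the other side of the circle has distance at least |nm x - t| from
  \<open>x\<close>. Half of the Gaussian exponent is estimated by this distance; the other half
  integrates to 2 h^2, to be divided by the normalisation h^2.\<close>

lemma smooth_ind_approx:
  assumes h: "h > 0" and t: "t \<ge> 0"
  shows "\<bar>of_bool (nm x \<le> t) - smooth_ind h t x\<bar> \<le> 2 * tail h t x"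
proof -
  let ?g = "\<lambda>y. exp (- (pi / h\<^sup>2) * (norm (vec x - y))\<^sup>2)"
  let ?G = "\<lambda>y. exp (- (pi / (2 * h\<^sup>2)) * (norm (vec x - y))\<^sup>2)"
  let ?B = "indicator (cball (0::real\<times>real) t) :: _ \<Rightarrow> real"
  have [measurable]: "cball 0 t \<in> sets (borel :: (real \<times> real) measure)" by simp
  have g: "integrable lborel ?g" "(LINT y|lborel. ?g y) = h\<^sup>2" using gauss_plane[of "1 / h\<^sup>2" "vec x"] h by simp_all
  have G: "integrable lborel ?G" "(LINT y|lborel. ?G y) = 2 * h\<^sup>2" using gauss_plane[of "1 / (2 * h\<^sup>2)" "vec x"] h by simp_all
  have iB: "integrable lborel (\<lambda>y. ?B y * ?g y)" by (rule smooth_ind_bounds(2)[OF h t])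
  have split: "?g y \<le> tail h t x * ?G y" if "\<bar>nm x - t\<bar> \<le> norm (vec x - y)" for y
  proof -
    have "(nm x - t)\<^sup>2 \<le> (norm (vec x - y))\<^sup>2" using that by (simp add: abs_le_square_iff[symmetric])
    then have "(pi / (2 * h\<^sup>2)) * (nm x - t)\<^sup>2 + (pi / (2 * h\<^sup>2)) * (norm (vec x - y))\<^sup>2 \<le> (pi / (2 * h\<^sup>2)) * (norm (vec x - y))\<^sup>2 + (pi / (2 * h\<^sup>2)) * (norm (vec x - y))\<^sup>2"
      by (intro add_right_mono mult_left_mono) auto
    also have "\<dots> = (pi / h\<^sup>2) * (norm (vec x - y))\<^sup>2" using h by (simp add: field_simps)
    finally show ?thesis by (simp add: tail_def exp_add[symmetric])
  qed
  have iG: "integrable lborel (\<lambda>y. tail h t x * ?G y)" using G(1) by simp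
  have vG: "(LINT y|lborel. tail h t x * ?G y) = 2 * h\<^sup>2 * tail h t x" using G(2) by simp
  show ?thesis
  proof (cases "nm x \<le> t")
    case False
    have "(LINT y|lborel. ?B y * ?g y) \<le> (LINT y|lborel. tail h t x * ?G y)"
    proof (rule Bochner_Integration.integral_mono[OF iB iG])
      fix y :: "real \<times> real"
      have "\<bar>nm x - t\<bar> \<le> norm (vec x - y)" if "norm y \<le> t"
        using that False norm_triangle_ineq2[of "vec x" y] by (simp add: nm_def)
      then show "?B y * ?g y \<le> tail h t x * ?G y" using split[of y] by (auto simp: tail_def split: split_indicator)
    qed
    then have "smooth_ind h t x \<le> 2 * tail h t x" unfolding smooth_ind_def vG using h by (simp add: field_simps)
    then show ?thesis using False smooth_ind_bounds(1)[OF h t, of x] by simp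
  next
    case True
    have d: "h\<^sup>2 - (LINT y|lborel. ?B y * ?g y) = (LINT y|lborel. ?g y - ?B y * ?g y)" using g iB by simp
    have "(LINT y|lborel. ?g y - ?B y * ?g y) \<le> (LINT y|lborel. tail h t x * ?G y)"
    proof (rule Bochner_Integration.integral_mono[OF _ iG])
      fix y :: "real \<times> real"
      have "\<bar>nm x - t\<bar> \<le> norm (vec x - y)" if "\<not> norm y \<le> t"
        using that True norm_triangle_ineq2[of y "vec x"] by (simp add: nm_def norm_minus_commute)
      then show "?g y - ?B y * ?g y \<le> tail h t x * ?G y" using split[of y] by (auto simp: tail_def split: split_indicator)
    qed (use g iB in simp)
    moreover have "(LINT y|lborel. ?g y - ?B y * ?g y) \<ge> 0" by (intro integral_nonneg_AE AE_I2) (auto split: split_indicator)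
    ultimately have "0 \<le> h\<^sup>2 - (LINT y|lborel. ?B y * ?g y)" "h\<^sup>2 - (LINT y|lborel. ?B y * ?g y) \<le> 2 * h\<^sup>2 * tail h t x"
      unfolding d vG by auto
    then have "0 \<le> 1 - smooth_ind h t x" "1 - smooth_ind h t x \<le> 2 * tail h t x"
      unfolding smooth_ind_def using h by (simp_all add: field_simps)
    then show ?thesis using True by simp
  qed
qed

lemma finite_nm_le: "finite {x. nm x \<le> t}"
proof (rule finite_subset)
  let ?n = "\<lfloor>t / lc\<rfloor>"
  show "{x. nm x \<le> t} \<subseteq> {- ?n..?n} \<times> {- ?n..?n}"
  proof (clarify, unfold mem_Times_iff fst_conv snd_conv atLeastAtMost_iff)
    fix a b assume "nm (a, b) \<le> t"
    then have "lc * (\<bar>of_int a\<bar> + \<bar>of_int b\<bar>) \<le> t" using nm_lower[of "(a, b)"] by simp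
    then have "\<bar>of_int a\<bar> + \<bar>of_int b\<bar> \<le> t / lc" using lc_pos by (simp add: field_simps)
    then have "of_int \<bar>a\<bar> \<le> t / lc" "of_int \<bar>b\<bar> \<le> t / lc" by linarith+
    then have "\<bar>a\<bar> \<le> ?n" "\<bar>b\<bar> \<le> ?n" by (simp_all only: le_floor_iff)
    then show "(- ?n \<le> a \<and> a \<le> ?n) \<and> - ?n \<le> b \<and> b \<le> ?n" by auto
  qed
qed auto

definition cnt :: "real \<Rightarrow> real" where "cnt t = real (card {x. nm x \<le> t})"

lemma csum_of_bool: "finite {x. P x} \<Longrightarrow> csum (\<lambda>x. of_bool (P x)) = real (card {x. P x})"
  "finite {x. P x} \<Longrightarrow> csummable (\<lambda>x. of_bool (P x) :: real)"
proof -
  assume f: "finite {x. P x}"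
  have eq: "(\<lambda>x. of_bool (P x) :: real) = indicator {x. P x}" by (auto simp: fun_eq_iff)
  show "csummable (\<lambda>x. of_bool (P x) :: real)"
    unfolding eq using f by (intro integrable_real_indicator) (auto simp: emeasure_count_space_finite of_nat_less_top)
  show "csum (\<lambda>x. of_bool (P x)) = real (card {x. P x})" unfolding eq using f by (simp add: measure_count_space)
qed

lemma csummable_tail:
  assumes "h > 0"
  shows "csummable (tail h r)"
proof (rule csummable_bound)
  let ?c = "pi / (2 * h\<^sup>2)"
  show "csummable (\<lambda>x. exp (?c * \<bar>r\<bar>\<^sup>2) * gbound (?c / 2) x)"
    using assms by (intro integrable_mult_right csummable_gbound) auto
  show "norm (tail h r x) \<le> exp (?c * \<bar>r\<bar>\<^sup>2) * gbound (?c / 2) x" for x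
    using gauss_shift_bound[of ?c "-r" "\<bar>r\<bar>" "nm x"] assms by (simp add: tail_def gbound_def)
qed

lemma cnt_smooth_diff:
  assumes h: "h > 0" and t: "t \<ge> 0"
  shows "\<bar>cnt t - smooth_count h t\<bar> \<le> 2 * csum (tail h t)"
proof -
  have "cnt t - smooth_count h t = csum (\<lambda>x. of_bool (nm x \<le> t) - smooth_ind h t x)"
    unfolding cnt_def smooth_count_def csum_of_bool(1)[OF finite_nm_le, symmetric]
    by (intro Bochner_Integration.integral_diff[symmetric] csum_of_bool(2)[OF finite_nm_le] csummable_smooth_ind h t)
  also have "norm \<dots> \<le> csum (\<lambda>x. 2 * tail h t x)"
    using smooth_ind_approx[OF h t] by (intro csum_norm_bound integrable_mult_right csummable_tail h) auto
  finally show ?thesis by simp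
qed

text \<open>The decay kap^(-3/2) is not summable over the plane. Trading the Gaussian factor for 1 /
  (h kap) lifts the exponent to 5/2, which is the origin of the 1/h.\<close>

lemma smooth_count_bound:
  "\<exists>C\<ge>0. \<forall>h t. 0 < h \<longrightarrow> h \<le> 1 \<longrightarrow> 1 \<le> t \<longrightarrow> \<bar>smooth_count h t - pi * t\<^sup>2 / \<beta>\<bar> \<le> C * sqrt t / h"
proof -
  obtain C where C: "\<And>h t. h > 0 \<Longrightarrow> t > 0 \<Longrightarrow> \<bar>smooth_count h t - pi * t\<^sup>2 / \<beta> - sqrt t / (pi * \<beta>) * csum (osc h t)\<bar> \<le> C / sqrt t"
    using smooth_count_asymptotics by blast
  let ?k = "\<lambda>x. if x = 0 then 0 else kap x powr (- (5/2))"
  have sk: "csummable ?k" by (rule csummable_kap_powr) simp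
  have kpos: "csum ?k \<ge> 0" by (intro integral_nonneg_AE AE_I2) auto
  define D where "D = csum ?k / (pi * \<beta>) + \<bar>C\<bar>"
  have "\<bar>smooth_count h t - pi * t\<^sup>2 / \<beta>\<bar> \<le> D * sqrt t / h" if h: "0 < h" "h \<le> 1" and t: "1 \<le> t" for h t
  proof -
    have "norm (osc h t x) \<le> 1 / h * ?k x" for x
    proof (cases "x = 0")
      case False
      have k: "kap x > 0" by (rule kap_pos[OF False])
      have "exp (- pi * h\<^sup>2 * (kap x)\<^sup>2) \<le> 1 / (h * kap x)"
        using exp_neg_sq_le[of "h * kap x"] h k by (simp add: power_mult_distrib mult.assoc)
      then have "exp (- pi * h\<^sup>2 * (kap x)\<^sup>2) * kap x powr (-3/2) * \<bar>sin (2 * pi * t * kap x - pi/4)\<bar> \<le> 1 / (h * kap x) * kap x powr (-3/2) * 1"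
        using h k by (intro mult_mono) auto
      also have "\<dots> = 1 / h * (kap x powr (-3/2) / kap x powr 1)" using k by simp
      also have "kap x powr (-3/2) / kap x powr 1 = kap x powr (- (5/2))" unfolding powr_diff[symmetric] by simp
      finally show ?thesis using False by (simp add: osc_def abs_mult)
    qed (simp add: osc_def)
    then have "norm (csum (osc h t)) \<le> csum (\<lambda>x. 1 / h * ?k x)" by (intro csum_norm_bound integrable_mult_right sk)
    then have "\<bar>csum (osc h t)\<bar> \<le> 1 / h * csum ?k" by (simp only: integral_mult_right_zero real_norm_def)
    then have "\<bar>sqrt t / (pi * \<beta>) * csum (osc h t)\<bar> \<le> sqrt t / (pi * \<beta>) * (1 / h * csum ?k)"
      using beta_pos t by (simp only: abs_mult) (intro mult_mono, auto)
    also have "\<dots> = csum ?k / (pi * \<beta>) * sqrt t / h" by simp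
    finally have 1: "\<bar>sqrt t / (pi * \<beta>) * csum (osc h t)\<bar> \<le> csum ?k / (pi * \<beta>) * sqrt t / h" .
    have "1 \<le> sqrt t" using t by simp
    then have "1 * 1 \<le> sqrt t * sqrt t" by (intro mult_mono) auto
    then have "1 / sqrt t \<le> sqrt t" using \<open>1 \<le> sqrt t\<close> by (simp add: field_simps)
    also have "sqrt t \<le> sqrt t / h" using h t by (simp add: field_simps)
    finally have "\<bar>C\<bar> * (1 / sqrt t) \<le> \<bar>C\<bar> * (sqrt t / h)" by (intro mult_left_mono) auto
    moreover have "C / sqrt t \<le> \<bar>C\<bar> * (1 / sqrt t)" using t by (simp add: divide_right_mono)
    ultimately have "C / sqrt t \<le> \<bar>C\<bar> * sqrt t / h" by simp
    then have "\<bar>smooth_count h t - pi * t\<^sup>2 / \<beta>\<bar> \<le> csum ?k / (pi * \<beta>) * sqrt t / h + \<bar>C\<bar> * sqrt t / h"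
      using 1 C[OF h(1), of t] t by linarith
    then show ?thesis by (simp add: D_def ring_distribs add_divide_distrib)
  qed
  moreover have "D \<ge> 0" using kpos beta_pos by (simp add: D_def)
  ultimately show ?thesis by blast
qed

text \<open>The annulus is covered by the difference of two smoothed discs whose radii leave an
  extra margin 2h. The main terms differ by the area of a slightly larger annulus, and the two
  smoothing errors give sqrt (r + 1) / h. Only smoothed counts enter, so there is no circularity
  with the sharp count.\<close>

lemma shell_card:
  "\<exists>C\<ge>0. \<forall>v h r. 1 \<le> v \<longrightarrow> 0 < h \<longrightarrow> h \<le> 1 \<longrightarrow> 0 \<le> r \<longrightarrow>
     real (card {x. \<bar>nm x - r\<bar> \<le> v * h}) \<le> C * v\<^sup>2 * ((r + 1) * h + sqrt (r + 1) / h)"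
proof -
  obtain C where C: "C \<ge> 0" "\<And>h t. 0 < h \<Longrightarrow> h \<le> 1 \<Longrightarrow> 1 \<le> t \<Longrightarrow> \<bar>smooth_count h t - pi * t\<^sup>2 / \<beta>\<bar> \<le> C * sqrt t / h"
    using smooth_count_bound by blast
  \<comment> \<open>At distance 2h from the circle the tail is exp (- 2 pi). Smoothed indicators are
    then within 1/8 of the sharp ones, so on the annulus their difference is at least 3/4, and
    doubling it gives at least 1.\<close>
  have tail2: "2 * exp (- (2 * pi)) \<le> 1 / 8"
  proof -
    have "4 \<le> exp pi" using pi_gt3 exp_ge_add_one_self[of pi] by linarith
    then have "4 * 4 \<le> exp pi * exp pi" by (intro mult_mono) auto
    then have "16 \<le> exp (2 * pi)" by (simp flip: exp_add)
    then show ?thesis by (simp add: exp_minus field_simps)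
  qed
  have in1: "smooth_ind h R x \<ge> 7 / 8" if "h > 0" "nm x + 2 * h \<le> R" for h R x
  proof -
    have "(2 * h)\<^sup>2 \<le> (nm x - R)\<^sup>2" using that by (subst power2_commute, intro power_mono) auto
    then have "(pi / (2 * h\<^sup>2)) * (2 * h)\<^sup>2 \<le> (pi / (2 * h\<^sup>2)) * (nm x - R)\<^sup>2" by (intro mult_left_mono) auto
    then have "2 * pi \<le> (pi / (2 * h\<^sup>2)) * (nm x - R)\<^sup>2" using that by (simp add: power2_eq_square)
    then have "tail h R x \<le> exp (- (2 * pi))" by (simp add: tail_def)
    moreover have "R \<ge> 0" "nm x \<le> R" using that nm_nonneg[of x] by linarith+
    ultimately show ?thesis using smooth_ind_approx[of h R x] that tail2 by simp
  qed
  have out1: "smooth_ind h R x \<le> 1 / 8" if "h > 0" "R + 2 * h \<le> nm x" "R \<ge> 0" for h R x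
  proof -
    have "(2 * h)\<^sup>2 \<le> (nm x - R)\<^sup>2" using that by (intro power_mono) auto
    then have "(pi / (2 * h\<^sup>2)) * (2 * h)\<^sup>2 \<le> (pi / (2 * h\<^sup>2)) * (nm x - R)\<^sup>2" by (intro mult_left_mono) auto
    then have "2 * pi \<le> (pi / (2 * h\<^sup>2)) * (nm x - R)\<^sup>2" using that by (simp add: power2_eq_square)
    then have "tail h R x \<le> exp (- (2 * pi))" by (simp add: tail_def)
    moreover have "\<not> nm x \<le> R" using that by linarith
    ultimately show ?thesis using smooth_ind_approx[of h R x] that tail2 by simp
  qed
  have mono: "smooth_ind h R' x \<le> smooth_ind h R x" if "h > 0" "0 \<le> R'" "R' \<le> R" for h R R' x
    unfolding smooth_ind_def using that
    by (intro divide_right_mono Bochner_Integration.integral_mono smooth_ind_bounds(2) mult_right_mono) (auto split: split_indicator)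
  define D where "D = max (4 * (pi / \<beta> * 12 + 4 * C)) (4 * (pi / \<beta> * 64 + 3 * C))"
  have pb: "0 \<le> pi / \<beta> * 12" "0 \<le> pi / \<beta> * 64" using beta_pos by simp_all
  have D1: "4 * (pi / \<beta> * 12 + 4 * C) \<le> D" and D2: "4 * (pi / \<beta> * 64 + 3 * C) \<le> D" by (auto simp: D_def)
  have gen: "0 \<le> E \<and> 2 * u \<le> E \<and> 2 * (k * c) \<le> E \<and> 2 * (u + k * c) \<le> E" if "0 \<le> u" "0 \<le> k * c" "4 * (u + k * c) \<le> E" for u k c E :: real
    using that by (intro conjI; argo)
  have add2: "2 * (a + b) \<le> 2 * (a' + b')" if "a \<le> a'" "b \<le> b'" for a b a' b' :: real using that by simp
  have D0: "D \<ge> 0" using gen[OF pb(1) _ D1] C(1) by simp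
  have "real (card {x. \<bar>nm x - r\<bar> \<le> v * h}) \<le> D * v\<^sup>2 * ((r + 1) * h + sqrt (r + 1) / h)"
    if v: "1 \<le> v" and h: "0 < h" "h \<le> 1" and r: "0 \<le> r" for v h r
  proof -
    have fin: "finite {x. \<bar>nm x - r\<bar> \<le> v * h}" by (rule finite_subset[OF _ finite_nm_le[of "r + v * h"]]) auto
    have vh: "h \<le> v" "v * h \<le> v" "h \<le> v * h" using v h mult_left_mono[of h 1 v] mult_right_mono[of 1 v h] by auto
    have B0: "(r + 1) * h + sqrt (r + 1) / h \<ge> 0" using r h by (intro add_nonneg_nonneg) auto
    show ?thesis
    \<comment> \<open>The bound for smoothed counts needs radius at least 1. If the inner radius is
      smaller, then r is below a multiple of v, and the single disc of radius at most 8v that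
      contains the annulus is small enough.\<close>
    proof (cases "r - (v + 2) * h \<ge> 1")
      case True
      define R R' where "R = r + (v + 2) * h" and "R' = r - (v + 2) * h"
      have "(v + 2) * h \<ge> 0" using v h by simp
      then have R: "R \<ge> 1" "R' \<ge> 1" "R' \<le> R" using True unfolding R_def R'_def by linarith+
      have "csum (\<lambda>x. of_bool (\<bar>nm x - r\<bar> \<le> v * h)) \<le> csum (\<lambda>x. 2 * (smooth_ind h R x - smooth_ind h R' x))"
      proof (rule Bochner_Integration.integral_mono)
        show "csummable (\<lambda>x. 2 * (smooth_ind h R x - smooth_ind h R' x))"
          using h R by (intro integrable_mult_right Bochner_Integration.integrable_diff csummable_smooth_ind) auto
        fix x
        show "of_bool (\<bar>nm x - r\<bar> \<le> v * h) \<le> 2 * (smooth_ind h R x - smooth_ind h R' x)"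
        proof (cases "\<bar>nm x - r\<bar> \<le> v * h")
          case xin: True
          have "nm x + 2 * h \<le> R" "R' + 2 * h \<le> nm x" using xin by (auto simp: R_def R'_def ring_distribs abs_le_iff)
          then show ?thesis using in1[of h x R] out1[of h R' x] h R xin by simp
        next
          case False
          then show ?thesis using mono[of h R' R x] h R by simp
        qed
      qed (rule csum_of_bool(2)[OF fin])
      then have "real (card {x. \<bar>nm x - r\<bar> \<le> v * h}) \<le> 2 * (smooth_count h R - smooth_count h R')"
        unfolding csum_of_bool(1)[OF fin] smooth_count_def using csummable_smooth_ind[of h R] csummable_smooth_ind[of h R'] h R by simp
      also have "\<dots> \<le> 2 * ((pi * R\<^sup>2 / \<beta> + C * sqrt R / h) - (pi * R'\<^sup>2 / \<beta> - C * sqrt R' / h))"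
      proof (intro mult_left_mono diff_mono)
        show "smooth_count h R \<le> pi * R\<^sup>2 / \<beta> + C * sqrt R / h" using abs_le_D1[OF C(2)[OF h R(1)]] by simp
        show "pi * R'\<^sup>2 / \<beta> - C * sqrt R' / h \<le> smooth_count h R'" using abs_le_D2[OF C(2)[OF h R(2)]] by simp
      qed simp
      also have "\<dots> = 2 * (pi / \<beta> * (R\<^sup>2 - R'\<^sup>2) + C * (sqrt R + sqrt R') / h)"
        by (simp add: ring_distribs add_divide_distrib diff_divide_distrib)
      also have "R\<^sup>2 - R'\<^sup>2 = 4 * r * (v + 2) * h" by (simp add: R_def R'_def power2_eq_square algebra_simps)
      also have "2 * (pi / \<beta> * (4 * r * (v + 2) * h) + C * (sqrt R + sqrt R') / h) \<le> 2 * (pi / \<beta> * (12 * v\<^sup>2 * ((r + 1) * h)) + C * (4 * v\<^sup>2 * sqrt (r + 1)) / h)"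
      proof -
        have "v \<le> v * v" using mult_left_mono[of 1 v v] v by simp
        then have v2: "v + 2 \<le> 3 * v\<^sup>2" "v \<le> v\<^sup>2" using v unfolding power2_eq_square by linarith+
        have "4 * (r * (v + 2)) * h \<le> 4 * ((r + 1) * (3 * v\<^sup>2)) * h" using v2 r h v by (intro mult_mono) auto
        then have 1: "4 * r * (v + 2) * h \<le> 12 * v\<^sup>2 * ((r + 1) * h)" by (simp add: mult_ac)
        have "(v + 2) * h = v * h + 2 * h" by (simp add: algebra_simps)
        then have "R \<le> r + 3 * v" using vh unfolding R_def by linarith
        also have "\<dots> \<le> (2 * v)\<^sup>2 * (r + 1)"
        proof -
          have "3 * v \<le> 4 * v\<^sup>2" "1 \<le> 4 * v\<^sup>2" using v v2 by linarith+
          moreover from this have "r * 1 \<le> r * (4 * v\<^sup>2)" using r by (intro mult_left_mono) auto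
          ultimately show ?thesis by (simp add: power_mult_distrib algebra_simps)
        qed
        finally have "sqrt R \<le> sqrt ((2 * v)\<^sup>2 * (r + 1))" by (rule real_sqrt_le_mono)
        also have "\<dots> = 2 * v * sqrt (r + 1)" using v by (simp add: real_sqrt_mult)
        also have "\<dots> \<le> 2 * v\<^sup>2 * sqrt (r + 1)" using v2 r by (intro mult_right_mono) auto
        finally have s1: "sqrt R \<le> 2 * v\<^sup>2 * sqrt (r + 1)" .
        moreover have "sqrt R' \<le> sqrt R" using R by simp
        ultimately have "sqrt R + sqrt R' \<le> 4 * v\<^sup>2 * sqrt (r + 1)" by linarith
        then have "C * (sqrt R + sqrt R') / h \<le> C * (4 * v\<^sup>2 * sqrt (r + 1)) / h"
          using C(1) h by (intro divide_right_mono mult_left_mono) auto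
        moreover have "pi / \<beta> * (4 * r * (v + 2) * h) \<le> pi / \<beta> * (12 * v\<^sup>2 * ((r + 1) * h))"
          using 1 beta_pos by (intro mult_left_mono) auto
        ultimately show ?thesis using add2 by blast
      qed
      also have "\<dots> = 2 * (pi / \<beta> * 12) * v\<^sup>2 * ((r + 1) * h) + 2 * (4 * C) * v\<^sup>2 * (sqrt (r + 1) / h)"
        by (simp add: algebra_simps add_divide_distrib)
      also have "\<dots> \<le> D * v\<^sup>2 * ((r + 1) * h) + D * v\<^sup>2 * (sqrt (r + 1) / h)"
      proof -
        have "0 \<le> 4 * C" using C(1) by simp
        then have "2 * (pi / \<beta> * 12) \<le> D" "2 * (4 * C) \<le> D" using gen[OF pb(1) _ D1] by blast+
        then show ?thesis using r h by (intro add_mono mult_right_mono) auto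
      qed
      finally show ?thesis by (simp add: distrib_left)
    next
      case False
      define R where "R = r + (v + 2) * h + 1"
      have "(v + 2) * h = v * h + 2 * h" by (simp add: algebra_simps)
      then have "(v + 2) * h \<le> 3 * v" using vh by linarith
      moreover have "(v + 2) * h \<ge> 0" using v h by simp
      ultimately have R: "R \<ge> 1" "R \<le> 8 * v" using False v r unfolding R_def by linarith+
      have "csum (\<lambda>x. of_bool (\<bar>nm x - r\<bar> \<le> v * h)) \<le> csum (\<lambda>x. 2 * smooth_ind h R x)"
      proof (rule Bochner_Integration.integral_mono)
        show "csummable (\<lambda>x. 2 * smooth_ind h R x)" using h R by (intro integrable_mult_right csummable_smooth_ind) auto
        fix x
        show "of_bool (\<bar>nm x - r\<bar> \<le> v * h) \<le> 2 * smooth_ind h R x"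
        proof (cases "\<bar>nm x - r\<bar> \<le> v * h")
          case xin: True
          have "nm x + 2 * h \<le> R" using xin by (auto simp: R_def ring_distribs abs_le_iff)
          then show ?thesis using in1[of h x R] h xin by simp
        next
          case False
          then show ?thesis using smooth_ind_bounds(1)[of h R x] h R by simp
        qed
      qed (rule csum_of_bool(2)[OF fin])
      then have "real (card {x. \<bar>nm x - r\<bar> \<le> v * h}) \<le> 2 * smooth_count h R"
        unfolding csum_of_bool(1)[OF fin] smooth_count_def by simp
      also have "\<dots> \<le> 2 * (pi / \<beta> * R\<^sup>2 + C * sqrt R / h)" using C(2)[of h R] h R by (simp add: abs_le_iff)
      also have "\<dots> \<le> 2 * (pi / \<beta> * (64 * v\<^sup>2 / h) + C * (3 * v\<^sup>2) / h)"
      proof -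
        have "R\<^sup>2 \<le> (8 * v)\<^sup>2" using R by (intro power_mono) auto
        also have "\<dots> = 64 * v\<^sup>2" by (simp add: power_mult_distrib)
        also have "\<dots> \<le> 64 * v\<^sup>2 / h" using h mult_right_mono[of h 1 "v\<^sup>2"] by (simp add: field_simps)
        finally have "pi / \<beta> * R\<^sup>2 \<le> pi / \<beta> * (64 * v\<^sup>2 / h)" using beta_pos by (intro mult_left_mono) auto
        moreover have "sqrt R \<le> 3 * v\<^sup>2"
        proof (rule real_le_lsqrt)
          have "v \<le> v\<^sup>2" using mult_left_mono[of 1 v v] v by (simp add: power2_eq_square)
          moreover from this have "1 \<le> v\<^sup>2" using v by linarith
          then have "v\<^sup>2 \<le> v\<^sup>2 * v\<^sup>2" using mult_left_mono[of 1 "v\<^sup>2" "v\<^sup>2"] by simp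
          moreover have "(3 * v\<^sup>2)\<^sup>2 = 9 * (v\<^sup>2 * v\<^sup>2)" by (simp add: power2_eq_square)
          ultimately show "R \<le> (3 * v\<^sup>2)\<^sup>2" using R(2) v by linarith
        qed (use R in auto)
        then have "C * sqrt R / h \<le> C * (3 * v\<^sup>2) / h" using C(1) h by (intro divide_right_mono mult_left_mono) auto
        ultimately show ?thesis using add2 by blast
      qed
      also have "\<dots> = 2 * (pi / \<beta> * 64 + 3 * C) * v\<^sup>2 * (1 / h)" by (simp add: algebra_simps add_divide_distrib)
      also have "\<dots> \<le> D * v\<^sup>2 * ((r + 1) * h + sqrt (r + 1) / h)"
      proof (intro mult_mono)
        show "2 * (pi / \<beta> * 64 + 3 * C) \<le> D" using gen[OF pb(2) _ D2] C(1) by simp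
        show "0 \<le> D" "0 \<le> D * v\<^sup>2" using D0 by auto
        have "1 / h \<le> sqrt (r + 1) / h" using r h by (intro divide_right_mono) auto
        also have "\<dots> \<le> (r + 1) * h + sqrt (r + 1) / h" using r h by simp
        finally show "1 / h \<le> (r + 1) * h + sqrt (r + 1) / h" .
      qed (use h in auto)
      finally show ?thesis .
    qed
  qed
  then show ?thesis using D0 by blast
qed

lemma tail_mono: "0 < h \<Longrightarrow> h \<le> h' \<Longrightarrow> tail h r x \<le> tail h' r x"
  unfolding tail_def by (auto intro!: divide_left_mono mult_right_mono power_mono)

lemma csum_tail_mono: "0 < h \<Longrightarrow> h \<le> h' \<Longrightarrow> csum (tail h r) \<le> csum (tail h' r)"
  by (intro Bochner_Integration.integral_mono csummable_tail tail_mono) auto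

text \<open>Cutting the plane into shells of width \<open>h\<close> around the circle: on the j-th
  shell the tail is at most exp (- (pi/2) j^2), while the number of points within (j + 1) h grows
  only by the factor (j + 1)^2.\<close>

lemma csum_tail_bound:
  "\<exists>C\<ge>0. \<forall>h r. 0 < h \<longrightarrow> h \<le> 1 \<longrightarrow> 0 \<le> r \<longrightarrow> csum (tail h r) \<le> C * ((r + 1) * h + sqrt (r + 1) / h)"
proof -
  obtain C where C: "C \<ge> 0" "\<And>v h r. 1 \<le> v \<Longrightarrow> 0 < h \<Longrightarrow> h \<le> 1 \<Longrightarrow> 0 \<le> r \<Longrightarrow>
     real (card {x. \<bar>nm x - r\<bar> \<le> v * h}) \<le> C * v\<^sup>2 * ((r + 1) * h + sqrt (r + 1) / h)" using shell_card by blast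
  define e :: "nat \<Rightarrow> real" where "e j = exp (- (1/2)) ^ j" for j
  have se: "csummable e" unfolding e_def by (subst integrable_count_space_nat_iff) (auto intro!: summable_geometric)
  have "csum (tail h r) \<le> (4 * C * csum e) * ((r + 1) * h + sqrt (r + 1) / h)" if h: "0 < h" "h \<le> 1" and r: "0 \<le> r" for h r
  proof -
    define B where "B = (r + 1) * h + sqrt (r + 1) / h"
    have B0: "B \<ge> 0" using r h unfolding B_def by (intro add_nonneg_nonneg) auto
    define p where "p j = exp (- (pi / 2) * (real j)\<^sup>2)" for j :: nat
    define F where "F = (\<lambda>(j::nat, x). p j * of_bool (\<bar>nm x - r\<bar> \<le> (real j + 1) * h))"
    have fin: "finite {x. \<bar>nm x - r\<bar> \<le> (real j + 1) * h}" for j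
      by (rule finite_subset[OF _ finite_nm_le[of "r + (real j + 1) * h"]]) auto
    have inner: "csum (\<lambda>x. F (j, x)) = p j * real (card {x. \<bar>nm x - r\<bar> \<le> (real j + 1) * h})" for j
      unfolding F_def using csum_of_bool(1)[OF fin] by simp
    have inner_le: "csum (\<lambda>x. F (j, x)) \<le> 4 * C * B * e j" for j
    proof -
      have "exp (- (pi / 2) * (real j)\<^sup>2) \<le> exp (- (3 / 2) * real j)"
      proof -
        have "3 / 2 * real j \<le> pi / 2 * real j" using pi_gt3 by (intro mult_right_mono) auto
        also have "\<dots> \<le> pi / 2 * (real j)\<^sup>2" by (intro mult_left_mono) (auto simp: power2_eq_square simp flip: of_nat_mult)
        finally show ?thesis by simp
      qed
      moreover have "(real j + 1)\<^sup>2 \<le> 4 * exp (real j)"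
      proof -
        have "(real j + 1) / 2 \<le> exp (real j / 2)" using exp_ge_add_one_self[of "real j / 2"] by (simp add: field_simps)
        then have "((real j + 1) / 2)\<^sup>2 \<le> (exp (real j / 2))\<^sup>2" by (intro power_mono) auto
        also have "\<dots> = exp (real j)" by (simp add: power2_eq_square flip: exp_add)
        finally show ?thesis by (simp add: power_divide)
      qed
      ultimately have "p j * (real j + 1)\<^sup>2 \<le> exp (- (3 / 2) * real j) * (4 * exp (real j))"
        unfolding p_def by (intro mult_mono) auto
      also have "\<dots> = 4 * exp (real j * (- (1/2)))" by (simp flip: exp_add)
      also have "\<dots> = 4 * e j" unfolding e_def by (simp only: exp_of_nat_mult)
      finally have pj: "p j * (real j + 1)\<^sup>2 \<le> 4 * e j" .
      have "csum (\<lambda>x. F (j, x)) \<le> p j * (C * (real j + 1)\<^sup>2 * B)"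
        unfolding inner B_def by (intro mult_left_mono C(2) h r) (auto simp: p_def)
      also have "\<dots> = C * B * (p j * (real j + 1)\<^sup>2)" by simp
      also have "\<dots> \<le> C * B * (4 * e j)" using pj C(1) B0 by (intro mult_left_mono) auto
      finally show ?thesis by simp
    qed
    have inner_s: "csummable (\<lambda>x. F (j, x))" for j unfolding F_def using csum_of_bool(2)[OF fin] by simp
    have Fn: "norm (F y) = F y" for y by (auto simp: F_def p_def split: prod.splits)
    have inn0: "csum (\<lambda>x. F (j, x)) \<ge> 0" for j using Fn by (intro integral_nonneg_AE AE_I2) (metis norm_ge_zero)
    have sF: "csummable F"
    proof (rule csummable_Sigma)
      show "csummable (\<lambda>j. csum (\<lambda>x. norm (F (j, x))))" unfolding Fn
        by (rule csummable_bound[OF integrable_mult_right[OF se, of "4 * C * B"]]) (use inner_le inn0 in auto)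
    qed (rule inner_s)
    have sF': "csummable (\<lambda>(x, j). F (j, x))"
      using csummable_reindex_bij[of prod.swap F] sF by (simp add: bij_swap case_prod_unfold prod.swap_def)
    have "csum (tail h r) \<le> csum (\<lambda>x. csum (\<lambda>j. F (j, x)))"
    proof (rule Bochner_Integration.integral_mono)
      show "csummable (tail h r)" by (rule csummable_tail[OF h(1)])
      show "csummable (\<lambda>x. csum (\<lambda>j. F (j, x)))" using csum_Sigma(3)[OF sF'] by simp
      fix x
      \<comment> \<open>The shell that contains \<open>x\<close>; this single term of the sum over
        shells already dominates the tail at \<open>x\<close>.\<close>
      define j0 where "j0 = nat \<lfloor>\<bar>nm x - r\<bar> / h\<rfloor>"
      have q: "\<bar>nm x - r\<bar> / h \<ge> 0" using h by simp
      have j0: "real j0 \<le> \<bar>nm x - r\<bar> / h" "\<bar>nm x - r\<bar> / h \<le> real j0 + 1"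
        using q unfolding j0_def by (simp_all add: le_nat_floor)
      have sj: "csummable (\<lambda>j. F (j, x))"
      proof (rule csummable_bound[OF se])
        fix j
        have "exp (- (pi / 2) * (real j)\<^sup>2) \<le> exp (real j * (- (1/2)))"
        proof -
          have "1 / 2 * real j \<le> pi / 2 * real j" using pi_gt3 by (intro mult_right_mono) auto
          also have "\<dots> \<le> pi / 2 * (real j)\<^sup>2" by (intro mult_left_mono) (auto simp: power2_eq_square simp flip: of_nat_mult)
          finally show ?thesis by simp
        qed
        also have "\<dots> = e j" unfolding e_def by (simp only: exp_of_nat_mult)
        finally show "norm (F (j, x)) \<le> e j" by (auto simp: F_def p_def e_def)
      qed
      have "tail h r x \<le> F (j0, x)"
      proof -
        have "(real j0)\<^sup>2 \<le> (\<bar>nm x - r\<bar> / h)\<^sup>2" using j0(1) by (intro power_mono) auto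
        then have "pi / 2 * (real j0)\<^sup>2 \<le> pi / 2 * ((nm x - r)\<^sup>2 / h\<^sup>2)" by (intro mult_left_mono) (auto simp: power_divide)
        then have "tail h r x \<le> p j0" by (simp add: tail_def p_def)
        moreover have "\<bar>nm x - r\<bar> \<le> (real j0 + 1) * h" using j0(2) h by (simp add: field_simps)
        ultimately show ?thesis by (simp add: F_def)
      qed
      also have "\<dots> = csum (\<lambda>j. indicator {j0} j *\<^sub>R F (j0, x))" by simp
      also have "\<dots> \<le> csum (\<lambda>j. F (j, x))"
      proof (rule Bochner_Integration.integral_mono[OF _ sj])
        fix j show "indicator {j0} j *\<^sub>R F (j0, x) \<le> F (j, x)"
          using norm_ge_zero[of "F (j, x)"] unfolding Fn by (auto split: split_indicator)
      qed simp
      finally show "tail h r x \<le> csum (\<lambda>j. F (j, x))" .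
    qed
    also have "\<dots> = csum (\<lambda>j. csum (\<lambda>x. F (j, x)))" using csum_Sigma(1,2)[OF sF] by simp
    also have "\<dots> \<le> csum (\<lambda>j. 4 * C * B * e j)"
      by (intro Bochner_Integration.integral_mono inner_le csum_Sigma(3)[OF sF] integrable_mult_right se)
    also have "\<dots> = (4 * C * csum e) * B" by (simp add: integral_mult_right_zero)
    finally show ?thesis unfolding B_def .
  qed
  moreover have "4 * C * csum e \<ge> 0" using C(1) by (intro mult_nonneg_nonneg integral_nonneg_AE AE_I2) (auto simp: e_def)
  ultimately show ?thesis by blast
qed

text \<open>Tails increase with the width, so \<open>h\<close> may be replaced by 1. This removes
  the blow-up 1/h for very small \<open>h\<close>.\<close>

lemma csum_tail_linear: "\<exists>C\<ge>0. \<forall>h r. 0 < h \<longrightarrow> h \<le> 1 \<longrightarrow> 0 \<le> r \<longrightarrow> csum (tail h r) \<le> C * (r + 1)"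
proof -
  obtain C where C: "C \<ge> 0" "\<And>h r. 0 < h \<Longrightarrow> h \<le> 1 \<Longrightarrow> 0 \<le> r \<Longrightarrow> csum (tail h r) \<le> C * ((r + 1) * h + sqrt (r + 1) / h)"
    using csum_tail_bound by blast
  have "csum (tail h r) \<le> 2 * C * (r + 1)" if h: "0 < h" "h \<le> 1" and r: "0 \<le> r" for h r
  proof -
    have "csum (tail h r) \<le> csum (tail 1 r)" using h by (rule csum_tail_mono)
    also have "\<dots> \<le> C * ((r + 1) * 1 + sqrt (r + 1) / 1)" using r by (intro C(2)) auto
    also have "\<dots> \<le> C * ((r + 1) * 1 + (r + 1))"
      using C(1) r by (intro mult_left_mono add_left_mono) (auto intro!: real_le_lsqrt simp: power2_eq_square mult_le_cancel_left1)
    finally show ?thesis by (simp add: algebra_simps)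
  qed
  then show ?thesis using C(1) by (intro exI[of _ "2 * C"]) auto
qed

text \<open>Smoothing at width 1 is enough for this crude error; radii below 1 are covered by
  monotonicity of the count.\<close>

lemma cnt_asymptotics: "\<exists>C\<ge>0. \<forall>t\<ge>0. \<bar>cnt t - pi * t\<^sup>2 / \<beta>\<bar> \<le> C * (t + 1)"
proof -
  obtain C where C: "C \<ge> 0" "\<And>h r. 0 < h \<Longrightarrow> h \<le> 1 \<Longrightarrow> 0 \<le> r \<Longrightarrow> csum (tail h r) \<le> C * (r + 1)"
    using csum_tail_linear by blast
  obtain D where D: "D \<ge> 0" "\<And>h t. 0 < h \<Longrightarrow> h \<le> 1 \<Longrightarrow> 1 \<le> t \<Longrightarrow> \<bar>smooth_count h t - pi * t\<^sup>2 / \<beta>\<bar> \<le> D * sqrt t / h"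
    using smooth_count_bound by blast
  have big: "\<bar>cnt t - pi * t\<^sup>2 / \<beta>\<bar> \<le> (2 * C + D) * (t + 1)" if "t \<ge> 1" for t
  proof -
    have "\<bar>cnt t - smooth_count 1 t\<bar> \<le> 2 * csum (tail 1 t)" using that by (intro cnt_smooth_diff) auto
    also have "\<dots> \<le> 2 * (C * (t + 1))" using that by (intro mult_left_mono C(2)) auto
    finally have 1: "\<bar>cnt t - smooth_count 1 t\<bar> \<le> 2 * C * (t + 1)" by simp
    have "\<bar>smooth_count 1 t - pi * t\<^sup>2 / \<beta>\<bar> \<le> D * sqrt t" using D(2)[of 1 t] that by simp
    also have "\<dots> \<le> D * (t + 1)"
      using D(1) that by (intro mult_left_mono) (auto intro!: real_le_lsqrt simp: power2_eq_square algebra_simps)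
    finally show ?thesis using 1 by (simp add: ring_distribs)
  qed
  have small: "\<bar>cnt t - pi * t\<^sup>2 / \<beta>\<bar> \<le> cnt 1 + pi / \<beta>" if "0 \<le> t" "t \<le> 1" for t
  proof -
    have "cnt t \<le> cnt 1" unfolding cnt_def using that by (auto intro!: card_mono finite_nm_le)
    moreover have "pi * t\<^sup>2 / \<beta> \<le> pi / \<beta>" using that beta_pos by (intro divide_right_mono) (auto simp: power_le_one)
    moreover have "pi * t\<^sup>2 / \<beta> \<ge> 0" "cnt t \<ge> 0" using beta_pos by (auto simp: cnt_def)
    ultimately show ?thesis by linarith
  qed
  show ?thesis
  proof (intro exI[of _ "2 * C + D + cnt 1 + pi / \<beta>"] conjI allI impI)
    show "0 \<le> 2 * C + D + cnt 1 + pi / \<beta>" using C(1) D(1) beta_pos by (auto simp: cnt_def)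
    fix t :: real assume t: "t \<ge> 0"
    have n: "0 \<le> cnt 1 + pi / \<beta>" using beta_pos by (auto simp: cnt_def)
    show "\<bar>cnt t - pi * t\<^sup>2 / \<beta>\<bar> \<le> (2 * C + D + cnt 1 + pi / \<beta>) * (t + 1)"
    proof (cases "t \<ge> 1")
      case True
      have "(2 * C + D) * (t + 1) \<le> (2 * C + D + cnt 1 + pi / \<beta>) * (t + 1)" using n t by (intro mult_right_mono) auto
      then show ?thesis using big[OF True] by linarith
    next
      case False
      have "(cnt 1 + pi / \<beta>) * 1 \<le> (2 * C + D + cnt 1 + pi / \<beta>) * (t + 1)" using n t C(1) D(1) by (intro mult_mono) auto
      then show ?thesis using order.trans[OF small[OF t]] False by simp
    qed
  qed
qed

lemma cnt_eq_count_pts: "real (count_pts (planar_lattice \<alpha> \<beta>) t) = cnt t"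
proof -
  let ?f = "\<lambda>x. of_int (fst x) + of_int (snd x) * Complex \<alpha> \<beta>"
  have inj: "inj ?f"
  proof (rule injI)
    fix x y assume e: "?f x = ?f y"
    then have "Im (?f x) = Im (?f y)" by simp
    then have s: "snd x = snd y" using beta_pos by simp
    then have "fst x = fst y" using e by simp
    then show "x = y" using s by (simp add: prod_eq_iff)
  qed
  have "{z \<in> planar_lattice \<alpha> \<beta>. cmod z \<le> t} = ?f ` {x. nm x \<le> t}"
    unfolding planar_lattice_def nm_cmod by (force simp: image_iff)
  then show ?thesis unfolding count_pts_def cnt_def using inj by (simp add: card_image inj_on_subset)
qed

text \<open>Averaging over t gains a factor \<open>h\<close>, the length of time that the circle
  spends near a given lattice point. The points that matter have norm at most about 6T; a weight (T
  / nm x)^(5/2) replaces counting them, since it is summable over the whole lattice and the loss of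
  T^(1/2) is harmless.\<close>

lemma integral_csum_tail:
  "\<exists>C\<ge>0. \<forall>h T. 0 < h \<longrightarrow> h \<le> 1 \<longrightarrow> 1 \<le> T \<longrightarrow> integrable lborel (\<lambda>t. indicator {T..2 * T + 1} t * csum (tail h t)) \<and>
     (LINT t|lborel. indicator {T..2 * T + 1} t * csum (tail h t)) \<le> C * h * T powr (5/2)"
proof -
  let ?k = "\<lambda>x. if x = 0 then 0 else nm x powr (- (5/2))"
  have sk: "csummable ?k" by (rule csummable_nm_powr) simp
  have one: "csummable (\<lambda>x::int\<times>int. indicator {0} x :: real)" by (intro integrable_real_indicator) (auto simp: emeasure_count_space_finite)
  \<comment> \<open>6^(5/2) serves norms up to 6T, and 4096 = 8^4 serves larger ones, where the
    distance to the circle is at least half the norm.\<close>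
  define D where "D = (4096 + 6 powr (5/2) :: real)"
  define g where "g x = indicator {0} x + D * ?k x" for x
  have sg: "csummable g" unfolding g_def by (intro Bochner_Integration.integrable_add one integrable_mult_right sk)
  have g0: "g x \<ge> 0" for x by (auto simp: g_def D_def intro!: add_nonneg_nonneg)
  show ?thesis
  proof (intro exI[of _ "2 * csum g"] conjI allI impI)
    show "0 \<le> 2 * csum g" using g0 by (simp add: integral_nonneg_AE)
    fix h T :: real assume h: "0 < h" "h \<le> 1" and T: "1 \<le> T"
    define f where "f x t = indicator {T..2 * T + 1} t * tail h t x" for x t
    \<comment> \<open>Again half of the exponent of the tail: this half is integrated in t, the
      remaining half supplies the decay in \<open>nm x\<close>.\<close>
    let ?W = "\<lambda>x t. exp (- (pi * (1 / (4 * h\<^sup>2))) * (nm x - t)\<^sup>2)"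
    have W: "integrable lborel (?W x)" "(LINT t|lborel. ?W x t) = 2 * h" for x
      using gauss_line[of "1 / (4 * h\<^sup>2)" "nm x"] h by (simp_all add: real_sqrt_divide real_sqrt_mult)
    have T52: "1 \<le> T powr (5/2)" using T by (simp add: ge_one_powr_ge_zero)
    have fle: "f x t \<le> T powr (5/2) * g x * ?W x t" for x t
    proof (cases "t \<in> {T..2 * T + 1}")
      case True
      have split: "tail h t x = exp (- (pi / (4 * h\<^sup>2)) * (nm x - t)\<^sup>2) * ?W x t"
        unfolding tail_def exp_add[symmetric] using h by (simp add: field_simps)
      have "exp (- (pi / (4 * h\<^sup>2)) * (nm x - t)\<^sup>2) \<le> T powr (5/2) * g x"
      proof (cases "x = 0")
        case True
        have "exp (- (pi / (4 * h\<^sup>2)) * (nm x - t)\<^sup>2) \<le> 1" by simp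
        also have "\<dots> \<le> T powr (5/2) * g x" using True T52 by (simp add: g_def)
        finally show ?thesis .
      next
        case False
        have n: "nm x > 0" by (rule nm_pos[OF False])
        have "exp (- (pi / (4 * h\<^sup>2)) * (nm x - t)\<^sup>2) \<le> D * (T powr (5/2) * nm x powr (- (5/2)))"
        proof (cases "nm x \<le> 6 * T")
          case True
          have "exp (- (pi / (4 * h\<^sup>2)) * (nm x - t)\<^sup>2) \<le> 1" by simp
          also have "1 = (6 * T) powr (5/2) * (6 * T) powr (- (5/2))" using T by (simp flip: powr_add)
          also have "\<dots> \<le> (6 * T) powr (5/2) * nm x powr (- (5/2))" using True n by (intro mult_left_mono powr_mono2') auto
          also have "\<dots> = 6 powr (5/2) * (T powr (5/2) * nm x powr (- (5/2)))" using T by (simp add: powr_mult)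
          also have "\<dots> \<le> D * (T powr (5/2) * nm x powr (- (5/2)))" by (intro mult_right_mono) (auto simp: D_def)
          finally show ?thesis .
        next
          case big: False
          have "t \<le> 3 * T" using True T by auto
          then have "nm x / 2 \<le> nm x - t" using big by simp
          then have "(nm x / 2)\<^sup>2 \<le> (nm x - t)\<^sup>2" using n by (intro power_mono) auto
          moreover have "pi / 4 \<le> pi / (4 * h\<^sup>2)" using h by (intro divide_left_mono) (auto simp: power_le_one)
          ultimately have "pi / 4 * (nm x / 2)\<^sup>2 \<le> pi / (4 * h\<^sup>2) * (nm x - t)\<^sup>2" by (intro mult_mono) auto
          then have "exp (- (pi / (4 * h\<^sup>2)) * (nm x - t)\<^sup>2) \<le> exp (- (pi / 4 * (nm x / 2)\<^sup>2))" by simp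
          also have "\<dots> = exp (- pi * (nm x / 8)\<^sup>2) ^ 4" by (simp add: power_divide flip: exp_of_nat_mult)
          also have "\<dots> \<le> (1 / (nm x / 8)) ^ 4" using n by (intro power_mono exp_neg_sq_le) auto
          also have "\<dots> = 4096 * nm x powr (- 4)" using n by (simp add: power_divide powr_minus_divide powr_numeral)
          also have "\<dots> \<le> 4096 * (T powr (5/2) * nm x powr (- (5/2)))"
          proof (intro mult_left_mono)
            have "nm x \<ge> 1" using big T by simp
            then have "nm x powr (- 4) \<le> nm x powr (- (5/2))" by (intro powr_mono) auto
            also have "\<dots> \<le> T powr (5/2) * nm x powr (- (5/2))" using T52 by (simp add: mult_le_cancel_right1)
            finally show "nm x powr (- 4) \<le> T powr (5/2) * nm x powr (- (5/2))" .
          qed auto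
          also have "\<dots> \<le> D * (T powr (5/2) * nm x powr (- (5/2)))" by (intro mult_right_mono) (auto simp: D_def)
          finally show ?thesis .
        qed
        then show ?thesis using False by (simp add: g_def mult_ac)
      qed
      then have "exp (- (pi / (4 * h\<^sup>2)) * (nm x - t)\<^sup>2) * ?W x t \<le> T powr (5/2) * g x * ?W x t" by (rule mult_right_mono) simp
      then show ?thesis using True unfolding f_def split by simp
    next
      case False then show ?thesis using g0[of x] by (simp add: f_def)
    qed
    have f0: "f x t \<ge> 0" for x t by (simp add: f_def tail_def)
    have fm[measurable]: "f x \<in> borel_measurable borel" for x unfolding f_def tail_def by measurable
    have fi: "integrable lborel (f x)" for x
      by (rule Bochner_Integration.integrable_bound[OF integrable_mult_right[OF W(1), of "T powr (5/2) * g x" x]])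
         (use fle f0 g0 in \<open>auto intro!: AE_I2 simp: abs_mult\<close>)
    have fint: "(LINT t|lborel. f x t) \<le> 2 * h * T powr (5/2) * g x" for x
    proof -
      have "(LINT t|lborel. f x t) \<le> (LINT t|lborel. T powr (5/2) * g x * ?W x t)"
        by (intro Bochner_Integration.integral_mono fi integrable_mult_right W(1) fle)
      also have "\<dots> = T powr (5/2) * g x * (2 * h)" using W(2)[of x] by simp
      finally show ?thesis by (simp add: mult_ac)
    qed
    have nf: "(\<lambda>x. LINT t|lborel. norm (f x t)) = (\<lambda>x. LINT t|lborel. f x t)" using f0 by simp
    have sf: "csummable (\<lambda>x. LINT t|lborel. norm (f x t))" unfolding nf
      by (rule csummable_bound[OF integrable_mult_right[OF sg, of "2 * h * T powr (5/2)"]])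
         (use fint f0 in \<open>auto simp: integral_nonneg_AE\<close>)
    have eq: "(\<lambda>t. csum (\<lambda>x. f x t)) = (\<lambda>t. indicator {T..2 * T + 1} t * csum (tail h t))" unfolding f_def by simp
    show "integrable lborel (\<lambda>t. indicator {T..2 * T + 1} t * csum (tail h t))"
      using csum_integral_swap(2)[OF sigma_finite_lborel fi sf] unfolding eq .
    have "(LINT t|lborel. indicator {T..2 * T + 1} t * csum (tail h t)) = csum (\<lambda>x. LINT t|lborel. f x t)"
      using csum_integral_swap(1)[OF sigma_finite_lborel fi sf] unfolding eq .
    also have "\<dots> \<le> csum (\<lambda>x. 2 * h * T powr (5/2) * g x)"
      by (intro Bochner_Integration.integral_mono fint integrable_mult_right sg) (use sf nf in simp)
    also have "\<dots> = 2 * csum g * h * T powr (5/2)" by simp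
    finally show "(LINT t|lborel. indicator {T..2 * T + 1} t * csum (tail h t)) \<le> 2 * csum g * h * T powr (5/2)" .
  qed
qed

end

section \<open>Mean square of the remainder\<close>

context planar
begin

text \<open>A bound for the number of frequencies within about 1/T of a given one, which is a tail
  sum of width proportional to 1/T. Moderate frequencies are handled by widening this to r^(-1/4),
  extreme ones by the smoothing factor at width 1 / T^2.\<close>

lemma near_diagonal:
  "\<exists>C\<ge>0. \<forall>T x. \<beta> + 1 \<le> T \<longrightarrow> 1 \<le> kap x \<longrightarrow>
     csummable (\<lambda>y. exp (- pi * T\<^sup>2 * (kap x - kap y)\<^sup>2)) \<and>
     exp (- pi * (1 / T\<^sup>2)\<^sup>2 * (kap x)\<^sup>2) * kap x powr (- 3) * csum (\<lambda>y. exp (- pi * T\<^sup>2 * (kap x - kap y)\<^sup>2)) \<le> C * kap x powr (- (9/4))"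
proof -
  obtain C where C: "C \<ge> 0" "\<And>h r. 0 < h \<Longrightarrow> h \<le> 1 \<Longrightarrow> 0 \<le> r \<Longrightarrow> csum (tail h r) \<le> C * ((r + 1) * h + sqrt (r + 1) / h)"
    using csum_tail_bound by blast
  obtain D where D: "D \<ge> 0" "\<And>h r. 0 < h \<Longrightarrow> h \<le> 1 \<Longrightarrow> 0 \<le> r \<Longrightarrow> csum (tail h r) \<le> D * (r + 1)"
    using csum_tail_linear by blast
  define E where "E = 2 * C * (\<beta> + 1) powr (3/4) + D * \<beta>\<^sup>2 / 2 * (\<beta> + 1) powr (3/2)"
  have E: "0 \<le> 2 * C * (\<beta> + 1) powr (3/4)" "0 \<le> D * \<beta>\<^sup>2 / 2 * (\<beta> + 1) powr (3/2)" using C(1) D(1) by simp_all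
  show ?thesis
  proof (intro exI[of _ E] conjI allI impI)
    show "E \<ge> 0" using E by (simp add: E_def)
    fix T x assume T: "\<beta> + 1 \<le> T" and k: "1 \<le> kap x"
    define r where "r = nm x"
    define h0 where "h0 = \<beta> / (sqrt 2 * T)"
    have T0: "T > 0" using T beta_pos by simp
    have h0: "0 < h0" using T0 beta_pos by (simp add: h0_def)
    have "T \<le> sqrt 2 * T" using mult_right_mono[of 1 "sqrt 2" T] T0 by simp
    then have "\<beta> \<le> sqrt 2 * T" using T by linarith
    then have h01: "h0 \<le> 1" using T0 by (simp add: h0_def)
    have r: "r = \<beta> * kap x" using beta_pos by (simp add: r_def kap_def)
    have r0: "r \<ge> 0" by (simp add: r_def)
    have r1: "r + 1 \<le> (\<beta> + 1) * kap x" using k unfolding r by (simp add: algebra_simps)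
    have eq: "(\<lambda>y. exp (- pi * T\<^sup>2 * (kap x - kap y)\<^sup>2)) = tail h0 r"
    proof
      fix y
      have "pi / (2 * h0\<^sup>2) * (nm y - r)\<^sup>2 = pi * T\<^sup>2 * (kap x - kap y)\<^sup>2"
        using beta_pos T0 unfolding kap_def r_def h0_def diff_divide_distrib[symmetric] power_divide power_mult_distrib
        by (simp add: power2_commute[of "nm x"])
      then show "exp (- pi * T\<^sup>2 * (kap x - kap y)\<^sup>2) = tail h0 r y" by (simp add: tail_def)
    qed
    show "csummable (\<lambda>y. exp (- pi * T\<^sup>2 * (kap x - kap y)\<^sup>2))" unfolding eq by (rule csummable_tail[OF h0])
    let ?e = "exp (- pi * (1 / T\<^sup>2)\<^sup>2 * (kap x)\<^sup>2)"
    have tail0: "csum (tail h0 r) \<ge> 0" by (simp add: integral_nonneg_AE tail_def)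
    show "?e * kap x powr (- 3) * csum (\<lambda>y. exp (- pi * T\<^sup>2 * (kap x - kap y)\<^sup>2)) \<le> E * kap x powr (- (9/4))"
      unfolding eq
    proof (cases "h0 \<le> (r + 1) powr (- (1/4))")
      case True
      \<comment> \<open>The width at which the two terms (r + 1) h and sqrt (r + 1) / h of the
        annulus bound coincide; both become (r + 1)^(3/4).\<close>
      define h1 where "h1 = (r + 1) powr (- (1/4))"
      have h1: "0 < h1" "h1 \<le> 1" using r0 by (auto simp: h1_def powr_minus_divide ge_one_powr_ge_zero)
      have "csum (tail h0 r) \<le> csum (tail h1 r)" using True h0 by (intro csum_tail_mono) (auto simp: h1_def)
      also have "\<dots> \<le> C * ((r + 1) * h1 + sqrt (r + 1) / h1)" by (rule C(2)[OF h1 r0])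
      also have "(r + 1) * h1 + sqrt (r + 1) / h1 = 2 * (r + 1) powr (3/4)"
      proof -
        have "(r + 1) * h1 = (r + 1) powr 1 * (r + 1) powr (- (1/4))" using r0 by (simp add: h1_def)
        also have "\<dots> = (r + 1) powr (1 + - (1/4))" by (rule powr_add[symmetric])
        also have "\<dots> = (r + 1) powr (3/4)" by simp
        finally have 1: "(r + 1) * h1 = (r + 1) powr (3/4)" .
        have "sqrt (r + 1) / h1 = (r + 1) powr (1/2) / (r + 1) powr (- (1/4))" using r0 by (simp add: h1_def powr_half_sqrt)
        also have "\<dots> = (r + 1) powr (3/4)" by (simp flip: powr_diff)
        finally show ?thesis using 1 by simp
      qed
      also have "C * (2 * (r + 1) powr (3/4)) \<le> C * (2 * ((\<beta> + 1) * kap x) powr (3/4))"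
        using C(1) r0 r1 by (intro mult_left_mono powr_mono2) auto
      also have "\<dots> = 2 * C * (\<beta> + 1) powr (3/4) * kap x powr (3/4)" using beta_pos by (simp add: powr_mult)
      finally have "?e * kap x powr (- 3) * csum (tail h0 r) \<le> 1 * kap x powr (- 3) * (2 * C * (\<beta> + 1) powr (3/4) * kap x powr (3/4))"
        using tail0 by (intro mult_mono) auto
      also have "\<dots> = 2 * C * (\<beta> + 1) powr (3/4) * (kap x powr (- 3) * kap x powr (3/4))" by simp
      also have "kap x powr (- 3) * kap x powr (3/4) = kap x powr (- (9/4))" by (simp flip: powr_add)
      also have "2 * C * (\<beta> + 1) powr (3/4) * kap x powr (- (9/4)) \<le> E * kap x powr (- (9/4))"
        using E(2) by (intro mult_right_mono) (auto simp: E_def)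
      finally show "?e * kap x powr (- 3) * csum (tail h0 r) \<le> E * kap x powr (- (9/4))" .
    next
      case False
      \<comment> \<open>In this case T^2 is at most a multiple of sqrt (r + 1), so the frequency is
        so large that the smoothing factor itself is bounded by T^2 / kap.\<close>
      have "1 / h0 \<le> 1 / (r + 1) powr (- (1/4))" using False h0 r0 by (intro divide_left_mono) auto
      also have "\<dots> = (r + 1) powr (1/4)" by (simp add: powr_minus_divide)
      finally have "(1 / h0)\<^sup>2 \<le> ((r + 1) powr (1/4))\<^sup>2" using h0 by (intro power_mono) auto
      also have "\<dots> = sqrt (r + 1)" using r0 by (simp add: powr_power powr_half_sqrt)
      also have "(1 / h0)\<^sup>2 = 2 * T\<^sup>2 / \<beta>\<^sup>2" by (simp add: h0_def power_divide power_mult_distrib)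
      finally have Tr: "T\<^sup>2 \<le> \<beta>\<^sup>2 / 2 * sqrt (r + 1)" using beta_pos by (simp add: field_simps)
      have "?e \<le> 1 / (1 / T\<^sup>2 * kap x)"
      proof -
        have "- pi * (1 / T\<^sup>2 * kap x)\<^sup>2 = - pi * (1 / T\<^sup>2)\<^sup>2 * (kap x)\<^sup>2" by (simp only: power_mult_distrib mult.assoc)
        moreover have "0 < 1 / T\<^sup>2 * kap x" using T0 k by simp
        ultimately show ?thesis using exp_neg_sq_le[of "1 / T\<^sup>2 * kap x"] by (simp only:)
      qed
      also have "\<dots> = T\<^sup>2 / kap x" by simp
      also have "\<dots> \<le> (\<beta>\<^sup>2 / 2 * sqrt (r + 1)) / kap x" using Tr k by (intro divide_right_mono) auto
      finally have e: "?e \<le> (\<beta>\<^sup>2 / 2 * sqrt (r + 1)) / kap x" .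
      have "?e * csum (tail h0 r) \<le> (\<beta>\<^sup>2 / 2 * sqrt (r + 1)) / kap x * (D * (r + 1))"
        using D(2)[OF h0 h01 r0] e tail0 r0 k by (intro mult_mono) auto
      also have "\<dots> = D * \<beta>\<^sup>2 / 2 * (r + 1) powr (3/2) / kap x"
      proof -
        have "(r + 1) powr (3/2) = (r + 1) powr (1/2 + 1)" by simp
        also have "\<dots> = sqrt (r + 1) * (r + 1)" unfolding powr_add using r0 by (simp add: powr_half_sqrt)
        finally show ?thesis by simp
      qed
      also have "\<dots> \<le> D * \<beta>\<^sup>2 / 2 * ((\<beta> + 1) * kap x) powr (3/2) / kap x"
        using D(1) r0 r1 k by (intro divide_right_mono mult_left_mono powr_mono2) auto
      also have "\<dots> = D * \<beta>\<^sup>2 / 2 * (\<beta> + 1) powr (3/2) * (kap x powr (3/2) / kap x powr 1)" using beta_pos k by (simp add: powr_mult)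
      also have "kap x powr (3/2) / kap x powr 1 = kap x powr (3/2 - 1)" by (rule powr_diff[symmetric])
      also have "kap x powr (3/2 - 1) = kap x powr (1/2)" by simp
      finally have "(?e * csum (tail h0 r)) * kap x powr (- 3) \<le> (D * \<beta>\<^sup>2 / 2 * (\<beta> + 1) powr (3/2) * kap x powr (1/2)) * kap x powr (- 3)"
        by (rule mult_right_mono) simp
      also have "\<dots> = D * \<beta>\<^sup>2 / 2 * (\<beta> + 1) powr (3/2) * (kap x powr (1/2) * kap x powr (- 3))" by simp
      also have "kap x powr (1/2) * kap x powr (- 3) = kap x powr (- (5/2))" by (simp flip: powr_add)
      also have "D * \<beta>\<^sup>2 / 2 * (\<beta> + 1) powr (3/2) * kap x powr (- (5/2)) \<le> E * kap x powr (- (9/4))"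
        using E k by (intro mult_mono powr_mono) (auto simp: E_def)
      finally show "?e * kap x powr (- 3) * csum (tail h0 r) \<le> E * kap x powr (- (9/4))" by (simp add: mult_ac)
    qed
  qed
qed

lemma gauss_window_fourier:
  assumes T: "T > 0"
  shows "norm (LINT t|lborel. complex_of_real (exp (- (pi * (1 / T\<^sup>2)) * (T - t)\<^sup>2)) * e2 (t * d)) = T * exp (- pi * T\<^sup>2 * d\<^sup>2)"
proof -
  let ?f = "\<lambda>t. complex_of_real (exp (- (pi * (1 / T\<^sup>2)) * (T - t)\<^sup>2)) * e2 (t * d)"
  have "(LINT t|lborel. ?f t) = (LINT t|lborel. ?f (T + 1 * t))" using lborel_integral_real_affine[of 1 ?f T] by simp
  also have "\<dots> = (LINT t|lborel. e2 (T * d) * (complex_of_real (exp (- pi * (1 / T\<^sup>2) * t\<^sup>2)) * e2 (d * t)))"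
    by (simp add: ring_distribs e2_add mult_ac)
  also have "\<dots> = e2 (T * d) * (exp (- pi * d\<^sup>2 / (1 / T\<^sup>2)) / sqrt (1 / T\<^sup>2))"
    using gauss_fourier(2)[of "1 / T\<^sup>2" d] T by (simp only: integral_mult_right_zero) simp
  finally show ?thesis using T by (simp add: norm_mult norm_divide real_sqrt_divide mult_ac)
qed

text \<open>The Gaussian factor is the one of \<open>osc\<close> at smoothing width h = 1 /
  T^2.\<close>

definition coef :: "real \<Rightarrow> real \<Rightarrow> int \<times> int \<Rightarrow> real" where
  "coef T M x = (if M < kap x then exp (- pi * (1 / T\<^sup>2)\<^sup>2 * (kap x)\<^sup>2) * kap x powr (-3/2) else 0)"

definition high :: "real \<Rightarrow> real \<Rightarrow> real \<Rightarrow> complex" where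
  "high T M t = csum (\<lambda>x. coef T M x * e2 (t * kap x))"

lemma csummable_coef:
  assumes "T > 0" "1 \<le> M"
  shows "csummable (coef T M)"
proof (rule csummable_bound)
  show "csummable (gbound (pi * (1 / T\<^sup>2)\<^sup>2 / \<beta>\<^sup>2))" using assms beta_pos by (intro csummable_gbound) auto
  fix x
  have "kap x powr (-3/2) \<le> 1" if "M < kap x" using that assms powr_mono[of "-3/2" 0 "kap x"] by simp
  then have "exp (- pi * (1 / T\<^sup>2)\<^sup>2 * (kap x)\<^sup>2) * kap x powr (-3/2) \<le> exp (- pi * (1 / T\<^sup>2)\<^sup>2 * (kap x)\<^sup>2) * 1" if "M < kap x"
    using that by (intro mult_left_mono) auto
  then show "norm (coef T M x) \<le> gbound (pi * (1 / T\<^sup>2)\<^sup>2 / \<beta>\<^sup>2) x"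
    by (auto simp: coef_def gbound_def kap_def power_divide)
qed

lemma coef_nonneg: "coef T M x \<ge> 0" by (simp add: coef_def)

text \<open>The window is dominated by a Gaussian because the Fourier transform of a Gaussian is
  again a Gaussian: after squaring, the pair (x, y) is weighted by exp (- pi T^2 (kap x - kap y)^2).
  This reduces the double sum to near-diagonal pairs, and kap^(-9/4) is split into M^(-1/8) and the
  summable kap^(-17/8).\<close>

lemma mean_square_high:
  "\<exists>C\<ge>0. \<forall>T M. \<beta> + 1 \<le> T \<longrightarrow> 1 \<le> T \<longrightarrow> 1 \<le> M \<longrightarrow> integrable lborel (\<lambda>t. indicator {T..2 * T + 1} t * (norm (high T M t))\<^sup>2) \<and>
     (LINT t|lborel. indicator {T..2 * T + 1} t * (norm (high T M t))\<^sup>2) \<le> C * T * M powr (- (1/8))"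
proof -
  let ?k = "\<lambda>x. if x = 0 then 0 else kap x powr (- (17/8))"
  have sk: "csummable ?k" by (rule csummable_kap_powr) simp
  have k0: "csum ?k \<ge> 0" by (simp add: integral_nonneg_AE)
  obtain C where C: "C \<ge> 0" "\<And>T x. \<beta> + 1 \<le> T \<Longrightarrow> 1 \<le> kap x \<Longrightarrow>
     csummable (\<lambda>y. exp (- pi * T\<^sup>2 * (kap x - kap y)\<^sup>2)) \<and>
     exp (- pi * (1 / T\<^sup>2)\<^sup>2 * (kap x)\<^sup>2) * kap x powr (- 3) * csum (\<lambda>y. exp (- pi * T\<^sup>2 * (kap x - kap y)\<^sup>2)) \<le> C * kap x powr (- (9/4))"
    using near_diagonal by blast
  show ?thesis
  proof (intro exI[of _ "exp (4 * pi) * C * csum ?k"] conjI allI impI)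
    show "0 \<le> exp (4 * pi) * C * csum ?k" using C(1) k0 by simp
    fix T M :: real assume T: "\<beta> + 1 \<le> T" "1 \<le> T" and M: "1 \<le> M"
    have T0: "T > 0" using T by simp
    let ?c = "coef T M"
    let ?E = "\<lambda>x y. exp (- pi * T\<^sup>2 * (kap x - kap y)\<^sup>2)"
    define W where "W t = exp (- (pi * (1 / T\<^sup>2)) * (T - t)\<^sup>2)" for t
    have W: "integrable lborel W" "(LINT t|lborel. W t) = T"
      using gauss_line[of "1 / T\<^sup>2" T] T0 by (simp_all add: W_def[abs_def] real_sqrt_divide)
    have [measurable]: "W \<in> borel_measurable borel" unfolding W_def by measurable
    have sc: "csummable ?c" by (rule csummable_coef[OF T0 M])
    define F where "F = (\<lambda>(x, y) t. complex_of_real (W t * (?c x * ?c y)) * e2 (t * (kap x - kap y)))"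
    have normF: "norm (F p t) = ?c (fst p) * ?c (snd p) * W t" for p t by (cases p) (simp add: F_def norm_mult coef_nonneg W_def)
    have scc: "csummable (\<lambda>p. ?c (fst p) * ?c (snd p))" using csummable_times[OF sc sc] by (simp add: case_prod_unfold)
    have Fm: "F p \<in> borel_measurable borel" for p
    proof -
      have "(\<lambda>t. complex_of_real (W t * (?c (fst p) * ?c (snd p))) * e2 (t * (kap (fst p) - kap (snd p)))) \<in> borel_measurable borel" by measurable
      then show ?thesis by (simp add: F_def case_prod_unfold)
    qed
    have Fi: "integrable lborel (F p)" for p
      by (rule Bochner_Integration.integrable_bound[OF integrable_mult_right[OF W(1), of "?c (fst p) * ?c (snd p)"]])
         (use Fm normF coef_nonneg in \<open>auto simp: W_def abs_mult\<close>)
    have sF: "csummable (\<lambda>p. LINT t|lborel. norm (F p t))" unfolding normF using W scc by simp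
    have Fsum: "csum (\<lambda>p. F p t) = of_real (W t * (norm (high T M t))\<^sup>2)" for t
    proof -
      have sFt: "csummable (\<lambda>p. F p t)" by (rule csummable_bound[OF integrable_mult_left[OF scc, of "W t"]]) (simp add: normF)
      have "csum (\<lambda>p. F p t) = csum (\<lambda>x. csum (\<lambda>y. F (x, y) t))" by (rule csum_Sigma(1)[OF sFt])
      also have "\<dots> = csum (\<lambda>x. csum (\<lambda>y. of_real (W t) * (?c x * e2 (t * kap x)) * cnj (?c y * e2 (t * kap y))))"
        by (simp add: F_def right_diff_distrib e2_add e2_minus mult_ac flip: diff_conv_add_uminus)
           (simp add: diff_conv_add_uminus e2_add e2_minus mult_ac del: add_uminus_conv_diff)
      also have "\<dots> = csum (\<lambda>x. (of_real (W t) * (?c x * e2 (t * kap x))) * cnj (high T M t))"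
        by (simp only: integral_mult_right_zero Bochner_Integration.integral_cnj high_def)
      also have "\<dots> = (of_real (W t) * high T M t) * cnj (high T M t)"
        by (simp only: integral_mult_left_zero integral_mult_right_zero high_def)
      also have "\<dots> = of_real (W t * (norm (high T M t))\<^sup>2)" by (simp only: of_real_mult complex_norm_square mult.assoc)
      finally show ?thesis .
    qed
    have swap: "(LINT t|lborel. csum (\<lambda>p. F p t)) = csum (\<lambda>p. LINT t|lborel. F p t)"
      and intsw: "integrable lborel (\<lambda>t. csum (\<lambda>p. F p t))"
      using csum_integral_swap(1,2)[OF sigma_finite_lborel Fi sF] by blast+
    have iW: "integrable lborel (\<lambda>t. W t * (norm (high T M t))\<^sup>2)"
      using intsw unfolding Fsum by (subst (asm) complex_of_real_integrable_eq)
    \<comment> \<open>By c d \<le> (c^2 + d^2) / 2 the mixed weights are replaced by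
      \<open>P\<close> and its transpose, which have equal sums; in \<open>P\<close> the sum over y
      can be carried out for each x.\<close>
    define P where "P = (\<lambda>(x, y). (?c x)\<^sup>2 * ?E x y)"
    have Pinner: "csummable (\<lambda>y. P (x, y))" "(?c x)\<^sup>2 * csum (?E x) \<le> C * M powr (- (1/8)) * ?k x" for x
    proof -
      have "csummable (\<lambda>y. P (x, y)) \<and> (?c x)\<^sup>2 * csum (?E x) \<le> C * M powr (- (1/8)) * ?k x"
      proof (cases "M < kap x")
        case True
        then have k1: "1 \<le> kap x" and x0: "x \<noteq> 0" using M by auto
        let ?e = "exp (- pi * (1 / T\<^sup>2)\<^sup>2 * (kap x)\<^sup>2)"
        have E0: "csum (?E x) \<ge> 0" by (simp add: integral_nonneg_AE)
        have "(kap x powr (-3/2))\<^sup>2 = kap x powr (- 3)" using k1 by (simp add: powr_power)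
        then have "(?c x)\<^sup>2 * csum (?E x) = ?e * (?e * kap x powr (- 3) * csum (?E x))"
          using True by (simp add: coef_def power_mult_distrib power2_eq_square mult_ac)
        also have "\<dots> \<le> 1 * (?e * kap x powr (- 3) * csum (?E x))" using E0 by (intro mult_right_mono) auto
        also have "\<dots> \<le> C * kap x powr (- (9/4))" using C(2)[OF T(1) k1] by simp
        also have "kap x powr (- (9/4)) = kap x powr (- (1/8)) * kap x powr (- (17/8))" by (simp flip: powr_add)
        also have "C * \<dots> \<le> C * (M powr (- (1/8)) * kap x powr (- (17/8)))"
          using C(1) M True by (intro mult_left_mono mult_right_mono powr_mono2') auto
        finally have "(?c x)\<^sup>2 * csum (?E x) \<le> C * M powr (- (1/8)) * ?k x" using x0 by simp
        moreover have "csummable (\<lambda>y. P (x, y))" unfolding P_def using C(2)[OF T(1) k1] by simp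
        ultimately show ?thesis by simp
      next
        case False
        then show ?thesis using C(1) by (simp add: P_def coef_def)
      qed
      then show "csummable (\<lambda>y. P (x, y))" "(?c x)\<^sup>2 * csum (?E x) \<le> C * M powr (- (1/8)) * ?k x" by auto
    qed
    have Psum: "csum (\<lambda>y. P (x, y)) = (?c x)\<^sup>2 * csum (?E x)" for x by (simp add: P_def)
    have Pn: "norm (P p) = P p" for p by (cases p) (simp add: P_def)
    have P0: "csum (\<lambda>y. P (x, y)) \<ge> 0" for x using Pn by (intro integral_nonneg_AE AE_I2) (metis norm_ge_zero)
    have sP: "csummable P"
    proof (rule csummable_Sigma)
      show "csummable (\<lambda>x. csum (\<lambda>y. norm (P (x, y))))" unfolding Pn
        by (rule csummable_bound[OF integrable_mult_right[OF sk, of "C * M powr (- (1/8))"]]) (use Pinner(2) Psum P0 in auto)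
    qed (rule Pinner(1))
    have Pbound: "csum P \<le> C * M powr (- (1/8)) * csum ?k"
    proof -
      have "csum P = csum (\<lambda>x. (?c x)\<^sup>2 * csum (?E x))" unfolding csum_Sigma(1)[OF sP] Psum ..
      also have "\<dots> \<le> csum (\<lambda>x. C * M powr (- (1/8)) * ?k x)"
        using csum_Sigma(3)[OF sP] unfolding Psum by (intro Bochner_Integration.integral_mono Pinner(2) integrable_mult_right sk)
      finally show ?thesis by (simp only: integral_mult_right_zero)
    qed
    have sP': "csummable (\<lambda>p. P (prod.swap p))" by (rule csummable_reindex_bij[OF bij_swap sP])
    have P': "csum (\<lambda>p. P (prod.swap p)) = csum P" by (rule csum_reindex_bij[OF bij_swap])
    have "(LINT t|lborel. W t * (norm (high T M t))\<^sup>2) = norm (LINT t|lborel. complex_of_real (W t * (norm (high T M t))\<^sup>2))"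
      by (simp add: integral_complex_of_real norm_of_real integral_nonneg_AE W_def del: of_real_mult)
    also have "\<dots> = norm (csum (\<lambda>p. LINT t|lborel. F p t))" unfolding Fsum[symmetric] swap ..
    also have "\<dots> \<le> csum (\<lambda>p. T / 2 * (P p + P (prod.swap p)))"
    proof (rule csum_norm_bound)
      show "csummable (\<lambda>p. T / 2 * (P p + P (prod.swap p)))" by (intro integrable_mult_right Bochner_Integration.integrable_add sP sP')
      fix p :: "(int \<times> int) \<times> (int \<times> int)"
      obtain x y where p: "p = (x, y)" by (cases p)
      have Fp: "(LINT t|lborel. F p t) = of_real (?c x * ?c y) * (LINT t|lborel. complex_of_real (exp (- (pi * (1 / T\<^sup>2)) * (T - t)\<^sup>2)) * e2 (t * (kap x - kap y)))"
        by (subst integral_mult_right_zero[symmetric]) (simp add: F_def p W_def mult_ac)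
      have "norm (LINT t|lborel. F p t) = (?c x * ?c y) * (T * ?E x y)"
        unfolding Fp norm_mult gauss_window_fourier[OF T0] by (simp add: norm_mult coef_nonneg)
      also have "\<dots> \<le> ((?c x)\<^sup>2 + (?c y)\<^sup>2) / 2 * (T * ?E x y)"
        using T0 zero_le_power2[of "?c x - ?c y"] by (intro mult_right_mono) (auto simp: power2_diff)
      also have "\<dots> = T / 2 * (P p + P (prod.swap p))" by (simp add: p P_def power2_commute[of "kap x"] field_simps)
      finally show "norm (LINT t|lborel. F p t) \<le> T / 2 * (P p + P (prod.swap p))" .
    qed
    also have "\<dots> = T * csum P" using sP sP' P' by simp
    also have "\<dots> \<le> T * (C * M powr (- (1/8)) * csum ?k)" using Pbound T0 by (intro mult_left_mono) auto
    finally have main: "(LINT t|lborel. W t * (norm (high T M t))\<^sup>2) \<le> T * (C * M powr (- (1/8)) * csum ?k)" .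
    \<comment> \<open>On the window the distance from T is at most 2T, so the Gaussian of width T is
      at least exp (- 4 pi) there.\<close>
    have Wlow: "indicator {T..2 * T + 1} t \<le> exp (4 * pi) * W t" for t
    proof (cases "t \<in> {T..2 * T + 1}")
      case True
      have "(T - t)\<^sup>2 \<le> (2 * T)\<^sup>2" using True T by (subst power2_commute, intro power_mono) auto
      then have "(1 / T\<^sup>2) * (T - t)\<^sup>2 \<le> (1 / T\<^sup>2) * (2 * T)\<^sup>2" by (intro mult_left_mono) auto
      also have "\<dots> = 4" using T0 by (simp add: power_mult_distrib)
      finally have "pi * ((1 / T\<^sup>2) * (T - t)\<^sup>2) \<le> pi * 4" by (intro mult_left_mono) auto
      then have "1 \<le> exp (4 * pi) * W t" unfolding W_def exp_add[symmetric] by (simp add: mult_ac)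
      then show ?thesis using True by simp
    qed (simp add: W_def)
    have le: "indicator {T..2 * T + 1} t * (norm (high T M t))\<^sup>2 \<le> exp (4 * pi) * (W t * (norm (high T M t))\<^sup>2)" for t
      using mult_right_mono[OF Wlow[of t], of "(norm (high T M t))\<^sup>2"] by (simp add: mult.assoc)
    have meas: "(\<lambda>t. (norm (high T M t))\<^sup>2) \<in> borel_measurable lborel"
    proof -
      have "(\<lambda>t. (norm (high T M t))\<^sup>2) = (\<lambda>t. (W t * (norm (high T M t))\<^sup>2) / W t)"
        by (auto simp: W_def fun_eq_iff)
      also have "\<dots> \<in> borel_measurable lborel" using borel_measurable_integrable[OF iW] by measurable
      finally show ?thesis .
    qed
    show int: "integrable lborel (\<lambda>t. indicator {T..2 * T + 1} t * (norm (high T M t))\<^sup>2)"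
      by (rule Bochner_Integration.integrable_bound[OF integrable_mult_right[OF iW, of "exp (4 * pi)"]])
         (use meas le in \<open>auto simp: W_def abs_mult\<close>)
    have "(LINT t|lborel. indicator {T..2 * T + 1} t * (norm (high T M t))\<^sup>2) \<le> (LINT t|lborel. exp (4 * pi) * (W t * (norm (high T M t))\<^sup>2))"
      by (intro Bochner_Integration.integral_mono int integrable_mult_right iW le)
    also have "\<dots> \<le> exp (4 * pi) * (T * (C * M powr (- (1/8)) * csum ?k))" using main by simp
    finally show "(LINT t|lborel. indicator {T..2 * T + 1} t * (norm (high T M t))\<^sup>2) \<le> exp (4 * pi) * C * csum ?k * T * M powr (- (1/8))"
      by (simp add: mult_ac)
  qed
qed

definition rem :: "real \<Rightarrow> real" where "rem t = (cnt t - pi * t\<^sup>2 / \<beta>) / sqrt t"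

definition low :: "real \<Rightarrow> (int \<times> int) set" where "low M = {x. x \<noteq> 0 \<and> kap x \<le> M}"

definition trig_sum :: "real \<Rightarrow> real \<Rightarrow> real" where
  "trig_sum M t = 1 / (pi * \<beta>) * (\<Sum>x\<in>low M. kap x powr (-3/2) * sin (2 * pi * t * kap x - pi/4))"

lemma finite_low: "finite (low M)"
proof (rule finite_subset[OF _ finite_nm_le[of "\<beta> * M"]])
  show "low M \<subseteq> {x. nm x \<le> \<beta> * M}" using beta_pos by (auto simp: low_def kap_def field_simps)
qed

lemma csum_finite_support:
  fixes f :: "'i \<Rightarrow> real"
  assumes "finite A"
  shows "csum (\<lambda>x. if x \<in> A then f x else 0) = (\<Sum>x\<in>A. f x)" "csummable (\<lambda>x. if x \<in> A then f x else 0)"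
proof -
  have eq: "(\<lambda>x. if x \<in> A then f x else 0) = (\<lambda>x. \<Sum>a\<in>A. indicator {a} x *\<^sub>R f a)"
    using assms by (auto simp: fun_eq_iff indicator_def if_distrib cong: if_cong)
  have s: "csummable (\<lambda>x. indicator {a} x *\<^sub>R f a)" for a by simp
  show "csum (\<lambda>x. if x \<in> A then f x else 0) = (\<Sum>x\<in>A. f x)"
    unfolding eq by (subst Bochner_Integration.integral_sum) (use s in auto)
  show "csummable (\<lambda>x. if x \<in> A then f x else 0)" unfolding eq by (intro Bochner_Integration.integrable_sum s)
qed

text \<open>Below M the Gaussian factor is replaced by 1, at a cost pi h^2 kap^2 with h = 1 / T^2.
  Since kap^2 kap^(-3/2) \<le> M^3 kap^(-5/2), the total cost is of order M^3 / T^4.\<close>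

lemma osc_split:
  assumes T: "T > 0" and M: "1 \<le> M"
  shows "\<bar>csum (osc (1 / T\<^sup>2) t) - (\<Sum>x\<in>low M. kap x powr (-3/2) * sin (2 * pi * t * kap x - pi/4))\<bar>
    \<le> norm (high T M t) + pi / T ^ 4 * M ^ 3 * csum (\<lambda>x. if x = 0 then 0 else kap x powr (- (5/2)))"
proof -
  let ?h = "1 / T\<^sup>2"
  let ?k = "\<lambda>x. if x = 0 then 0 else kap x powr (- (5/2))"
  let ?s = "\<lambda>x. kap x powr (-3/2) * sin (2 * pi * t * kap x - pi/4)"
  have sk: "csummable ?k" by (rule csummable_kap_powr) simp
  have h: "?h > 0" using T by simp
  define a where "a x = (if x \<in> low M then osc ?h t x else 0)" for x
  define b where "b x = coef T M x * sin (2 * pi * t * kap x - pi/4)" for x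
  have ab: "osc ?h t x = a x + b x" for x using M by (auto simp: osc_def a_def b_def low_def coef_def not_le)
  have sa: "csum a = (\<Sum>x\<in>low M. osc ?h t x)" "csummable a" unfolding a_def[abs_def] by (rule csum_finite_support[OF finite_low])+
  have sb: "csummable b" by (rule csummable_bound[OF csummable_coef[OF T M]])
       (auto simp: b_def abs_mult coef_nonneg intro!: mult_left_le)
  \<comment> \<open>The phase pi/4 is an eighth of a full turn; the sine sum is the imaginary part
    of the turned exponential sum.\<close>
  have b_high: "csum b = Im (e2 (- 1/8) * high T M t)"
  proof -
    have sh: "csummable (\<lambda>x. e2 (- 1/8) * (coef T M x * e2 (t * kap x)))"
      by (rule csummable_bound[OF csummable_coef[OF T M]]) (simp add: norm_mult coef_nonneg)
    have bi: "b x = Im (e2 (- 1/8) * (coef T M x * e2 (t * kap x)))" for x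
    proof -
      have e: "e2 (- 1/8) * (coef T M x * e2 (t * kap x)) = of_real (coef T M x) * e2 (t * kap x + - 1/8)" unfolding e2_add by simp
      have "Im (e2 (- 1/8) * (coef T M x * e2 (t * kap x))) = coef T M x * sin (2 * pi * (t * kap x + - 1/8))"
        unfolding e by (simp add: Im_e2)
      also have "2 * pi * (t * kap x + - 1/8) = 2 * pi * t * kap x - pi/4" by (simp add: algebra_simps)
      finally show ?thesis by (simp add: b_def)
    qed
    have "csum b = Im (csum (\<lambda>x. e2 (- 1/8) * (coef T M x * e2 (t * kap x))))" unfolding bi by (rule integral_Im[OF sh])
    then show ?thesis by (simp only: integral_mult_right_zero high_def)
  qed
  have "csum (osc ?h t) = csum a + csum b" unfolding ab[abs_def] by (rule Bochner_Integration.integral_add[OF sa(2) sb])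
  then have "\<bar>csum (osc ?h t) - (\<Sum>x\<in>low M. ?s x)\<bar> \<le> \<bar>csum b\<bar> + \<bar>(\<Sum>x\<in>low M. osc ?h t x) - (\<Sum>x\<in>low M. ?s x)\<bar>"
    unfolding sa by linarith
  also have "\<bar>csum b\<bar> \<le> norm (high T M t)"
    unfolding b_high using abs_Im_le_cmod[of "e2 (- 1/8) * high T M t"] by (simp add: norm_mult)
  also have "\<bar>(\<Sum>x\<in>low M. osc ?h t x) - (\<Sum>x\<in>low M. ?s x)\<bar> \<le> (\<Sum>x\<in>low M. pi / T ^ 4 * M ^ 3 * ?k x)"
    unfolding sum_subtractf[symmetric]
  proof (rule order.trans[OF sum_abs sum_mono])
    fix x assume x: "x \<in> low M"
    then have x0: "x \<noteq> 0" and k: "kap x > 0" "kap x \<le> M" using kap_pos by (auto simp: low_def)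
    let ?e = "exp (- pi * ?h\<^sup>2 * (kap x)\<^sup>2)"
    have e: "0 \<le> 1 - ?e" "1 - ?e \<le> pi * ?h\<^sup>2 * (kap x)\<^sup>2"
      using exp_ge_add_one_self[of "- pi * ?h\<^sup>2 * (kap x)\<^sup>2"] by auto
    have "\<bar>osc ?h t x - ?s x\<bar> = (1 - ?e) * (kap x powr (-3/2) * \<bar>sin (2 * pi * t * kap x - pi/4)\<bar>)"
    proof -
      have "osc ?h t x - ?s x = - ((1 - ?e) * (kap x powr (-3/2) * sin (2 * pi * t * kap x - pi/4)))"
        using x0 by (simp add: osc_def algebra_simps)
      then show ?thesis using e(1) by (simp only: abs_minus_cancel abs_mult) simp
    qed
    also have "\<dots> \<le> (pi * ?h\<^sup>2 * (kap x)\<^sup>2) * (kap x powr (-3/2) * 1)" using e by (intro mult_mono mult_left_mono) auto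
    also have "\<dots> = pi / T ^ 4 * (kap x powr 2 * kap x powr (-3/2))" using k by (simp add: powr_numeral power_divide flip: power_mult)
    also have "kap x powr 2 * kap x powr (-3/2) = kap x powr (2 + -3/2)" by (rule powr_add[symmetric])
    also have "kap x powr (2 + -3/2) = kap x powr (3 + - (5/2))" by simp
    also have "\<dots> = kap x powr 3 * kap x powr (- (5/2))" by (rule powr_add)
    also have "\<dots> \<le> M ^ 3 * kap x powr (- (5/2))" using k by (intro mult_right_mono) (auto simp: powr_numeral intro!: power_mono)
    finally show "\<bar>osc ?h t x - ?s x\<bar> \<le> pi / T ^ 4 * M ^ 3 * ?k x"
      using x0 T by (simp add: divide_right_mono mult_left_mono mult.assoc)
  qed
  also have "(\<Sum>x\<in>low M. pi / T ^ 4 * M ^ 3 * ?k x) = pi / T ^ 4 * M ^ 3 * (\<Sum>x\<in>low M. ?k x)"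
    by (simp add: sum_distrib_left)
  also have "pi / T ^ 4 * M ^ 3 * (\<Sum>x\<in>low M. ?k x) \<le> pi / T ^ 4 * M ^ 3 * csum ?k"
  proof (rule mult_left_mono)
    show "(\<Sum>x\<in>low M. ?k x) \<le> csum ?k" unfolding csum_finite_support(1)[OF finite_low, symmetric]
      by (intro Bochner_Integration.integral_mono csum_finite_support(2)[OF finite_low] sk) auto
  qed (use T M in simp)
  finally show ?thesis by simp
qed

lemma borel_measurable_rem [measurable]: "rem \<in> borel_measurable borel"
proof -
  have "mono cnt" unfolding cnt_def mono_def by (auto intro!: card_mono finite_nm_le)
  then have [measurable]: "cnt \<in> borel_measurable borel" by (rule borel_measurable_mono)
  show ?thesis unfolding rem_def[abs_def] by measurable
qed

lemma borel_measurable_trig_sum [measurable]: "trig_sum M \<in> borel_measurable borel" unfolding trig_sum_def[abs_def] by measurable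

text \<open>Three errors: \<open>a\<close> from smoothing the count, \<open>b\<close> from the
  Bessel remainder, \<open>c\<close> from cutting the sum at M. The last one dominates; M \<le> T
  keeps M^3 / T^4 and the negative powers of T below it.\<close>

lemma mean_square_rem:
  "\<exists>C\<ge>0. \<forall>T M. \<beta> + 1 \<le> T \<longrightarrow> 1 \<le> M \<longrightarrow> M \<le> T \<longrightarrow>
     integrable lborel (\<lambda>t. indicator {T..2 * T + 1} t * (rem t - trig_sum M t)\<^sup>2) \<and>
     (LINT t|lborel. indicator {T..2 * T + 1} t * (rem t - trig_sum M t)\<^sup>2) \<le> C * T * M powr (- (1/8))"
proof -
  let ?k = "\<lambda>x. if x = 0 then 0 else kap x powr (- (5/2))"
  have k0: "csum ?k \<ge> 0" by (simp add: integral_nonneg_AE)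
  obtain A where A: "A \<ge> 0" "\<And>h T. 0 < h \<Longrightarrow> h \<le> 1 \<Longrightarrow> 1 \<le> T \<Longrightarrow> integrable lborel (\<lambda>t. indicator {T..2 * T + 1} t * csum (tail h t)) \<and>
     (LINT t|lborel. indicator {T..2 * T + 1} t * csum (tail h t)) \<le> A * h * T powr (5/2)" using integral_csum_tail by blast
  obtain B where B: "B \<ge> 0" "\<And>h r. 0 < h \<Longrightarrow> h \<le> 1 \<Longrightarrow> 0 \<le> r \<Longrightarrow> csum (tail h r) \<le> B * (r + 1)"
    using csum_tail_linear by blast
  obtain D where D: "\<And>h t. 0 < h \<Longrightarrow> 0 < t \<Longrightarrow> \<bar>smooth_count h t - pi * t\<^sup>2 / \<beta> - sqrt t / (pi * \<beta>) * csum (osc h t)\<bar> \<le> D / sqrt t"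
    using smooth_count_asymptotics by blast
  obtain E where E: "E \<ge> 0" "\<And>T M. \<beta> + 1 \<le> T \<Longrightarrow> 1 \<le> T \<Longrightarrow> 1 \<le> M \<Longrightarrow> integrable lborel (\<lambda>t. indicator {T..2 * T + 1} t * (norm (high T M t))\<^sup>2) \<and>
     (LINT t|lborel. indicator {T..2 * T + 1} t * (norm (high T M t))\<^sup>2) \<le> E * T * M powr (- (1/8))"
    using mean_square_high by blast
  define c1 c2 c3 where "c1 = 4 * (8 * B)" and "c2 = 4 * (D\<^sup>2 + (csum ?k / \<beta>)\<^sup>2)" and "c3 = 4 * (1 / (pi * \<beta>))\<^sup>2"
  have c0: "c1 \<ge> 0" "c2 \<ge> 0" "c3 \<ge> 0" using B(1) by (simp_all add: c1_def c2_def c3_def)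
  show ?thesis
  proof (intro exI[of _ "c1 * A + 2 * c2 + c3 * E"] conjI allI impI)
    show "0 \<le> c1 * A + 2 * c2 + c3 * E" using c0 A(1) E(1) by (intro add_nonneg_nonneg mult_nonneg_nonneg) auto
    fix T M :: real assume T: "\<beta> + 1 \<le> T" and M: "1 \<le> M" "M \<le> T"
    have T1: "1 \<le> T" and T0: "0 < T" using T beta_pos by linarith+
    \<comment> \<open>With this width the averaged smoothing error h T^(5/2) is T^(1/2), hence at
      most T^(7/8) \<le> T M^(-1/8).\<close>
    define h where "h = 1 / T\<^sup>2"
    have h: "0 < h" "h \<le> 1" using T1 by (auto simp: h_def power2_eq_square mult_ge1_I)
    let ?I = "indicator {T..2 * T + 1} :: real \<Rightarrow> real"
    define R where "R t = c1 * (?I t * csum (tail h t)) + c2 / T * ?I t + c3 * (?I t * (norm (high T M t))\<^sup>2)" for t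
    have le: "?I t * (rem t - trig_sum M t)\<^sup>2 \<le> R t" for t
    proof (cases "t \<in> {T..2 * T + 1}")
      case False then show ?thesis by (simp add: R_def)
    next
      case True
      then have t: "T \<le> t" "1 \<le> t" "0 < t" using T1 by auto
      define a where "a = (cnt t - smooth_count h t) / sqrt t"
      define b where "b = (smooth_count h t - pi * t\<^sup>2 / \<beta> - sqrt t / (pi * \<beta>) * csum (osc h t)) / sqrt t"
      define c where "c = 1 / (pi * \<beta>) * (csum (osc h t) - (\<Sum>x\<in>low M. kap x powr (-3/2) * sin (2 * pi * t * kap x - pi/4)))"
      have st: "sqrt t > 0" "(sqrt t)\<^sup>2 = t" using t by auto
      have split: "rem t - trig_sum M t = a + b + c"
      proof -
        have "sqrt t / (pi * \<beta>) * csum (osc h t) / sqrt t = 1 / (pi * \<beta>) * csum (osc h t)" using st by simp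
        then show ?thesis unfolding a_def b_def c_def rem_def trig_sum_def diff_divide_distrib right_diff_distrib by linarith
      qed
      have tl0: "csum (tail h t) \<ge> 0" by (simp add: integral_nonneg_AE tail_def)
      \<comment> \<open>One factor of the squared tail sum is estimated by the linear bound and
        cancels the division by t; the other is kept for the average over t.\<close>
      have a2: "a\<^sup>2 \<le> 8 * B * csum (tail h t)"
      proof -
        have "\<bar>cnt t - smooth_count h t\<bar>\<^sup>2 \<le> (2 * csum (tail h t))\<^sup>2"
          using cnt_smooth_diff[OF h(1), of t] t by (intro power_mono) auto
        then have "(cnt t - smooth_count h t)\<^sup>2 \<le> 4 * csum (tail h t) * csum (tail h t)" by (simp add: power2_eq_square)
        also have "\<dots> \<le> 4 * csum (tail h t) * (B * (2 * t))"
        proof -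
          have "csum (tail h t) \<le> B * (t + 1)" using B(2)[OF h] t by simp
          also have "\<dots> \<le> B * (2 * t)" using B(1) t by (intro mult_left_mono) auto
          finally show ?thesis using tl0 by (intro mult_left_mono) auto
        qed
        finally have "(cnt t - smooth_count h t)\<^sup>2 / t \<le> 4 * csum (tail h t) * (B * (2 * t)) / t" using t by (intro divide_right_mono) auto
        also have "\<dots> = 8 * B * csum (tail h t)" using t by simp
        finally show ?thesis unfolding a_def power_divide st .
      qed
      have b2: "b\<^sup>2 \<le> D\<^sup>2 / T"
      proof -
        have "\<bar>b\<bar> = \<bar>smooth_count h t - pi * t\<^sup>2 / \<beta> - sqrt t / (pi * \<beta>) * csum (osc h t)\<bar> / sqrt t"
          unfolding b_def using st by simp
        also have "\<dots> \<le> D / sqrt t / sqrt t" using D[OF h(1) t(3)] st by (intro divide_right_mono) auto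
        also have "\<dots> = D / t" using st by (simp add: power2_eq_square)
        finally have bd: "\<bar>b\<bar> \<le> D / t" .
        then have "\<bar>b\<bar>\<^sup>2 \<le> (D / t)\<^sup>2" by (intro power_mono) auto
        also have "\<dots> = D\<^sup>2 / (t * t)" by (simp add: power_divide power2_eq_square)
        also have "\<dots> \<le> D\<^sup>2 / (T * 1)" using t T0 by (intro divide_left_mono mult_mono) auto
        finally show ?thesis by simp
      qed
      have c2': "c\<^sup>2 \<le> 2 * (1 / (pi * \<beta>))\<^sup>2 * (norm (high T M t))\<^sup>2 + 2 * ((csum ?k / \<beta>)\<^sup>2 / T)"
      proof -
        define w where "w = pi / T ^ 4 * M ^ 3 * csum ?k"
        have "\<bar>c\<bar> = 1 / (pi * \<beta>) * \<bar>csum (osc h t) - (\<Sum>x\<in>low M. kap x powr (-3/2) * sin (2 * pi * t * kap x - pi/4))\<bar>"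
          unfolding c_def abs_mult using beta_pos by simp
        also have "\<dots> \<le> 1 / (pi * \<beta>) * (norm (high T M t) + w)"
          using osc_split[OF T0 M(1), of t] beta_pos unfolding w_def h_def by (intro mult_left_mono) auto
        finally have "\<bar>c\<bar> \<le> 1 / (pi * \<beta>) * (norm (high T M t) + w)" .
        then have "\<bar>c\<bar>\<^sup>2 \<le> (1 / (pi * \<beta>) * (norm (high T M t) + w))\<^sup>2" by (intro power_mono) auto
        also have "\<dots> = (1 / (pi * \<beta>))\<^sup>2 * (norm (high T M t) + w)\<^sup>2" by (rule power_mult_distrib)
        also have "\<dots> \<le> (1 / (pi * \<beta>))\<^sup>2 * (2 * (norm (high T M t))\<^sup>2 + 2 * w\<^sup>2)"
          using zero_le_power2[of "norm (high T M t) - w"] by (intro mult_left_mono) (auto simp: power2_sum power2_diff)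
        also have "\<dots> = 2 * (1 / (pi * \<beta>))\<^sup>2 * (norm (high T M t))\<^sup>2 + 2 * (1 / (pi * \<beta>) * w)\<^sup>2"
          by (simp add: power_mult_distrib power_divide distrib_left)
        also have "(1 / (pi * \<beta>) * w)\<^sup>2 \<le> (csum ?k / \<beta>)\<^sup>2 / T"
        proof -
          have "1 / (pi * \<beta>) * w = M ^ 3 / T ^ 4 * (csum ?k / \<beta>)" by (simp add: w_def)
          moreover have "M ^ 3 / T ^ 4 \<le> 1 / T"
          proof -
            have "M ^ 3 \<le> T ^ 3" using M by (intro power_mono) auto
            then have "M ^ 3 / T ^ 4 \<le> T ^ 3 / T ^ 4" using T0 by (intro divide_right_mono) auto
            also have "\<dots> = 1 / T" using T0 by (simp add: power_numeral_reduce)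
            finally show ?thesis .
          qed
          ultimately have "1 / (pi * \<beta>) * w \<le> 1 / T * (csum ?k / \<beta>)"
            using k0 beta_pos by (simp only:) (intro mult_right_mono, auto)
          moreover have "0 \<le> 1 / (pi * \<beta>) * w" using k0 beta_pos T0 M by (simp add: w_def)
          ultimately have "(1 / (pi * \<beta>) * w)\<^sup>2 \<le> (1 / T * (csum ?k / \<beta>))\<^sup>2" by (intro power_mono)
          also have "\<dots> = (csum ?k / \<beta>)\<^sup>2 / (T * T)" by (simp add: power_mult_distrib power_divide power2_eq_square)
          also have "\<dots> \<le> (csum ?k / \<beta>)\<^sup>2 / (T * 1)" using T1 by (intro divide_left_mono mult_left_mono) auto
          finally show ?thesis by simp
        qed
        finally show ?thesis by simp
      qed
      have "(a + b + c)\<^sup>2 \<le> 4 * a\<^sup>2 + 4 * b\<^sup>2 + 2 * c\<^sup>2"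
        using zero_le_power2[of "a - b"] zero_le_power2[of "a + b - c"] by (simp add: power2_sum power2_diff algebra_simps)
      also have "\<dots> \<le> 4 * (8 * B * csum (tail h t)) + 4 * (D\<^sup>2 / T) + 2 * (2 * (1 / (pi * \<beta>))\<^sup>2 * (norm (high T M t))\<^sup>2 + 2 * ((csum ?k / \<beta>)\<^sup>2 / T))"
        using a2 b2 c2' by (intro add_mono mult_left_mono) auto
      also have "\<dots> = c1 * csum (tail h t) + c2 / T + c3 * (norm (high T M t))\<^sup>2"
        by (simp add: c1_def c2_def c3_def add_divide_distrib algebra_simps)
      finally show ?thesis using True by (simp add: R_def split)
    qed
    have iI: "integrable lborel ?I" "(LINT t|lborel. ?I t) = T + 1" using T0 by (auto intro!: integrable_real_indicator)
    have A': "integrable lborel (\<lambda>t. ?I t * csum (tail h t))" "(LINT t|lborel. ?I t * csum (tail h t)) \<le> A * h * T powr (5/2)"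
      using A(2)[OF h T1] by auto
    have E': "integrable lborel (\<lambda>t. ?I t * (norm (high T M t))\<^sup>2)" "(LINT t|lborel. ?I t * (norm (high T M t))\<^sup>2) \<le> E * T * M powr (- (1/8))"
      using E(2)[OF T T1 M(1)] by auto
    have iR: "integrable lborel R" unfolding R_def by (intro Bochner_Integration.integrable_add integrable_mult_right A'(1) iI(1) E'(1))
    have R0: "R t \<ge> 0" for t using le[of t] by (rule order.trans[rotated]) simp
    show int: "integrable lborel (\<lambda>t. ?I t * (rem t - trig_sum M t)\<^sup>2)"
      by (rule Bochner_Integration.integrable_bound[OF iR]) (use le R0 in auto)
    have Mp: "T powr (- (1/8)) \<le> M powr (- (1/8))" using M by (intro powr_mono2') auto
    have "(LINT t|lborel. ?I t * (rem t - trig_sum M t)\<^sup>2) \<le> (LINT t|lborel. R t)"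
      by (intro Bochner_Integration.integral_mono int iR le)
    also have "\<dots> = c1 * (LINT t|lborel. ?I t * csum (tail h t)) + c2 / T * (T + 1) + c3 * (LINT t|lborel. ?I t * (norm (high T M t))\<^sup>2)"
      unfolding R_def using A'(1) E'(1) iI by (simp add: Bochner_Integration.integral_add)
    also have "\<dots> \<le> c1 * (A * h * T powr (5/2)) + c2 * 2 + c3 * (E * T * M powr (- (1/8)))"
    proof (intro add_mono mult_left_mono A'(2) E'(2) c0)
      have "c2 / T * (T + 1) \<le> c2 / T * (T + T)" using T1 c0 by (intro mult_left_mono) auto
      also have "\<dots> = c2 * 2" using T0 by simp
      finally show "c2 / T * (T + 1) \<le> c2 * 2" .
    qed
    also have "\<dots> \<le> c1 * (A * (T * M powr (- (1/8)))) + c2 * 2 * (T * M powr (- (1/8))) + c3 * (E * T * M powr (- (1/8)))"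
    proof -
      have "h * T powr (5/2) = T powr (5/2) / T powr 2" using T0 by (simp add: h_def powr_numeral)
      also have "\<dots> = T powr (5/2 - 2)" by (rule powr_diff[symmetric])
      also have "\<dots> \<le> T powr (1 + - (1/8))" using T1 by (intro powr_mono) auto
      also have "\<dots> = T * T powr (- (1/8))" unfolding powr_add using T0 by simp
      also have "\<dots> \<le> T * M powr (- (1/8))" using Mp T0 by (intro mult_left_mono) auto
      finally have 1: "h * T powr (5/2) \<le> T * M powr (- (1/8))" .
      have "1 \<le> T powr (1 + - (1/8))" using T1 by (intro ge_one_powr_ge_zero) auto
      also have "\<dots> = T * T powr (- (1/8))" unfolding powr_add using T0 by simp
      also have "\<dots> \<le> T * M powr (- (1/8))" using Mp T0 by (intro mult_left_mono) auto
      finally have 2: "1 \<le> T * M powr (- (1/8))" .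
      have "c2 * 2 * 1 \<le> c2 * 2 * (T * M powr (- (1/8)))" using 2 c0 by (intro mult_left_mono) auto
      then have 3: "c2 * 2 \<le> c2 * 2 * (T * M powr (- (1/8)))" by (simp only: mult_1_right)
      have "c1 * (A * h * T powr (5/2)) \<le> c1 * (A * (T * M powr (- (1/8))))"
        unfolding mult.assoc[of A] using 1 c0 A(1) by (intro mult_left_mono) auto
      then show ?thesis using 3 by (intro add_mono order.refl)
    qed
    also have "\<dots> = (c1 * A + 2 * c2 + c3 * E) * T * M powr (- (1/8))" by (simp add: algebra_simps)
    finally show "(LINT t|lborel. ?I t * (rem t - trig_sum M t)\<^sup>2) \<le> (c1 * A + 2 * c2 + c3 * E) * T * M powr (- (1/8))" .
  qed
qed

end

section \<open>Variance\<close>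

lemma DERIV_Si: "t > 0 \<Longrightarrow> (Si has_real_derivative sin t / t) (at t)"
proof -
  assume t: "t > 0"
  have "(Si has_vector_derivative sinc t) (at t within {0..t + 1})"
  proof -
    have *: "Si u = integral {0..u} sinc" if "u \<in> {0..t + 1}" for u
    proof -
      have i: "set_integrable lborel {0..u} sinc" by (intro borel_integrable_atLeastAtMost' continuous_intros)
      have "Si u = (LBINT x=ereal 0..ereal u. sinc x)" unfolding Si_alt_def by (simp add: zero_ereal_def)
      also have "\<dots> = (LBINT x:{0..u}. sinc x)" using that by (subst interval_integral_Icc) auto
      finally show ?thesis using set_borel_integral_eq_integral(2)[OF i] by simp
    qed
    have "((\<lambda>u. integral {0..u} sinc) has_vector_derivative sinc t) (at t within {0..t + 1})"
      by (rule integral_has_vector_derivative) (use t in \<open>auto intro!: continuous_intros\<close>)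
    then show ?thesis by (rule has_vector_derivative_transform[rotated 2]) (use t * in auto)
  qed
  then have "(Si has_vector_derivative sinc t) (at t)" using t by (subst (asm) at_within_interior) (auto simp: interior_atLeastAtMost_real)
  then show ?thesis using t by (simp add: has_real_derivative_iff_has_vector_derivative)
qed

lemma Si_0: "Si 0 = 0" unfolding Si_def zero_ereal_def by (rule interval_integral_endpoints_same)

context planar
begin

text \<open>The profile of the variance: kap^(-3) sin^2 (pi r kap) equals r^3
  \<open>wt (r * kap x)\<close>.\<close>

definition wt :: "real \<Rightarrow> real" where "wt v = (sin (pi * v))\<^sup>2 / v ^ 3"
definition wt' :: "real \<Rightarrow> real" where
  "wt' v = (2 * pi * sin (pi * v) * cos (pi * v) * v - 3 * (sin (pi * v))\<^sup>2) / v ^ 4"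

lemma DERIV_wt: "v > 0 \<Longrightarrow> (wt has_real_derivative wt' v) (at v)"
proof -
  assume v: "v > 0"
  have "(wt has_real_derivative (2 * sin (pi * v) * (cos (pi * v) * pi) * v ^ 3 - (sin (pi * v))\<^sup>2 * (3 * v\<^sup>2)) / (v ^ 3 * v ^ 3)) (at v)"
    unfolding wt_def[abs_def] using v by (auto intro!: derivative_eq_intros)
  moreover have "2 * sin (pi * v) * (cos (pi * v) * pi) * v ^ 3 - (sin (pi * v))\<^sup>2 * (3 * v\<^sup>2) =
      v\<^sup>2 * (2 * pi * sin (pi * v) * cos (pi * v) * v - 3 * (sin (pi * v))\<^sup>2)"
    by (simp add: power2_eq_square power3_eq_cube algebra_simps)
  moreover have "v ^ 3 * v ^ 3 = v\<^sup>2 * v ^ 4" by (simp flip: power_add)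
  ultimately have "(wt has_real_derivative (v\<^sup>2 * (2 * pi * sin (pi * v) * cos (pi * v) * v - 3 * (sin (pi * v))\<^sup>2)) / (v\<^sup>2 * v ^ 4)) (at v)"
    by (simp only:)
  then show ?thesis unfolding wt'_def using v by (subst (asm) mult_divide_mult_cancel_left) auto
qed

lemma abs_sin_pi_le: "v \<ge> 0 \<Longrightarrow> \<bar>sin (pi * v)\<bar> \<le> pi * v"
  using abs_sin_x_le_abs_x[of "pi * v"] by (simp add: abs_mult)

text \<open>The singularity at 0 is of the order that the quadratic bound on the number of nonzero
  lattice points can absorb.\<close>

lemma wt'_bound: "v > 0 \<Longrightarrow> \<bar>wt' v\<bar> \<le> 5 * pi\<^sup>2 / v\<^sup>2"
proof -
  assume v: "v > 0"
  have s: "\<bar>sin (pi * v)\<bar> \<le> pi * v" using v by (intro abs_sin_pi_le) auto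
  then have s2: "(sin (pi * v))\<^sup>2 \<le> (pi * v)\<^sup>2" using v by (simp add: abs_le_square_iff[symmetric])
  have "\<bar>2 * pi * sin (pi * v) * cos (pi * v) * v\<bar> = 2 * pi * (\<bar>sin (pi * v)\<bar> * \<bar>cos (pi * v)\<bar>) * v"
    using v by (simp add: abs_mult)
  also have "\<dots> \<le> 2 * pi * (pi * v * 1) * v" using v s by (intro mult_right_mono mult_left_mono mult_mono) auto
  finally have "\<bar>2 * pi * sin (pi * v) * cos (pi * v) * v\<bar> \<le> 2 * (pi * v)\<^sup>2" by (simp add: power2_eq_square mult_ac)
  then have "\<bar>2 * pi * sin (pi * v) * cos (pi * v) * v - 3 * (sin (pi * v))\<^sup>2\<bar> \<le> 5 * (pi * v)\<^sup>2"
    using s2 zero_le_power2[of "sin (pi * v)"] by linarith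
  then have "\<bar>wt' v\<bar> \<le> 5 * (pi * v)\<^sup>2 / v ^ 4" unfolding wt'_def using v by (simp add: divide_right_mono)
  also have "\<dots> = 5 * pi\<^sup>2 / v\<^sup>2" using v by (simp add: power_mult_distrib power_numeral_reduce power2_eq_square)
  finally show ?thesis .
qed

text \<open>Without the origin there is no lattice point of norm below \<open>lc\<close>, so the
  linear and constant errors of the count can be absorbed into r^2 down to r = 0.\<close>

lemma cnt_quadratic: "\<exists>C\<ge>0. \<forall>r>0. 0 \<le> cnt r - 1 \<and> cnt r - 1 \<le> C * r\<^sup>2"
proof -
  obtain C where C: "C \<ge> 0" "\<And>t. t \<ge> 0 \<Longrightarrow> \<bar>cnt t - pi * t\<^sup>2 / \<beta>\<bar> \<le> C * (t + 1)"
    using cnt_asymptotics by blast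
  define D where "D = pi / \<beta> + C * (1 / lc + 1 / lc\<^sup>2)"
  have D0: "D \<ge> 0" unfolding D_def using beta_pos lc_pos C(1) by (intro add_nonneg_nonneg mult_nonneg_nonneg) auto
  have "0 \<le> cnt r - 1 \<and> cnt r - 1 \<le> D * r\<^sup>2" if r: "r > 0" for r
  proof (cases "r < lc")
    case True
    have "{x. nm x \<le> r} = {0}" using nm_ge_lc True r by force
    then show ?thesis using D0 by (simp add: cnt_def)
  next
    case False
    have "card {0::int\<times>int} \<le> card {x. nm x \<le> r}" using r by (intro card_mono finite_nm_le) auto
    then have 1: "0 \<le> cnt r - 1" by (simp add: cnt_def)
    have "r \<le> r\<^sup>2 / lc" "1 \<le> r\<^sup>2 / lc\<^sup>2"
      using False lc_pos r mult_left_mono[of lc r r] power_mono[of lc r 2] by (simp_all add: field_simps power2_eq_square)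
    then have "C * (r + 1) \<le> C * (r\<^sup>2 / lc + r\<^sup>2 / lc\<^sup>2)" using C(1) by (intro mult_left_mono) auto
    moreover have "cnt r \<le> pi * r\<^sup>2 / \<beta> + C * (r + 1)" using C(2)[of r] r by linarith
    ultimately have "cnt r - 1 \<le> pi * r\<^sup>2 / \<beta> + C * (r\<^sup>2 / lc + r\<^sup>2 / lc\<^sup>2)" by linarith
    also have "\<dots> = D * r\<^sup>2" by (simp add: D_def algebra_simps)
    finally show ?thesis using 1 by simp
  qed
  then show ?thesis using D0 by blast
qed

lemma card_low: "M \<ge> 0 \<Longrightarrow> real (card (low M)) = cnt (\<beta> * M) - 1"
proof -
  assume M: "M \<ge> 0"
  have "{x. nm x \<le> \<beta> * M} = insert 0 (low M)" "0 \<notin> low M" using beta_pos M by (auto simp: low_def kap_def field_simps)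
  then show ?thesis unfolding cnt_def using finite_low by simp
qed

text \<open>Equal to 2 pi \<beta> times the integral of (sin (pi v) / v)^2 over [0, V], integrated
  by parts.\<close>

definition wlim :: "real \<Rightarrow> real" where
  "wlim V = pi * \<beta> * (2 * pi * Si (2 * pi * V) - 2 * ((sin (pi * V))\<^sup>2 / V))"

lemma wlim_tendsto: "(wlim \<longlongrightarrow> pi ^ 3 * \<beta>) at_top"
proof -
  have "((\<lambda>V. Si (2 * pi * V)) \<longlongrightarrow> pi / 2) at_top" by (rule filterlim_compose[OF Si_at_top]) real_asymp
  moreover have "((\<lambda>V. (sin (pi * V))\<^sup>2 / V) \<longlongrightarrow> 0) at_top"
  proof (rule Lim_null_comparison)
    show "\<forall>\<^sub>F V in at_top. norm ((sin (pi * V))\<^sup>2 / V) \<le> 1 / V"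
      using eventually_gt_at_top[of 0] by eventually_elim (auto intro!: divide_right_mono simp: abs_square_le_1)
    show "((\<lambda>V::real. 1 / V) \<longlongrightarrow> 0) at_top" by real_asymp
  qed
  ultimately have "(wlim \<longlongrightarrow> pi * \<beta> * (2 * pi * (pi / 2) - 2 * 0)) at_top"
    unfolding wlim_def[abs_def] by (intro tendsto_intros)
  then show ?thesis by (simp add: power_numeral_reduce mult_ac)
qed

lemma wt_integral:
  assumes V: "V > 0"
  shows "((\<lambda>t. - wt' t * t\<^sup>2) has_integral (2 * pi * Si (2 * pi * V) - 3 * ((sin (pi * V))\<^sup>2 / V))) {0..V}"
proof -
  define K where "K t = 2 * pi * Si (2 * pi * t) - 3 * ((sin (pi * t))\<^sup>2 / t)" for t
  have "((\<lambda>t. - wt' t * t\<^sup>2) has_integral (K V - K 0)) {0..V}"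
  proof (rule fundamental_theorem_of_calculus_interior)
    \<comment> \<open>At 0 the quotient is 0 by the convention for division; this is also its limit,
      so \<open>K\<close> has no jump.\<close>
    show "continuous_on {0..V} K"
    proof -
      have 1: "continuous_on {0..V} (\<lambda>t. Si (2 * pi * t))"
        by (rule continuous_on_compose2[of UNIV Si]) (auto intro!: continuous_intros continuous_at_imp_continuous_on isCont_Si)
      have 2: "isCont (\<lambda>t. (sin (pi * t))\<^sup>2 / t) u" for u :: real
      proof (cases "u = 0")
        case False then show ?thesis by (intro continuous_intros) auto
      next
        case True
        have "((\<lambda>t. (sin (pi * t))\<^sup>2 / t) \<longlongrightarrow> 0) (at 0)"
        proof (rule Lim_null_comparison)
          show "\<forall>\<^sub>F t in at 0. norm ((sin (pi * t))\<^sup>2 / t) \<le> pi\<^sup>2 * \<bar>t\<bar>"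
          proof (rule always_eventually, rule allI)
            fix t :: real
            have "\<bar>sin (pi * t)\<bar>\<^sup>2 \<le> \<bar>pi * t\<bar>\<^sup>2" by (intro power_mono abs_sin_x_le_abs_x) auto
            then have "(sin (pi * t))\<^sup>2 / \<bar>t\<bar> \<le> pi\<^sup>2 * t\<^sup>2 / \<bar>t\<bar>" by (intro divide_right_mono) (auto simp: power_mult_distrib)
            also have "\<dots> = pi\<^sup>2 * \<bar>t\<bar>" by (cases t "0 :: real" rule: linorder_cases) (auto simp: power2_eq_square)
            finally show "norm ((sin (pi * t))\<^sup>2 / t) \<le> pi\<^sup>2 * \<bar>t\<bar>" by simp
          qed
          show "((\<lambda>t. pi\<^sup>2 * \<bar>t\<bar>) \<longlongrightarrow> 0) (at 0)" by (auto intro!: tendsto_eq_intros)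
        qed
        then show ?thesis using True by (simp add: isCont_def)
      qed
      show ?thesis unfolding K_def by (intro continuous_intros 1 continuous_at_imp_continuous_on ballI 2)
    qed
    fix t assume t: "t \<in> {0<..<V}"
    then have t0: "t > 0" by simp
    have d1: "((\<lambda>t. Si (2 * pi * t)) has_real_derivative (sin (2 * pi * t) / (2 * pi * t)) * (2 * pi)) (at t)"
      by (rule DERIV_chain2[OF DERIV_Si]) (use t0 in \<open>auto intro!: derivative_eq_intros\<close>)
    have d2: "((\<lambda>t. (sin (pi * t))\<^sup>2 / t) has_real_derivative (2 * pi * sin (pi * t) * cos (pi * t) * t - (sin (pi * t))\<^sup>2) / t\<^sup>2) (at t)"
      using t0 by (auto intro!: derivative_eq_intros simp: field_simps power2_eq_square)
    have "(K has_real_derivative 2 * pi * ((sin (2 * pi * t) / (2 * pi * t)) * (2 * pi)) - 3 * ((2 * pi * sin (pi * t) * cos (pi * t) * t - (sin (pi * t))\<^sup>2) / t\<^sup>2)) (at t)"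
      unfolding K_def by (intro DERIV_diff DERIV_cmult d1 d2)
    moreover have "2 * pi * ((sin (2 * pi * t) / (2 * pi * t)) * (2 * pi)) - 3 * ((2 * pi * sin (pi * t) * cos (pi * t) * t - (sin (pi * t))\<^sup>2) / t\<^sup>2) = - wt' t * t\<^sup>2"
    proof -
      have "sin (2 * pi * t) = 2 * sin (pi * t) * cos (pi * t)" using sin_double[of "pi * t"] by (simp add: mult.assoc)
      moreover have "2 * pi * ((2 * s * c / (2 * pi * t)) * (2 * pi)) - 3 * ((2 * pi * s * c * t - s\<^sup>2) / t\<^sup>2)
          = - ((2 * pi * s * c * t - 3 * s\<^sup>2) / t ^ 4) * t\<^sup>2" for s c :: real
      proof -
        have "2 * pi * ((2 * s * c / (2 * pi * t)) * (2 * pi)) = 4 * pi * s * c * t / t\<^sup>2" using t0 by (simp add: power2_eq_square)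
        moreover have "((2 * pi * s * c * t - 3 * s\<^sup>2) / t ^ 4) * t\<^sup>2 = (2 * pi * s * c * t - 3 * s\<^sup>2) / t\<^sup>2"
          using t0 by (simp add: power4_eq_xxxx power2_eq_square)
        moreover have "4 * pi * s * c * t / t\<^sup>2 - 3 * ((2 * pi * s * c * t - s\<^sup>2) / t\<^sup>2) = - ((2 * pi * s * c * t - 3 * s\<^sup>2) / t\<^sup>2)"
          unfolding times_divide_eq_right diff_divide_distrib[symmetric] minus_divide_left by (rule arg_cong[of _ _ "\<lambda>x. x / t\<^sup>2"]) (simp add: algebra_simps)
        ultimately show ?thesis by simp
      qed
      ultimately show ?thesis unfolding wt'_def by simp
    qed
    ultimately show "(K has_vector_derivative - wt' t * t\<^sup>2) (at t)" by (simp add: has_real_derivative_iff_has_vector_derivative)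
  qed (use V in auto)
  then show ?thesis by (simp add: K_def Si_0)
qed

text \<open>Abel summation writes the sum as an integral of - wt' against the counting function. The
  rescaled counting function tends to pi \<beta> t^2, and its quadratic bound together with the
  bound on \<open>wt'\<close> makes the integrand bounded, so dominated convergence applies.\<close>

lemma wt_sum_limit:
  fixes r :: "nat \<Rightarrow> real"
  assumes r: "\<And>n. r n > 0" "r \<longlonglongrightarrow> 0" and V: "V > 0"
  shows "(\<lambda>n. (r n)\<^sup>2 * (\<Sum>x\<in>low (V / r n). wt (r n * kap x))) \<longlonglongrightarrow> wlim V"
proof -
  obtain C where C: "C \<ge> 0" "\<And>t. t > 0 \<Longrightarrow> 0 \<le> cnt t - 1 \<and> cnt t - 1 \<le> C * t\<^sup>2"
    using cnt_quadratic by blast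
  obtain D where D: "D \<ge> 0" "\<And>t. t \<ge> 0 \<Longrightarrow> \<bar>cnt t - pi * t\<^sup>2 / \<beta>\<bar> \<le> D * (t + 1)"
    using cnt_asymptotics by blast
  \<comment> \<open>The number of nonzero lattice points with r kap \<le> t, in the scaling in which
    it has a limit.\<close>
  define a where "a n t = (r n)\<^sup>2 * (cnt (\<beta> * (t / r n)) - 1)" for n t
  have a_lim: "(\<lambda>n. a n t) \<longlonglongrightarrow> pi * \<beta> * t\<^sup>2" if t: "t > 0" for t
  proof -
    have "(\<lambda>n. a n t - pi * \<beta> * t\<^sup>2) \<longlonglongrightarrow> 0"
    proof (rule Lim_null_comparison)
      show "\<forall>\<^sub>F n in sequentially. norm (a n t - pi * \<beta> * t\<^sup>2) \<le> D * (\<beta> * t * r n + (r n)\<^sup>2) + (r n)\<^sup>2"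
      proof (rule always_eventually, rule allI)
        fix n
        define u where "u = \<beta> * (t / r n)"
        have u: "u \<ge> 0" using t r(1)[of n] beta_pos by (simp add: u_def)
        have ru: "(r n)\<^sup>2 * (pi * u\<^sup>2 / \<beta>) = pi * \<beta> * t\<^sup>2" "(r n)\<^sup>2 * u = \<beta> * t * r n"
          using r(1)[of n] beta_pos by (simp_all add: u_def power2_eq_square)
        have "a n t - pi * \<beta> * t\<^sup>2 = (r n)\<^sup>2 * (cnt u - pi * u\<^sup>2 / \<beta>) - (r n)\<^sup>2"
          unfolding a_def u_def[symmetric] ru(1)[symmetric] by (simp add: algebra_simps)
        then have "\<bar>a n t - pi * \<beta> * t\<^sup>2\<bar> \<le> (r n)\<^sup>2 * \<bar>cnt u - pi * u\<^sup>2 / \<beta>\<bar> + (r n)\<^sup>2"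
          using abs_triangle_ineq4[of "(r n)\<^sup>2 * (cnt u - pi * u\<^sup>2 / \<beta>)" "(r n)\<^sup>2"] by (simp add: abs_mult)
        also have "\<dots> \<le> (r n)\<^sup>2 * (D * (u + 1)) + (r n)\<^sup>2" using D(2)[OF u] by (intro add_right_mono mult_left_mono) auto
        also have "(r n)\<^sup>2 * (D * (u + 1)) = D * ((r n)\<^sup>2 * u + (r n)\<^sup>2)" by (simp add: algebra_simps)
        finally show "norm (a n t - pi * \<beta> * t\<^sup>2) \<le> D * (\<beta> * t * r n + (r n)\<^sup>2) + (r n)\<^sup>2" unfolding ru by simp
      qed
      have "(\<lambda>n. D * (\<beta> * t * r n + (r n)\<^sup>2) + (r n)\<^sup>2) \<longlonglongrightarrow> D * (\<beta> * t * 0 + 0\<^sup>2) + 0\<^sup>2"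
        by (intro tendsto_intros r(2))
      then show "(\<lambda>n. D * (\<beta> * t * r n + (r n)\<^sup>2) + (r n)\<^sup>2) \<longlonglongrightarrow> 0" by simp
    qed
    then show ?thesis by (rule LIM_zero_cancel)
  qed
  have a_bound: "0 \<le> a n t" "a n t \<le> C * \<beta>\<^sup>2 * t\<^sup>2" if t: "t > 0" for n t
  proof -
    have u: "\<beta> * (t / r n) > 0" using t r(1)[of n] beta_pos by simp
    show "0 \<le> a n t" unfolding a_def using C(2)[OF u] by simp
    have "a n t \<le> (r n)\<^sup>2 * (C * (\<beta> * (t / r n))\<^sup>2)" unfolding a_def using C(2)[OF u] by (intro mult_left_mono) auto
    also have "\<dots> = C * \<beta>\<^sup>2 * t\<^sup>2" using r(1)[of n] by (simp add: power_mult_distrib power_divide)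
    finally show "a n t \<le> C * \<beta>\<^sup>2 * t\<^sup>2" .
  qed
  have [measurable]: "wt' \<in> borel_measurable borel" unfolding wt'_def[abs_def] by measurable
  have [measurable]: "cnt \<in> borel_measurable borel"
    by (intro borel_measurable_mono) (auto simp: mono_def cnt_def intro!: card_mono finite_nm_le)
  have [measurable]: "a n \<in> borel_measurable borel" for n unfolding a_def[abs_def] by measurable
  let ?J = "indicator {0<..V} :: real \<Rightarrow> real"
  have Jint: "integrable lborel (\<lambda>t. 5 * pi\<^sup>2 * (C * \<beta>\<^sup>2) * ?J t)" using V by (intro integrable_mult_right integrable_real_indicator) auto
  have dom: "norm (?J t * (- wt' t * a n t)) \<le> 5 * pi\<^sup>2 * (C * \<beta>\<^sup>2) * ?J t" for n t
  proof (cases "t \<in> {0<..V}")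
    case True
    then have t: "t > 0" by simp
    have "\<bar>wt' t\<bar> * a n t \<le> (5 * pi\<^sup>2 / t\<^sup>2) * (C * \<beta>\<^sup>2 * t\<^sup>2)"
      using wt'_bound[OF t] a_bound[OF t] by (intro mult_mono) auto
    also have "\<dots> = 5 * pi\<^sup>2 * (C * \<beta>\<^sup>2)" using t by simp
    finally show ?thesis using True a_bound(1)[OF t] by (simp add: abs_mult)
  qed simp
  \<comment> \<open>Each summand is its value at V plus an integral of - wt'; summing under the
    integral sign counts the points below t.\<close>
  have sum_eq: "(r n)\<^sup>2 * (\<Sum>x\<in>low (V / r n). wt (r n * kap x)) = wt V * a n V + (LINT t|lborel. ?J t * (- wt' t * a n t))" for n
  proof -
    have rn: "r n > 0" by (rule r(1))
    let ?L = "low (V / r n)"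
    have one: "wt (r n * kap x) = wt V + (LINT t|lborel. indicator {r n * kap x..V} t * (- wt' t))"
      and onei: "integrable lborel (\<lambda>t. indicator {r n * kap x..V} t * (- wt' t))" if x: "x \<in> ?L" for x
    proof -
      have u: "0 < r n * kap x" "r n * kap x \<le> V" using x rn kap_pos by (auto simp: low_def field_simps)
      have "(wt' has_integral (wt V - wt (r n * kap x))) {r n * kap x..V}"
      proof (rule fundamental_theorem_of_calculus[OF u(2)])
        fix t assume "t \<in> {r n * kap x..V}"
        then have "t > 0" using u(1) by auto
        then have "(wt has_real_derivative wt' t) (at t within {r n * kap x..V})" by (rule has_field_derivative_at_within[OF DERIV_wt])
        then show "(wt has_vector_derivative wt' t) (at t within {r n * kap x..V})"
          unfolding has_real_derivative_iff_has_vector_derivative .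
      qed
      moreover have si: "set_integrable lborel {r n * kap x..V} wt'"
        using u(1) unfolding wt'_def[abs_def] by (intro borel_integrable_atLeastAtMost' continuous_intros) auto
      ultimately have "(LINT t:{r n * kap x..V}|lborel. wt' t) = wt V - wt (r n * kap x)"
        using set_borel_integral_eq_integral(2)[OF si] by (simp add: integral_unique)
      then show "wt (r n * kap x) = wt V + (LINT t|lborel. indicator {r n * kap x..V} t * (- wt' t))"
        by (simp add: set_lebesgue_integral_def)
      show "integrable lborel (\<lambda>t. indicator {r n * kap x..V} t * (- wt' t))" using si by (simp add: set_integrable_def)
    qed
    have cardt: "(\<Sum>x\<in>?L. indicator {r n * kap x..V} t * (- wt' t)) = ?J t * (- wt' t * (cnt (\<beta> * (t / r n)) - 1))" for t
    proof (cases "t \<in> {0<..V}")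
      case True
      have "(\<Sum>x\<in>?L. indicator {r n * kap x..V} t * (- wt' t)) = (\<Sum>x\<in>low (t / r n). - wt' t)"
      proof (rule sum.mono_neutral_cong_right)
        show "low (t / r n) \<subseteq> ?L" using True rn by (auto simp: low_def field_simps intro: order.trans)
        show "\<forall>x\<in>?L - low (t / r n). indicator {r n * kap x..V} t * (- wt' t) = 0"
          using rn by (auto simp: low_def field_simps split: split_indicator)
        show "indicator {r n * kap x..V} t * (- wt' t) = - wt' t" if "x \<in> low (t / r n)" for x
          using that True rn by (auto simp: low_def field_simps split: split_indicator)
      qed (rule finite_low)
      also have "\<dots> = - wt' t * (cnt (\<beta> * (t / r n)) - 1)" using card_low[of "t / r n"] True rn by simp
      finally show ?thesis using True by simp
    next
      case False
      have "indicator {r n * kap x..V} t * (- wt' t) = 0" if "x \<in> ?L" for x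
      proof -
        have "0 < r n * kap x" using that rn kap_pos by (auto simp: low_def)
        then show ?thesis using False by (auto split: split_indicator)
      qed
      then have z: "(\<Sum>x\<in>?L. indicator {r n * kap x..V} t * (- wt' t)) = 0" by (intro sum.neutral) blast
      show ?thesis unfolding z using False by simp
    qed
    have "(\<Sum>x\<in>?L. wt (r n * kap x)) = (\<Sum>x\<in>?L. wt V) + (\<Sum>x\<in>?L. LINT t|lborel. indicator {r n * kap x..V} t * (- wt' t))"
      unfolding sum.distrib[symmetric] by (intro sum.cong refl one)
    also have "(\<Sum>x\<in>?L. LINT t|lborel. indicator {r n * kap x..V} t * (- wt' t)) = (LINT t|lborel. (\<Sum>x\<in>?L. indicator {r n * kap x..V} t * (- wt' t)))"
      by (rule Bochner_Integration.integral_sum[symmetric]) (rule onei)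
    also have "\<dots> = (LINT t|lborel. ?J t * (- wt' t * (cnt (\<beta> * (t / r n)) - 1)))" unfolding cardt ..
    also have "(\<Sum>x\<in>?L. wt V) = wt V * (cnt (\<beta> * (V / r n)) - 1)" using card_low[of "V / r n"] V rn by simp
    finally have S: "(\<Sum>x\<in>?L. wt (r n * kap x)) = wt V * (cnt (\<beta> * (V / r n)) - 1) + (LINT t|lborel. ?J t * (- wt' t * (cnt (\<beta> * (t / r n)) - 1)))" .
    have "(r n)\<^sup>2 * (\<Sum>x\<in>?L. wt (r n * kap x)) = wt V * a n V + (r n)\<^sup>2 * (LINT t|lborel. ?J t * (- wt' t * (cnt (\<beta> * (t / r n)) - 1)))"
      unfolding S a_def by (simp only: distrib_left mult.left_commute)
    also have "(r n)\<^sup>2 * (LINT t|lborel. ?J t * (- wt' t * (cnt (\<beta> * (t / r n)) - 1))) = (LINT t|lborel. ?J t * (- wt' t * a n t))"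
      by (subst integral_mult_right_zero[symmetric]) (simp add: a_def mult_ac)
    finally show ?thesis .
  qed
  have "(\<lambda>n. LINT t|lborel. ?J t * (- wt' t * a n t)) \<longlonglongrightarrow> (LINT t|lborel. ?J t * (- wt' t * (pi * \<beta> * t\<^sup>2)))"
  proof (rule integral_dominated_convergence[OF _ _ Jint])
    show "AE t in lborel. (\<lambda>n. ?J t * (- wt' t * a n t)) \<longlonglongrightarrow> ?J t * (- wt' t * (pi * \<beta> * t\<^sup>2))"
    proof (rule AE_I2)
      fix t :: real
      show "(\<lambda>n. ?J t * (- wt' t * a n t)) \<longlonglongrightarrow> ?J t * (- wt' t * (pi * \<beta> * t\<^sup>2))"
        by (cases "t \<in> {0<..V}") (auto intro!: tendsto_intros a_lim)
    qed
    show "AE t in lborel. norm (?J t * (- wt' t * a n t)) \<le> 5 * pi\<^sup>2 * (C * \<beta>\<^sup>2) * ?J t" for n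
      by (rule AE_I2) (rule dom)
  qed auto
  moreover have "(LINT t|lborel. ?J t * (- wt' t * (pi * \<beta> * t\<^sup>2))) = pi * \<beta> * (2 * pi * Si (2 * pi * V) - 3 * ((sin (pi * V))\<^sup>2 / V))"
  proof -
    have i: "integrable lborel (\<lambda>t. ?J t * (- wt' t * t\<^sup>2))"
    proof (rule Bochner_Integration.integrable_bound)
      show "integrable lborel (\<lambda>t. 5 * pi\<^sup>2 * ?J t)" using V by (intro integrable_mult_right integrable_real_indicator) auto
      show "AE t in lborel. norm (?J t * (- wt' t * t\<^sup>2)) \<le> norm (5 * pi\<^sup>2 * ?J t)"
      proof (rule AE_I2)
        fix t :: real
        show "norm (?J t * (- wt' t * t\<^sup>2)) \<le> norm (5 * pi\<^sup>2 * ?J t)"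
        proof (cases "t \<in> {0<..V}")
          case True
          then have "\<bar>wt' t\<bar> * t\<^sup>2 \<le> 5 * pi\<^sup>2 / t\<^sup>2 * t\<^sup>2" by (intro mult_right_mono wt'_bound) auto
          then show ?thesis using True by (simp add: abs_mult)
        qed simp
      qed
    qed measurable
    then have si: "set_integrable lborel {0<..V} (\<lambda>t. - wt' t * t\<^sup>2)" by (simp add: set_integrable_def)
    have "((\<lambda>t. - wt' t * t\<^sup>2) has_integral (2 * pi * Si (2 * pi * V) - 3 * ((sin (pi * V))\<^sup>2 / V))) {0<..V}"
      by (rule has_integral_spike_set_eq[THEN iffD1, OF _ _ wt_integral[OF V]]) (rule negligible_subset[of "{0}"]; auto)+
    then have "(LINT t:{0<..V}|lborel. - wt' t * t\<^sup>2) = 2 * pi * Si (2 * pi * V) - 3 * ((sin (pi * V))\<^sup>2 / V)"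
      unfolding set_borel_integral_eq_integral(2)[OF si] by (rule integral_unique)
    then have "(LINT t|lborel. ?J t * (- wt' t * t\<^sup>2)) = 2 * pi * Si (2 * pi * V) - 3 * ((sin (pi * V))\<^sup>2 / V)"
      by (simp add: set_lebesgue_integral_def)
    moreover have "(LINT t|lborel. ?J t * (- wt' t * (pi * \<beta> * t\<^sup>2))) = pi * \<beta> * (LINT t|lborel. ?J t * (- wt' t * t\<^sup>2))"
      by (subst integral_mult_right_zero[symmetric]) (simp add: mult_ac)
    ultimately show ?thesis by simp
  qed
  ultimately have "(\<lambda>n. wt V * a n V + (LINT t|lborel. ?J t * (- wt' t * a n t))) \<longlonglongrightarrow>
      wt V * (pi * \<beta> * V\<^sup>2) + pi * \<beta> * (2 * pi * Si (2 * pi * V) - 3 * ((sin (pi * V))\<^sup>2 / V))"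
    by (intro tendsto_intros a_lim V) simp
  also have "wt V * (pi * \<beta> * V\<^sup>2) + pi * \<beta> * (2 * pi * Si (2 * pi * V) - 3 * ((sin (pi * V))\<^sup>2 / V)) = wlim V"
  proof -
    have "wt V * (pi * \<beta> * V\<^sup>2) = pi * \<beta> * ((sin (pi * V))\<^sup>2 / V)" using V by (simp add: wt_def power_numeral_reduce)
    then show ?thesis by (simp add: wlim_def algebra_simps)
  qed
  finally show ?thesis unfolding sum_eq .
qed

text \<open>Each kap^(-3) is the integral of 3 s^(-4) over s \<ge> kap. After exchanging sum and
  integral, the number of points below s is at most a multiple of s^2.\<close>

lemma tail_cubes:
  "\<exists>C\<ge>0. \<forall>Z K. 0 < Z \<longrightarrow> finite K \<longrightarrow> (\<forall>x\<in>K. Z < kap x) \<longrightarrow> (\<Sum>x\<in>K. kap x powr (- 3)) \<le> C / Z"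
proof -
  obtain C where C: "C \<ge> 0" "\<And>t. t > 0 \<Longrightarrow> 0 \<le> cnt t - 1 \<and> cnt t - 1 \<le> C * t\<^sup>2"
    using cnt_quadratic by blast
  have "(\<Sum>x\<in>K. kap x powr (- 3)) \<le> 3 * (C * \<beta>\<^sup>2) / Z" if Z: "0 < Z" and K: "finite K" "\<And>x. x \<in> K \<Longrightarrow> Z < kap x" for Z K
  proof -
    have h1: "((\<lambda>s. if s \<in> {kap x..} then 3 * s powr (- 4) else 0) has_integral kap x powr (- 3)) {Z..}" if x: "x \<in> K" for x
    proof -
      have k: "kap x > 0" "Z < kap x" using K(2)[OF x] Z by auto
      have "((\<lambda>s. 3 * s powr (- 4)) has_integral 3 * (- (kap x powr (- 4 + 1)) / (- 4 + 1))) {kap x..}"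
        by (intro has_integral_mult_right has_integral_powr_to_inf k) auto
      then have "((\<lambda>s. 3 * s powr (- 4)) has_integral kap x powr (- 3)) {kap x..}" by simp
      then show ?thesis using k by (subst has_integral_restrict) auto
    qed
    have "((\<lambda>s. \<Sum>x\<in>K. if s \<in> {kap x..} then 3 * s powr (- 4) else 0) has_integral (\<Sum>x\<in>K. kap x powr (- 3))) {Z..}"
      by (rule has_integral_sum[OF K(1) h1])
    moreover have "((\<lambda>s. 3 * (C * \<beta>\<^sup>2) * s powr (- 2)) has_integral 3 * (C * \<beta>\<^sup>2) * (- (Z powr (- 2 + 1)) / (- 2 + 1))) {Z..}"
      by (intro has_integral_mult_right has_integral_powr_to_inf Z) auto
    ultimately have "(\<Sum>x\<in>K. kap x powr (- 3)) \<le> 3 * (C * \<beta>\<^sup>2) * (- (Z powr (- 2 + 1)) / (- 2 + 1))"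
    proof (rule has_integral_le)
      fix s assume "s \<in> {Z..}"
      then have s: "s > 0" using Z by auto
      have "(\<Sum>x\<in>K. if s \<in> {kap x..} then 3 * s powr (- 4) else 0) = (\<Sum>x\<in>{x\<in>K. kap x \<le> s}. 3 * s powr (- 4))"
        by (subst sum.inter_filter[OF K(1)]) simp
      also have "\<dots> = real (card {x\<in>K. kap x \<le> s}) * (3 * s powr (- 4))" by simp
      also have "\<dots> \<le> (C * (\<beta> * s)\<^sup>2) * (3 * s powr (- 4))"
      proof (rule mult_right_mono)
        have "{x\<in>K. kap x \<le> s} \<subseteq> low s" using K(2) Z by (force simp: low_def)
        then have "card {x\<in>K. kap x \<le> s} \<le> card (low s)" by (rule card_mono[OF finite_low])
        also have "real (card (low s)) = cnt (\<beta> * s) - 1" using s by (intro card_low) auto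
        also have "\<dots> \<le> C * (\<beta> * s)\<^sup>2" using C(2)[of "\<beta> * s"] s beta_pos by simp
        finally show "real (card {x\<in>K. kap x \<le> s}) \<le> C * (\<beta> * s)\<^sup>2" by simp
      qed simp
      also have "\<dots> = 3 * (C * \<beta>\<^sup>2) * (s powr 2 * s powr (- 4))" using s by (simp add: power_mult_distrib powr_numeral)
      also have "s powr 2 * s powr (- 4) = s powr (2 + - 4)" by (rule powr_add[symmetric])
      finally show "(\<Sum>x\<in>K. if s \<in> {kap x..} then 3 * s powr (- 4) else 0) \<le> 3 * (C * \<beta>\<^sup>2) * s powr (- 2)" by simp
    qed
    also have "\<dots> = 3 * (C * \<beta>\<^sup>2) / Z" using Z by (simp add: powr_minus_divide)
    finally show ?thesis .
  qed
  then show ?thesis using C(1) by (intro exI[of _ "3 * (C * \<beta>\<^sup>2)"]) auto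
qed

text \<open>Frequencies up to V / r are governed by the limit for fixed V; those above contribute at
  most C / V after division by r, because sin^2 \<le> 1. That r m tends to infinity ensures that
  every fixed V is eventually below the cut.\<close>

theorem variance_limit:
  fixes r m :: "nat \<Rightarrow> real"
  assumes r: "\<And>n. r n > 0" "r \<longlonglongrightarrow> 0" and m: "filterlim (\<lambda>n. r n * m n) at_top sequentially"
  shows "(\<lambda>n. (\<Sum>x\<in>low (m n). kap x powr (- 3) * (sin (pi * r n * kap x))\<^sup>2) / r n) \<longlonglongrightarrow> pi ^ 3 * \<beta>"
proof (rule tendstoI)
  fix e :: real assume e: "e > 0"
  obtain C where C: "C \<ge> 0" "\<And>Z K. 0 < Z \<Longrightarrow> finite K \<Longrightarrow> (\<And>x. x \<in> K \<Longrightarrow> Z < kap x) \<Longrightarrow> (\<Sum>x\<in>K. kap x powr (- 3)) \<le> C / Z"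
    using tail_cubes by blast
  have "\<forall>\<^sub>F V in at_top. dist (wlim V) (pi ^ 3 * \<beta>) < e / 3" using wlim_tendsto e by (intro tendstoD) auto
  moreover have "\<forall>\<^sub>F V in at_top. V > 3 * C / e" by (rule eventually_gt_at_top)
  moreover have "\<forall>\<^sub>F V::real in at_top. V > 0" by (rule eventually_gt_at_top)
  ultimately have "\<forall>\<^sub>F V in at_top. dist (wlim V) (pi ^ 3 * \<beta>) < e / 3 \<and> V > 3 * C / e \<and> V > 0" by eventually_elim auto
  then obtain V where V: "dist (wlim V) (pi ^ 3 * \<beta>) < e / 3" "V > 3 * C / e" "V > 0"
    using eventually_happens'[OF trivial_limit_at_top_linorder] by blast
  have CV: "C / V < e / 3" using V e by (simp add: field_simps)
  have "\<forall>\<^sub>F n in sequentially. dist ((r n)\<^sup>2 * (\<Sum>x\<in>low (V / r n). wt (r n * kap x))) (wlim V) < e / 3"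
    using wt_sum_limit[OF r V(3)] e by (intro tendstoD) auto
  moreover have "\<forall>\<^sub>F n in sequentially. r n * m n \<ge> V" using m by (simp add: filterlim_at_top)
  ultimately show "\<forall>\<^sub>F n in sequentially. dist ((\<Sum>x\<in>low (m n). kap x powr (- 3) * (sin (pi * r n * kap x))\<^sup>2) / r n) (pi ^ 3 * \<beta>) < e"
  proof eventually_elim
    case (elim n)
    have rn: "r n > 0" by (rule r(1))
    let ?f = "\<lambda>x. kap x powr (- 3) * (sin (pi * r n * kap x))\<^sup>2"
    let ?A = "low (V / r n)" and ?B = "low (m n) - low (V / r n)"
    have "V / r n \<le> m n" using elim(2) rn by (simp add: field_simps)
    then have sub: "?A \<subseteq> low (m n)" by (auto simp: low_def)
    have split: "(\<Sum>x\<in>low (m n). ?f x) = (\<Sum>x\<in>?A. ?f x) + (\<Sum>x\<in>?B. ?f x)"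
      using sum.subset_diff[OF sub finite_low, of ?f] by simp
    have fA: "(\<Sum>x\<in>?A. ?f x) / r n = (r n)\<^sup>2 * (\<Sum>x\<in>?A. wt (r n * kap x))"
      unfolding sum_divide_distrib sum_distrib_left
    proof (rule sum.cong[OF refl])
      fix x assume "x \<in> ?A"
      then have k: "kap x > 0" using kap_pos by (simp add: low_def)
      then show "?f x / r n = (r n)\<^sup>2 * wt (r n * kap x)"
        using rn by (simp add: wt_def powr_minus_divide powr_numeral power_mult_distrib power_numeral_reduce mult_ac)
    qed
    have "(\<Sum>x\<in>?B. ?f x) \<le> (\<Sum>x\<in>?B. kap x powr (- 3))" by (intro sum_mono mult_left_le) (auto simp: abs_square_le_1)
    also have "\<dots> \<le> C / (V / r n)" by (rule C(2)) (use V(3) rn finite_low in \<open>auto simp: low_def\<close>)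
    finally have "(\<Sum>x\<in>?B. ?f x) / r n \<le> C / (V / r n) / r n" using rn by (intro divide_right_mono) auto
    then have B1: "(\<Sum>x\<in>?B. ?f x) / r n \<le> C / V" using rn by simp
    have B0: "0 \<le> (\<Sum>x\<in>?B. ?f x) / r n" using rn by (intro divide_nonneg_nonneg sum_nonneg) auto
    have "(\<Sum>x\<in>low (m n). ?f x) / r n = (r n)\<^sup>2 * (\<Sum>x\<in>?A. wt (r n * kap x)) + (\<Sum>x\<in>?B. ?f x) / r n"
      unfolding split add_divide_distrib fA ..
    then show ?case using elim(1) V(1) CV B0 B1 e unfolding dist_real_def by linarith
  qed
qed

end

section \<open>Trigonometric sums and sums of independent waves\<close>

definition unif :: "real \<Rightarrow> real \<Rightarrow> real measure" where "unif a b = uniform_measure lborel {a..b}"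

lemma prob_space_unif: "a < b \<Longrightarrow> prob_space (unif a b)" unfolding unif_def by (rule prob_space_uniform_measure) auto

lemma sets_unif [simp, measurable_cong]: "sets (unif a b) = sets borel" by (simp add: unif_def)

lemma space_unif [simp]: "space (unif a b) = UNIV" using sets_eq_imp_space_eq[OF sets_unif] by simp

lemma unif_density:
  assumes ab: "a < b"
  shows "unif a b = density lborel (\<lambda>t. ennreal (indicator {a..b} t / (b - a)))" unfolding unif_def uniform_measure_def
  proof (intro density_cong AE_I2)
  fix t
  have e: "emeasure lborel {a..b} = ennreal (b - a)" using ab by simp
  have q: "1 / ennreal (b - a) = ennreal (1 / (b - a))" using ab by (metis divide_ennreal ennreal_1 zero_le_one diff_gt_0_iff_gt)
  show "indicator {a..b} t / emeasure lborel {a..b} = ennreal (indicator {a..b} t / (b - a))"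
  proof (cases "t \<in> {a..b}")
    case True then show ?thesis unfolding e by (simp only: indicator_simps q)
  next
    case False then show ?thesis unfolding e by simp
  qed
  qed auto

lemma integral_unif:
  fixes f :: "real \<Rightarrow> 'b::{banach, second_countable_topology}"
  assumes ab: "a < b" and f: "f \<in> borel_measurable borel"
  shows "integral\<^sup>L (unif a b) f = (1 / (b - a)) *\<^sub>R (LINT t|lborel. indicator {a..b} t *\<^sub>R f t)"
proof -
  have "integral\<^sup>L (unif a b) f = (LINT t|lborel. (indicator {a..b} t / (b - a)) *\<^sub>R f t)"
    unfolding unif_density[OF ab] using ab f by (simp add: integral_density)
  also have "\<dots> = (LINT t|lborel. (1 / (b - a)) *\<^sub>R (indicator {a..b} t *\<^sub>R f t))"
    by (intro Bochner_Integration.integral_cong) auto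
  also have "\<dots> = (1 / (b - a)) *\<^sub>R (LINT t|lborel. indicator {a..b} t *\<^sub>R f t)" by (rule integral_scaleR_right)
  finally show ?thesis .
qed

lemma integrable_unif:
  fixes f :: "real \<Rightarrow> real"
  assumes ab: "a < b" and f: "f \<in> borel_measurable borel" and i: "integrable lborel (\<lambda>t. indicator {a..b} t * f t)"
  shows "integrable (unif a b) f"
proof -
  have "integrable lborel (\<lambda>t. 1 / (b - a) * (indicator {a..b} t * f t))" by (intro integrable_mult_right i)
  then show ?thesis unfolding unif_density[OF ab] using ab f by (subst integrable_density) auto
qed

lemma integral_unif_e2_int: "integral\<^sup>L (unif 0 1) (\<lambda>t. e2 (of_int k * t)) = (if k = 0 then 1 else 0)"
  using e2_int_integral[of k] by (subst integral_unif) (auto simp: set_lebesgue_integral_def)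

lemma norm_integral_unif_e2:
  assumes T: "T > 0" and w: "w \<noteq> 0"
  shows "norm (integral\<^sup>L (unif T (2 * T)) (\<lambda>t. e2 (w * t))) \<le> 1 / (pi * \<bar>w\<bar> * T)"
proof -
  have "((\<lambda>x. e2 (w * x)) has_integral (e2 (w * (2 * T)) / (2 * pi * \<i> * w) - e2 (w * T) / (2 * pi * \<i> * w))) {T..2 * T}"
  proof (rule fundamental_theorem_of_calculus)
    fix x :: real
    have "((\<lambda>x. exp (2 * pi * \<i> * w * of_real x) / (2 * pi * \<i> * w)) has_vector_derivative
       exp (2 * pi * \<i> * w * of_real x)) (at x within {T..2 * T})"
      using w by (auto intro!: derivative_eq_intros has_vector_derivative_real_field)
    then show "((\<lambda>x. e2 (w * x) / (2 * pi * \<i> * w)) has_vector_derivative e2 (w * x)) (at x within {T..2 * T})"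
      by (simp add: e2_def cis_conv_exp mult_ac)
  qed (use T in simp)
  then have I: "integral {T..2 * T} (\<lambda>x. e2 (w * x)) = e2 (w * (2 * T)) / (2 * pi * \<i> * w) - e2 (w * T) / (2 * pi * \<i> * w)"
    by (rule integral_unique)
  have "(LINT t:{T..2 * T}|lborel. e2 (w * t)) = integral {T..2 * T} (\<lambda>x. e2 (w * x))"
    by (rule set_borel_integral_eq_integral) (auto intro!: borel_integrable_atLeastAtMost' continuous_intros)
  then have "norm (LINT t:{T..2 * T}|lborel. e2 (w * t)) \<le> 1 / (pi * \<bar>w\<bar>)"
    unfolding I using norm_triangle_ineq4[of "e2 (w * (2 * T)) / (2 * pi * \<i> * w)" "e2 (w * T) / (2 * pi * \<i> * w)"]
    by (simp add: norm_divide norm_mult)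
  then have "norm (LINT t:{T..2 * T}|lborel. e2 (w * t)) / T \<le> 1 / (pi * \<bar>w\<bar>) / T" using T by (intro divide_right_mono) auto
  then show ?thesis using T by (subst integral_unif) (auto simp: set_lebesgue_integral_def field_simps)
qed

lemma e2_sum: "finite A \<Longrightarrow> e2 (\<Sum>x\<in>A. g x) = (\<Prod>x\<in>A. e2 (g x))"
  by (induction A rule: finite_induct) (auto simp: e2_add)

lemma integral_PiM_e2:
  fixes N :: "'b \<Rightarrow> int"
  assumes P: "finite P"
  shows "integral\<^sup>L (Pi\<^sub>M P (\<lambda>_. unif 0 1)) (\<lambda>\<theta>. e2 (\<Sum>p\<in>P. of_int (N p) * \<theta> p)) = (if \<forall>p\<in>P. N p = 0 then 1 else 0)"
proof -
  interpret U: prob_space "unif 0 1" by (rule prob_space_unif) simp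
  interpret product_sigma_finite "\<lambda>_ :: 'b. unif 0 1" by standard
  have "integral\<^sup>L (Pi\<^sub>M P (\<lambda>_. unif 0 1)) (\<lambda>\<theta>. e2 (\<Sum>p\<in>P. of_int (N p) * \<theta> p)) =
     integral\<^sup>L (Pi\<^sub>M P (\<lambda>_. unif 0 1)) (\<lambda>\<theta>. \<Prod>p\<in>P. e2 (of_int (N p) * \<theta> p))"
    by (simp only: e2_sum[OF P])
  also have "\<dots> = (\<Prod>p\<in>P. integral\<^sup>L (unif 0 1) (\<lambda>t. e2 (of_int (N p) * t)))"
    by (rule product_integral_prod[OF P]) (rule U.integrable_const_bound[where B=1], auto)
  also have "\<dots> = (\<Prod>p\<in>P. if N p = 0 then 1 else 0)" unfolding integral_unif_e2_int ..
  also have "\<dots> = (if \<forall>p\<in>P. N p = 0 then 1 else 0)" using P by (auto simp: prod_zero_iff)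
  finally show ?thesis .
qed

text \<open>The k-th power is expanded over all choices of k terms, and time average and torus
  average are compared choice by choice. Each differs by at most 1 / (pi \<delta> T), and the
  coefficients add up to the k-th power of their total.\<close>

lemma trig_moment_compare:
  fixes c :: "'a \<Rightarrow> complex" and m :: "'a \<Rightarrow> int" and d :: "'a \<Rightarrow> 'b" and l :: "'b \<Rightarrow> real"
  assumes L: "finite L" and T: "T > 0" and \<delta>: "\<delta> > 0"
    and sep: "\<And>f. f \<in> {..<k} \<rightarrow>\<^sub>E L \<Longrightarrow> (\<forall>p. (\<Sum>i | i < k \<and> d (f i) = p. m (f i)) = 0) \<or>
       \<delta> \<le> \<bar>\<Sum>i<k. of_int (m (f i)) * l (d (f i))\<bar>"
  shows "norm ((LINT t|unif T (2 * T). (\<Sum>x\<in>L. c x * e2 (of_int (m x) * l (d x) * t)) ^ k)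
     - (LINT \<theta>|Pi\<^sub>M (d ` L) (\<lambda>_. unif 0 1). (\<Sum>x\<in>L. c x * e2 (of_int (m x) * \<theta> (d x))) ^ k))
     \<le> (\<Sum>x\<in>L. norm (c x)) ^ k / (pi * \<delta> * T)"
proof -
  let ?F = "{..<k} \<rightarrow>\<^sub>E L" and ?Q = "Pi\<^sub>M (d ` L) (\<lambda>_. unif 0 1)"
  interpret U: prob_space "unif T (2 * T)" using T by (intro prob_space_unif) simp
  interpret U1: prob_space "unif 0 1" by (rule prob_space_unif) simp
  interpret Q: prob_space ?Q by (rule prob_space_PiM) (rule U1.prob_space_axioms)
  have F: "finite ?F" using L by (intro finite_PiE) auto
  define W where "W f = (\<Sum>i<k. of_int (m (f i)) * l (d (f i)))" for f
  define N where "N f p = (\<Sum>i | i < k \<and> d (f i) = p. m (f i))" for f p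
  define C where "C f = (\<Prod>i<k. c (f i))" for f
  have pw: "(\<Sum>x\<in>L. c x * e2 (g x)) ^ k = (\<Sum>f\<in>?F. C f * e2 (\<Sum>i<k. g (f i)))" for g
  proof -
    have "(\<Sum>x\<in>L. c x * e2 (g x)) ^ k = (\<Prod>i<k. \<Sum>x\<in>L. c x * e2 (g x))" by simp
    also have "\<dots> = (\<Sum>f\<in>?F. \<Prod>i<k. c (f i) * e2 (g (f i)))" by (rule prod_sum_PiE) (use L in auto)
    finally show ?thesis by (simp add: prod.distrib C_def e2_sum)
  qed
  \<comment> \<open>Collecting equal directions turns the phase into an integer combination of
    distinct coordinates, which is what orthogonality on the torus requires.\<close>
  have grp: "(\<Sum>i<k. of_int (m (f i)) * \<theta> (d (f i))) = (\<Sum>p\<in>d ` L. of_int (N f p) * \<theta> p)" if f: "f \<in> ?F" for f and \<theta> :: "'b \<Rightarrow> real"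
  proof -
    have "(\<Sum>p\<in>d ` L. of_int (N f p) * \<theta> p) = (\<Sum>p\<in>d ` L. \<Sum>i\<in>{i\<in>{..<k}. d (f i) = p}. of_int (m (f i)) * \<theta> (d (f i)))"
      by (intro sum.cong) (auto simp: N_def sum_distrib_right)
    also have "\<dots> = (\<Sum>i<k. of_int (m (f i)) * \<theta> (d (f i)))" by (rule sum.group) (use L f in auto)
    finally show ?thesis by simp
  qed
  have A: "(LINT t|unif T (2 * T). (\<Sum>x\<in>L. c x * e2 (of_int (m x) * l (d x) * t)) ^ k)
      = (\<Sum>f\<in>?F. C f * integral\<^sup>L (unif T (2 * T)) (\<lambda>t. e2 (W f * t)))"
  proof -
    have "(\<lambda>t. (\<Sum>x\<in>L. c x * e2 (of_int (m x) * l (d x) * t)) ^ k) = (\<lambda>t. \<Sum>f\<in>?F. C f * e2 (W f * t))"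
      unfolding pw W_def by (simp add: sum_distrib_right)
    moreover have "integrable (unif T (2 * T)) (\<lambda>t. C f * e2 (W f * t))" for f
      by (intro integrable_mult_right U.integrable_const_bound[where B=1]) auto
    ultimately show ?thesis by simp
  qed
  have B: "(LINT \<theta>|?Q. (\<Sum>x\<in>L. c x * e2 (of_int (m x) * \<theta> (d x))) ^ k)
      = (\<Sum>f\<in>?F. C f * integral\<^sup>L ?Q (\<lambda>\<theta>. e2 (\<Sum>p\<in>d ` L. of_int (N f p) * \<theta> p)))"
  proof -
    have "(\<lambda>\<theta>. (\<Sum>x\<in>L. c x * e2 (of_int (m x) * \<theta> (d x))) ^ k) = (\<lambda>\<theta>. \<Sum>f\<in>?F. C f * e2 (\<Sum>p\<in>d ` L. of_int (N f p) * \<theta> p))"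
      unfolding pw by (rule ext, rule sum.cong) (simp_all add: grp)
    moreover have "integrable ?Q (\<lambda>\<theta>. C f * e2 (\<Sum>p\<in>d ` L. of_int (N f p) * \<theta> p))" for f
    proof (intro integrable_mult_right Q.integrable_const_bound[where B=1])
      have "(\<lambda>\<theta>. \<theta> p) \<in> borel_measurable ?Q" if "p \<in> d ` L" for p
        using measurable_component_singleton[OF that, of "\<lambda>_. unif 0 1"] by (simp cong: measurable_cong_sets)
      then have "(\<lambda>\<theta>. \<Sum>p\<in>d ` L. of_int (N f p) * \<theta> p) \<in> borel_measurable ?Q"
        by (intro borel_measurable_sum borel_measurable_times) auto
      then show "(\<lambda>\<theta>. e2 (\<Sum>p\<in>d ` L. of_int (N f p) * \<theta> p)) \<in> borel_measurable ?Q" by measurable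
    qed auto
    ultimately show ?thesis by simp
  qed
  \<comment> \<open>Either all collected multiplicities vanish and both averages are 1, or the torus
    average is 0 and the time average has frequency at least \<delta>.\<close>
  have dl: "norm (integral\<^sup>L (unif T (2 * T)) (\<lambda>t. e2 (W f * t)) - integral\<^sup>L ?Q (\<lambda>\<theta>. e2 (\<Sum>p\<in>d ` L. of_int (N f p) * \<theta> p))) \<le> 1 / (pi * \<delta> * T)"
    if f: "f \<in> ?F" for f
  proof (cases "\<forall>p\<in>d ` L. N f p = 0")
    case True
    then have "W f = 0" unfolding W_def grp[OF f] by (intro sum.neutral) simp
    then show ?thesis
      unfolding integral_PiM_e2[OF finite_imageI[OF L]] using True T \<delta> by (simp add: U.prob_space[unfolded space_unif])
  next
    case False
    then have w: "\<delta> \<le> \<bar>W f\<bar>" using sep[OF f] unfolding N_def W_def by blast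
    then have "norm (integral\<^sup>L (unif T (2 * T)) (\<lambda>t. e2 (W f * t))) \<le> 1 / (pi * \<bar>W f\<bar> * T)"
      using \<delta> T by (intro norm_integral_unif_e2) auto
    also have "\<dots> \<le> 1 / (pi * \<delta> * T)"
      using w \<delta> T by (intro divide_left_mono mult_right_mono mult_left_mono mult_pos_pos) auto
    finally show ?thesis unfolding integral_PiM_e2[OF finite_imageI[OF L]] if_not_P[OF False] by simp
  qed
  have "norm ((\<Sum>f\<in>?F. C f * integral\<^sup>L (unif T (2 * T)) (\<lambda>t. e2 (W f * t)))
      - (\<Sum>f\<in>?F. C f * integral\<^sup>L ?Q (\<lambda>\<theta>. e2 (\<Sum>p\<in>d ` L. of_int (N f p) * \<theta> p))))
      \<le> (\<Sum>f\<in>?F. norm (C f) * (1 / (pi * \<delta> * T)))" unfolding sum_subtractf[symmetric] right_diff_distrib[symmetric]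
  proof (rule order.trans[OF norm_sum sum_mono])
    fix f assume "f \<in> ?F"
    then show "norm (C f * (integral\<^sup>L (unif T (2 * T)) (\<lambda>t. e2 (W f * t)) - integral\<^sup>L ?Q (\<lambda>\<theta>. e2 (\<Sum>p\<in>d ` L. of_int (N f p) * \<theta> p))))
        \<le> norm (C f) * (1 / (pi * \<delta> * T))" unfolding norm_mult by (intro mult_left_mono dl norm_ge_zero)
  qed
  also have "\<dots> = (\<Sum>f\<in>?F. \<Prod>i<k. norm (c (f i))) / (pi * \<delta> * T)"
    by (simp add: C_def prod_norm[symmetric] sum_divide_distrib)
  also have "(\<Sum>f\<in>?F. \<Prod>i<k. norm (c (f i))) = (\<Prod>i<k. \<Sum>x\<in>L. norm (c x))"
    by (rule prod_sum_PiE[symmetric]) (use L in auto)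
  finally show ?thesis unfolding A B by simp
qed

lemma norm_integral_le:
  fixes f :: "'a \<Rightarrow> 'b::{banach,second_countable_topology}"
  assumes "integrable M f" "integrable M g" "\<And>x. x \<in> space M \<Longrightarrow> norm (f x) \<le> g x"
  shows "norm (integral\<^sup>L M f) \<le> integral\<^sup>L M g"
  by (rule order.trans[OF integral_norm_bound Bochner_Integration.integral_mono]) (use assms in auto)

lemma power_div_fact_le_exp: "y \<ge> 0 \<Longrightarrow> y ^ n / fact n \<le> exp (y::real)"
  and sum_power_div_fact_le_exp: "y \<ge> 0 \<Longrightarrow> (\<Sum>k\<le>n. y ^ k / fact k) \<le> exp (y::real)"
proof -
  assume y: "y \<ge> 0"
  have e: "(\<lambda>k. y ^ k / fact k) sums exp y" using exp_converges[of y] by (simp add: field_simps)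
  show s: "(\<Sum>k\<le>n. y ^ k / fact k) \<le> exp y"
    unfolding sums_unique[OF e] using y by (intro sum_le_suminf sums_summable[OF e]) auto
  have "y ^ n / fact n \<le> (\<Sum>k\<le>n. y ^ k / fact k)" by (rule member_le_sum) (use y in auto)
  then show "y ^ n / fact n \<le> exp y" using s by simp
qed

lemma (in prob_space) iexp_moments:
  assumes [measurable]: "X \<in> borel_measurable M" and B: "\<And>x. x \<in> space M \<Longrightarrow> \<bar>X x\<bar> \<le> B"
  shows "norm (integral\<^sup>L M (\<lambda>x. iexp (u * X x)) - (\<Sum>k\<le>n. (\<i> * u) ^ k / fact k * of_real (integral\<^sup>L M (\<lambda>x. X x ^ k))))
     \<le> \<bar>u\<bar> ^ Suc n / fact (Suc n) * integral\<^sup>L M (\<lambda>x. \<bar>X x\<bar> ^ Suc n)"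
proof -
  have int: "integrable M (\<lambda>x. X x ^ k)" "integrable M (\<lambda>x. \<bar>X x\<bar> ^ k)" for k
    using B by (auto intro!: integrable_const_bound[where B="B ^ k"] AE_I2 power_mono simp: power_abs)
  have ic: "integrable M (\<lambda>x. (\<i> * u) ^ k / fact k * of_real (X x ^ k))" for k
    using int(1)[of k] by (intro integrable_mult_right) (rule integrable_of_real)
  have ie: "integrable M (\<lambda>x. iexp (u * X x))" by (intro integrable_const_bound[where B=1]) auto
  have "integral\<^sup>L M (\<lambda>x. iexp (u * X x)) - (\<Sum>k\<le>n. (\<i> * u) ^ k / fact k * of_real (integral\<^sup>L M (\<lambda>x. X x ^ k)))
     = integral\<^sup>L M (\<lambda>x. iexp (u * X x) - (\<Sum>k\<le>n. (\<i> * u) ^ k / fact k * of_real (X x ^ k)))"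
    using ic ie int by (simp add: Bochner_Integration.integral_diff Bochner_Integration.integral_sum del: of_real_power)
  also have "norm \<dots> \<le> integral\<^sup>L M (\<lambda>x. \<bar>u\<bar> ^ Suc n / fact (Suc n) * \<bar>X x\<bar> ^ Suc n)"
  proof (rule norm_integral_le)
    show "integrable M (\<lambda>x. iexp (u * X x) - (\<Sum>k\<le>n. (\<i> * u) ^ k / fact k * of_real (X x ^ k)))"
      using ic ie by (intro Bochner_Integration.integrable_diff Bochner_Integration.integrable_sum) auto
    show "integrable M (\<lambda>x. \<bar>u\<bar> ^ Suc n / fact (Suc n) * \<bar>X x\<bar> ^ Suc n)" by (intro integrable_mult_right int)
    fix x
    have "(\<Sum>k\<le>n. (\<i> * u) ^ k / fact k * of_real (X x ^ k)) = (\<Sum>k\<le>n. (\<i> * (u * X x)) ^ k / fact k)"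
      by (intro sum.cong) (auto simp: power_mult_distrib)
    then show "norm (iexp (u * X x) - (\<Sum>k\<le>n. (\<i> * u) ^ k / fact k * of_real (X x ^ k))) \<le> \<bar>u\<bar> ^ Suc n / fact (Suc n) * \<bar>X x\<bar> ^ Suc n"
      using iexp_approx1[of "u * X x" n] by (simp add: abs_mult power_mult_distrib del: power_Suc fact_Suc)
  qed
  finally show ?thesis using int by simp
qed

text \<open>Both characteristic functions are expanded to the odd order \<open>n\<close>, so that
  the remainder is an even moment without absolute value. The even moment of \<open>f\<close> is
  passed on to \<open>g\<close> by the moment comparison, and that of \<open>g\<close> is controlled
  by its exponential moments; no growth condition on the moments of \<open>f\<close> enters.\<close>

lemma char_compare:
  fixes f :: "'a \<Rightarrow> real" and g :: "'b \<Rightarrow> real"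
  assumes \<mu>: "prob_space \<mu>" and \<nu>: "prob_space \<nu>"
    and f: "f \<in> borel_measurable \<mu>" "\<And>x. x \<in> space \<mu> \<Longrightarrow> \<bar>f x\<bar> \<le> B" and g: "g \<in> borel_measurable \<nu>" "\<And>x. x \<in> space \<nu> \<Longrightarrow> \<bar>g x\<bar> \<le> B"
    and n: "odd n"
    and mom: "\<And>k. k \<le> Suc n \<Longrightarrow> \<bar>(LINT x|\<mu>. f x ^ k) - (LINT y|\<nu>. g y ^ k)\<bar> \<le> \<epsilon>"
    and Q: "(LINT y|\<nu>. exp (2 * u * g y)) \<le> Q" "(LINT y|\<nu>. exp (- (2 * u) * g y)) \<le> Q"
  shows "norm ((LINT x|\<mu>. iexp (u * f x)) - (LINT y|\<nu>. iexp (u * g y))) \<le> 2 * exp \<bar>u\<bar> * \<epsilon> + 4 * Q / 2 ^ Suc n"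
proof -
  interpret f: prob_space \<mu> by (rule \<mu>)
  interpret g: prob_space \<nu> by (rule \<nu>)
  note [measurable] = f(1) g(1)
  have ev: "even (Suc n)" using n by simp
  let ?a = "\<lambda>k. (\<i> * u) ^ k / fact k"
  let ?R = "\<bar>u\<bar> ^ Suc n / fact (Suc n)"
  have F: "norm ((LINT x|\<mu>. iexp (u * f x)) - (\<Sum>k\<le>n. ?a k * of_real (LINT x|\<mu>. f x ^ k))) \<le> ?R * (LINT x|\<mu>. f x ^ Suc n)"
    using f.iexp_moments[OF f, of u n] unfolding power_even_abs[OF ev] .
  have G: "norm ((LINT x|\<nu>. iexp (u * g x)) - (\<Sum>k\<le>n. ?a k * of_real (LINT x|\<nu>. g x ^ k))) \<le> ?R * (LINT x|\<nu>. g x ^ Suc n)"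
    using g.iexp_moments[OF g, of u n] unfolding power_even_abs[OF ev] .
  have \<epsilon>: "\<epsilon> \<ge> 0" using mom[of 0] by simp
  have D: "norm ((\<Sum>k\<le>n. ?a k * of_real (LINT x|\<mu>. f x ^ k)) - (\<Sum>k\<le>n. ?a k * of_real (LINT x|\<nu>. g x ^ k))) \<le> exp \<bar>u\<bar> * \<epsilon>"
  proof -
    have "norm ((\<Sum>k\<le>n. ?a k * of_real (LINT x|\<mu>. f x ^ k)) - (\<Sum>k\<le>n. ?a k * of_real (LINT x|\<nu>. g x ^ k)))
       \<le> (\<Sum>k\<le>n. \<bar>u\<bar> ^ k / fact k * \<epsilon>)"
      unfolding sum_subtractf[symmetric] right_diff_distrib[symmetric] of_real_diff[symmetric]
    proof (rule order.trans[OF norm_sum sum_mono])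
      fix k assume "k \<in> {..n}"
      then have "\<bar>(LINT x|\<mu>. f x ^ k) - (LINT y|\<nu>. g y ^ k)\<bar> \<le> \<epsilon>" by (intro mom) auto
      then have "\<bar>u\<bar> ^ k / fact k * \<bar>(LINT x|\<mu>. f x ^ k) - (LINT y|\<nu>. g y ^ k)\<bar> \<le> \<bar>u\<bar> ^ k / fact k * \<epsilon>"
        by (rule mult_left_mono) simp
      then show "norm (?a k * of_real ((LINT x|\<mu>. f x ^ k) - (LINT y|\<nu>. g y ^ k))) \<le> \<bar>u\<bar> ^ k / fact k * \<epsilon>"
        by (simp only: norm_mult norm_divide norm_power norm_of_real norm_ii mult_1 norm_fact)
    qed
    also have "\<dots> = (\<Sum>k\<le>n. \<bar>u\<bar> ^ k / fact k) * \<epsilon>" by (simp add: sum_distrib_right)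
    also have "\<dots> \<le> exp \<bar>u\<bar> * \<epsilon>" by (intro mult_right_mono sum_power_div_fact_le_exp \<epsilon>) simp
    finally show ?thesis .
  qed
  have R: "?R \<le> exp \<bar>u\<bar>" "?R \<ge> 0" by (rule power_div_fact_le_exp) auto
  have "?R * (LINT x|\<mu>. f x ^ Suc n) \<le> ?R * ((LINT x|\<nu>. g x ^ Suc n) + \<epsilon>)"
    using mom[of "Suc n"] R by (intro mult_left_mono) auto
  also have "\<dots> = ?R * (LINT x|\<nu>. g x ^ Suc n) + ?R * \<epsilon>" by (rule distrib_left)
  also have "?R * \<epsilon> \<le> exp \<bar>u\<bar> * \<epsilon>" using R \<epsilon> by (intro mult_right_mono)
  finally have F2: "?R * (LINT x|\<mu>. f x ^ Suc n) \<le> ?R * (LINT x|\<nu>. g x ^ Suc n) + exp \<bar>u\<bar> * \<epsilon>" by simp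
  have ie: "integrable \<nu> (\<lambda>y. exp (s * g y))" for s
  proof (intro g.integrable_const_bound[where B="exp (\<bar>s\<bar> * B)"] AE_I2)
    fix y assume "y \<in> space \<nu>"
    then have "\<bar>s\<bar> * \<bar>g y\<bar> \<le> \<bar>s\<bar> * B" by (intro mult_left_mono g(2)) auto
    moreover have "s * g y \<le> \<bar>s\<bar> * \<bar>g y\<bar>" by (simp flip: abs_mult)
    ultimately show "norm (exp (s * g y)) \<le> exp (\<bar>s\<bar> * B)" by simp
  qed simp
  have "?R * (LINT x|\<nu>. g x ^ Suc n) = (LINT x|\<nu>. ?R * g x ^ Suc n)" by simp
  also have "\<dots> \<le> (LINT x|\<nu>. (exp (2 * u * g x) + exp (- (2 * u) * g x)) / 2 ^ Suc n)"
  proof (rule Bochner_Integration.integral_mono)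
    show "integrable \<nu> (\<lambda>x. ?R * g x ^ Suc n)"
      using g(2) by (intro integrable_mult_right g.integrable_const_bound[where B="B ^ Suc n"])
        (auto intro!: AE_I2 power_mono simp: power_abs simp del: power_Suc)
    show "integrable \<nu> (\<lambda>x. (exp (2 * u * g x) + exp (- (2 * u) * g x)) / 2 ^ Suc n)"
      by (intro integrable_divide Bochner_Integration.integrable_add ie)
    fix x
    \<comment> \<open>Taking the exponential at 2u instead of u is what produces the factor 1 / 2^(n
      + 1) that makes the remainder small.\<close>
    have "2 ^ Suc n * (?R * g x ^ Suc n) = \<bar>2 * u * g x\<bar> ^ Suc n / fact (Suc n)"
      unfolding abs_mult power_mult_distrib power_even_abs[OF ev, of "g x"] by simp
    also have "\<dots> \<le> exp \<bar>2 * u * g x\<bar>" by (rule power_div_fact_le_exp) simp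
    also have "\<dots> \<le> exp (2 * u * g x) + exp (- (2 * u) * g x)" by (cases "2 * u * g x \<ge> 0") auto
    finally show "?R * g x ^ Suc n \<le> (exp (2 * u * g x) + exp (- (2 * u) * g x)) / 2 ^ Suc n" by (simp add: field_simps)
  qed
  also have "\<dots> = ((LINT x|\<nu>. exp (2 * u * g x)) + (LINT x|\<nu>. exp (- (2 * u) * g x))) / 2 ^ Suc n"
    using ie[of "2 * u"] ie[of "- (2 * u)"] by (simp add: Bochner_Integration.integral_add)
  also have "\<dots> \<le> (Q + Q) / 2 ^ Suc n" by (intro divide_right_mono add_mono Q) simp
  finally have G2: "?R * (LINT x|\<nu>. g x ^ Suc n) \<le> 2 * (Q / 2 ^ Suc n)" by simp
  have tri: "norm (a - b) \<le> norm (a - p) + norm (p - q) + norm (b - q)" for a b p q :: complex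
    using norm_triangle_ineq[of "a - p" "p - q"] norm_triangle_ineq4[of "a - q" "b - q"] by simp
  show ?thesis using tri[of "LINT x|\<mu>. iexp (u * f x)" "LINT y|\<nu>. iexp (u * g y)"
        "\<Sum>k\<le>n. ?a k * of_real (LINT x|\<mu>. f x ^ k)" "\<Sum>k\<le>n. ?a k * of_real (LINT x|\<nu>. g x ^ k)"] F G D F2 G2 by argo
qed

text \<open>The uniform exponential moments fix the degree of the expansion first, so that only
  finitely many moments have to be close afterwards. The bounds \<open>B n\<close> give
  integrability only and may grow with \<open>n\<close>.\<close>

lemma char_diff_tendsto:
  fixes f :: "nat \<Rightarrow> 'a \<Rightarrow> real" and g :: "nat \<Rightarrow> 'b \<Rightarrow> real"
  assumes \<mu>: "\<And>n. prob_space (\<mu> n)" and \<nu>: "\<And>n. prob_space (\<nu> n)"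
    and f: "\<And>n. f n \<in> borel_measurable (\<mu> n)" "\<And>n x. x \<in> space (\<mu> n) \<Longrightarrow> \<bar>f n x\<bar> \<le> B n"
    and g: "\<And>n. g n \<in> borel_measurable (\<nu> n)" "\<And>n x. x \<in> space (\<nu> n) \<Longrightarrow> \<bar>g n x\<bar> \<le> B n"
    and mom: "\<And>k. (\<lambda>n. (LINT x|\<mu> n. f n x ^ k) - (LINT y|\<nu> n. g n y ^ k)) \<longlonglongrightarrow> 0"
    and Q: "\<And>s. \<exists>Q. \<forall>n. (LINT y|\<nu> n. exp (s * g n y)) \<le> Q"
  shows "(\<lambda>n. (LINT x|\<mu> n. iexp (u * f n x)) - (LINT y|\<nu> n. iexp (u * g n y))) \<longlonglongrightarrow> 0"
proof (rule tendstoI)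
  fix e :: real assume e: "e > 0"
  obtain Q1 Q2 where Q12: "\<And>n. (LINT y|\<nu> n. exp (2 * u * g n y)) \<le> Q1" "\<And>n. (LINT y|\<nu> n. exp (- (2 * u) * g n y)) \<le> Q2"
    using Q[of "2 * u"] Q[of "- (2 * u)"] by metis
  define q where "q = max 0 (max Q1 Q2)"
  have q: "Q1 \<le> q" "Q2 \<le> q" "0 \<le> q" by (auto simp: q_def)
  have "(\<lambda>D. 4 * q / 2 ^ (2 * D + 2)) \<longlonglongrightarrow> 0" by real_asymp
  then have "\<forall>\<^sub>F D in sequentially. 4 * q / 2 ^ (2 * D + 2) < e / 2" using e by (intro order_tendstoD) auto
  then obtain D where "4 * q / 2 ^ (2 * D + 2) < e / 2" by (auto simp: eventually_sequentially)
  then have D: "4 * q / 2 ^ Suc (2 * D + 1) < e / 2" by simp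
  define \<epsilon> where "\<epsilon> = e / (4 * exp \<bar>u\<bar>)"
  have "\<forall>\<^sub>F n in sequentially. \<bar>(LINT x|\<mu> n. f n x ^ k) - (LINT y|\<nu> n. g n y ^ k)\<bar> < \<epsilon>" for k
    using tendstoD[OF mom, of \<epsilon> k] e by (simp add: \<epsilon>_def)
  then have "\<forall>\<^sub>F n in sequentially. \<forall>k\<in>{..Suc (2 * D + 1)}. \<bar>(LINT x|\<mu> n. f n x ^ k) - (LINT y|\<nu> n. g n y ^ k)\<bar> < \<epsilon>"
    by (intro eventually_ball_finite) auto
  then show "\<forall>\<^sub>F n in sequentially. dist ((LINT x|\<mu> n. iexp (u * f n x)) - (LINT y|\<nu> n. iexp (u * g n y))) 0 < e"
  proof eventually_elim
    case (elim n)
    have "norm ((LINT x|\<mu> n. iexp (u * f n x)) - (LINT y|\<nu> n. iexp (u * g n y))) \<le> 2 * exp \<bar>u\<bar> * \<epsilon> + 4 * q / 2 ^ Suc (2 * D + 1)"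
      by (rule char_compare[OF \<mu> \<nu> f g])
        (use elim in \<open>auto intro!: less_imp_le order.trans[OF Q12(1) q(1)] order.trans[OF Q12(2)[simplified] q(2)]\<close>)
    also have "2 * exp \<bar>u\<bar> * \<epsilon> = e / 2" by (simp add: \<epsilon>_def)
    finally show ?case unfolding dist_norm diff_0_right using D by linarith
  qed
qed

section \<open>Sums of independent bounded variables\<close>

lemma exp_le_quadratic: "exp z \<le> 1 + z + z\<^sup>2 / 2 * exp \<bar>z\<bar>" for z :: real
proof -
  obtain t where t: "\<bar>t\<bar> \<le> \<bar>z\<bar>" "exp z = (\<Sum>m<2. z ^ m / fact m) + exp t / fact 2 * z ^ 2"
    using Maclaurin_exp_le[of z 2] by blast
  have "exp t * z\<^sup>2 \<le> exp \<bar>z\<bar> * z\<^sup>2" using t(1) by (intro mult_right_mono) auto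
  then show ?thesis using t(2) by (simp add: numeral_2_eq_2 field_simps)
qed

text \<open>Independence is encoded by a power of \<open>U\<close> in which the p-th summand sees
  only the p-th coordinate. The individual bounds \<open>B p\<close> measure the Lindeberg error,
  the common bound \<open>b\<close> keeps exponentials under control.\<close>

locale independent_sum = prob_space U for U :: "'a measure" +
  fixes P :: "'b set" and Y :: "'b \<Rightarrow> 'a \<Rightarrow> real" and B :: "'b \<Rightarrow> real" and b :: real
  assumes finite_P: "finite P"
    and measurable_Y: "p \<in> P \<Longrightarrow> Y p \<in> borel_measurable U"
    and Y_bound: "p \<in> P \<Longrightarrow> x \<in> space U \<Longrightarrow> \<bar>Y p x\<bar> \<le> B p" and B_le: "p \<in> P \<Longrightarrow> B p \<le> b"
    and mean_Y: "p \<in> P \<Longrightarrow> (LINT x|U. Y p x) = 0"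
begin

definition var :: "'b \<Rightarrow> real" where "var p = (LINT x|U. (Y p x)\<^sup>2)"

lemma var_nonneg: "var p \<ge> 0" by (simp add: var_def)

lemma integrable_Y_power: "p \<in> P \<Longrightarrow> integrable U (\<lambda>x. Y p x ^ k)" "p \<in> P \<Longrightarrow> integrable U (\<lambda>x. \<bar>Y p x\<bar> ^ k)"
  using measurable_Y[of p] Y_bound[of p] by (auto intro!: integrable_const_bound[where B="B p ^ k"] AE_I2 power_mono simp: power_abs)

lemma product: "product_sigma_finite (\<lambda>_. U)" by standard

lemma integrable_exp_Y: "p \<in> P \<Longrightarrow> integrable U (\<lambda>x. exp (s * Y p x))"
proof (intro integrable_const_bound[where B="exp (\<bar>s\<bar> * B p)"] AE_I2)
  fix x assume "p \<in> P" "x \<in> space U"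
  then have "\<bar>s\<bar> * \<bar>Y p x\<bar> \<le> \<bar>s\<bar> * B p" by (intro mult_left_mono Y_bound) auto
  moreover have "s * Y p x \<le> \<bar>s\<bar> * \<bar>Y p x\<bar>" by (simp flip: abs_mult)
  ultimately show "norm (exp (s * Y p x)) \<le> exp (\<bar>s\<bar> * B p)" by simp
qed (use measurable_Y in simp)

text \<open>The exponential moment factors by independence, and since the mean is zero each factor
  exceeds 1 only by a multiple of the variance. The bound depends on the summands only through
  \<open>b\<close> and the total variance.\<close>

lemma exp_moment_bound:
  "(LINT \<theta>|Pi\<^sub>M P (\<lambda>_. U). exp (s * (\<Sum>p\<in>P. Y p (\<theta> p)))) \<le> exp (s\<^sup>2 / 2 * exp (\<bar>s\<bar> * b) * (\<Sum>p\<in>P. var p))"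
proof -
  interpret product_sigma_finite "\<lambda>_ :: 'b. U" by (rule product)
  have "(LINT \<theta>|Pi\<^sub>M P (\<lambda>_. U). exp (s * (\<Sum>p\<in>P. Y p (\<theta> p)))) = (LINT \<theta>|Pi\<^sub>M P (\<lambda>_. U). (\<Prod>p\<in>P. exp (s * Y p (\<theta> p))))"
    by (simp add: sum_distrib_left exp_sum finite_P)
  also have "\<dots> = (\<Prod>p\<in>P. LINT x|U. exp (s * Y p x))" by (rule product_integral_prod[OF finite_P integrable_exp_Y])
  also have "\<dots> \<le> (\<Prod>p\<in>P. exp (s\<^sup>2 / 2 * exp (\<bar>s\<bar> * b) * var p))"
  proof (rule prod_mono, safe)
    fix p assume p: "p \<in> P"
    show "0 \<le> (LINT x|U. exp (s * Y p x))" by simp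
    have "(LINT x|U. exp (s * Y p x)) \<le> (LINT x|U. 1 + s * Y p x + s\<^sup>2 / 2 * exp (\<bar>s\<bar> * b) * (Y p x)\<^sup>2)"
    proof (rule Bochner_Integration.integral_mono[OF integrable_exp_Y[OF p]])
      show "integrable U (\<lambda>x. 1 + s * Y p x + s\<^sup>2 / 2 * exp (\<bar>s\<bar> * b) * (Y p x)\<^sup>2)"
        using integrable_Y_power(1)[OF p, of 1] integrable_Y_power(1)[OF p, of 2] by simp
      fix x assume x: "x \<in> space U"
      have "exp (s * Y p x) \<le> 1 + s * Y p x + (s * Y p x)\<^sup>2 / 2 * exp \<bar>s * Y p x\<bar>" by (rule exp_le_quadratic)
      also have "(s * Y p x)\<^sup>2 / 2 * exp \<bar>s * Y p x\<bar> \<le> (s * Y p x)\<^sup>2 / 2 * exp (\<bar>s\<bar> * b)"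
        using order.trans[OF Y_bound[OF p x] B_le[OF p]] by (intro mult_left_mono) (auto simp: abs_mult intro!: mult_left_mono)
      finally show "exp (s * Y p x) \<le> 1 + s * Y p x + s\<^sup>2 / 2 * exp (\<bar>s\<bar> * b) * (Y p x)\<^sup>2"
        by (simp add: power_mult_distrib mult_ac)
    qed
    also have "\<dots> = 1 + s\<^sup>2 / 2 * exp (\<bar>s\<bar> * b) * var p"
      using integrable_Y_power(1)[OF p, of 1] integrable_Y_power(1)[OF p, of 2] mean_Y[OF p]
      by (simp add: Bochner_Integration.integral_add var_def prob_space)
    also have "\<dots> \<le> exp (s\<^sup>2 / 2 * exp (\<bar>s\<bar> * b) * var p)" by (rule exp_ge_add_one_self)
    finally show "(LINT x|U. exp (s * Y p x)) \<le> exp (s\<^sup>2 / 2 * exp (\<bar>s\<bar> * b) * var p)" .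
  qed
  also have "\<dots> = exp (s\<^sup>2 / 2 * exp (\<bar>s\<bar> * b) * (\<Sum>p\<in>P. var p))"
    by (simp add: sum_distrib_left exp_sum finite_P)
  finally show ?thesis .
qed

text \<open>Lindeberg's replacement: a difference of products of numbers of modulus at most 1 is at
  most the sum of the differences of the factors. Each factor agrees with its Gaussian counterpart
  to second order, and the third absolute moment is at most \<open>B p * var p\<close>.\<close>

lemma char_gauss_bound:
  "norm ((LINT \<theta>|Pi\<^sub>M P (\<lambda>_. U). iexp (u * (\<Sum>p\<in>P. Y p (\<theta> p)))) - exp (- (u\<^sup>2 / 2) * (\<Sum>p\<in>P. var p)))
     \<le> (\<bar>u\<bar> ^ 3 / 6 + u ^ 4 * b / 8) * (\<Sum>p\<in>P. B p * var p)"
proof -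
  interpret product_sigma_finite "\<lambda>_ :: 'b. U" by (rule product)
  have ii: "integrable U (\<lambda>x. iexp (u * Y p x))" if "p \<in> P" for p
    using measurable_Y[OF that] by (intro integrable_const_bound[where B=1]) auto
  have "(LINT \<theta>|Pi\<^sub>M P (\<lambda>_. U). iexp (u * (\<Sum>p\<in>P. Y p (\<theta> p)))) = (LINT \<theta>|Pi\<^sub>M P (\<lambda>_. U). (\<Prod>p\<in>P. iexp (u * Y p (\<theta> p))))"
    by (simp add: sum_distrib_left exp_sum finite_P)
  also have "\<dots> = (\<Prod>p\<in>P. LINT x|U. iexp (u * Y p x))" by (rule product_integral_prod[OF finite_P ii])
  finally have 1: "(LINT \<theta>|Pi\<^sub>M P (\<lambda>_. U). iexp (u * (\<Sum>p\<in>P. Y p (\<theta> p)))) = (\<Prod>p\<in>P. LINT x|U. iexp (u * Y p x))" .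
  have 2: "complex_of_real (exp (- (u\<^sup>2 / 2) * (\<Sum>p\<in>P. var p))) = (\<Prod>p\<in>P. complex_of_real (exp (- (u\<^sup>2 / 2) * var p)))"
    by (simp only: sum_distrib_left exp_sum[OF finite_P] of_real_prod)
  have "norm ((\<Prod>p\<in>P. LINT x|U. iexp (u * Y p x)) - (\<Prod>p\<in>P. complex_of_real (exp (- (u\<^sup>2 / 2) * var p))))
     \<le> (\<Sum>p\<in>P. norm ((LINT x|U. iexp (u * Y p x)) - complex_of_real (exp (- (u\<^sup>2 / 2) * var p))))"
  proof (rule norm_prod_diff)
    fix p assume p: "p \<in> P"
    have "norm (LINT x|U. iexp (u * Y p x)) \<le> (LINT x|U. 1)" by (rule norm_integral_le[OF ii[OF p]]) auto
    then show "norm (LINT x|U. iexp (u * Y p x)) \<le> 1" by (simp add: prob_space)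
    show "norm (complex_of_real (exp (- (u\<^sup>2 / 2) * var p))) \<le> 1" by (simp add: var_nonneg)
  qed
  also have "\<dots> \<le> (\<Sum>p\<in>P. (\<bar>u\<bar> ^ 3 / 6 + u ^ 4 * b / 8) * (B p * var p))"
  proof (rule sum_mono)
    fix p assume p: "p \<in> P"
    have h: "norm ((LINT x|U. iexp (u * Y p x)) - (\<Sum>k\<le>2. (\<i> * u) ^ k / fact k * of_real (LINT x|U. Y p x ^ k)))
       \<le> \<bar>u\<bar> ^ Suc 2 / fact (Suc 2) * (LINT x|U. \<bar>Y p x\<bar> ^ Suc 2)"
      by (rule iexp_moments[OF measurable_Y[OF p] Y_bound[OF p]])
    have q: "(\<Sum>k\<le>2. (\<i> * u) ^ k / fact k * of_real (LINT x|U. Y p x ^ k)) = of_real (1 - u\<^sup>2 / 2 * var p)"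
    proof -
      have s3: "(\<Sum>k\<le>2. h k) = h 0 + h 1 + h (2 :: nat)" for h :: "nat \<Rightarrow> complex" by (simp add: numeral_2_eq_2)
      show ?thesis unfolding s3 using mean_Y[OF p] by (simp add: var_def prob_space power_mult_distrib)
    qed
    have "(LINT x|U. \<bar>Y p x\<bar> ^ Suc 2) \<le> (LINT x|U. B p * (Y p x)\<^sup>2)"
    proof (rule Bochner_Integration.integral_mono[OF integrable_Y_power(2)[OF p]])
      show "integrable U (\<lambda>x. B p * (Y p x)\<^sup>2)" using integrable_Y_power(1)[OF p, of 2] by simp
      show "\<bar>Y p x\<bar> ^ Suc 2 \<le> B p * (Y p x)\<^sup>2" if "x \<in> space U" for x
        unfolding power_Suc[of _ 2] power2_abs using Y_bound[OF p that] by (rule mult_right_mono) simp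
    qed
    also have "(LINT x|U. B p * (Y p x)\<^sup>2) = B p * var p" by (simp add: var_def)
    finally have le: "\<bar>u\<bar> ^ Suc 2 / fact (Suc 2) * (LINT x|U. \<bar>Y p x\<bar> ^ Suc 2) \<le> \<bar>u\<bar> ^ Suc 2 / fact (Suc 2) * (B p * var p)"
      by (rule mult_left_mono) simp
    have e: "\<bar>u\<bar> ^ Suc 2 / fact (Suc 2) = \<bar>u\<bar> ^ 3 / 6" by (simp add: eval_nat_numeral)
    have a: "norm ((LINT x|U. iexp (u * Y p x)) - of_real (1 - u\<^sup>2 / 2 * var p)) \<le> \<bar>u\<bar> ^ 3 / 6 * (B p * var p)"
      using order.trans[OF h le] unfolding q e .
    \<comment> \<open>Turns the square of the variance, left by expanding the Gaussian factor, into
      a multiple of \<open>B p * var p\<close>, so that one sum controls both errors.\<close>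
    have vb: "var p \<le> b * B p"
    proof -
      have "var p \<le> (LINT x|U. b * B p)" unfolding var_def
      proof (rule Bochner_Integration.integral_mono[OF integrable_Y_power(1)[OF p]])
        fix x assume x: "x \<in> space U"
        have "(Y p x)\<^sup>2 = \<bar>Y p x\<bar> * \<bar>Y p x\<bar>" by (simp add: power2_eq_square)
        also have "\<dots> \<le> b * B p" using Y_bound[OF p x] B_le[OF p] by (intro mult_mono) auto
        finally show "(Y p x)\<^sup>2 \<le> b * B p" .
      qed simp
      then show ?thesis by (simp add: prob_space)
    qed
    define x where "x = u\<^sup>2 / 2 * var p"
    have x: "x \<ge> 0" by (simp add: x_def var_nonneg)
    have "exp (- x) \<le> 1 - x + x\<^sup>2 / 2"
    proof -
      obtain t where t: "exp (- x) = (\<Sum>m<3. (- x) ^ m / fact m) + exp t / fact 3 * (- x) ^ 3"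
        using Maclaurin_exp_le[of "- x" 3] by blast
      have "exp t / fact 3 * (- x) ^ 3 \<le> 0" using x by (simp add: mult_nonneg_nonpos)
      then show ?thesis using t by (simp add: eval_nat_numeral)
    qed
    moreover have "1 - x \<le> exp (- x)" using exp_ge_add_one_self[of "- x"] by simp
    ultimately have "\<bar>(1 - x) - exp (- x)\<bar> \<le> x\<^sup>2 / 2" by linarith
    moreover have "x\<^sup>2 / 2 = u ^ 4 / 8 * (var p * var p)" by (simp add: x_def power2_eq_square power4_eq_xxxx)
    moreover have "var p * var p \<le> b * B p * var p" using vb by (intro mult_right_mono var_nonneg)
    then have "u ^ 4 / 8 * (var p * var p) \<le> u ^ 4 / 8 * (b * B p * var p)" by (intro mult_left_mono) auto
    ultimately have b: "\<bar>(1 - x) - exp (- x)\<bar> \<le> u ^ 4 * b / 8 * (B p * var p)" by simp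
    have "norm (complex_of_real (1 - x) - complex_of_real (exp (- x))) = \<bar>(1 - x) - exp (- x)\<bar>"
      by (simp only: of_real_diff[symmetric] norm_of_real)
    with a b have "norm ((LINT x|U. iexp (u * Y p x)) - complex_of_real (exp (- x))) \<le> \<bar>u\<bar> ^ 3 / 6 * (B p * var p) + u ^ 4 * b / 8 * (B p * var p)"
      using norm_triangle_ineq[of "(LINT x|U. iexp (u * Y p x)) - of_real (1 - x)" "complex_of_real (1 - x) - of_real (exp (- x))"]
      unfolding x_def by simp
    then show "norm ((LINT x|U. iexp (u * Y p x)) - complex_of_real (exp (- (u\<^sup>2 / 2) * var p))) \<le> (\<bar>u\<bar> ^ 3 / 6 + u ^ 4 * b / 8) * (B p * var p)"
      by (simp add: x_def distrib_right)
  qed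
  also have "\<dots> = (\<bar>u\<bar> ^ 3 / 6 + u ^ 4 * b / 8) * (\<Sum>p\<in>P. B p * var p)" by (rule sum_distrib_left[symmetric])
  finally show ?thesis unfolding 1 2 .
qed

end

section \<open>Primitive directions\<close>

lemma sum_int_abs_le:
  fixes f :: "nat \<Rightarrow> real"
  assumes J: "finite J" "0 \<notin> J" and f: "\<And>n. f n \<ge> 0" and S: "\<And>n. (\<Sum>i=1..n. f i) \<le> S"
  shows "(\<Sum>j\<in>J. f (nat \<bar>j\<bar>)) \<le> 2 * S"
proof -
  obtain n where n: "\<And>j. j \<in> J \<Longrightarrow> nat \<bar>j\<bar> \<le> n"
    using finite_nat_set_iff_bounded_le[of "(\<lambda>j. nat \<bar>j\<bar>) ` J"] J(1) by auto
  have "J \<subseteq> int ` {1..n} \<union> (\<lambda>i. - int i) ` {1..n}"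
  proof
    fix j assume j: "j \<in> J"
    then have "nat \<bar>j\<bar> \<in> {1..n}" using n[OF j] J(2) by (cases "j = 0") auto
    moreover have "j = int (nat \<bar>j\<bar>) \<or> j = - int (nat \<bar>j\<bar>)" by linarith
    ultimately show "j \<in> int ` {1..n} \<union> (\<lambda>i. - int i) ` {1..n}" by blast
  qed
  then have "(\<Sum>j\<in>J. f (nat \<bar>j\<bar>)) \<le> (\<Sum>j\<in>int ` {1..n} \<union> (\<lambda>i. - int i) ` {1..n}. f (nat \<bar>j\<bar>))"
    by (intro sum_mono2) (auto intro: f)
  also have "\<dots> = (\<Sum>j\<in>int ` {1..n}. f (nat \<bar>j\<bar>)) + (\<Sum>j\<in>(\<lambda>i. - int i) ` {1..n}. f (nat \<bar>j\<bar>))"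
    by (rule sum.union_disjoint) auto
  also have "\<dots> = (\<Sum>i=1..n. f i) + (\<Sum>i=1..n. f i)" by (subst (1 2) sum.reindex) (auto simp: inj_on_def)
  finally show ?thesis using S[of n] by linarith
qed

text \<open>The summands are majorised by the increments of \<open>4 * sqrt a * arctan (sqrt (a * y))\<close>.\<close>

lemma sum_min_powr_le:
  assumes a: "a > 0"
  shows "(\<Sum>i=1..n. min 1 (a * real i) * real i powr (- (3/2))) \<le> 2 * pi * sqrt a"
proof -
  define F where "F y = 4 * sqrt a * arctan (sqrt (a * y))" for y
  have step: "min 1 (a * real i) * real i powr (- (3/2)) \<le> F (real i) - F (real (i - 1))" if i: "i \<ge> 1" for i
  proof -
    have c: "continuous_on {real (i - 1)..real i} F" unfolding F_def by (intro continuous_intros)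
    have d: "(F has_real_derivative 2 * a / ((1 + a * y) * sqrt y)) (at y)" if y: "y > 0" for y
    proof -
      have "((\<lambda>y. a * y) has_real_derivative a) (at y)" by (auto intro!: derivative_eq_intros)
      then have "((\<lambda>y. sqrt (a * y)) has_real_derivative (inverse (sqrt (a * y)) / 2) * a) (at y)"
        by (rule DERIV_chain2[OF DERIV_real_sqrt, rotated]) (use a y in simp)
      then have "((\<lambda>y. arctan (sqrt (a * y))) has_real_derivative (inverse (1 + (sqrt (a * y))\<^sup>2)) * ((inverse (sqrt (a * y)) / 2) * a)) (at y)"
        by (rule DERIV_chain2[OF DERIV_arctan])
      then have "(F has_real_derivative 4 * sqrt a * ((inverse (1 + (sqrt (a * y))\<^sup>2)) * ((inverse (sqrt (a * y)) / 2) * a))) (at y)"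
        unfolding F_def by (rule DERIV_cmult)
      also have "4 * sqrt a * ((inverse (1 + (sqrt (a * y))\<^sup>2)) * ((inverse (sqrt (a * y)) / 2) * a)) = 2 * a / ((1 + a * y) * sqrt y)"
      proof -
        have "4 * s * (inverse w * (inverse (s * q) / 2 * a)) = 2 * a / (w * q)" if "s \<noteq> 0" "q \<noteq> 0" "w \<noteq> 0" for s q w
          using that by (simp add: field_simps)
        moreover have "sqrt a \<noteq> 0" "sqrt y \<noteq> 0" "1 + a * y \<noteq> 0" using a y by (auto simp: add_pos_pos less_imp_neq[symmetric])
        moreover have "(sqrt (a * y))\<^sup>2 = a * y" using a y by simp
        moreover have "sqrt (a * y) = sqrt a * sqrt y" by (rule real_sqrt_mult)
        ultimately show ?thesis by (simp only:)
      qed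
      finally show ?thesis .
    qed
    have "\<exists>l z. real (i - 1) < z \<and> z < real i \<and> (F has_real_derivative l) (at z) \<and> F (real i) - F (real (i - 1)) = (real i - real (i - 1)) * l"
    proof (rule MVT[OF _ c])
      show "real (i - 1) < real i" using i by simp
      show "F differentiable (at x)" if "real (i - 1) < x" "x < real i" for x using d[of x] that by (auto simp: real_differentiable_def)
    qed
    then obtain l z where z: "real (i - 1) < z" "z < real i" "(F has_real_derivative l) (at z)" "F (real i) - F (real (i - 1)) = (real i - real (i - 1)) * l"
      by blast
    have z0: "z > 0" using z(1) by linarith
    have "l = 2 * a / ((1 + a * z) * sqrt z)" using DERIV_unique[OF z(3) d[OF z0]] .
    moreover have "real i - real (i - 1) = 1" using i by simp
    ultimately have "F (real i) - F (real (i - 1)) = 2 * a / ((1 + a * z) * sqrt z)" using z(4) by simp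
    \<comment> \<open>The derivative of \<open>F\<close> decreases, so at the intermediate point it
      is at least its value at \<open>i\<close>.\<close>
    moreover have "2 * a / ((1 + a * real i) * sqrt (real i)) \<le> 2 * a / ((1 + a * z) * sqrt z)"
      using z(2) z0 a i by (intro divide_left_mono mult_mono mult_pos_pos add_pos_pos) auto
    moreover have "min 1 (a * real i) * real i powr (- (3/2)) \<le> 2 * a / ((1 + a * real i) * sqrt (real i))"
    proof -
      have "min 1 (a * real i) * (1 + a * real i) \<le> 2 * (a * real i)"
      proof (cases "a * real i \<le> 1")
        case True
        have "(a * real i) * (1 + a * real i) \<le> (a * real i) * 2" using True a by (intro mult_left_mono) auto
        then show ?thesis using True by simp
      qed simp
      moreover have p: "1 + a * real i > 0" using a by (intro add_pos_nonneg) auto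
      ultimately have "min 1 (a * real i) \<le> 2 * (a * real i) / (1 + a * real i)" by (simp add: pos_le_divide_eq)
      then have "min 1 (a * real i) * real i powr (- (3/2)) \<le> 2 * (a * real i) / (1 + a * real i) * real i powr (- (3/2))"
        by (rule mult_right_mono) simp
      also have "\<dots> = 2 * a / (1 + a * real i) * (real i powr 1 * real i powr (- (3/2)))" using i by simp
      also have "real i powr 1 * real i powr (- (3/2)) = real i powr (1 + - (3/2))" by (rule powr_add[symmetric])
      also have "\<dots> = real i powr (- (1/2))" by simp
      also have "\<dots> = 1 / sqrt (real i)" by (simp add: powr_minus_divide powr_half_sqrt)
      finally show ?thesis by simp
    qed
    ultimately show ?thesis by linarith
  qed
  have "(\<Sum>i=1..n. min 1 (a * real i) * real i powr (- (3/2))) \<le> F (real n) - F 0"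
  proof (induction n)
    case (Suc n)
    then show ?case using step[of "Suc n"] by simp
  qed simp
  also have "\<dots> = 4 * sqrt a * arctan (sqrt (a * real n))" by (simp add: F_def)
  also have "\<dots> \<le> 4 * sqrt a * (pi / 2)" using a arctan_ubound[of "sqrt (a * real n)"] by (intro mult_left_mono) auto
  finally show ?thesis by simp
qed

lemma sum_powr_three_halves: "\<exists>S\<ge>0. \<forall>n. (\<Sum>i=1..n. real i powr (- (3/2))) \<le> S"
proof -
  have s: "summable (\<lambda>i. real i powr (- (3/2)))" by (simp add: summable_real_powr_iff)
  have "(\<Sum>i=1..n. real i powr (- (3/2))) \<le> (\<Sum>i. real i powr (- (3/2)))" for n by (rule sum_le_suminf[OF s]) auto
  moreover have "(\<Sum>i. real i powr (- (3/2))) \<ge> 0" by (rule suminf_nonneg[OF s]) simp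
  ultimately show ?thesis by blast
qed

section \<open>Lattice vectors as multiples of primitive directions\<close>

definition upper :: "int \<times> int \<Rightarrow> bool" where "upper x \<longleftrightarrow> snd x > 0 \<or> snd x = 0 \<and> fst x > 0"
definition sg :: "int \<times> int \<Rightarrow> int" where "sg x = (if upper x then 1 else - 1)"
text \<open>A nonzero x is \<open>mlt x\<close> times the primitive vector \<open>dir x\<close> in
  the upper half plane. The sign goes into the multiplicity, so x and -x share a direction and
  receive opposite integers.\<close>

definition mlt :: "int \<times> int \<Rightarrow> int" where "mlt x = sg x * gcd (fst x) (snd x)"
definition dir :: "int \<times> int \<Rightarrow> int \<times> int" where "dir x = (fst x div mlt x, snd x div mlt x)"

lemma pair_nonzero: "x \<noteq> 0 \<longleftrightarrow> fst x \<noteq> 0 \<or> snd x \<noteq> 0" for x :: "int \<times> int"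
  by (cases x) (auto simp: zero_prod_def)

lemma mlt_nonzero: "x \<noteq> 0 \<Longrightarrow> mlt x \<noteq> 0" by (auto simp: mlt_def sg_def pair_nonzero)

lemma mlt_dir: "fst x = mlt x * fst (dir x)" "snd x = mlt x * snd (dir x)" by (auto simp: dir_def mlt_def sg_def)

lemma mlt_dir_inj: "dir x = dir y \<Longrightarrow> mlt x = mlt y \<Longrightarrow> x = y"
  using mlt_dir[of x] mlt_dir[of y] by (simp add: prod_eq_iff)

lemma dir_nonzero: "x \<noteq> 0 \<Longrightarrow> dir x \<noteq> 0" using mlt_dir[of x] by (auto simp: pair_nonzero)

lemma coprime_dir: "x \<noteq> 0 \<Longrightarrow> coprime (fst (dir x)) (snd (dir x))"
proof -
  assume x: "x \<noteq> 0"
  have "coprime (fst x div gcd (fst x) (snd x)) (snd x div gcd (fst x) (snd x))"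
    using x by (intro div_gcd_coprime) (auto simp: pair_nonzero)
  then show ?thesis by (auto simp: dir_def mlt_def sg_def dvd_div_neg)
qed

lemma upper_dir: "x \<noteq> 0 \<Longrightarrow> upper (dir x)"
proof -
  assume x: "x \<noteq> 0"
  then have g: "gcd (fst x) (snd x) > 0" by (auto simp: pair_nonzero)
  show ?thesis
  proof (cases "upper x")
    case True
    then have m: "mlt x > 0" using g by (simp add: mlt_def sg_def)
    show ?thesis using True mlt_dir[of x] m unfolding upper_def by (metis mult_eq_0_iff order.asym zero_less_mult_pos)
  next
    case False
    then have m: "mlt x < 0" using g by (simp add: mlt_def sg_def)
    have "snd x < 0 \<or> snd x = 0 \<and> fst x < 0" using False x by (auto simp: upper_def pair_nonzero)
    then show ?thesis using mlt_dir[of x] m unfolding upper_def by (metis mult_eq_0_iff mult_less_0_iff order.asym)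
  qed
qed

text \<open>Coprimality makes the second coordinates divide each other. Hence distinct directions
  are never proportional, as the lower bound for linear forms demands.\<close>

lemma primitive_upper_unique:
  assumes "coprime (fst p) (snd p)" "coprime (fst q) (snd q)" "upper p" "upper q" "fst p * snd q = fst q * snd p"
  shows "p = q"
proof -
  obtain a b c d where pq: "p = (a, b)" "q = (c, d)" by (metis surj_pair)
  have co: "coprime a b" "coprime c d" and e: "a * d = c * b" using assms pq by auto
  have "b dvd d" using co(1) e by (metis coprime_commute coprime_dvd_mult_right_iff dvd_triv_right)
  moreover have "d dvd b" using co(2) e by (metis coprime_commute coprime_dvd_mult_right_iff dvd_triv_right)
  ultimately have bd: "b = d" using assms(3,4) pq by (auto simp: upper_def intro: zdvd_antisym_nonneg)
  show ?thesis
  proof (cases "b = 0")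
    case True
    then show ?thesis using co assms(3,4) bd pq by (auto simp: upper_def)
  next
    case False
    then show ?thesis using e bd pq by simp
  qed
qed

lemma upper_uminus: "x \<noteq> 0 \<Longrightarrow> upper (- x) \<longleftrightarrow> \<not> upper x" by (auto simp: upper_def pair_nonzero)

lemma sg_uminus: "x \<noteq> 0 \<Longrightarrow> sg (- x) = - sg x" by (simp add: sg_def upper_uminus)

lemma mlt_uminus: "x \<noteq> 0 \<Longrightarrow> mlt (- x) = - mlt x" by (simp add: mlt_def sg_uminus)

lemma dir_uminus: "x \<noteq> 0 \<Longrightarrow> dir (- x) = dir x" by (simp add: dir_def mlt_uminus)

context planar
begin

lemma nm_dir: "nm x = \<bar>of_int (mlt x)\<bar> * nm (dir x)"
proof -
  have "complex_of_int (fst x) + of_int (snd x) * Complex \<alpha> \<beta> = of_int (mlt x) * (of_int (fst (dir x)) + of_int (snd (dir x)) * Complex \<alpha> \<beta>)"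
    by (subst mlt_dir(1), subst mlt_dir(2)) (simp add: algebra_simps)
  then show ?thesis by (simp add: nm_cmod norm_mult)
qed

lemma kap_dir: "kap x = \<bar>of_int (mlt x)\<bar> * kap (dir x)" by (simp add: kap_def nm_dir[of x])

lemma sg_kap: "of_int (mlt x) * kap (dir x) = of_int (sg x) * kap x" unfolding kap_dir[of x] by (auto simp: mlt_def sg_def)

lemma kap_uminus: "kap (- x) = kap x"
proof -
  have "complex_of_int (fst (- x)) + of_int (snd (- x)) * Complex \<alpha> \<beta> = - (of_int (fst x) + of_int (snd x) * Complex \<alpha> \<beta>)"
    by simp
  then have "nm (- x) = nm x" unfolding nm_cmod by (simp only: norm_minus_cancel)
  then show ?thesis by (simp add: kap_def)
qed

text \<open>The factor 2 sin (pi r kap) comes from writing a difference of two sines as a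
  product.\<close>

definition amp :: "real \<Rightarrow> int \<times> int \<Rightarrow> real" where
  "amp r x = 2 / (pi * \<beta>) * (kap x powr (-3/2) * sin (pi * r * kap x))"

text \<open>A phase in full turns, odd in x, so that the terms of x and -x are complex
  conjugates.\<close>

definition ph :: "real \<Rightarrow> int \<times> int \<Rightarrow> real" where
  "ph r x = of_int (sg x) * (r * kap x / 2 - 1/8)"

lemma amp_uminus: "amp r (- x) = amp r x" by (simp add: amp_def kap_uminus)
lemma ph_uminus: "x \<noteq> 0 \<Longrightarrow> ph r (- x) = - ph r x"
proof -
  assume x: "x \<noteq> 0"
  show ?thesis unfolding ph_def kap_uminus sg_uminus[OF x] by simp
qed

text \<open>The terms of x and -x are conjugate, so the sines cancel. Real cosine sums can thus be
  handled as sums of pure exponentials, whose powers expand without case distinctions.\<close>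

lemma symmetric_sum_real:
  assumes A: "finite A" "\<And>x. x \<in> A \<Longrightarrow> - x \<in> A" "0 \<notin> A"
  shows "(\<Sum>x\<in>A. (of_real (amp r x) * e2 (ph r x)) * e2 (of_int (mlt x) * \<theta> (dir x)))
    = of_real (\<Sum>x\<in>A. amp r x * cos (2 * pi * (ph r x + of_int (mlt x) * \<theta> (dir x))))"
proof -
  have e: "(of_real (amp r x) * e2 (ph r x)) * e2 (of_int (mlt x) * \<theta> (dir x)) = of_real (amp r x) * e2 (ph r x + of_int (mlt x) * \<theta> (dir x))" for x
    by (simp add: e2_add)
  let ?s = "\<lambda>x. amp r x * sin (2 * pi * (ph r x + of_int (mlt x) * \<theta> (dir x)))"
  have "uminus ` A = A" using A(2) by (force simp: image_iff)
  then have "(\<Sum>x\<in>A. ?s x) = (\<Sum>x\<in>uminus ` A. ?s x)" by simp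
  also have "\<dots> = (\<Sum>x\<in>A. ?s (- x))" by (subst sum.reindex) (auto simp: inj_on_def)
  also have "\<dots> = (\<Sum>x\<in>A. - ?s x)"
  proof (rule sum.cong[OF refl])
    fix x assume "x \<in> A"
    then have x: "x \<noteq> 0" using A(3) by auto
    have "2 * pi * (ph r (- x) + of_int (mlt (- x)) * \<theta> (dir (- x))) = - (2 * pi * (ph r x + of_int (mlt x) * \<theta> (dir x)))"
      unfolding ph_uminus[OF x] mlt_uminus[OF x] dir_uminus[OF x] by (simp add: algebra_simps)
    then show "?s (- x) = - ?s x" unfolding amp_uminus by (simp only: sin_minus mult_minus_right)
  qed
  finally have "(\<Sum>x\<in>A. ?s x) = 0" by (simp add: sum_negf)
  then show ?thesis unfolding e by (simp add: complex_eq_iff Re_e2 Im_e2)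
qed

lemma low_symmetric: "x \<in> low M \<Longrightarrow> - x \<in> low M" by (simp add: low_def kap_uminus)

lemma trig_sum_shift:
  "trig_sum M (t + r) - trig_sum M t = (\<Sum>x\<in>low M. amp r x * cos (2 * pi * (ph r x + of_int (mlt x) * (kap (dir x) * t))))"
proof -
  have "trig_sum M (t + r) - trig_sum M t =
     (\<Sum>x\<in>low M. 1 / (pi * \<beta>) * (kap x powr (-3/2) * (sin (2 * pi * (t + r) * kap x - pi/4) - sin (2 * pi * t * kap x - pi/4))))"
    by (simp add: trig_sum_def sum_distrib_left sum_subtractf right_diff_distrib)
  also have "\<dots> = (\<Sum>x\<in>low M. amp r x * cos (2 * pi * (ph r x + of_int (mlt x) * (kap (dir x) * t))))"
  proof (rule sum.cong[OF refl])
    fix x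
    have "sin (2 * pi * (t + r) * kap x - pi/4) - sin (2 * pi * t * kap x - pi/4) =
      2 * sin (pi * r * kap x) * cos (2 * pi * t * kap x + pi * r * kap x - pi/4)"
    proof -
      define A where "A = 2 * pi * t * kap x + pi * r * kap x - pi/4"
      have "2 * pi * (t + r) * kap x - pi/4 = A + pi * r * kap x" "2 * pi * t * kap x - pi/4 = A - pi * r * kap x"
        by (simp_all add: A_def algebra_simps)
      then show ?thesis unfolding A_def[symmetric] by (simp only: sin_add sin_diff) simp
    qed
    moreover have "cos (2 * pi * (ph r x + of_int (mlt x) * (kap (dir x) * t))) = cos (2 * pi * t * kap x + pi * r * kap x - pi/4)"
    proof -
      have "2 * pi * (ph r x + of_int (mlt x) * (kap (dir x) * t)) = of_int (sg x) * (2 * pi * t * kap x + pi * r * kap x - pi/4)"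
        unfolding mult.assoc[symmetric, of "of_int (mlt x)"] sg_kap ph_def by (simp add: algebra_simps)
      moreover have "cos (of_int (sg x) * A) = cos A" for A :: real by (simp add: sg_def)
      ultimately show ?thesis by (simp only:)
    qed
    ultimately show "1 / (pi * \<beta>) * (kap x powr (-3/2) * (sin (2 * pi * (t + r) * kap x - pi/4) - sin (2 * pi * t * kap x - pi/4)))
       = amp r x * cos (2 * pi * (ph r x + of_int (mlt x) * (kap (dir x) * t)))" by (simp add: amp_def)
  qed
  finally show ?thesis .
qed

lemma abs_amp_le:
  assumes r: "r > 0"
  shows "\<bar>amp r x\<bar> \<le> 2 / (pi * \<beta>) * (kap x powr (-3/2) * min 1 (pi * r * kap x))"
proof -
  have "\<bar>sin (pi * r * kap x)\<bar> \<le> min 1 (pi * r * kap x)"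
    using abs_sin_x_le_abs_x[of "pi * r * kap x"] r by (simp add: abs_mult)
  then show ?thesis using beta_pos unfolding amp_def abs_mult by (intro mult_mono) auto
qed

text \<open>Along the multiples j of one direction the amplitudes are at most a constant times min 1
  (a j) j^(-3/2) with a = pi r kap p, up to a power of kap p; their sum is of order sqrt a. The
  resulting sqrt r is the order of the standard deviation, so a single wave stays bounded after
  normalisation.\<close>

lemma fiber_amp_sum:
  assumes r: "r > 0" and A: "finite A" "0 \<notin> A" "\<And>x. x \<in> A \<Longrightarrow> dir x = p" and p: "p \<noteq> 0"
  shows "(\<Sum>x\<in>A. \<bar>amp r x\<bar>) \<le> (8 * sqrt pi / \<beta>) * (sqrt r / kap p)"
proof -
  let ?k = "kap p" and ?a = "pi * r * kap p"
  have k: "?k > 0" using kap_pos[OF p] .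
  have a: "?a > 0" using k r by simp
  define f where "f i = min 1 (?a * real i) * real i powr (- (3/2))" for i :: nat
  have inj: "inj_on mlt A" using A(3) mlt_dir_inj by (metis inj_onI)
  have "(\<Sum>x\<in>A. \<bar>amp r x\<bar>) \<le> (\<Sum>x\<in>A. 2 / (pi * \<beta>) * ?k powr (-3/2) * f (nat \<bar>mlt x\<bar>))"
  proof (rule sum_mono)
    fix x assume x: "x \<in> A"
    have kx: "kap x = real (nat \<bar>mlt x\<bar>) * ?k" using kap_dir[of x] A(3)[OF x] by simp
    show "\<bar>amp r x\<bar> \<le> 2 / (pi * \<beta>) * ?k powr (-3/2) * f (nat \<bar>mlt x\<bar>)"
      using abs_amp_le[OF r, of x] k unfolding kx f_def by (simp add: powr_mult mult_ac)
  qed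
  also have "\<dots> = 2 / (pi * \<beta>) * ?k powr (-3/2) * (\<Sum>j\<in>mlt ` A. f (nat \<bar>j\<bar>))"
    by (simp add: sum.reindex[OF inj] sum_distrib_left)
  also have "\<dots> \<le> 2 / (pi * \<beta>) * ?k powr (-3/2) * (2 * (2 * pi * sqrt ?a))"
  proof (rule mult_left_mono[OF sum_int_abs_le])
    show "finite (mlt ` A)" using A(1) by simp
    show "0 \<notin> mlt ` A" using A(2) mlt_nonzero by force
    show "f n \<ge> 0" for n using a by (simp add: f_def)
    show "(\<Sum>i=1..n. f i) \<le> 2 * pi * sqrt ?a" for n unfolding f_def by (rule sum_min_powr_le[OF a])
  qed (use beta_pos in simp)
  also have "\<dots> = (8 * sqrt pi / \<beta>) * (sqrt r * (?k powr (-3/2) * sqrt ?k))" by (simp add: real_sqrt_mult)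
  also have "?k powr (-3/2) * sqrt ?k = ?k powr (-3/2) * ?k powr (1/2)" using k by (simp add: powr_half_sqrt)
  also have "\<dots> = ?k powr (-3/2 + 1/2)" by (rule powr_add[symmetric])
  also have "\<dots> = 1 / ?k" using k by (simp add: powr_minus_divide)
  finally show ?thesis by simp
qed

text \<open>With (min 1 y)^2 \<le> y^(3/2) the sum over multiples still converges, and the power
  r^(3/2) gains sqrt r over the total variance, which is of order r. That gain is what the Lindeberg
  condition needs.\<close>

lemma fiber_amp_square_sum:
  "\<exists>C\<ge>0. \<forall>r>0. \<forall>A p. finite A \<longrightarrow> 0 \<notin> A \<longrightarrow> (\<forall>x\<in>A. dir x = p) \<longrightarrow> p \<noteq> 0 \<longrightarrow> (\<Sum>x\<in>A. (amp r x)\<^sup>2) \<le> C * (r powr (3/2) * kap p powr (- (3/2)))"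
proof -
  obtain S where S: "S \<ge> 0" "\<And>n. (\<Sum>i=1..n. real i powr (- (3/2))) \<le> S" using sum_powr_three_halves by blast
  define D where "D = (2 / (pi * \<beta>))\<^sup>2 * pi powr (3/2)"
  have D: "D \<ge> 0" by (simp add: D_def)
  have "(\<Sum>x\<in>A. (amp r x)\<^sup>2) \<le> (D * (2 * S)) * (r powr (3/2) * kap p powr (- (3/2)))"
    if r: "r > 0" and A: "finite A" "0 \<notin> A" "\<And>x. x \<in> A \<Longrightarrow> dir x = p" and p: "p \<noteq> 0" for r A p
  proof -
    have k: "kap p > 0" using kap_pos[OF p] .
    have inj: "inj_on mlt A" using A(3) mlt_dir_inj by (metis inj_onI)
    have "(\<Sum>x\<in>A. (amp r x)\<^sup>2) \<le> (\<Sum>x\<in>A. D * (r powr (3/2) * kap p powr (- (3/2))) * real (nat \<bar>mlt x\<bar>) powr (- (3/2)))"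
    proof (rule sum_mono)
      fix x assume x: "x \<in> A"
      have kx: "kap x = real (nat \<bar>mlt x\<bar>) * kap p" using kap_dir[of x] A(3)[OF x] by simp
      have x0: "kap x > 0" using kap_pos[of x] x A(2) by auto
      define y where "y = pi * r * kap x"
      have y: "y > 0" using x0 r by (simp add: y_def)
      have m: "(min 1 y)\<^sup>2 \<le> y powr (3/2)"
      proof (cases "y \<le> 1")
        case True
        have "y\<^sup>2 = y powr 2" using y by (simp add: powr_numeral)
        also have "\<dots> \<le> y powr (3/2)" using y True by (intro powr_mono') auto
        finally show ?thesis using True by simp
      next
        case False
        then show ?thesis using ge_one_powr_ge_zero[of y "3/2"] by simp
      qed
      have "(amp r x)\<^sup>2 = \<bar>amp r x\<bar>\<^sup>2" by simp
      also have "\<dots> \<le> (2 / (pi * \<beta>) * (kap x powr (-3/2) * min 1 y))\<^sup>2"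
        using abs_amp_le[OF r, of x] unfolding y_def by (intro power_mono) auto
      also have "\<dots> = (2 / (pi * \<beta>))\<^sup>2 * ((kap x powr (-3/2))\<^sup>2 * (min 1 y)\<^sup>2)" by (simp only: power_mult_distrib)
      also have "\<dots> \<le> (2 / (pi * \<beta>))\<^sup>2 * ((kap x powr (-3/2))\<^sup>2 * y powr (3/2))" by (intro mult_left_mono m) auto
      also have "y powr (3/2) = pi powr (3/2) * r powr (3/2) * kap x powr (3/2)" using r x0 by (simp add: y_def powr_mult)
      also have "(kap x powr (-3/2))\<^sup>2 * (pi powr (3/2) * r powr (3/2) * kap x powr (3/2)) =
         pi powr (3/2) * r powr (3/2) * (kap x powr (-3/2) * kap x powr (-3/2) * kap x powr (3/2))" by (simp only: power2_eq_square mult_ac)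
      also have "kap x powr (-3/2) * kap x powr (-3/2) * kap x powr (3/2) = kap x powr (-3/2 + -3/2 + 3/2)" by (simp only: powr_add)
      also have "\<dots> = kap x powr (- (3/2))" by simp
      also have "\<dots> = real (nat \<bar>mlt x\<bar>) powr (- (3/2)) * kap p powr (- (3/2))" unfolding kx using k by (subst powr_mult) auto
      finally show "(amp r x)\<^sup>2 \<le> D * (r powr (3/2) * kap p powr (- (3/2))) * real (nat \<bar>mlt x\<bar>) powr (- (3/2))"
        by (simp add: D_def mult_ac)
    qed
    also have "\<dots> = D * (r powr (3/2) * kap p powr (- (3/2))) * (\<Sum>j\<in>mlt ` A. real (nat \<bar>j\<bar>) powr (- (3/2)))"
      by (simp add: sum.reindex[OF inj] sum_distrib_left)
    also have "\<dots> \<le> D * (r powr (3/2) * kap p powr (- (3/2))) * (2 * S)"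
    proof (rule mult_left_mono[OF sum_int_abs_le])
      show "finite (mlt ` A)" using A(1) by simp
      show "0 \<notin> mlt ` A" using A(2) mlt_nonzero by force
    qed (use D S in auto)
    finally show ?thesis by (simp add: mult_ac)
  qed
  moreover have "D * (2 * S) \<ge> 0" using D S by simp
  ultimately show ?thesis by blast
qed

text \<open>Equal directions are collected, which leaves a form in at most \<open>k\<close> pairwise
  non-proportional vectors whose coordinates and coefficients are at most a multiple of M. The
  number of distinct directions varies with \<open>f\<close>, hence the extremes of the constants
  over all \<open>d \<le> k\<close>.\<close>

lemma separation:
  fixes k :: nat
  assumes ai: "algebraically_independent \<alpha> \<beta>" and sd: "strongly_Diophantine \<alpha> \<beta>"
  shows "\<exists>c>0. \<exists>K\<ge>0. \<forall>M\<ge>1. \<forall>f. (\<forall>i<k. f i \<in> low M) \<longrightarrow>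
    (\<forall>p. (\<Sum>i | i < k \<and> dir (f i) = p. mlt (f i)) = 0) \<or>
    c * M powr (- K) \<le> \<bar>\<Sum>i<k. of_int (mlt (f i)) * kap (dir (f i))\<bar>"
proof -
  \<comment> \<open>Names the lower bound so that its constants can be chosen simultaneously for all
    \<open>d\<close>.\<close>
  define good where "good d c K \<longleftrightarrow> c > 0 \<and> K \<ge> 0 \<and> (\<forall>N m n H. form_bounded d (N, m, n, H) \<longrightarrow> (\<exists>i<d. N i \<noteq> 0) \<longrightarrow>
     (\<forall>i<d. m i \<noteq> 0 \<or> n i \<noteq> 0) \<longrightarrow> (\<forall>i<d. \<forall>j<d. i \<noteq> j \<longrightarrow> m i * n j \<noteq> m j * n i) \<longrightarrow>
     c * H powr (- K) \<le> \<bar>\<Sum>i<d. of_int (N i) * cmod (of_int (m i) + of_int (n i) * Complex \<alpha> \<beta>)\<bar>)" for d and c K :: real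
  have "\<exists>c K. good d c K" for d using linear_form_lower_bound[OF ai sd, of d] unfolding good_def by blast
  then obtain c0 K0 where g: "\<And>d. good d (c0 d) (K0 d)" by metis
  have c0: "c0 d > 0" "K0 d \<ge> 0" for d using g[of d] by (simp_all add: good_def)
  have low: "c0 d * H powr (- K0 d) \<le> \<bar>\<Sum>i<d. of_int (N i) * cmod (of_int (m i) + of_int (n i) * Complex \<alpha> \<beta>)\<bar>"
    if "form_bounded d (N, m, n, H)" "\<exists>i<d. N i \<noteq> 0" "\<forall>i<d. m i \<noteq> 0 \<or> n i \<noteq> 0" "\<forall>i<d. \<forall>j<d. i \<noteq> j \<longrightarrow> m i * n j \<noteq> m j * n i" for d N m n H
    using g[of d] that unfolding good_def by blast
  define c1 where "c1 = Min (c0 ` {..k})"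
  define K where "K = Max (K0 ` {..k})"
  \<comment> \<open>Large enough for single coordinates, which are at most (\<beta> / lc) M, and for
    sums of up to k multiplicities of that size.\<close>
  define h where "h = (real k + 1) * (\<beta> / lc + 1)"
  have bl: "\<beta> / lc > 0" using beta_pos lc_pos by simp
  have h: "h \<ge> 1"
  proof -
    have "1 * 1 \<le> h" unfolding h_def using bl by (intro mult_mono) auto
    then show ?thesis by simp
  qed
  have c1: "c1 > 0" "\<And>d. d \<le> k \<Longrightarrow> c1 \<le> c0 d" unfolding c1_def using c0 by auto
  have K: "K \<ge> 0" "\<And>d. d \<le> k \<Longrightarrow> K0 d \<le> K"
  proof -
    show le: "K0 d \<le> K" if "d \<le> k" for d unfolding K_def using that by auto
    show "K \<ge> 0" using le[of 0] c0(2)[of 0] by simp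
  qed
  define c where "c = c1 * h powr (- K) / \<beta>"
  have "(\<forall>p. (\<Sum>i | i < k \<and> dir (f i) = p. mlt (f i)) = 0) \<or>
    c * M powr (- K) \<le> \<bar>\<Sum>i<k. of_int (mlt (f i)) * kap (dir (f i))\<bar>"
    if M: "M \<ge> 1" and f: "\<And>i. i < k \<Longrightarrow> f i \<in> low M" for M f
  proof (rule disjCI)
    assume nz: "\<not> c * M powr (- K) \<le> \<bar>\<Sum>i<k. of_int (mlt (f i)) * kap (dir (f i))\<bar>"
    define N where "N p = (\<Sum>i | i < k \<and> dir (f i) = p. mlt (f i))" for p
    define D where "D = (\<lambda>i. dir (f i)) ` {..<k}"
    define d where "d = card D"
    have fD: "finite D" by (simp add: D_def)
    have dk: "d \<le> k" unfolding d_def D_def using card_image_le[of "{..<k}" "\<lambda>i. dir (f i)"] by simp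
    obtain e where e: "bij_betw e {..<d} D" using ex_bij_betw_nat_finite[OF fD] by (auto simp: d_def atLeast0LessThan)
    have fx: "f i \<noteq> 0" "kap (f i) \<le> M" if "i < k" for i using f[OF that] by (auto simp: low_def)
    have bnd: "\<bar>real_of_int (fst (f i))\<bar> \<le> \<beta> / lc * M" "\<bar>real_of_int (snd (f i))\<bar> \<le> \<beta> / lc * M" if "i < k" for i
    proof -
      have "lc * (\<bar>of_int (fst (f i))\<bar> + \<bar>of_int (snd (f i))\<bar>) \<le> \<beta> * M"
        using nm_lower[of "f i"] fx(2)[OF that] beta_pos by (simp add: kap_def field_simps)
      then have "\<bar>real_of_int (fst (f i))\<bar> + \<bar>real_of_int (snd (f i))\<bar> \<le> \<beta> / lc * M"
        using lc_pos by (simp add: field_simps)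
      then show "\<bar>real_of_int (fst (f i))\<bar> \<le> \<beta> / lc * M" "\<bar>real_of_int (snd (f i))\<bar> \<le> \<beta> / lc * M" by auto
    qed
    have mb: "\<bar>real_of_int (mlt (f i))\<bar> \<le> \<beta> / lc * M" if i: "i < k" for i
    proof -
      have "\<bar>mlt (f i)\<bar> \<le> max \<bar>fst (f i)\<bar> \<bar>snd (f i)\<bar>"
      proof (cases "fst (f i) = 0")
        case False
        then have "\<bar>mlt (f i)\<bar> \<le> \<bar>fst (f i)\<bar>" using mlt_dir(1)[of "f i"] by (intro dvd_imp_le_int) (auto intro: dvdI)
        then show ?thesis by simp
      next
        case True
        then have "snd (f i) \<noteq> 0" using fx(1)[OF i] by (auto simp: pair_nonzero)
        then have "\<bar>mlt (f i)\<bar> \<le> \<bar>snd (f i)\<bar>" using mlt_dir(2)[of "f i"] by (intro dvd_imp_le_int) (auto intro: dvdI)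
        then show ?thesis by simp
      qed
      then have "real_of_int \<bar>mlt (f i)\<bar> \<le> real_of_int (max \<bar>fst (f i)\<bar> \<bar>snd (f i)\<bar>)" by (simp only: of_int_le_iff)
      then show ?thesis using bnd[OF i] by (simp add: of_int_max)
    qed
    have db: "\<bar>real_of_int (fst (dir (f i)))\<bar> \<le> \<beta> / lc * M" "\<bar>real_of_int (snd (dir (f i)))\<bar> \<le> \<beta> / lc * M" if i: "i < k" for i
    proof -
      have m1: "1 \<le> \<bar>real_of_int (mlt (f i))\<bar>" using mlt_nonzero[OF fx(1)[OF i]] by linarith
      have "\<bar>real_of_int (fst (dir (f i)))\<bar> * 1 \<le> \<bar>real_of_int (fst (dir (f i)))\<bar> * \<bar>real_of_int (mlt (f i))\<bar>" using m1 by (rule mult_left_mono) simp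
      also have "\<dots> = \<bar>real_of_int (fst (f i))\<bar>" by (subst (2) mlt_dir(1)) (simp add: abs_mult mult.commute)
      finally show "\<bar>real_of_int (fst (dir (f i)))\<bar> \<le> \<beta> / lc * M" using bnd(1)[OF i] by simp
      have "\<bar>real_of_int (snd (dir (f i)))\<bar> * 1 \<le> \<bar>real_of_int (snd (dir (f i)))\<bar> * \<bar>real_of_int (mlt (f i))\<bar>" using m1 by (rule mult_left_mono) simp
      also have "\<dots> = \<bar>real_of_int (snd (f i))\<bar>" by (subst (2) mlt_dir(2)) (simp add: abs_mult mult.commute)
      finally show "\<bar>real_of_int (snd (dir (f i)))\<bar> \<le> \<beta> / lc * M" using bnd(2)[OF i] by simp
    qed
    have Mb: "\<beta> / lc * M \<le> h * M" "real k * (\<beta> / lc * M) \<le> h * M"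
    proof -
      have "1 * (\<beta> / lc) \<le> h" unfolding h_def using bl by (intro mult_mono) auto
      then show "\<beta> / lc * M \<le> h * M" using M by (intro mult_right_mono) auto
      have "real k * (\<beta> / lc) \<le> h" unfolding h_def using bl by (intro mult_mono) auto
      then have "real k * (\<beta> / lc) * M \<le> h * M" using M by (intro mult_right_mono) auto
      then show "real k * (\<beta> / lc * M) \<le> h * M" by (simp add: mult_ac)
    qed
    have Nb: "\<bar>real_of_int (N p)\<bar> \<le> h * M" for p
    proof -
      have "\<bar>real_of_int (N p)\<bar> \<le> (\<Sum>i | i < k \<and> dir (f i) = p. \<bar>real_of_int (mlt (f i))\<bar>)"
        unfolding N_def of_int_sum by (rule sum_abs)
      also have "\<dots> \<le> (\<Sum>i | i < k \<and> dir (f i) = p. \<beta> / lc * M)" by (intro sum_mono mb) auto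
      also have "\<dots> \<le> (\<Sum>i<k. \<beta> / lc * M)" using lc_pos beta_pos M by (intro sum_mono2) auto
      also have "\<dots> = real k * (\<beta> / lc * M)" by simp
      finally show ?thesis using Mb by linarith
    qed
    have eD: "\<exists>i<k. e j = dir (f i)" if "j < d" for j using bij_betwE[OF e] that by (auto simp: D_def)
    have fb: "form_bounded d (\<lambda>j. N (e j), \<lambda>j. fst (e j), \<lambda>j. snd (e j), h * M)"
    proof -
      have "1 * 1 \<le> h * M" using h M by (intro mult_mono) auto
      moreover have "\<bar>real_of_int (fst (e j))\<bar> \<le> h * M \<and> \<bar>real_of_int (snd (e j))\<bar> \<le> h * M" if j: "j < d" for j
        using eD[OF j] db Mb(1) by (metis order.trans)
      ultimately show ?thesis using Nb by (simp add: form_bounded_def)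
    qed
    have n0: "\<forall>j<d. fst (e j) \<noteq> 0 \<or> snd (e j) \<noteq> 0" using eD dir_nonzero fx(1) by (metis pair_nonzero)
    have np: "\<forall>i<d. \<forall>j<d. i \<noteq> j \<longrightarrow> fst (e i) * snd (e j) \<noteq> fst (e j) * snd (e i)"
    proof (intro allI impI notI)
      fix i j assume ij: "i < d" "j < d" "i \<noteq> j" "fst (e i) * snd (e j) = fst (e j) * snd (e i)"
      obtain i' j' where "i' < k" "e i = dir (f i')" "j' < k" "e j = dir (f j')" using eD ij by metis
      then have "e i = e j" using ij(4) fx(1) by (metis primitive_upper_unique coprime_dir upper_dir)
      then show False using ij e by (auto simp: bij_betw_def inj_on_def)
    qed
    have sum_eq: "(\<Sum>i<k. of_int (mlt (f i)) * kap (dir (f i))) = (\<Sum>j<d. of_int (N (e j)) * cmod (of_int (fst (e j)) + of_int (snd (e j)) * Complex \<alpha> \<beta>)) / \<beta>"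
    proof -
      have "(\<Sum>i<k. of_int (mlt (f i)) * kap (dir (f i))) = (\<Sum>p\<in>D. \<Sum>i\<in>{i\<in>{..<k}. dir (f i) = p}. of_int (mlt (f i)) * kap (dir (f i)))"
        by (rule sum.group[symmetric]) (auto simp: D_def)
      also have "\<dots> = (\<Sum>p\<in>D. of_int (N p) * kap p)" by (intro sum.cong) (auto simp: N_def sum_distrib_right)
      also have "\<dots> = (\<Sum>j<d. of_int (N (e j)) * kap (e j))" by (rule sum.reindex_bij_betw[OF e, symmetric])
      finally show ?thesis by (simp add: kap_def nm_cmod sum_divide_distrib)
    qed
    have "\<forall>j<d. N (e j) = 0"
    proof (rule ccontr)
      assume "\<not> (\<forall>j<d. N (e j) = 0)"
      then have ex: "\<exists>j<d. N (e j) \<noteq> 0" by blast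
      have l: "c0 d * (h * M) powr (- K0 d) \<le> \<bar>\<Sum>j<d. of_int (N (e j)) * cmod (of_int (fst (e j)) + of_int (snd (e j)) * Complex \<alpha> \<beta>)\<bar>"
        by (rule low[OF fb ex n0 np])
      have hM: "h * M \<ge> 1" using fb by (simp add: form_bounded_def)
      have "c1 * (h * M) powr (- K) \<le> c0 d * (h * M) powr (- K0 d)"
        using c1(2)[OF dk] c0(1)[of d] K(2)[OF dk] hM by (intro mult_mono powr_mono) auto
      also note l
      finally have "c1 * (h * M) powr (- K) / \<beta> \<le> \<bar>\<Sum>j<d. of_int (N (e j)) * cmod (of_int (fst (e j)) + of_int (snd (e j)) * Complex \<alpha> \<beta>)\<bar> / \<beta>"
        using beta_pos by (intro divide_right_mono) auto
      also have "\<dots> = \<bar>\<Sum>i<k. of_int (mlt (f i)) * kap (dir (f i))\<bar>" unfolding sum_eq using beta_pos by (simp add: abs_divide)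
      also have "c1 * (h * M) powr (- K) / \<beta> = c * M powr (- K)" using h M by (simp add: c_def powr_mult)
      finally show False using nz by simp
    qed
    then have "N p = 0" if "p \<in> D" for p using e that by (auto simp: bij_betw_def)
    moreover have "N p = 0" if "p \<notin> D" for p
    proof -
      have "{i. i < k \<and> dir (f i) = p} = {}" using that by (auto simp: D_def)
      then show ?thesis by (simp only: N_def sum.empty)
    qed
    ultimately show "\<forall>p. (\<Sum>i | i < k \<and> dir (f i) = p. mlt (f i)) = 0" unfolding N_def by blast
  qed
  moreover have "c > 0" using c1(1) h beta_pos by (simp add: c_def)
  ultimately show ?thesis using K(1) by blast
qed

section \<open>Waves of one direction and the random phase model\<close>

definition fib :: "real \<Rightarrow> int \<times> int \<Rightarrow> (int \<times> int) set" where "fib M p = {x \<in> low M. dir x = p}"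

definition wave :: "real \<Rightarrow> real \<Rightarrow> int \<times> int \<Rightarrow> real \<Rightarrow> real" where
  "wave M r p s = (\<Sum>x\<in>fib M p. amp r x * cos (2 * pi * (ph r x + of_int (mlt x) * s)))"

definition shift_sum :: "real \<Rightarrow> real \<Rightarrow> real \<Rightarrow> real" where
  "shift_sum M r t = trig_sum M (t + r) - trig_sum M t"

definition dirs :: "real \<Rightarrow> (int \<times> int) set" where "dirs M = dir ` low M"

text \<open>The increment with each deterministic phase \<open>kap p * t\<close> replaced by a free
  coordinate \<theta> p; under the product of uniform measures its waves are independent.\<close>

definition model :: "real \<Rightarrow> real \<Rightarrow> (int \<times> int \<Rightarrow> real) \<Rightarrow> real" where
  "model M r \<theta> = (\<Sum>p\<in>dirs M. wave M r p (\<theta> p))"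

lemma finite_dirs: "finite (dirs M)" by (simp add: dirs_def finite_low)
lemma finite_fib: "finite (fib M p)" by (simp add: fib_def finite_low)

lemma dirs_nonzero: "p \<in> dirs M \<Longrightarrow> p \<noteq> 0" by (auto simp: dirs_def low_def dir_nonzero)

lemma fib_nonzero: "0 \<notin> fib M p" by (simp add: fib_def low_def)

lemma sum_fib: "(\<Sum>p\<in>dirs M. \<Sum>x\<in>fib M p. f x) = (\<Sum>x\<in>low M. f x :: real)"
  unfolding fib_def by (rule sum.group) (auto simp: finite_low dirs_def)

lemma model_eq: "model M r \<theta> = (\<Sum>x\<in>low M. amp r x * cos (2 * pi * (ph r x + of_int (mlt x) * \<theta> (dir x))))"
proof -
  have "model M r \<theta> = (\<Sum>p\<in>dirs M. \<Sum>x\<in>fib M p. amp r x * cos (2 * pi * (ph r x + of_int (mlt x) * \<theta> (dir x))))"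
    unfolding model_def wave_def by (intro sum.cong refl) (simp add: fib_def)
  then show ?thesis unfolding sum_fib .
qed

lemma of_real_shift_sum:
  "of_real (shift_sum M r t) = (\<Sum>x\<in>low M. (of_real (amp r x) * e2 (ph r x)) * e2 (of_int (mlt x) * kap (dir x) * t))"
  unfolding shift_sum_def trig_sum_shift mult.assoc[of "real_of_int _"]
  by (rule symmetric_sum_real[of "low M" r "\<lambda>p. kap p * t", symmetric]) (auto simp: finite_low low_symmetric, simp add: low_def)

lemma of_real_model:
  "of_real (model M r \<theta>) = (\<Sum>x\<in>low M. (of_real (amp r x) * e2 (ph r x)) * e2 (of_int (mlt x) * \<theta> (dir x)))"
  unfolding model_eq by (rule symmetric_sum_real[symmetric]) (auto simp: finite_low low_symmetric, simp add: low_def)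

lemma fib_symmetric: "x \<in> fib M p \<Longrightarrow> - x \<in> fib M p"
  using dir_uminus[of x] low_symmetric[of x M] by (auto simp: fib_def low_def)

lemma of_real_wave:
  "of_real (wave M r p s) = (\<Sum>x\<in>fib M p. (of_real (amp r x) * e2 (ph r x)) * e2 (of_int (mlt x) * s))" unfolding wave_def
  by (rule symmetric_sum_real[of "fib M p" r "\<lambda>_. s", symmetric]) (auto simp: finite_fib fib_symmetric fib_nonzero)

lemma moment_diff:
  assumes T: "T > 0" and \<delta>: "\<delta> > 0"
    and sep: "\<And>f. (\<forall>i<k. f i \<in> low M) \<Longrightarrow> (\<forall>p. (\<Sum>i | i < k \<and> dir (f i) = p. mlt (f i)) = 0) \<or>
       \<delta> \<le> \<bar>\<Sum>i<k. of_int (mlt (f i)) * kap (dir (f i))\<bar>"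
  shows "\<bar>(LINT t|unif T (2 * T). shift_sum M r t ^ k) - (LINT \<theta>|Pi\<^sub>M (dirs M) (\<lambda>_. unif 0 1). model M r \<theta> ^ k)\<bar>
     \<le> (\<Sum>x\<in>low M. \<bar>amp r x\<bar>) ^ k / (pi * \<delta> * T)"
proof -
  have "norm ((LINT t|unif T (2 * T). of_real (shift_sum M r t) ^ k) - (LINT \<theta>|Pi\<^sub>M (dirs M) (\<lambda>_. unif 0 1). of_real (model M r \<theta>) ^ k) :: complex)
     \<le> (\<Sum>x\<in>low M. norm (of_real (amp r x) * e2 (ph r x))) ^ k / (pi * \<delta> * T)"
    unfolding of_real_shift_sum of_real_model dirs_def
    by (rule trig_moment_compare[OF finite_low T \<delta>]) (use sep in \<open>auto simp: PiE_iff\<close>)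
  then show ?thesis by (simp add: norm_mult of_real_power[symmetric] of_real_diff[symmetric] del: of_real_power of_real_diff)
qed

lemma continuous_wave: "continuous_on S (wave M r p)" unfolding wave_def[abs_def] by (intro continuous_intros)

lemma borel_measurable_wave [measurable]: "wave M r p \<in> borel_measurable borel"
  by (intro borel_measurable_continuous_onI continuous_wave)

lemma abs_wave_le: "\<bar>wave M r p s\<bar> \<le> (\<Sum>x\<in>fib M p. \<bar>amp r x\<bar>)"
  unfolding wave_def by (rule order.trans[OF sum_abs sum_mono]) (simp add: abs_mult mult_left_le)

lemma abs_model_le: "\<bar>model M r \<theta>\<bar> \<le> (\<Sum>x\<in>low M. \<bar>amp r x\<bar>)"
  unfolding model_eq by (rule order.trans[OF sum_abs sum_mono]) (simp add: abs_mult mult_left_le)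

lemma abs_shift_sum_le: "\<bar>shift_sum M r t\<bar> \<le> (\<Sum>x\<in>low M. \<bar>amp r x\<bar>)"
  unfolding shift_sum_def trig_sum_shift by (rule order.trans[OF sum_abs sum_mono]) (simp add: abs_mult mult_left_le)

lemma mean_wave: "(LINT s|unif 0 1. wave M r p s) = 0"
proof -
  interpret prob_space "unif 0 1" by (rule prob_space_unif) simp
  have "complex_of_real (LINT s|unif 0 1. wave M r p s) = (LINT s|unif 0 1. of_real (wave M r p s))"
    by (rule integral_complex_of_real[symmetric])
  also have "\<dots> = (\<Sum>x\<in>fib M p. LINT s|unif 0 1. (of_real (amp r x) * e2 (ph r x)) * e2 (of_int (mlt x) * s))"
    unfolding of_real_wave by (intro Bochner_Integration.integral_sum integrable_mult_right integrable_const_bound[where B=1]) auto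
  also have "\<dots> = 0"
  proof (intro sum.neutral ballI)
    fix x assume "x \<in> fib M p"
    then have "mlt x \<noteq> 0" using fib_nonzero mlt_nonzero by metis
    then show "(LINT s|unif 0 1. (of_real (amp r x) * e2 (ph r x)) * e2 (of_int (mlt x) * s)) = 0" by (simp add: integral_unif_e2_int)
  qed
  finally show ?thesis by simp
qed

text \<open>Parseval: distinct elements of a fibre have distinct multiplicities, so their
  exponentials are orthogonal on the circle.\<close>

lemma variance_wave: "(LINT s|unif 0 1. (wave M r p s)\<^sup>2) = (\<Sum>x\<in>fib M p. (amp r x)\<^sup>2)"
proof -
  interpret prob_space "unif 0 1" by (rule prob_space_unif) simp
  let ?c = "\<lambda>x. of_real (amp r x) * e2 (ph r x)"
  have "complex_of_real ((wave M r p s)\<^sup>2) = (\<Sum>x\<in>fib M p. \<Sum>y\<in>fib M p. (?c x * cnj (?c y)) * e2 (of_int (mlt x - mlt y) * s))" for s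
  proof -
    have e: "e2 (of_int (mlt x) * s) * cnj (e2 (of_int (mlt y) * s)) = e2 (of_int (mlt x - mlt y) * s)" for x y
      by (simp only: e2_minus[symmetric] e2_add[symmetric]) (simp add: algebra_simps)
    have "complex_of_real ((wave M r p s)\<^sup>2) = of_real (wave M r p s) * cnj (of_real (wave M r p s))" by (simp add: power2_eq_square)
    also have "\<dots> = (\<Sum>x\<in>fib M p. \<Sum>y\<in>fib M p. (?c x * e2 (of_int (mlt x) * s)) * cnj (?c y * e2 (of_int (mlt y) * s)))"
      unfolding of_real_wave cnj_sum sum_product ..
    also have "\<dots> = (\<Sum>x\<in>fib M p. \<Sum>y\<in>fib M p. (?c x * cnj (?c y)) * e2 (of_int (mlt x - mlt y) * s))"
      unfolding e[symmetric] complex_cnj_mult by (intro sum.cong refl) (simp only: mult_ac)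
    finally show ?thesis .
  qed
  then have "complex_of_real (LINT s|unif 0 1. (wave M r p s)\<^sup>2) =
     (LINT s|unif 0 1. (\<Sum>x\<in>fib M p. \<Sum>y\<in>fib M p. (?c x * cnj (?c y)) * e2 (of_int (mlt x - mlt y) * s)))"
    by (simp only: integral_complex_of_real[symmetric])
  also have "\<dots> = (\<Sum>x\<in>fib M p. \<Sum>y\<in>fib M p. (?c x * cnj (?c y)) * (LINT s|unif 0 1. e2 (of_int (mlt x - mlt y) * s)))"
  proof -
    have i: "integrable (unif 0 1) (\<lambda>s. (?c x * cnj (?c y)) * e2 (of_int (mlt x - mlt y) * s))" for x y
      by (intro integrable_mult_right integrable_const_bound[where B=1]) auto
    show ?thesis by (subst Bochner_Integration.integral_sum, intro Bochner_Integration.integrable_sum i,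
          intro sum.cong refl, subst Bochner_Integration.integral_sum, intro i, intro sum.cong refl integral_mult_right_zero)
  qed
  also have "\<dots> = (\<Sum>x\<in>fib M p. \<Sum>y\<in>fib M p. if y = x then of_real ((amp r x)\<^sup>2) else 0)"
  proof (intro sum.cong refl)
    fix x y assume xy: "x \<in> fib M p" "y \<in> fib M p"
    have "mlt x = mlt y \<longleftrightarrow> y = x" using xy mlt_dir_inj[of x y] by (auto simp: fib_def)
    moreover have "?c x * cnj (?c x) = of_real ((amp r x)\<^sup>2)"
      by (simp only: complex_norm_square[symmetric] norm_mult norm_of_real norm_e2 mult_1_right power2_abs)
    ultimately show "(?c x * cnj (?c y)) * (LINT s|unif 0 1. e2 (of_int (mlt x - mlt y) * s)) = (if y = x then of_real ((amp r x)\<^sup>2) else 0)"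
      unfolding integral_unif_e2_int by auto
  qed
  also have "\<dots> = of_real (\<Sum>x\<in>fib M p. (amp r x)\<^sup>2)" by (simp add: finite_fib)
  finally show ?thesis by (simp only: of_real_eq_iff)
qed

text \<open>The normalisation \<sigma> as a function of \<rho>.\<close>

definition sd :: "real \<Rightarrow> real" where "sd r = sqrt (4 * pi / \<beta> * r)"

lemma sd_pos: "r > 0 \<Longrightarrow> sd r > 0" using beta_pos by (simp add: sd_def)
lemma sd_sq: "r > 0 \<Longrightarrow> (sd r)\<^sup>2 = 4 * pi / \<beta> * r" using beta_pos by (simp add: sd_def)
lemma sd_eq: "sd r = sd 1 * sqrt r" unfolding sd_def by (subst real_sqrt_mult) simp

lemma kap_ge: "x \<noteq> 0 \<Longrightarrow> kap x \<ge> lc / \<beta>" using nm_ge_lc beta_pos by (simp add: kap_def divide_right_mono)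

definition wave_bound :: "real \<Rightarrow> int \<times> int \<Rightarrow> real" where
  "wave_bound r p = (8 * sqrt pi / \<beta>) * (sqrt r / kap p) / sd r"

text \<open>The value of \<open>wave_bound\<close> for the smallest possible frequency lc / \<beta>;
  the square roots of \<open>r\<close> cancel.\<close>

definition wave_sup :: real where "wave_sup = (8 * sqrt pi / \<beta>) / (lc / \<beta>) / sd 1"

lemma independent_sum_wave:
  assumes r: "r > 0"
  shows "independent_sum (unif 0 1) (dirs M) (\<lambda>p s. wave M r p s / sd r) (wave_bound r) wave_sup"
proof -
  interpret prob_space "unif 0 1" by (rule prob_space_unif) simp
  show ?thesis
  proof
    show "finite (dirs M)" by (rule finite_dirs)
    show "(\<lambda>s. wave M r p s / sd r) \<in> borel_measurable (unif 0 1)" for p by measurable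
    fix p assume p: "p \<in> dirs M"
    show "(LINT s|unif 0 1. wave M r p s / sd r) = 0" by (simp add: mean_wave)
    show "wave_bound r p \<le> wave_sup"
    proof -
      have "wave_bound r p = (8 * sqrt pi / \<beta>) / kap p / sd 1" unfolding wave_bound_def sd_eq[of r] using r by simp
      also have "\<dots> \<le> wave_sup" unfolding wave_sup_def
        using kap_ge[OF dirs_nonzero[OF p]] beta_pos lc_pos sd_pos[of 1] kap_pos[OF dirs_nonzero[OF p]]
        by (intro divide_right_mono divide_left_mono) auto
      finally show ?thesis .
    qed
    fix s
    have "\<bar>wave M r p s\<bar> \<le> (\<Sum>x\<in>fib M p. \<bar>amp r x\<bar>)" by (rule abs_wave_le)
    also have "\<dots> \<le> (8 * sqrt pi / \<beta>) * (sqrt r / kap p)"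
      by (rule fiber_amp_sum[OF r finite_fib fib_nonzero _ dirs_nonzero[OF p]]) (simp add: fib_def)
    finally have "\<bar>wave M r p s\<bar> / sd r \<le> wave_bound r p"
      unfolding wave_bound_def using sd_pos[OF r] by (intro divide_right_mono) auto
    then show "\<bar>wave M r p s / sd r\<bar> \<le> wave_bound r p" using sd_pos[OF r] by simp
  qed
qed

lemma var_wave: "r > 0 \<Longrightarrow> independent_sum.var (unif 0 1) (\<lambda>p s. wave M r p s / sd r) p = (\<Sum>x\<in>fib M p. (amp r x)\<^sup>2) / (sd r)\<^sup>2"
  unfolding independent_sum.var_def[OF independent_sum_wave] variance_wave[symmetric] by (simp add: power_divide)

lemma sum_var_wave: "r > 0 \<Longrightarrow> (\<Sum>p\<in>dirs M. independent_sum.var (unif 0 1) (\<lambda>p s. wave M r p s / sd r) p) = (\<Sum>x\<in>low M. (amp r x)\<^sup>2) / (sd r)\<^sup>2"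
  by (simp add: var_wave sum_fib[symmetric] sum_divide_distrib)

text \<open>The normalised bound of a wave is of order 1 / kap p and its normalised variance at most
  of order sqrt r kap^(-3/2). The product is sqrt r times the summable kap^(-5/2), whatever the cut
  M.\<close>

lemma lindeberg_sum:
  "\<exists>C\<ge>0. \<forall>M. \<forall>r>0. (\<Sum>p\<in>dirs M. wave_bound r p * independent_sum.var (unif 0 1) (\<lambda>p s. wave M r p s / sd r) p) \<le> C * sqrt r"
proof -
  obtain C where C: "C \<ge> 0" "\<And>r A p. r > 0 \<Longrightarrow> finite A \<Longrightarrow> 0 \<notin> A \<Longrightarrow> (\<forall>x\<in>A. dir x = p) \<Longrightarrow> p \<noteq> 0 \<Longrightarrow>
     (\<Sum>x\<in>A. (amp r x)\<^sup>2) \<le> C * (r powr (3/2) * kap p powr (- (3/2)))" using fiber_amp_square_sum by metis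
  let ?k = "\<lambda>x. if x = 0 then 0 else kap x powr (- (5/2))"
  have sk: "csummable ?k" by (rule csummable_kap_powr) simp
  define E where "E = (8 * sqrt pi / \<beta>) / sd 1 * (C / (4 * pi / \<beta>))"
  have E: "E \<ge> 0" using C(1) beta_pos sd_pos[of 1] by (simp add: E_def)
  have "(\<Sum>p\<in>dirs M. wave_bound r p * independent_sum.var (unif 0 1) (\<lambda>p s. wave M r p s / sd r) p) \<le> (E * csum ?k) * sqrt r"
    if r: "r > 0" for M r
  proof -
    have "(\<Sum>p\<in>dirs M. wave_bound r p * independent_sum.var (unif 0 1) (\<lambda>p s. wave M r p s / sd r) p) \<le> (\<Sum>p\<in>dirs M. E * sqrt r * ?k p)"
    proof (rule sum_mono)
      fix p assume "p \<in> dirs M"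
      then have p: "p \<noteq> 0" by (rule dirs_nonzero)
      have k: "kap p > 0" using kap_pos[OF p] .
      have wb: "wave_bound r p = (8 * sqrt pi / \<beta>) / sd 1 / kap p" unfolding wave_bound_def sd_eq[of r] using r by simp
      have "(\<Sum>x\<in>fib M p. (amp r x)\<^sup>2) / (sd r)\<^sup>2 \<le> C * (r powr (3/2) * kap p powr (- (3/2))) / (4 * pi / \<beta> * r)"
        unfolding sd_sq[OF r] using beta_pos r by (intro divide_right_mono C(2) finite_fib fib_nonzero p) (auto simp: fib_def)
      also have "\<dots> = C / (4 * pi / \<beta>) * (r powr (3/2) / r) * kap p powr (- (3/2))" by simp
      also have "r powr (3/2) / r = r powr (3/2) / r powr 1" using r by simp
      also have "\<dots> = r powr (3/2 - 1)" by (rule powr_diff[symmetric])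
      also have "\<dots> = sqrt r" using r by (simp add: powr_half_sqrt)
      finally have "wave_bound r p * ((\<Sum>x\<in>fib M p. (amp r x)\<^sup>2) / (sd r)\<^sup>2) \<le> wave_bound r p * (C / (4 * pi / \<beta>) * sqrt r * kap p powr (- (3/2)))"
        unfolding wb using k beta_pos sd_pos[of 1] by (intro mult_left_mono) auto
      also have "\<dots> = E * sqrt r * (kap p powr (- (3/2)) / kap p)" unfolding wb E_def by simp
      also have "kap p powr (- (3/2)) / kap p = kap p powr (- (3/2)) / kap p powr 1" using k by simp
      also have "\<dots> = kap p powr (- (3/2) - 1)" by (rule powr_diff[symmetric])
      also have "\<dots> = ?k p" using p by simp
      finally show "wave_bound r p * independent_sum.var (unif 0 1) (\<lambda>p s. wave M r p s / sd r) p \<le> E * sqrt r * ?k p"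
        unfolding var_wave[OF r] .
    qed
    also have "\<dots> = E * sqrt r * (\<Sum>p\<in>dirs M. ?k p)" by (simp only: sum_distrib_left)
    also have "\<dots> \<le> E * sqrt r * csum ?k"
    proof (rule mult_left_mono)
      show "(\<Sum>p\<in>dirs M. ?k p) \<le> csum ?k" unfolding csum_finite_support(1)[OF finite_dirs, symmetric]
        by (intro Bochner_Integration.integral_mono csum_finite_support(2)[OF finite_dirs] sk) auto
    qed (use E r in simp)
    finally show ?thesis by (simp add: mult_ac)
  qed
  moreover have "E * csum ?k \<ge> 0" using E by (intro mult_nonneg_nonneg integral_nonneg_AE) auto
  ultimately show ?thesis by blast
qed

text \<open>This confirms the constant in \<sigma>^2: the factor (2 / (pi \<beta>))^2 / (4 pi /
  \<beta>) is the reciprocal of pi^3 \<beta>.\<close>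

lemma amp_variance_limit:
  assumes r: "\<And>n. r n > (0 :: real)" "r \<longlonglongrightarrow> 0" and m: "filterlim (\<lambda>n. r n * m n) at_top sequentially"
  shows "(\<lambda>n. (\<Sum>x\<in>low (m n). (amp (r n) x)\<^sup>2) / (sd (r n))\<^sup>2) \<longlonglongrightarrow> 1"
proof -
  let ?S = "\<lambda>n. (\<Sum>x\<in>low (m n). kap x powr (- 3) * (sin (pi * r n * kap x))\<^sup>2) / r n"
  have e: "(\<Sum>x\<in>low (m n). (amp (r n) x)\<^sup>2) / (sd (r n))\<^sup>2 = (2 / (pi * \<beta>))\<^sup>2 / (4 * pi / \<beta>) * ?S n" for n
  proof -
    have "(amp (r n) x)\<^sup>2 = (2 / (pi * \<beta>))\<^sup>2 * (kap x powr (- 3) * (sin (pi * r n * kap x))\<^sup>2)" for x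
    proof -
      have "(kap x powr (-3/2))\<^sup>2 = kap x powr (-3/2 + -3/2)" unfolding powr_add power2_eq_square ..
      also have "\<dots> = kap x powr (- 3)" by simp
      finally show ?thesis unfolding amp_def power_mult_distrib by simp
    qed
    then show ?thesis unfolding sd_sq[OF r(1)] by (simp add: sum_distrib_left[symmetric])
  qed
  have "(\<lambda>n. (2 / (pi * \<beta>))\<^sup>2 / (4 * pi / \<beta>) * ?S n) \<longlonglongrightarrow> (2 / (pi * \<beta>))\<^sup>2 / (4 * pi / \<beta>) * (pi ^ 3 * \<beta>)"
    by (intro tendsto_mult_left variance_limit[OF r m])
  also have "(2 / (pi * \<beta>))\<^sup>2 / (4 * pi / \<beta>) * (pi ^ 3 * \<beta>) = 1"
    using beta_pos by (simp add: power2_eq_square power3_eq_cube)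
  finally show ?thesis unfolding e .
qed

text \<open>About r^(-18) lattice vectors lie below r^(-9), each with bounded amplitude, and the
  normalisation costs another r^(-1/2). The exponent 27 is generous; any fixed power would
  serve.\<close>

lemma amp_sum_poly:
  "\<exists>C\<ge>0. \<forall>r. 0 < r \<longrightarrow> r \<le> 1 \<longrightarrow> (\<Sum>x\<in>low (r powr (- 9)). \<bar>amp r x\<bar>) / sd r \<le> C * r powr (- 27)"
proof -
  obtain C where C: "C \<ge> 0" "\<And>t. t > 0 \<Longrightarrow> cnt t - 1 \<le> C * t\<^sup>2" using cnt_quadratic by blast
  define A where "A = 2 / (pi * \<beta>) * (lc / \<beta>) powr (-3/2)"
  have A: "A \<ge> 0" using beta_pos by (simp add: A_def)
  have "(\<Sum>x\<in>low (r powr (- 9)). \<bar>amp r x\<bar>) / sd r \<le> (C * \<beta>\<^sup>2 * A / sd 1) * r powr (- 27)"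
    if r: "0 < r" "r \<le> 1" for r
  proof -
    let ?M = "r powr (- 9)"
    have M: "?M > 0" using r by simp
    have "(\<Sum>x\<in>low ?M. \<bar>amp r x\<bar>) \<le> (\<Sum>x\<in>low ?M. A)"
    proof (rule sum_mono)
      fix x assume "x \<in> low ?M"
      then have x: "x \<noteq> 0" by (simp add: low_def)
      have "\<bar>amp r x\<bar> \<le> 2 / (pi * \<beta>) * (kap x powr (-3/2) * 1)"
        unfolding amp_def abs_mult using beta_pos by (intro mult_mono) auto
      also have "\<dots> \<le> 2 / (pi * \<beta>) * ((lc / \<beta>) powr (-3/2) * 1)"
        using kap_ge[OF x] lc_pos beta_pos by (intro mult_left_mono mult_right_mono powr_mono2') auto
      finally show "\<bar>amp r x\<bar> \<le> A" by (simp add: A_def)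
    qed
    also have "\<dots> = (cnt (\<beta> * ?M) - 1) * A" using card_low[of ?M] M by simp
    also have "\<dots> \<le> C * (\<beta> * ?M)\<^sup>2 * A" using C(2)[of "\<beta> * ?M"] M beta_pos A by (intro mult_right_mono) auto
    finally have "(\<Sum>x\<in>low ?M. \<bar>amp r x\<bar>) / sd r \<le> C * (\<beta> * ?M)\<^sup>2 * A / sd r"
      using sd_pos[OF r(1)] by (intro divide_right_mono) auto
    also have "\<dots> = (C * \<beta>\<^sup>2 * A / sd 1) * (?M\<^sup>2 / sqrt r)" unfolding sd_eq[of r] by (simp add: power_mult_distrib)
    also have "?M\<^sup>2 / sqrt r = r powr (- 9) * r powr (- 9) / r powr (1/2)" using r by (simp add: power2_eq_square powr_half_sqrt)
    also have "\<dots> = r powr (- 9 + - 9 - 1/2)" by (simp only: powr_add powr_diff)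
    also have "(C * \<beta>\<^sup>2 * A / sd 1) * r powr (- 9 + - 9 - 1/2) \<le> (C * \<beta>\<^sup>2 * A / sd 1) * r powr (- 27)"
      using r C(1) A sd_pos[of 1] by (intro mult_left_mono powr_mono') auto
    finally show ?thesis .
  qed
  moreover have "C * \<beta>\<^sup>2 * A / sd 1 \<ge> 0" using C(1) A sd_pos[of 1] by simp
  ultimately show ?thesis by blast
qed

text \<open>The time average is compared with the model by moments, the model with a Gaussian of its
  own variance by Lindeberg, and that variance tends to 1. Convergence of the variance also bounds
  it, which gives exponential moments uniform in \<open>n\<close>.\<close>

theorem clt_shift_sum:
  fixes r T :: "nat \<Rightarrow> real"
  assumes ai: "algebraically_independent \<alpha> \<beta>" and sD: "strongly_Diophantine \<alpha> \<beta>"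
    and r: "\<And>n. 0 < r n" "\<And>n. r n \<le> 1" "r \<longlonglongrightarrow> 0" and T: "\<And>n. T n > 0"
    and rT: "\<And>B. (\<lambda>n. r n powr (- B) / T n) \<longlonglongrightarrow> 0"
  shows "(\<lambda>n. LINT t|unif (T n) (2 * T n). iexp (u * (shift_sum (r n powr (- 9)) (r n) t / sd (r n)))) \<longlonglongrightarrow> of_real (exp (- (u\<^sup>2 / 2)))"
proof -
  define m where "m n = r n powr (- 9)" for n
  define P where "P n = dirs (m n)" for n
  define Q where "Q n = Pi\<^sub>M (P n) (\<lambda>_. unif 0 1)" for n
  define f where "f n t = shift_sum (m n) (r n) t / sd (r n)" for n t
  define g where "g n \<theta> = (\<Sum>p\<in>P n. wave (m n) (r n) p (\<theta> p) / sd (r n))" for n \<theta>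
  have g_model: "g n \<theta> = model (m n) (r n) \<theta> / sd (r n)" for n \<theta>
    by (simp add: g_def model_def P_def sum_divide_distrib)
  define V where "V n = (\<Sum>p\<in>P n. independent_sum.var (unif 0 1) (\<lambda>p s. wave (m n) (r n) p s / sd (r n)) p)" for n
  interpret U: prob_space "unif 0 1" by (rule prob_space_unif) simp
  note isw = independent_sum_wave[OF r(1)]
  have m1: "m n \<ge> 1" for n using powr_mono'[of "-9" 0 "r n"] r(1,2)[of n] by (simp add: m_def)
  \<comment> \<open>r m = r^(-8) tends to infinity: the cut lies far beyond the frequencies of order
    1 / r that carry the variance.\<close>
  have rm: "filterlim (\<lambda>n. r n * m n) at_top sequentially"
  proof -
    have "\<forall>n. r n \<in> {0<..} \<and> r n \<noteq> 0" using r(1) by (metis greaterThan_iff less_irrefl)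
    then have "filterlim r (at_right 0) sequentially" unfolding filterlim_at using r(3) by (auto intro: always_eventually)
    moreover have "filterlim (\<lambda>x::real. x * x powr (- 9)) at_top (at_right 0)" by real_asymp
    ultimately show ?thesis unfolding m_def by (rule filterlim_compose[rotated])
  qed
  have V: "V \<longlonglongrightarrow> 1" unfolding V_def P_def sum_var_wave[OF r(1)] by (rule amp_variance_limit[OF r(1) r(3) rm])
  obtain W where W: "\<And>n. V n \<le> W"
  proof -
    obtain K where "\<And>n. norm (V n) \<le> K" using convergent_imp_Bseq[OF convergentI[OF V]] by (auto simp: Bseq_def)
    then have "V n \<le> K" for n using abs_le_D1[of "V n" K] by simp
    then show ?thesis using that by blast
  qed
  have diff: "(\<lambda>n. (LINT t|unif (T n) (2 * T n). iexp (u * f n t)) - (LINT \<theta>|Q n. iexp (u * g n \<theta>))) \<longlonglongrightarrow> 0"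
  proof (rule char_diff_tendsto[where B="\<lambda>n. (\<Sum>x\<in>low (m n). \<bar>amp (r n) x\<bar>) / sd (r n)"])
    show "prob_space (unif (T n) (2 * T n))" for n using T[of n] by (intro prob_space_unif) simp
    show "prob_space (Q n)" for n unfolding Q_def by (rule prob_space_PiM) (rule U.prob_space_axioms)
    show "f n \<in> borel_measurable (unif (T n) (2 * T n))" for n unfolding f_def[abs_def] shift_sum_def[abs_def] by measurable
    show "\<bar>f n t\<bar> \<le> (\<Sum>x\<in>low (m n). \<bar>amp (r n) x\<bar>) / sd (r n)" for n t
      unfolding f_def using abs_shift_sum_le sd_pos[OF r(1)[of n]] by (simp add: abs_divide divide_right_mono)
    show "\<bar>g n \<theta>\<bar> \<le> (\<Sum>x\<in>low (m n). \<bar>amp (r n) x\<bar>) / sd (r n)" for n \<theta>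
      unfolding g_model using abs_model_le sd_pos[OF r(1)[of n]] by (simp add: abs_divide divide_right_mono)
    show "g n \<in> borel_measurable (Q n)" for n unfolding g_def[abs_def]
    proof (rule borel_measurable_sum)
      fix p assume p: "p \<in> P n"
      have [measurable]: "(\<lambda>\<theta>. \<theta> p) \<in> borel_measurable (Q n)"
        using measurable_component_singleton[OF p, of "\<lambda>_. unif 0 1"] unfolding Q_def by (simp cong: measurable_cong_sets)
      show "(\<lambda>\<theta>. wave (m n) (r n) p (\<theta> p) / sd (r n)) \<in> borel_measurable (Q n)" by measurable
    qed
    show "\<exists>q. \<forall>n. (LINT \<theta>|Q n. exp (s * g n \<theta>)) \<le> q" for s
    proof (intro exI allI)
      fix n
      have "(LINT \<theta>|Q n. exp (s * g n \<theta>)) \<le> exp (s\<^sup>2 / 2 * exp (\<bar>s\<bar> * wave_sup) * V n)"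
        unfolding g_def Q_def V_def P_def by (rule independent_sum.exp_moment_bound[OF isw])
      also have "\<dots> \<le> exp (s\<^sup>2 / 2 * exp (\<bar>s\<bar> * wave_sup) * W)" using W[of n] by (simp add: mult_left_mono)
      finally show "(LINT \<theta>|Q n. exp (s * g n \<theta>)) \<le> exp (s\<^sup>2 / 2 * exp (\<bar>s\<bar> * wave_sup) * W)" .
    qed
    show "(\<lambda>n. (LINT t|unif (T n) (2 * T n). f n t ^ k) - (LINT \<theta>|Q n. g n \<theta> ^ k)) \<longlonglongrightarrow> 0" for k
    proof -
      define good where "good c K \<longleftrightarrow> (\<forall>M\<ge>1. \<forall>f. (\<forall>i<k. f i \<in> low M) \<longrightarrow> (\<forall>p. (\<Sum>i | i < k \<and> dir (f i) = p. mlt (f i)) = 0) \<or>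
        c * M powr (- K) \<le> \<bar>\<Sum>i<k. of_int (mlt (f i)) * kap (dir (f i))\<bar>)" for c K
      have "\<exists>c>0. \<exists>K\<ge>0. good c K" unfolding good_def by (rule separation[OF ai sD])
      then obtain c K where cK: "c > 0" "K \<ge> 0" "good c K" by blast
      have sep: "(\<forall>p. (\<Sum>i | i < k \<and> dir (f i) = p. mlt (f i)) = 0) \<or> c * M powr (- K) \<le> \<bar>\<Sum>i<k. of_int (mlt (f i)) * kap (dir (f i))\<bar>"
        if "M \<ge> 1" "\<forall>i<k. f i \<in> low M" for M f using cK(3) that unfolding good_def by blast
      obtain C where C: "C \<ge> 0" "\<And>r. 0 < r \<Longrightarrow> r \<le> 1 \<Longrightarrow> (\<Sum>x\<in>low (r powr (- 9)). \<bar>amp r x\<bar>) / sd r \<le> C * r powr (- 27)"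
        using amp_sum_poly by metis
      \<comment> \<open>27 k comes from the k-th power of the amplitude sum, 9 K from the separation
        M^(-K) at M = r^(-9).\<close>
      define B where "B = 27 * real k + 9 * K"
      have bound: "norm ((LINT t|unif (T n) (2 * T n). f n t ^ k) - (LINT \<theta>|Q n. g n \<theta> ^ k)) \<le> C ^ k / (pi * c) * (r n powr (- B) / T n)" for n
      proof -
        have rn: "0 < r n" "r n \<le> 1" by (rule r)+
        have s: "sd (r n) > 0" by (rule sd_pos[OF rn(1)])
        have \<delta>: "c * m n powr (- K) > 0" using cK m1[of n] by simp
        have a1: "(LINT t|unif (T n) (2 * T n). f n t ^ k) = (LINT t|unif (T n) (2 * T n). shift_sum (m n) (r n) t ^ k) / sd (r n) ^ k"
          unfolding f_def power_divide by (rule integral_divide_zero)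
        have a2: "(LINT \<theta>|Q n. g n \<theta> ^ k) = (LINT \<theta>|Q n. model (m n) (r n) \<theta> ^ k) / sd (r n) ^ k"
          unfolding g_model power_divide by (rule integral_divide_zero)
        have "norm ((LINT t|unif (T n) (2 * T n). f n t ^ k) - (LINT \<theta>|Q n. g n \<theta> ^ k))
           = \<bar>(LINT t|unif (T n) (2 * T n). shift_sum (m n) (r n) t ^ k) - (LINT \<theta>|Q n. model (m n) (r n) \<theta> ^ k)\<bar> / sd (r n) ^ k"
          unfolding a1 a2 diff_divide_distrib[symmetric] using s by (simp add: abs_divide)
        also have "\<dots> \<le> ((\<Sum>x\<in>low (m n). \<bar>amp (r n) x\<bar>) ^ k / (pi * (c * m n powr (- K)) * T n)) / sd (r n) ^ k"
          unfolding Q_def P_def using s by (intro divide_right_mono moment_diff[OF T \<delta>] sep[OF m1]) auto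
        also have "\<dots> = ((\<Sum>x\<in>low (m n). \<bar>amp (r n) x\<bar>) / sd (r n)) ^ k / (pi * (c * m n powr (- K)) * T n)"
          by (simp add: power_divide)
        also have "\<dots> \<le> (C * r n powr (- 27)) ^ k / (pi * (c * m n powr (- K)) * T n)"
          using C(2)[OF rn] cK(1) T[of n] s unfolding m_def
          by (intro divide_right_mono power_mono divide_nonneg_nonneg sum_nonneg mult_nonneg_nonneg) auto
        also have "\<dots> = C ^ k / (pi * c) * ((r n powr (- 27)) ^ k / m n powr (- K) / T n)" by (simp add: power_mult_distrib)
        also have "(r n powr (- 27)) ^ k = r n powr (- 27 * real k)" using rn by (simp add: powr_powr powr_realpow[symmetric])
        also have "m n powr (- K) = r n powr (9 * K)" by (simp add: m_def powr_powr)
        also have "r n powr (- 27 * real k) / r n powr (9 * K) = r n powr (- 27 * real k - 9 * K)" by (rule powr_diff[symmetric])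
        also have "- 27 * real k - 9 * K = - B" by (simp add: B_def)
        finally show ?thesis .
      qed
      have "(\<lambda>n. C ^ k / (pi * c) * (r n powr (- B) / T n)) \<longlonglongrightarrow> C ^ k / (pi * c) * 0"
        by (intro tendsto_mult_left rT)
      then show ?thesis by (intro Lim_null_comparison[OF always_eventually[OF allI[OF bound]]]) simp
    qed
  qed
  obtain L where L: "L \<ge> 0" "\<And>M r. r > 0 \<Longrightarrow> (\<Sum>p\<in>dirs M. wave_bound r p * independent_sum.var (unif 0 1) (\<lambda>p s. wave M r p s / sd r) p) \<le> L * sqrt r"
    using lindeberg_sum by blast
  have "(\<lambda>n. (LINT \<theta>|Q n. iexp (u * g n \<theta>)) - of_real (exp (- (u\<^sup>2 / 2) * V n))) \<longlonglongrightarrow> 0"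
  proof (rule Lim_null_comparison[OF always_eventually[OF allI]])
    fix n
    have ws: "wave_sup \<ge> 0" using beta_pos lc_pos sd_pos[of 1] by (simp add: wave_sup_def)
    have "norm ((LINT \<theta>|Q n. iexp (u * g n \<theta>)) - of_real (exp (- (u\<^sup>2 / 2) * V n))) \<le>
      (\<bar>u\<bar> ^ 3 / 6 + u ^ 4 * wave_sup / 8) * (\<Sum>p\<in>P n. wave_bound (r n) p * independent_sum.var (unif 0 1) (\<lambda>p s. wave (m n) (r n) p s / sd (r n)) p)"
      unfolding g_def Q_def V_def P_def by (rule independent_sum.char_gauss_bound[OF isw])
    also have "\<dots> \<le> (\<bar>u\<bar> ^ 3 / 6 + u ^ 4 * wave_sup / 8) * (L * sqrt (r n))"
      unfolding P_def using ws by (intro mult_left_mono L(2) r) auto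
    finally show "norm ((LINT \<theta>|Q n. iexp (u * g n \<theta>)) - of_real (exp (- (u\<^sup>2 / 2) * V n))) \<le> (\<bar>u\<bar> ^ 3 / 6 + u ^ 4 * wave_sup / 8) * (L * sqrt (r n))" .
  next
    have "(\<lambda>n. (\<bar>u\<bar> ^ 3 / 6 + u ^ 4 * wave_sup / 8) * (L * sqrt (r n))) \<longlonglongrightarrow> (\<bar>u\<bar> ^ 3 / 6 + u ^ 4 * wave_sup / 8) * (L * sqrt 0)"
      by (intro tendsto_intros r)
    then show "(\<lambda>n. (\<bar>u\<bar> ^ 3 / 6 + u ^ 4 * wave_sup / 8) * (L * sqrt (r n))) \<longlonglongrightarrow> 0" by simp
  qed
  moreover have "(\<lambda>n. complex_of_real (exp (- (u\<^sup>2 / 2) * V n))) \<longlonglongrightarrow> of_real (exp (- (u\<^sup>2 / 2) * 1))"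
    by (intro tendsto_intros V)
  ultimately have "(\<lambda>n. ((LINT t|unif (T n) (2 * T n). iexp (u * f n t)) - (LINT \<theta>|Q n. iexp (u * g n \<theta>)))
      + ((LINT \<theta>|Q n. iexp (u * g n \<theta>)) - of_real (exp (- (u\<^sup>2 / 2) * V n))) + of_real (exp (- (u\<^sup>2 / 2) * V n))) \<longlonglongrightarrow> 0 + 0 + of_real (exp (- (u\<^sup>2 / 2) * 1))"
    by (intro tendsto_add diff)
  then show ?thesis unfolding f_def m_def by simp
qed

end

section \<open>The limit law\<close>

lemma norm_iexp_diff: "norm (iexp x - iexp y) \<le> \<bar>x - y\<bar>"
proof -
  have "iexp x - iexp y = iexp y * (iexp (x - y) - 1)" by (simp add: algebra_simps flip: exp_add)
  then have "norm (iexp x - iexp y) = norm (iexp (x - y) - 1)" by (simp add: norm_mult)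
  also have "\<dots> \<le> \<bar>x - y\<bar>" using iexp_approx1[of "x - y" 0] by simp
  finally show ?thesis .
qed

text \<open>Closeness in mean square is all that the truncation provides; this passes it on to
  characteristic functions. Strict positivity of \<open>b\<close> allows division by its
  root.\<close>

lemma (in prob_space) char_perturbation:
  assumes [measurable]: "X \<in> borel_measurable M" "Y \<in> borel_measurable M"
    and i: "integrable M (\<lambda>x. (X x - Y x)\<^sup>2)" and b: "(LINT x|M. (X x - Y x)\<^sup>2) \<le> b" "b > 0"
  shows "norm ((LINT x|M. iexp (u * X x)) - (LINT x|M. iexp (u * Y x))) \<le> 2 * \<bar>u\<bar> * sqrt b"
proof -
  let ?s = "sqrt b"
  have s: "?s > 0" using b by simp
  have ie: "integrable M (\<lambda>x. iexp (u * X x))" "integrable M (\<lambda>x. iexp (u * Y x))"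
    by (intro integrable_const_bound[where B=1]; auto)+
  have i2: "integrable M (\<lambda>x. \<bar>u\<bar> * (?s + (X x - Y x)\<^sup>2 / ?s))" using i by simp
  have "(LINT x|M. iexp (u * X x)) - (LINT x|M. iexp (u * Y x)) = (LINT x|M. iexp (u * X x) - iexp (u * Y x))"
    by (rule Bochner_Integration.integral_diff[OF ie, symmetric])
  also have "norm \<dots> \<le> (LINT x|M. \<bar>u\<bar> * (?s + (X x - Y x)\<^sup>2 / ?s))"
  proof (rule norm_integral_le[OF Bochner_Integration.integrable_diff[OF ie] i2])
    fix x
    have "norm (iexp (u * X x) - iexp (u * Y x)) \<le> \<bar>u * X x - u * Y x\<bar>" by (rule norm_iexp_diff)
    also have "\<dots> = \<bar>u\<bar> * \<bar>X x - Y x\<bar>" by (simp only: right_diff_distrib[symmetric] abs_mult)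
    \<comment> \<open>A deviation is either at most \<open>?s\<close> or at most its square divided
      by \<open>?s\<close>; with \<open>?s\<close> the root of \<open>b\<close> both terms
      contribute equally.\<close>
    also have "\<bar>X x - Y x\<bar> \<le> ?s + (X x - Y x)\<^sup>2 / ?s"
    proof (cases "\<bar>X x - Y x\<bar> \<le> ?s")
      case True
      moreover have "(X x - Y x)\<^sup>2 / ?s \<ge> 0" using s by simp
      ultimately show ?thesis by linarith
    next
      case False
      then have "?s * \<bar>X x - Y x\<bar> \<le> \<bar>X x - Y x\<bar> * \<bar>X x - Y x\<bar>" by (intro mult_right_mono) auto
      then have "\<bar>X x - Y x\<bar> \<le> (X x - Y x)\<^sup>2 / ?s" using s by (simp add: pos_le_divide_eq power2_eq_square mult.commute)
      then show ?thesis using s by linarith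
    qed
    finally show "norm (iexp (u * X x) - iexp (u * Y x)) \<le> \<bar>u\<bar> * (?s + (X x - Y x)\<^sup>2 / ?s)"
      by (simp add: mult_left_mono)
  qed
  also have "\<dots> = \<bar>u\<bar> * (?s + (LINT x|M. (X x - Y x)\<^sup>2) / ?s)" using i by (simp add: prob_space)
  also have "\<dots> \<le> \<bar>u\<bar> * (?s + b / ?s)" using b s by (intro mult_left_mono add_left_mono divide_right_mono) auto
  also have "b / ?s = ?s" using b by (simp add: real_div_sqrt)
  finally show ?thesis by simp
qed

context planar
begin

text \<open>\<open>rem (t + r)\<close> is normalised by sqrt (t + r), the annulus count by sqrt t;
  the square root factor corrects this.\<close>

definition ann :: "real \<Rightarrow> real \<Rightarrow> real" where
  "ann r t = rem (t + r) * sqrt ((t + r) / t) - rem t"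

lemma borel_measurable_ann [measurable]: "ann r \<in> borel_measurable borel" unfolding ann_def[abs_def] by measurable

lemma borel_measurable_shift_sum [measurable]: "shift_sum M r \<in> borel_measurable borel" unfolding shift_sum_def[abs_def] by measurable

lemma S_annulus_eq_ann:
  assumes t: "t > 0" and r: "r \<ge> 0"
  shows "S_annulus \<alpha> \<beta> t r = ann r t"
proof -
  have "rem (t + r) * sqrt ((t + r) / t) = (cnt (t + r) - pi * (t + r)\<^sup>2 / \<beta>) / sqrt t"
    using t r by (simp add: rem_def real_sqrt_divide)
  then have "ann r t = ((cnt (t + r) - pi * (t + r)\<^sup>2 / \<beta>) - (cnt t - pi * t\<^sup>2 / \<beta>)) / sqrt t"
    by (simp add: ann_def rem_def diff_divide_distrib)
  also have "(cnt (t + r) - pi * (t + r)\<^sup>2 / \<beta>) - (cnt t - pi * t\<^sup>2 / \<beta>) = cnt (t + r) - cnt t - pi / \<beta> * (2 * t * r + r\<^sup>2)"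
    using beta_pos by (simp add: field_simps power2_eq_square)
  finally show ?thesis by (simp add: S_annulus_def cnt_eq_count_pts)
qed

lemma rem_bound: "\<exists>C\<ge>0. \<forall>t\<ge>1. \<bar>rem t\<bar> \<le> C * sqrt t"
proof -
  obtain C where C: "C \<ge> 0" "\<And>t. t \<ge> 0 \<Longrightarrow> \<bar>cnt t - pi * t\<^sup>2 / \<beta>\<bar> \<le> C * (t + 1)"
    using cnt_asymptotics by blast
  have "\<bar>rem t\<bar> \<le> (2 * C) * sqrt t" if t: "t \<ge> 1" for t
  proof -
    have "C * (t + 1) \<le> C * (2 * t)" using C(1) t by (intro mult_left_mono) auto
    then have "\<bar>cnt t - pi * t\<^sup>2 / \<beta>\<bar> \<le> (2 * C) * t" using C(2)[of t] t by simp
    then have "\<bar>cnt t - pi * t\<^sup>2 / \<beta>\<bar> / sqrt t \<le> (2 * C) * t / sqrt t" using t by (intro divide_right_mono) auto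
    also have "\<dots> = (2 * C) * sqrt t" using t by (simp add: real_div_sqrt flip: times_divide_eq_right)
    finally show ?thesis using t by (simp add: rem_def)
  qed
  moreover have "2 * C \<ge> 0" using C(1) by simp
  ultimately show ?thesis by blast
qed

text \<open>The normalisation factor differs from 1 by at most r / t, and \<open>rem\<close> is
  trivially of order sqrt t, so the correction costs only r / sqrt t.\<close>

lemma ann_shift_sum:
  "\<exists>C\<ge>0. \<forall>t\<ge>1. \<forall>r M. 0 < r \<longrightarrow> r \<le> 1 \<longrightarrow>
     \<bar>ann r t - shift_sum M r t\<bar> \<le> \<bar>rem (t + r) - trig_sum M (t + r)\<bar> + \<bar>rem t - trig_sum M t\<bar> + C * r / sqrt t"
proof -
  obtain C where C: "C \<ge> 0" "\<And>t. t \<ge> 1 \<Longrightarrow> \<bar>rem t\<bar> \<le> C * sqrt t" using rem_bound by blast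
  have "\<bar>ann r t - shift_sum M r t\<bar> \<le> \<bar>rem (t + r) - trig_sum M (t + r)\<bar> + \<bar>rem t - trig_sum M t\<bar> + (2 * C) * r / sqrt t"
    if t: "t \<ge> 1" and r: "0 < r" "r \<le> 1" for t r M
  proof -
    have e: "ann r t - shift_sum M r t = (rem (t + r) - trig_sum M (t + r)) - (rem t - trig_sum M t) + rem (t + r) * (sqrt ((t + r) / t) - 1)"
      by (simp add: ann_def shift_sum_def algebra_simps)
    have q: "(t + r) / t = 1 + r / t" using t by (simp add: field_simps)
    have rt: "r / t \<ge> 0" using r t by simp
    have "sqrt (1 + r / t) \<le> sqrt ((1 + r / t)\<^sup>2)"
      using mult_left_mono[of 1 "1 + r / t" "1 + r / t"] rt by (intro real_sqrt_le_mono) (simp add: power2_eq_square)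
    then have s: "\<bar>sqrt ((t + r) / t) - 1\<bar> \<le> r / t" using rt by (simp add: q)
    have "\<bar>rem (t + r)\<bar> \<le> C * sqrt (t + r)" using C(2)[of "t + r"] t r by simp
    also have "\<dots> \<le> C * sqrt (4 * t)" using C(1) t r by (intro mult_left_mono real_sqrt_le_mono) auto
    also have "\<dots> = 2 * C * sqrt t" by (simp add: real_sqrt_mult)
    finally have "\<bar>rem (t + r) * (sqrt ((t + r) / t) - 1)\<bar> \<le> 2 * C * sqrt t * (r / t)"
      unfolding abs_mult using s C(1) t by (intro mult_mono) auto
    also have "2 * C * sqrt t * (r / t) = 2 * C * r * (sqrt t / t)" by simp
    also have "sqrt t / t = 1 / sqrt t" using t by (simp add: real_div_sqrt divide_simps)
    finally show ?thesis unfolding e by simp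
  qed
  moreover have "2 * C \<ge> 0" using C(1) by simp
  ultimately show ?thesis by blast
qed

text \<open>The remainder is approximated at t and at t + r separately; both times lie in
  [T, 2T + 1] when t is in [T, 2T] and r \<le> 1.\<close>

lemma mean_square_ann:
  "\<exists>C\<ge>0. \<forall>T M r. \<beta> + 1 \<le> T \<longrightarrow> 1 \<le> M \<longrightarrow> M \<le> T \<longrightarrow> 0 < r \<longrightarrow> r \<le> 1 \<longrightarrow>
     integrable (unif T (2 * T)) (\<lambda>t. (ann r t - shift_sum M r t)\<^sup>2) \<and>
     (LINT t|unif T (2 * T). (ann r t - shift_sum M r t)\<^sup>2) \<le> C * (M powr (- (1/8)) + r\<^sup>2 / T)"
proof -
  obtain C where C: "C \<ge> 0" "\<And>T M. \<beta> + 1 \<le> T \<Longrightarrow> 1 \<le> M \<Longrightarrow> M \<le> T \<Longrightarrow>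
     integrable lborel (\<lambda>t. indicator {T..2 * T + 1} t * (rem t - trig_sum M t)\<^sup>2) \<and>
     (LINT t|lborel. indicator {T..2 * T + 1} t * (rem t - trig_sum M t)\<^sup>2) \<le> C * T * M powr (- (1/8))"
    using mean_square_rem by blast
  obtain D where D: "D \<ge> 0" "\<And>t r M. t \<ge> 1 \<Longrightarrow> 0 < r \<Longrightarrow> r \<le> 1 \<Longrightarrow>
     \<bar>ann r t - shift_sum M r t\<bar> \<le> \<bar>rem (t + r) - trig_sum M (t + r)\<bar> + \<bar>rem t - trig_sum M t\<bar> + D * r / sqrt t"
    using ann_shift_sum by blast
  define E where "E = 6 * C + 3 * D\<^sup>2"
  have "integrable (unif T (2 * T)) (\<lambda>t. (ann r t - shift_sum M r t)\<^sup>2) \<and>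
     (LINT t|unif T (2 * T). (ann r t - shift_sum M r t)\<^sup>2) \<le> E * (M powr (- (1/8)) + r\<^sup>2 / T)"
    if T: "\<beta> + 1 \<le> T" and M: "1 \<le> M" "M \<le> T" and r: "0 < r" "r \<le> 1" for T M r
  proof -
    let ?G = "\<lambda>t. indicator {T..2 * T + 1} t * (rem t - trig_sum M t)\<^sup>2"
    let ?H = "\<lambda>t. indicator {T..2 * T} t * (D\<^sup>2 * r\<^sup>2 / T)"
    let ?F = "\<lambda>t. indicator {T..2 * T} t * (ann r t - shift_sum M r t)\<^sup>2"
    have T1: "T \<ge> 1" "T > 0" using T beta_pos by auto
    have G: "integrable lborel ?G" "(LINT t|lborel. ?G t) \<le> C * T * M powr (- (1/8))" using C(2)[OF T M] by auto
    \<comment> \<open>Translation invariance on the whole line: the shifted error has the same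
      integral as the unshifted one.\<close>
    have Gr: "integrable lborel (\<lambda>t. ?G (t + r))" "(LINT t|lborel. ?G (t + r)) = (LINT t|lborel. ?G t)"
      using lborel_integrable_real_affine[OF G(1), of 1 r] lborel_integral_real_affine[of 1 ?G r] by (simp_all add: add.commute)
    have H: "integrable lborel ?H" "(LINT t|lborel. ?H t) = D\<^sup>2 * r\<^sup>2"
      using T1 by (auto intro!: integrable_mult_left integrable_real_indicator)
    have sum: "integrable lborel (\<lambda>t. 3 * (?G (t + r) + ?G t + ?H t))"
      by (intro integrable_mult_right Bochner_Integration.integrable_add G Gr H)
    have bd: "?F t \<le> 3 * (?G (t + r) + ?G t + ?H t)" for t
    proof (cases "t \<in> {T..2 * T}")
      case True
      define a b c where "a = \<bar>rem (t + r) - trig_sum M (t + r)\<bar>" and "b = \<bar>rem t - trig_sum M t\<bar>" and "c = D * r / sqrt t"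
      have t: "t \<ge> 1" using True T1 by auto
      have "\<bar>ann r t - shift_sum M r t\<bar> \<le> a + b + c" unfolding a_def b_def c_def by (rule D(2)[OF t r])
      then have "\<bar>ann r t - shift_sum M r t\<bar>\<^sup>2 \<le> (a + b + c)\<^sup>2" by (intro power_mono) auto
      also have "\<dots> \<le> 3 * (a\<^sup>2 + b\<^sup>2 + c\<^sup>2)"
        using zero_le_power2[of "a - b"] zero_le_power2[of "b - c"] zero_le_power2[of "a - c"] by (simp add: power2_eq_square algebra_simps)
      also have "c\<^sup>2 = D\<^sup>2 * r\<^sup>2 / t" using t by (simp add: c_def power_mult_distrib power_divide)
      also have "D\<^sup>2 * r\<^sup>2 / t \<le> D\<^sup>2 * r\<^sup>2 / T" using True T1 by (intro divide_left_mono) auto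
      finally have "(ann r t - shift_sum M r t)\<^sup>2 \<le> 3 * (a\<^sup>2 + b\<^sup>2 + D\<^sup>2 * r\<^sup>2 / T)" by simp
      then show ?thesis using True r by (simp add: a_def b_def)
    next
      case False
      have "0 \<le> 3 * (?G (t + r) + ?G t + ?H t)" using T1 by (intro mult_nonneg_nonneg add_nonneg_nonneg) auto
      then show ?thesis using False by simp
    qed
    have iF: "integrable lborel ?F"
    proof (rule Bochner_Integration.integrable_bound[OF sum _ AE_I2])
      show "?F \<in> borel_measurable lborel" by measurable
      fix t
      have "?F t \<ge> 0" by simp
      then show "norm (?F t) \<le> norm (3 * (?G (t + r) + ?G t + ?H t))" using bd[of t] unfolding real_norm_def by linarith
    qed
    have iu: "integrable (unif T (2 * T)) (\<lambda>t. (ann r t - shift_sum M r t)\<^sup>2)"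
      by (rule integrable_unif[OF _ _ iF]) (use T1 in auto)
    have "(LINT t|lborel. ?F t) \<le> (LINT t|lborel. 3 * (?G (t + r) + ?G t + ?H t))"
      by (rule Bochner_Integration.integral_mono[OF iF sum bd])
    also have "\<dots> = 3 * ((LINT t|lborel. ?G (t + r)) + (LINT t|lborel. ?G t) + (LINT t|lborel. ?H t))"
      by (simp only: integral_mult_right_zero Bochner_Integration.integral_add Bochner_Integration.integrable_add G(1) Gr(1) H(1))
    also have "\<dots> \<le> 3 * (C * T * M powr (- (1/8)) + C * T * M powr (- (1/8)) + D\<^sup>2 * r\<^sup>2)"
      unfolding Gr(2) H(2) using G(2) by (intro mult_left_mono add_mono) auto
    also have "\<dots> \<le> T * (E * (M powr (- (1/8)) + r\<^sup>2 / T))"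
    proof -
      have "T * (E * (M powr (- (1/8)) + r\<^sup>2 / T)) = E * T * M powr (- (1/8)) + E * r\<^sup>2" using T1 by (simp add: field_simps)
      also have "\<dots> = 3 * (C * T * M powr (- (1/8)) + C * T * M powr (- (1/8)) + D\<^sup>2 * r\<^sup>2) + (3 * D\<^sup>2 * (T * M powr (- (1/8))) + 6 * C * r\<^sup>2)"
        by (simp add: E_def algebra_simps)
      finally show ?thesis using C(1) T1 by simp
    qed
    finally have "(LINT t|lborel. ?F t) / T \<le> E * (M powr (- (1/8)) + r\<^sup>2 / T)"
      using T1 by (simp add: pos_divide_le_eq mult.commute)
    moreover have "(LINT t|unif T (2 * T). (ann r t - shift_sum M r t)\<^sup>2) = (LINT t|lborel. ?F t) / T"
      using T1 by (subst integral_unif) auto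
    ultimately show ?thesis using iu by simp
  qed
  moreover have "E \<ge> 0" using C(1) by (simp add: E_def)
  ultimately show ?thesis by blast
qed

text \<open>Dividing the mean square error by the variance, of order r, turns M^(-1/8) = r^(9/8)
  into r^(1/8), which tends to 0. The limit law therefore passes from the trigonometric sum to the
  annulus count.\<close>

theorem clt_ann:
  fixes r T :: "nat \<Rightarrow> real"
  assumes ai: "algebraically_independent \<alpha> \<beta>" and sD: "strongly_Diophantine \<alpha> \<beta>"
    and r: "\<And>n. 0 < r n" "\<And>n. r n \<le> 1" "r \<longlonglongrightarrow> 0" and T: "\<And>n. T n > 0" "filterlim T at_top sequentially"
    and rT: "\<And>B. (\<lambda>n. r n powr (- B) / T n) \<longlonglongrightarrow> 0"
  shows "(\<lambda>n. LINT t|unif (T n) (2 * T n). iexp (u * (ann (r n) t / sd (r n)))) \<longlonglongrightarrow> of_real (exp (- (u\<^sup>2 / 2)))"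
proof -
  obtain C where C: "C \<ge> 0" "\<And>T M r. \<beta> + 1 \<le> T \<Longrightarrow> 1 \<le> M \<Longrightarrow> M \<le> T \<Longrightarrow> 0 < r \<Longrightarrow> r \<le> 1 \<Longrightarrow>
     integrable (unif T (2 * T)) (\<lambda>t. (ann r t - shift_sum M r t)\<^sup>2) \<and>
     (LINT t|unif T (2 * T). (ann r t - shift_sum M r t)\<^sup>2) \<le> C * (M powr (- (1/8)) + r\<^sup>2 / T)"
    using mean_square_ann by blast
  define m where "m n = r n powr (- 9)" for n
  define X where "X n t = ann (r n) t / sd (r n)" for n t
  define Y where "Y n t = shift_sum (m n) (r n) t / sd (r n)" for n t
  \<comment> \<open>The summand \<open>r n\<close> is added only to make the bound strictly
    positive.\<close>
  define b where "b n = C / (sd 1)\<^sup>2 * (r n powr (1/8) + r n / T n) + r n" for n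
  have m1: "m n \<ge> 1" for n using powr_mono'[of "-9" 0 "r n"] r(1,2)[of n] by (simp add: m_def)
  have bpos: "b n > 0" for n
    unfolding b_def using r(1)[of n] T(1)[of n] C(1) by (intro add_nonneg_pos mult_nonneg_nonneg add_nonneg_nonneg) auto
  \<comment> \<open>The mean square estimate requires M \<le> T, which holds eventually by slow
    decay with exponent 9.\<close>
  have "\<forall>\<^sub>F n in sequentially. r n powr (- 9) / T n < 1" using rT[of 9] by (intro order_tendstoD) auto
  then have ev1: "\<forall>\<^sub>F n in sequentially. m n \<le> T n"
    by eventually_elim (use T(1) in \<open>simp add: m_def divide_less_eq less_imp_le\<close>)
  have ev2: "\<forall>\<^sub>F n in sequentially. \<beta> + 1 \<le> T n" using T(2) by (simp add: filterlim_at_top)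
  have "(\<lambda>n. (LINT t|unif (T n) (2 * T n). iexp (u * X n t)) - (LINT t|unif (T n) (2 * T n). iexp (u * Y n t))) \<longlonglongrightarrow> 0"
  proof (rule Lim_null_comparison)
    show "\<forall>\<^sub>F n in sequentially. norm ((LINT t|unif (T n) (2 * T n). iexp (u * X n t)) - (LINT t|unif (T n) (2 * T n). iexp (u * Y n t))) \<le> 2 * \<bar>u\<bar> * sqrt (b n)"
      using ev1 ev2
    proof eventually_elim
      case (elim n)
      have rn: "0 < r n" "r n \<le> 1" by (rule r)+
      have s: "sd (r n) > 0" by (rule sd_pos[OF rn(1)])
      interpret prob_space "unif (T n) (2 * T n)" using T(1)[of n] by (intro prob_space_unif) simp
      have ms: "integrable (unif (T n) (2 * T n)) (\<lambda>t. (ann (r n) t - shift_sum (m n) (r n) t)\<^sup>2)"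
        "(LINT t|unif (T n) (2 * T n). (ann (r n) t - shift_sum (m n) (r n) t)\<^sup>2) \<le> C * (m n powr (- (1/8)) + (r n)\<^sup>2 / T n)"
        using C(2)[OF elim(2) m1 elim(1) rn] by auto
      have e: "(X n t - Y n t)\<^sup>2 = (ann (r n) t - shift_sum (m n) (r n) t)\<^sup>2 / (sd (r n))\<^sup>2" for t
        unfolding X_def Y_def diff_divide_distrib[symmetric] by (rule power_divide)
      show ?case
      proof (rule char_perturbation[OF _ _ _ _ bpos])
        show "X n \<in> borel_measurable (unif (T n) (2 * T n))" "Y n \<in> borel_measurable (unif (T n) (2 * T n))"
          unfolding X_def[abs_def] Y_def[abs_def] by measurable
        show "integrable (unif (T n) (2 * T n)) (\<lambda>t. (X n t - Y n t)\<^sup>2)" unfolding e by (intro integrable_divide ms)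
        have "(LINT t|unif (T n) (2 * T n). (X n t - Y n t)\<^sup>2) \<le> C * (m n powr (- (1/8)) + (r n)\<^sup>2 / T n) / (sd (r n))\<^sup>2"
          unfolding e integral_divide_zero using ms(2) by (rule divide_right_mono) simp
        also have "(sd (r n))\<^sup>2 = (sd 1)\<^sup>2 * r n" unfolding sd_eq[of "r n"] power_mult_distrib using rn by simp
        also have "C * (m n powr (- (1/8)) + (r n)\<^sup>2 / T n) / ((sd 1)\<^sup>2 * r n) = C / (sd 1)\<^sup>2 * (m n powr (- (1/8)) / r n + r n / T n)"
        proof -
          have "(r n)\<^sup>2 / T n / r n = r n / T n" using rn by (simp add: power2_eq_square)
          then have "(m n powr (- (1/8)) + (r n)\<^sup>2 / T n) / r n = m n powr (- (1/8)) / r n + r n / T n" by (simp only: add_divide_distrib)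
          then show ?thesis by (metis times_divide_times_eq)
        qed
        also have "m n powr (- (1/8)) / r n = r n powr (9/8) / r n powr 1" using rn by (simp add: m_def powr_powr)
        also have "\<dots> = r n powr (9/8 - 1)" by (rule powr_diff[symmetric])
        also have "C / (sd 1)\<^sup>2 * (r n powr (9/8 - 1) + r n / T n) \<le> b n" using rn by (simp add: b_def)
        finally show "(LINT t|unif (T n) (2 * T n). (X n t - Y n t)\<^sup>2) \<le> b n" .
      qed
    qed
    have r8: "(\<lambda>n. r n powr (1/8)) \<longlonglongrightarrow> 0"
      using tendsto_powr'[OF r(3) tendsto_const[of "1/8"]] r(1) by (auto simp: less_imp_le)
    \<comment> \<open>The hypothesis on powers of \<open>r\<close> is applied with exponent B =
      -1.\<close>
    have "(\<lambda>n. r n powr (- (- 1)) / T n) \<longlonglongrightarrow> 0" by (rule rT)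
    then have rT1: "(\<lambda>n. r n / T n) \<longlonglongrightarrow> 0" using r(1) by (simp add: less_imp_le)
    have "b \<longlonglongrightarrow> C / (sd 1)\<^sup>2 * (0 + 0) + 0"
      unfolding b_def[abs_def] by (intro tendsto_add tendsto_mult_left r8 rT1 r(3))
    then have "(\<lambda>n. 2 * \<bar>u\<bar> * sqrt (b n)) \<longlonglongrightarrow> 2 * \<bar>u\<bar> * sqrt 0" by (intro tendsto_intros) simp
    then show "(\<lambda>n. 2 * \<bar>u\<bar> * sqrt (b n)) \<longlonglongrightarrow> 0" by simp
  qed
  moreover have "(\<lambda>n. LINT t|unif (T n) (2 * T n). iexp (u * Y n t)) \<longlonglongrightarrow> of_real (exp (- (u\<^sup>2 / 2)))"
    unfolding Y_def m_def by (rule clt_shift_sum[OF ai sD r T(1) rT])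
  ultimately have "(\<lambda>n. ((LINT t|unif (T n) (2 * T n). iexp (u * X n t)) - (LINT t|unif (T n) (2 * T n). iexp (u * Y n t)))
      + (LINT t|unif (T n) (2 * T n). iexp (u * Y n t))) \<longlonglongrightarrow> 0 + of_real (exp (- (u\<^sup>2 / 2)))"
    by (rule tendsto_add)
  then show ?thesis unfolding X_def by simp
qed

text \<open>Levy's theorem gives weak convergence of the laws. An interval is a continuity set of
  the normal law, so its probabilities converge as well.\<close>

theorem prob_ann_limit:
  fixes r T :: "nat \<Rightarrow> real"
  assumes ai: "algebraically_independent \<alpha> \<beta>" and sD: "strongly_Diophantine \<alpha> \<beta>"
    and r: "\<And>n. 0 < r n" "\<And>n. r n \<le> 1" "r \<longlonglongrightarrow> 0" and T: "\<And>n. T n > 0" "filterlim T at_top sequentially"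
    and rT: "\<And>B. (\<lambda>n. r n powr (- B) / T n) \<longlonglongrightarrow> 0" and A: "is_interval A"
  shows "(\<lambda>n. measure (unif (T n) (2 * T n)) {t. ann (r n) t / sd (r n) \<in> A}) \<longlonglongrightarrow> 1 / sqrt (2 * pi) * (LINT x:A|lborel. exp (- x\<^sup>2 / 2))"
proof -
  have Ab [measurable]: "A \<in> sets borel" using A by (rule real_interval_borel_measurable)
  define \<mu> where "\<mu> n = distr (unif (T n) (2 * T n)) borel (\<lambda>t. ann (r n) t / sd (r n))" for n
  have ps: "prob_space (unif (T n) (2 * T n))" for n using T(1)[of n] by (intro prob_space_unif) simp
  have rd: "real_distribution (\<mu> n)" for n unfolding \<mu>_def by (rule prob_space.real_distribution_distr[OF ps]) measurable
  have ch: "char (\<mu> n) u = (LINT t|unif (T n) (2 * T n). iexp (u * (ann (r n) t / sd (r n))))" for n u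
    unfolding char_def \<mu>_def by (subst integral_distr) auto
  have wc: "weak_conv_m \<mu> std_normal_distribution"
  proof (rule levy_continuity[OF rd real_dist_normal_dist])
    fix u
    have "char std_normal_distribution u = of_real (exp (- (u\<^sup>2 / 2)))" by (simp add: char_std_normal_distribution)
    then show "(\<lambda>n. char (\<mu> n) u) \<longlonglongrightarrow> char std_normal_distribution u"
      unfolding ch by (simp only:) (rule clt_ann[OF ai sD r T rT])
  qed
  \<comment> \<open>An interval is convex, and the frontier of a convex set is negligible; this
    covers all types of intervals at once.\<close>
  have "frontier A \<in> null_sets lborel" using negligible_convex_frontier[OF is_interval_convex[OF A]]
    by (simp add: negligible_iff_null_sets null_sets_completion_iff frontier_closed borel_closed)
  then have "frontier A \<in> null_sets std_normal_distribution"
    using absolutely_continuousI_density[of std_normal_density lborel] unfolding absolutely_continuous_def by auto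
  then have fr: "emeasure std_normal_distribution (frontier A) = 0" by auto
  have "(\<lambda>n. measure (\<mu> n) A) \<longlonglongrightarrow> measure std_normal_distribution A"
    by (rule weak_conv_imp_continuity_set_conv[OF rd real_dist_normal_dist wc Ab fr])
  moreover have "measure (\<mu> n) A = measure (unif (T n) (2 * T n)) {t. ann (r n) t / sd (r n) \<in> A}" for n
    unfolding \<mu>_def by (subst measure_distr) (auto simp: vimage_def)
  moreover have "measure std_normal_distribution A = 1 / sqrt (2 * pi) * (LINT x:A|lborel. exp (- x\<^sup>2 / 2))"
  proof -
    have "measure std_normal_distribution A = (LINT x|std_normal_distribution. indicator A x)" by simp
    also have "\<dots> = (LINT x|lborel. std_normal_density x * indicator A x)"
      by (subst integral_density) (auto simp: normal_density_nonneg)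
    also have "\<dots> = (LINT x|lborel. 1 / sqrt (2 * pi) * (indicator A x * exp (- x\<^sup>2 / 2)))"
      by (rule Bochner_Integration.integral_cong) (auto simp: std_normal_density_def)
    finally show ?thesis by (simp add: set_lebesgue_integral_def)
  qed
  ultimately show ?thesis by simp
qed

end

text \<open>Slow decay with exponent 1 / (2 D), where D = max B 1, keeps \<rho>^(-B) below a
  multiple of T^(1/2), which the division by T beats. The maximum with 1 also handles small or
  negative \<open>B\<close>, as \<rho> < 1 eventually.\<close>

lemma powr_div_tendsto_0:
  fixes \<rho> :: "real \<Rightarrow> real"
  assumes pos: "\<forall>\<^sub>F T in at_top. \<rho> T > 0" and lim: "(\<rho> \<longlongrightarrow> 0) at_top"
    and big: "\<And>\<delta>. \<delta> > 0 \<Longrightarrow> \<rho> \<in> \<Omega>[at_top](\<lambda>T. T powr (- \<delta>))"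
  shows "((\<lambda>T. \<rho> T powr (- B) / T) \<longlongrightarrow> 0) at_top"
proof -
  define D where "D = max B 1"
  have D: "D \<ge> 1" "B \<le> D" by (auto simp: D_def)
  obtain c where c: "c > 0" "\<forall>\<^sub>F T in at_top. norm (\<rho> T) \<ge> c * norm (T powr (- (1 / (2 * D))))"
    using big[of "1 / (2 * D)"] D by (auto elim!: landau_omega.bigE)
  have le1: "\<forall>\<^sub>F T in at_top. \<rho> T < 1" using lim by (intro order_tendstoD) auto
  show ?thesis
  proof (rule Lim_null_comparison)
    show "\<forall>\<^sub>F T in at_top. norm (\<rho> T powr (- B) / T) \<le> c powr (- D) * T powr (- (1/2))"
      using pos le1 c(2) eventually_gt_at_top[of 0]
    proof eventually_elim
      case (elim T)
      have "\<rho> T powr (- B) \<le> \<rho> T powr (- D)" using elim D by (intro powr_mono') auto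
      also have "\<dots> \<le> (c * T powr (- (1 / (2 * D)))) powr (- D)" using elim D c(1) by (intro powr_mono2') auto
      also have "\<dots> = c powr (- D) * T powr (1/2)" using D c(1) by (simp add: powr_mult powr_powr)
      finally have "\<rho> T powr (- B) / T \<le> c powr (- D) * T powr (1/2) / T" using elim by (intro divide_right_mono) auto
      also have "\<dots> = c powr (- D) * (T powr (1/2) / T powr 1)" using elim by simp
      also have "T powr (1/2) / T powr 1 = T powr (1/2 - 1)" by (rule powr_diff[symmetric])
      finally show ?case using elim by simp
    qed
    show "((\<lambda>T. c powr (- D) * T powr (- (1/2))) \<longlongrightarrow> 0) at_top" by real_asymp
  qed
qed

theorem theorem1:
  fixes \<alpha> \<beta> :: real and \<rho> :: "real \<Rightarrow> real" and \<A> :: "real set"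
  assumes "\<beta> > 0"
    and "algebraically_independent \<alpha> \<beta>"
    and "strongly_Diophantine \<alpha> \<beta>"
    and "\<forall>\<^sub>F T in at_top. \<rho> T > 0"
    and "(\<rho> \<longlongrightarrow> 0) at_top"
    and "\<And>\<delta>. \<delta> > 0 \<Longrightarrow> \<rho> \<in> \<Omega>[at_top](\<lambda>T. T powr (- \<delta>))"
    and "is_interval \<A>"
  shows "((\<lambda>T. 1 / T * measure lebesgue
             {t \<in> {T..2 * T}. S_annulus \<alpha> \<beta> t (\<rho> T) / sqrt (4 * pi / \<beta> * \<rho> T) \<in> \<A>})
          \<longlongrightarrow> 1 / sqrt (2 * pi) * (LINT x:\<A>|lborel. exp (- x\<^sup>2 / 2))) at_top"
proof (rule tendsto_at_topI_sequentially)
  interpret planar \<alpha> \<beta> using assms(1) by unfold_locales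
  \<comment> \<open>The limit is tested along arbitrary sequences, since Levy's theorem is about
    sequences of laws.\<close>
  fix X :: "nat \<Rightarrow> real" assume X: "filterlim X at_top sequentially"
  have "\<forall>\<^sub>F T in at_top. \<rho> T < 1" using assms(5) by (intro order_tendstoD) auto
  with assms(4) eventually_gt_at_top[of "0 :: real"] have "\<forall>\<^sub>F T in at_top. \<rho> T > 0 \<and> \<rho> T \<le> 1 \<and> T > 0"
    by eventually_elim auto
  then have "\<forall>\<^sub>F n in sequentially. \<rho> (X n) > 0 \<and> \<rho> (X n) \<le> 1 \<and> X n > 0"
    using X by (rule eventually_compose_filterlim)
  then obtain N where N: "\<And>n. n \<ge> N \<Longrightarrow> \<rho> (X n) > 0 \<and> \<rho> (X n) \<le> 1 \<and> X n > 0"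
    by (auto simp: eventually_sequentially)
  \<comment> \<open>Positivity of \<rho> and \<rho> \<le> 1 hold only eventually; the index shift
    makes them hold for every n and is undone at the end.\<close>
  define T where "T n = X (n + N)" for n
  define r where "r n = \<rho> (T n)" for n
  have rT: "0 < r n" "r n \<le> 1" "T n > 0" for n using N[of "n + N"] by (auto simp: r_def T_def)
  have T: "filterlim T at_top sequentially" unfolding T_def by (rule filterlim_compose[OF X]) (rule filterlim_add_const_nat_at_top)
  have lim: "(\<lambda>n. measure (unif (T n) (2 * T n)) {t. ann (r n) t / sd (r n) \<in> \<A>}) \<longlonglongrightarrow> 1 / sqrt (2 * pi) * (LINT x:\<A>|lborel. exp (- x\<^sup>2 / 2))"
  proof (rule prob_ann_limit[OF assms(2,3) rT(1,2) _ rT(3) T _ assms(7)])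
    show "r \<longlonglongrightarrow> 0" unfolding r_def by (rule filterlim_compose[OF assms(5) T])
    show "(\<lambda>n. r n powr (- B) / T n) \<longlonglongrightarrow> 0" for B
      unfolding r_def by (rule filterlim_compose[OF powr_div_tendsto_0[OF assms(4,5,6)] T])
  qed
  have [measurable]: "\<A> \<in> sets borel" using assms(7) by (rule real_interval_borel_measurable)
  have "measure (unif (T n) (2 * T n)) {t. ann (r n) t / sd (r n) \<in> \<A>} =
     1 / T n * measure lebesgue {t \<in> {T n..2 * T n}. S_annulus \<alpha> \<beta> t (\<rho> (T n)) / sqrt (4 * pi / \<beta> * \<rho> (T n)) \<in> \<A>}" for n
  proof -
    have B: "{t. ann (r n) t / sd (r n) \<in> \<A>} \<in> sets borel" by measurable
    have "{t \<in> {T n..2 * T n}. S_annulus \<alpha> \<beta> t (\<rho> (T n)) / sqrt (4 * pi / \<beta> * \<rho> (T n)) \<in> \<A>}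
       = {T n..2 * T n} \<inter> {t. ann (r n) t / sd (r n) \<in> \<A>}"
      using rT[of n] S_annulus_eq_ann[of _ "r n"] by (auto simp: sd_def r_def)
    moreover have "measure lebesgue ({T n..2 * T n} \<inter> {t. ann (r n) t / sd (r n) \<in> \<A>}) = measure lborel ({T n..2 * T n} \<inter> {t. ann (r n) t / sd (r n) \<in> \<A>})"
      using B by (intro measure_completion) auto
    moreover have "measure (unif (T n) (2 * T n)) {t. ann (r n) t / sd (r n) \<in> \<A>} = measure lborel ({T n..2 * T n} \<inter> {t. ann (r n) t / sd (r n) \<in> \<A>}) / T n"
      unfolding unif_def using rT(3)[of n] B by (subst measure_uniform_measure) auto
    ultimately show ?thesis by simp
  qed
  then have "(\<lambda>n. 1 / X (n + N) * measure lebesgue {t \<in> {X (n + N)..2 * X (n + N)}. S_annulus \<alpha> \<beta> t (\<rho> (X (n + N))) / sqrt (4 * pi / \<beta> * \<rho> (X (n + N))) \<in> \<A>})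
     \<longlonglongrightarrow> 1 / sqrt (2 * pi) * (LINT x:\<A>|lborel. exp (- x\<^sup>2 / 2))" using lim by (simp add: T_def)
  then show "(\<lambda>n. 1 / X n * measure lebesgue {t \<in> {X n..2 * X n}. S_annulus \<alpha> \<beta> t (\<rho> (X n)) / sqrt (4 * pi / \<beta> * \<rho> (X n)) \<in> \<A>})
     \<longlonglongrightarrow> 1 / sqrt (2 * pi) * (LINT x:\<A>|lborel. exp (- x\<^sup>2 / 2))" by (rule LIMSEQ_offset[of _ N])
qed

end
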